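(* The following two statements are equivalent (i.e. (I) holds if and only if (II) holds). (I) [Convex formulation] There exists an absolute constant $C_0 \ge 1$ such that the following holds. For every integer $m \ge 1$, every $G \in \{\mathbb{R}^m, \mathbb{Z}^m\}$, every real $K \ge 1$ and every finite nonempty set $A \subseteq G$ with $|A+A| \le K|A|$, there exist an integer $d \ge 0$ with $d \le C_0 \log(2K)$, a centrally symmetric convex body $B \subseteq \mathbb{R}^d$, elements $a_0, a_1, \dots, a_d \in G$, and a finite set $X \subseteq G$ such that - $|B \cap \mathbb{Z}^d| \le C_0 K^{C_0} |A|$, - $|X| \le C_0 K^{C_0}$, - $A \subseteq P + X$, where $P = \{ a_0 + n_1 a_1 + \dots + n_d a_d : (n_1,\dots,n_d) \in \mathbb{Z}^d \cap B\}$. (II) [Ellipsoid formulation] There exists an absolute constant $C_0 \ge 1$ such that the following holds. For every integer $m \ge 1$, every $G \in \{\mathbb{R}^m, \mathbb{Z}^m\}$, every real $K \ge 1$ and every finite nonempty set $A \subseteq G$ with $|A+A| \le K|A|$, there exist an integer $d \ge 0$ with $d \le C_0 \log(2K)$, a linear map $\gamma \in \mathrm{GL}_d(\mathbb{R})$, elements $a_0, a_1, \dots, a_d \in G$, and a finite set $X \subseteq G$ such that - $|\{\vec n \in \mathbb{Z}^d : \|\gamma(\vec n)\|_2 \le 1\}| \le C_0 K^{C_0} |A|$, - $|X| \le C_0 K^{C_0}$, - $A \subseteq P + X$, where $P = \{ a_0 + n_1 a_1 + \dots + n_d a_d : \vec n = (n_1,\dots,n_d) \in \mathbb{Z}^d,\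 \|\gamma(\vec n)\|_2 \le 1\}$.
   Context: For subsets $A, B$ of an abelian group, $A+B = \{a+b : a \in A, b \in B\}$. $\|\cdot\|_2$ is the Euclidean norm. A convex body is a compact convex set with nonempty interior; centrally symmetric means $B = -B$. The constants $C_0$ are absolute: in particular they do not depend on $m$, $K$ or $A$. Statement (I) is the "convex progression" formulation of the polynomial Freiman–Ruzsa conjecture over $\mathbb{R}^m$/$\mathbb{Z}^m$, and (II) its "ellipsoid progression" formulation; neither is asserted to be true, only their equivalence. *)

theory Defs
  imports "HOL-Analysis.Analysis" "HOL-Library.Function_Algebras" "HOL-Library.Set_Algebras"
begin

text \<open>The dimensions are quantified inside the statement, so vectors are functions
  \<open>nat \<Rightarrow> real\<close> and \<open>\<real>\<^sup>n\<close> consists of those vanishing at all indices \<open>\<ge> n\<close>, topologised by the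
  library's \<^const>\<open>Euclidean_space\<close>. The pointwise vector space structure makes \<^const>\<open>convex\<close>
  and \<^const>\<open>linear\<close> available.\<close>

instantiation "fun" :: (type, real_vector) real_vector
begin

definition scaleR_fun :: "real \<Rightarrow> ('a \<Rightarrow> 'b) \<Rightarrow> 'a \<Rightarrow> 'b"
  where "scaleR_fun c f = (\<lambda>x. c *\<^sub>R f x)"

instance
  by standard (simp_all add: scaleR_fun_def fun_eq_iff scaleR_add_right scaleR_add_left)

end

definition real_space :: "nat \<Rightarrow> (nat \<Rightarrow> real) set"
  where "real_space n = topspace (Euclidean_space n)"

definition int_lattice :: "nat \<Rightarrow> (nat \<Rightarrow> real) set"
  where "int_lattice n = {x \<in> real_space n. \<forall>i. x i \<in> \<int>}"

text \<open>The interior is taken relative to \<open>\<real>\<^sup>d\<close>, not to the ambient function space.\<close>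

definition convex_body :: "nat \<Rightarrow> (nat \<Rightarrow> real) set \<Rightarrow> bool"
  where "convex_body d B \<longleftrightarrow>
    compactin (Euclidean_space d) B \<and> convex B \<and> (Euclidean_space d) interior_of B \<noteq> {}"

definition centrally_symmetric :: "(nat \<Rightarrow> real) set \<Rightarrow> bool"
  where "centrally_symmetric B \<longleftrightarrow> B = uminus ` B"

text \<open>Only the restriction of an element of \<open>GL d\<close> to \<open>\<real>\<^sup>d\<close> matters. Every linear automorphism of
  \<open>\<real>\<^sup>d\<close> arises this way: extend it by composing with the projection onto the first \<open>d\<close>
  coordinates.\<close>

definition GL :: "nat \<Rightarrow> ((nat \<Rightarrow> real) \<Rightarrow> (nat \<Rightarrow> real)) set"
  where "GL d = {\<gamma>. linear \<gamma> \<and> bij_betw \<gamma> (real_space d) (real_space d)}"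

definition ellipsoid_lattice_points :: "nat \<Rightarrow> ((nat \<Rightarrow> real) \<Rightarrow> (nat \<Rightarrow> real)) \<Rightarrow> (nat \<Rightarrow> real) set"
  where "ellipsoid_lattice_points d \<gamma> = {n \<in> int_lattice d. L2_set (\<gamma> n) {..<d} \<le> 1}"

text \<open>Coordinates of \<open>n\<close> are numbered from \<open>0\<close>, so coordinate \<open>i\<close> is the coefficient of \<open>a (i+1)\<close>.\<close>

definition progression :: "nat \<Rightarrow> (nat \<Rightarrow> nat \<Rightarrow> real) \<Rightarrow> (nat \<Rightarrow> real) set \<Rightarrow> (nat \<Rightarrow> real) set"
  where "progression d a N = {a 0 + (\<Sum>i<d. n i *\<^sub>R a (Suc i)) | n. n \<in> N}"

end

theory Submission
  imports Defs "HOL-Probability.Distributions" "Jordan_Normal_Form.Determinant"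
begin

text \<open>An ellipsoid is itself a symmetric convex body. For the converse one needs Milman's theorem: for a symmetric
  convex body \<open>B\<close> in \<open>\<real>\<^sup>d\<close> there is an ellipsoid \<open>E\<close> such that \<open>C\<^sup>d\<close> translates of \<open>E\<close> cover \<open>B\<close> and
  \<open>C\<^sup>d\<close> translates of \<open>B/2\<close> cover \<open>2E\<close>. Since \<open>d \<le> C\<^sub>0 ln (2K)\<close>, the factor \<open>C\<^sup>d\<close> is polynomial in \<open>K\<close>. Then
  \<open>B \<inter> \<int>\<^sup>d\<close> is covered by \<open>C\<^sup>d\<close> integer translates of \<open>2E \<inter> \<int>\<^sup>d\<close>, which has at most \<open>C\<^sup>d\<close> times as many
  points as \<open>B \<inter> \<int>\<^sup>d\<close>; the translations are absorbed into \<open>X\<close>.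

  Milman's ellipsoid is found as follows. Tilt the uniform distribution on the points of a fine grid in \<open>B\<close> by
  \<open>y \<mapsto> exp (x\<cdot>y)\<close>; its mean and covariance are the gradient and the Hessian in \<open>x\<close> of the logarithmic
  moment generating function \<open>F\<close>. The gradient map of \<open>F\<close> takes values in \<open>B\<close>, so a change of variables
  bounds the average of \<open>det F''\<close> over a multiple of \<open>d B\<degree>\<close> by \<open>C\<^sup>d vol B / vol (d B\<degree>)\<close>, and by the
  Bourgain-Milman inequality some \<open>x\<close> has \<open>det F''(x) \<le> C\<^sup>d (vol B)\<^sup>2\<close>. There the density of the tilt is between
  \<open>C\<^sup>-\<^sup>d\<close> and \<open>C\<^sup>d\<close>, so by Chebyshev the covariance ellipsoid contains a \<open>C\<^sup>-\<^sup>d\<close> fraction of \<open>B\<close>, while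
  its volume is at most \<open>C\<^sup>d vol B\<close>. Covering numbers are then estimated by packing.

  The Bourgain-Milman inequality compares two integrals over \<open>\<real>\<^bsup>2d\<^esup>\<close>: for \<open>y\<^sub>i\<close> a gradient at
  \<open>x\<^sub>i\<close>, a real substitution expresses the product of the volumes by \<open>(x\<^sub>1 + x\<^sub>2)/2\<close> and
  \<open>(y\<^sub>2 - y\<^sub>1)/2\<close>, and a complex one turns \<open>exp (- (x\<^sub>1\<cdot>y\<^sub>1 + x\<^sub>2\<cdot>y\<^sub>2)/2)\<close> into a Gaussian. Their Jacobians are
  proportional. Both substitutions are deformations to the identity along which the integral of a closed form is
  constant, so that no injectivity is required.\<close>

text \<open>An inscribed ellipsoid of maximal volume would not do: it can lose a factor
  \<open>d powr (d / 2)\<close> in the covering numbers, and for \<open>d\<close> of order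
  \<open>ln K\<close> that is not polynomial in \<open>K\<close>. Every loss must stay of the form
  \<open>C ^ d\<close>, so the ellipsoid is fitted to the bulk of the volume instead. Bodies enter
  the analysis only through finite sets: a net \<open>V\<close> of the body, a finite set
  \<open>W\<close> in \<open>d\<close> times its polar, and a grid in the body. Each instantiates
  the locale \<open>lse\<close>, whose functions are built from finite sums of exponentials; so the
  derivatives are explicit, and nothing is differentiated under an integral.
  \<open>exp (- F)\<close> for \<open>V\<close> and \<open>W\<close> stands in for the indicator
  functions of the dilated polar and of the body; at the scale \<open>d\<close> of the polar this
  exchange costs only \<open>C ^ d\<close>. The gradient of such an \<open>F\<close> is bounded, so
  as a map it is not proper, and its deformation to the identity would be uncontrolled at infinity.
  A small linear term (\<open>\<delta>\<close>, \<open>\<epsilon>\<close>, \<open>dl\<close>)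
  repairs this. Its size depends on the body but drops out of the final estimates, which keeps the
  constants absolute.\<close>

section \<open>Lebesgue measure on finitely many coordinates\<close>

text \<open>Lebesgue measure of \<open>\<real>\<^sup>n\<close> as a measure on the whole function type, concentrated on \<^const>\<open>real_space\<close>.\<close>

fun leb :: "nat \<Rightarrow> (nat \<Rightarrow> real) measure" where
  "leb 0 = return borel (\<lambda>_. 0)"
| "leb (Suc n) = distr (leb n \<Otimes>\<^sub>M lborel) borel (\<lambda>(x, t). x(n := t))"

declare leb.simps [simp del]

text \<open>The weight for all decay bounds: \<open>exp (- c * ell1 n x)\<close> factorizes over the
  coordinates, so it can be integrated one coordinate at a time.\<close>

definition ell1 :: "nat \<Rightarrow> (nat \<Rightarrow> real) \<Rightarrow> real" where
  "ell1 n x = (\<Sum>i<n. \<bar>x i\<bar>)"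

lemma sets_leb [simp, measurable_cong]: "sets (leb n) = sets borel"
  by (cases n) (auto simp: leb.simps)

lemma space_leb [simp]: "space (leb n) = UNIV"
  using sets_eq_imp_space_eq[OF sets_leb[of n]] by simp

lemma continuous_imp_borel_fun:
  fixes f :: "(nat \<Rightarrow> real) \<Rightarrow> 'b::topological_space"
  assumes "continuous_on UNIV f" shows "f \<in> borel_measurable borel"
  using assms by (rule borel_measurable_continuous_onI)

lemma continuous_on_coord [continuous_intros]: "continuous_on S (\<lambda>x::nat \<Rightarrow> real. x i)"
  by (rule continuous_on_subset[OF continuous_on_product_coordinates]) auto

lemma measurable_coord [measurable]: "(\<lambda>x::nat \<Rightarrow> real. x i) \<in> borel_measurable borel"
  by (intro continuous_imp_borel_fun continuous_intros)

lemma ell1_measurable [measurable]: "ell1 n \<in> borel_measurable borel"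
  unfolding ell1_def by measurable

lemma measurable_fun_upd_leb:
  assumes [measurable]: "f \<in> borel_measurable M" "g \<in> borel_measurable M"
  shows "(\<lambda>w. (f w :: nat \<Rightarrow> real)(n := g w)) \<in> borel_measurable M"
proof (rule measurable_coordinatewise_then_product)
  fix i
  have [measurable]: "(\<lambda>w. f w i) \<in> borel_measurable M"
    using measurable_compose[OF assms(1) measurable_coord[of i]] by simp
  show "(\<lambda>w. ((f w)(n := g w)) i) \<in> borel_measurable M"
    by (cases "i = n") auto
qed

lemma measurable_upd_pair [measurable]:
  "(\<lambda>(x, t). x(n := t)) \<in> borel_measurable (borel \<Otimes>\<^sub>M (borel :: real measure) :: ((nat \<Rightarrow> real) \<times> real) measure)"
  unfolding split_beta by (rule measurable_fun_upd_leb) auto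

lemma measurable_upd_pair' [measurable]:
  "(\<lambda>(x, t). x(n := t)) \<in> borel_measurable (leb m \<Otimes>\<^sub>M lborel)"
  unfolding split_beta by (rule measurable_fun_upd_leb) auto

lemma measurable_upd1 [measurable]: "(\<lambda>x. x(n := t)) \<in> borel_measurable (borel :: (nat \<Rightarrow> real) measure)"
  by (rule measurable_fun_upd_leb) auto

lemma measurable_upd2 [measurable]: "(\<lambda>t. (x :: nat \<Rightarrow> real)(n := t)) \<in> borel_measurable (borel :: real measure)"
  using measurable_fun_upd_leb[of "\<lambda>_. x" borel "\<lambda>t. t" n] by simp

text \<open>The boxes restrict only the first \<open>n\<close> coordinates, so countably many of
  them exhaust the whole function space. Their finite measure is carried along in the induction and
  yields sigma-finiteness.\<close>

lemma sigma_finite_leb: "sigma_finite_measure (leb n)"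
  and emeasure_leb_box: "emeasure (leb n) {x. \<forall>i<n. \<bar>x i\<bar> \<le> real k} < \<infinity>"
proof (induction n arbitrary: k)
  case 0
  {
    case 1
    have "prob_space (leb 0)" by (simp add: prob_space_return leb.simps)
    then show ?case
      using finite_measure.axioms(1) prob_space.axioms(1) by blast
  next
    case 2
    show ?case by (simp add: leb.simps)
  }
next
  case (Suc n)
  interpret L: sigma_finite_measure "leb n" by (rule Suc.IH)
  have *: "emeasure (leb (Suc n)) {x. \<forall>i<Suc n. \<bar>x i\<bar> \<le> real k} < \<infinity>" for k
  proof -
    have [measurable]: "{x :: nat \<Rightarrow> real. \<forall>i<m. \<bar>x i\<bar> \<le> real k} \<in> sets borel" for m
    proof -
      have "{x :: nat \<Rightarrow> real. \<forall>i\<in>{..<m}. \<bar>x i\<bar> \<le> real k} \<in> sets borel" by measurable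
      then show ?thesis by (simp add: Ball_def)
    qed
    have "emeasure (leb (Suc n)) {x. \<forall>i<Suc n. \<bar>x i\<bar> \<le> real k}
        = emeasure (leb n \<Otimes>\<^sub>M lborel) ({x. \<forall>i<n. \<bar>x i\<bar> \<le> real k} \<times> {- real k .. real k})"
      by (simp add: leb.simps, subst emeasure_distr) (auto intro!: arg_cong2[where f=emeasure] simp: All_less_Suc space_pair_measure)
    also have "\<dots> = emeasure (leb n) {x. \<forall>i<n. \<bar>x i\<bar> \<le> real k} * emeasure lborel {- real k .. real k}"
      by (rule lborel.emeasure_pair_measure_Times) auto
    also have "\<dots> < \<infinity>"
      using Suc.IH(2)[of k] by (simp add: ennreal_mult_less_top)
    finally show ?thesis .
  qed
  {
    case 1
    show ?case
    proof
      let ?B = "\<lambda>k. {x :: nat \<Rightarrow> real. \<forall>i<Suc n. \<bar>x i\<bar> \<le> real k}"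
      have U: "(\<Union>k. ?B k) = UNIV"
      proof safe
        fix x :: "nat \<Rightarrow> real"
        obtain k :: nat where k: "(\<Sum>i<Suc n. \<bar>x i\<bar>) \<le> real k"
          using real_arch_simple by blast
        have "\<bar>x i\<bar> \<le> real k" if "i < Suc n" for i
          using member_le_sum[of i "{..<Suc n}" "\<lambda>i. \<bar>x i\<bar>"] that k by (auto intro: order_trans)
        then show "x \<in> (\<Union>k. ?B k)" by blast
      qed auto
      show "\<exists>A. countable A \<and> A \<subseteq> sets (leb (Suc n)) \<and> \<Union> A = space (leb (Suc n)) \<and> (\<forall>a\<in>A. emeasure (leb (Suc n)) a \<noteq> \<infinity>)"
      proof (intro exI[of _ "range ?B"] conjI)
        show "range ?B \<subseteq> sets (leb (Suc n))"
          unfolding sets_leb by (rule image_subsetI, measurable)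
        show "\<Union> (range ?B) = space (leb (Suc n))" using U by simp
        show "\<forall>a\<in>range ?B. emeasure (leb (Suc n)) a \<noteq> \<infinity>" using * by (auto simp: less_top)
      qed auto
    qed
  next
    case 2
    show ?case by (rule *)
  }
qed

interpretation leb: sigma_finite_measure "leb n" for n by (rule sigma_finite_leb)
interpretation lebp: pair_sigma_finite "leb n" "lborel :: real measure" for n ..

lemma nn_integral_leb_0 [simp]: "f \<in> borel_measurable borel \<Longrightarrow> (\<integral>\<^sup>+x. f x \<partial>leb 0) = f (\<lambda>_. 0)"
  by (simp add: nn_integral_return leb.simps)

lemma measurable_comp_upd:
  assumes [measurable]: "f \<in> borel_measurable borel"
  shows "(\<lambda>x. f (x(n := t))) \<in> borel_measurable borel" "(\<lambda>t. f (x(n := t))) \<in> borel_measurable borel"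
    "(\<lambda>(x, t). f (x(n := t))) \<in> borel_measurable (borel \<Otimes>\<^sub>M (borel :: real measure))"
    "(\<lambda>(x, t). f (x(n := t))) \<in> borel_measurable (leb m \<Otimes>\<^sub>M lborel)"
proof -
  show 3: "(\<lambda>(x, t). f (x(n := t))) \<in> borel_measurable (borel \<Otimes>\<^sub>M (borel :: real measure))"
    using measurable_comp[OF measurable_upd_pair assms] by (simp add: comp_def split_beta)
  then show "(\<lambda>(x, t). f (x(n := t))) \<in> borel_measurable (leb m \<Otimes>\<^sub>M lborel)" by measurable
qed measurable

lemma nn_integral_leb_Suc:
  assumes [measurable]: "f \<in> borel_measurable borel"
  shows "(\<integral>\<^sup>+x. f x \<partial>leb (Suc n)) = (\<integral>\<^sup>+x. \<integral>\<^sup>+t. f (x(n := t)) \<partial>lborel \<partial>leb n)"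
    "(\<integral>\<^sup>+x. f x \<partial>leb (Suc n)) = (\<integral>\<^sup>+t. \<integral>\<^sup>+x. f (x(n := t)) \<partial>leb n \<partial>lborel)"
proof -
  note [measurable] = measurable_comp_upd[OF assms]
  have *: "(\<integral>\<^sup>+x. f x \<partial>leb (Suc n)) = (\<integral>\<^sup>+w. (case w of (x, t) \<Rightarrow> f (x(n := t))) \<partial>(leb n \<Otimes>\<^sub>M lborel))"
    by (simp add: nn_integral_distr split_beta leb.simps)
  show "(\<integral>\<^sup>+x. f x \<partial>leb (Suc n)) = (\<integral>\<^sup>+x. \<integral>\<^sup>+t. f (x(n := t)) \<partial>lborel \<partial>leb n)"
    unfolding * by (subst lborel.nn_integral_fst[symmetric]) simp_all
  show "(\<integral>\<^sup>+x. f x \<partial>leb (Suc n)) = (\<integral>\<^sup>+t. \<integral>\<^sup>+x. f (x(n := t)) \<partial>leb n \<partial>lborel)"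
    unfolding * by (subst lebp.nn_integral_snd[symmetric]) simp_all
qed

lemma integral_leb_Suc:
  fixes f :: "_ \<Rightarrow> 'b::{banach, second_countable_topology}"
  assumes f: "integrable (leb (Suc n)) f"
  shows "(\<integral>x. f x \<partial>leb (Suc n)) = (\<integral>x. \<integral>t. f (x(n := t)) \<partial>lborel \<partial>leb n)"
    "(\<integral>x. f x \<partial>leb (Suc n)) = (\<integral>t. \<integral>x. f (x(n := t)) \<partial>leb n \<partial>lborel)"
proof -
  have [measurable]: "f \<in> borel_measurable borel"
    using borel_measurable_integrable[OF f] by simp
  note [measurable] = measurable_comp_upd[OF this]
  have i: "integrable (leb n \<Otimes>\<^sub>M lborel) (\<lambda>(x, t). f (x(n := t)))"
    using f unfolding leb.simps by (subst (asm) integrable_distr_eq) (simp_all add: case_prod_unfold)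
  have *: "(\<integral>x. f x \<partial>leb (Suc n)) = (\<integral>w. (case w of (x, t) \<Rightarrow> f (x(n := t))) \<partial>(leb n \<Otimes>\<^sub>M lborel))"
    by (simp add: integral_distr split_beta leb.simps)
  show "(\<integral>x. f x \<partial>leb (Suc n)) = (\<integral>x. \<integral>t. f (x(n := t)) \<partial>lborel \<partial>leb n)"
    unfolding * by (subst lebp.integral_fst[symmetric, OF i]) simp
  show "(\<integral>x. f x \<partial>leb (Suc n)) = (\<integral>t. \<integral>x. f (x(n := t)) \<partial>leb n \<partial>lborel)"
    unfolding * by (subst lebp.integral_snd[symmetric, OF i]) simp
qed

lemma AE_leb_real_space: "AE x in leb n. x \<in> real_space n"
proof (induction n)
  case 0
  have "Measurable.pred borel (\<lambda>x :: nat \<Rightarrow> real. \<forall>i. x i = 0)" by measurable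
  then show ?case
    unfolding leb.simps real_space_def topspace_Euclidean_space by (subst AE_return) auto
next
  case (Suc n)
  have rs: "real_space m = {x. \<forall>i. m \<le> i \<longrightarrow> x i = 0}" for m
    by (auto simp: real_space_def topspace_Euclidean_space)
  have rs_sets: "real_space m \<in> sets borel" for m
  proof -
    have "{x :: nat \<Rightarrow> real. \<forall>i. m \<le> i \<longrightarrow> x i = 0} \<in> sets borel" by measurable
    then show ?thesis by (simp add: rs)
  qed
  note [measurable] = rs_sets
  have "AE w in leb n \<Otimes>\<^sub>M (lborel :: real measure). fst w \<in> real_space n"
  proof (rule lebp.AE_pair_measure[where P="\<lambda>w. fst w \<in> real_space n"])
    show "{w \<in> space (leb n \<Otimes>\<^sub>M (lborel :: real measure)). fst w \<in> real_space n} \<in> sets (leb n \<Otimes>\<^sub>M lborel)"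
      by measurable
  qed (use Suc in auto)
  then have "AE w in leb n \<Otimes>\<^sub>M lborel. (\<lambda>(x, t). x(n := t)) w \<in> real_space (Suc n)"
    by eventually_elim (auto simp: rs)
  then show ?case
    unfolding leb.simps by (subst AE_distr_iff) (auto simp: case_prod_unfold rs_sets)
qed

text \<open>\<open>leb n\<close> lives on \<open>real_space n\<close>, hence the condition on the
  shift \<open>a\<close>. In the induction the last entry of \<open>a\<close> is split off, leaving
  \<open>a(n := 0)\<close> in the smaller space.\<close>

lemma nn_integral_leb_translate:
  assumes "f \<in> borel_measurable borel" "c > 0" "a \<in> real_space n"
  shows "(\<integral>\<^sup>+x. f x \<partial>leb n) = ennreal (c ^ n) * (\<integral>\<^sup>+x. f (\<lambda>i. a i + c * x i) \<partial>leb n)"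
  using assms(1,3)
proof (induction n arbitrary: f a)
  case 0
  have "a = (\<lambda>_. 0)" using 0 by (auto simp: real_space_def topspace_Euclidean_space)
  moreover have "(\<lambda>x. f (\<lambda>i. c * x i)) \<in> borel_measurable borel"
    by (rule measurable_compose[OF measurable_coordinatewise_then_product 0(1)]) measurable
  ultimately show ?case using 0 by (simp only: nn_integral_leb_0) simp
next
  case (Suc n)
  note [measurable] = Suc.prems(1)
  have m1 [measurable]: "(\<lambda>x i. a i + c * x i) \<in> borel_measurable (borel :: (nat \<Rightarrow> real) measure)" for a :: "nat \<Rightarrow> real"
    by (rule measurable_coordinatewise_then_product) measurable
  have m2: "(\<lambda>x. f (\<lambda>i. a i + c * x i)) \<in> borel_measurable borel" by measurable
  have "(\<integral>\<^sup>+x. f x \<partial>leb (Suc n)) = (\<integral>\<^sup>+t. \<integral>\<^sup>+x. f (x(n := t)) \<partial>leb n \<partial>lborel)"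
    by (rule nn_integral_leb_Suc) fact
  also have "\<dots> = c * (\<integral>\<^sup>+t. \<integral>\<^sup>+x. f (x(n := a n + c * t)) \<partial>leb n \<partial>lborel)"
    using assms(2) by (subst nn_integral_real_affine[where c=c and t="a n"]) auto
  also have "(\<integral>\<^sup>+t. \<integral>\<^sup>+x. f (x(n := a n + c * t)) \<partial>leb n \<partial>lborel)
     = (\<integral>\<^sup>+t. ennreal (c ^ n) * \<integral>\<^sup>+x. f (\<lambda>i. a i + c * (x(n := t)) i) \<partial>leb n \<partial>lborel)"
  proof (rule nn_integral_cong)
    fix t
    let ?a = "a(n := 0)"
    have "?a \<in> real_space n" using Suc.prems(2) by (auto simp: real_space_def topspace_Euclidean_space)
    moreover have "(\<lambda>x. f (x(n := a n + c * t))) \<in> borel_measurable borel" by measurable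
    ultimately have "(\<integral>\<^sup>+x. f (x(n := a n + c * t)) \<partial>leb n)
      = ennreal (c ^ n) * (\<integral>\<^sup>+x. f ((\<lambda>i. ?a i + c * x i)(n := a n + c * t)) \<partial>leb n)"
      using Suc.IH by blast
    also have "(\<lambda>x. (\<lambda>i. ?a i + c * x i)(n := a n + c * t)) = (\<lambda>x i. a i + c * (x(n := t)) i)"
      by (intro ext) auto
    then have "(\<lambda>x. f ((\<lambda>i. ?a i + c * x i)(n := a n + c * t))) = (\<lambda>x. f (\<lambda>i. a i + c * (x(n := t)) i))"
      by (metis (no_types))
    finally show "(\<integral>\<^sup>+x. f (x(n := a n + c * t)) \<partial>leb n) = ennreal (c ^ n) * (\<integral>\<^sup>+x. f (\<lambda>i. a i + c * (x(n := t)) i) \<partial>leb n)" .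
  qed
  also have "\<dots> = ennreal (c ^ n) * (\<integral>\<^sup>+x. f (\<lambda>i. a i + c * x i) \<partial>leb (Suc n))"
    unfolding nn_integral_leb_Suc(2)[OF m2]
    by (rule nn_integral_cmult) (use m2 in measurable)
  finally show ?case using assms(2)
    by (simp add: ennreal_mult mult.assoc del: leb.simps)
qed

text \<open>Tonelli for splitting \<open>m + n\<close> coordinates into two blocks, the second one
  read off by a shift of indices. It later separates an integral over pairs of points into a product
  of two volumes.\<close>

lemma nn_integral_leb_add:
  assumes [measurable]: "f \<in> borel_measurable borel" "g \<in> borel_measurable borel"
    and dep: "\<And>x j t. m \<le> j \<Longrightarrow> f (x(j := t)) = f x"
  shows "(\<integral>\<^sup>+x. f x * g (\<lambda>i. x (m + i)) \<partial>leb (m + n)) = (\<integral>\<^sup>+x. f x \<partial>leb m) * (\<integral>\<^sup>+x. g x \<partial>leb n)"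
  using assms(2)
proof (induction n arbitrary: g)
  case 0
  note [measurable] = 0
  have "(\<integral>\<^sup>+x. f x * g (\<lambda>i. x (m + i)) \<partial>leb m) = (\<integral>\<^sup>+x. f x * g (\<lambda>_. 0) \<partial>leb m)"
    by (rule nn_integral_cong_AE, rule AE_mp[OF AE_leb_real_space])
       (auto simp: real_space_def topspace_Euclidean_space)
  also have "\<dots> = (\<integral>\<^sup>+x. f x \<partial>leb m) * g (\<lambda>_. 0)" by (rule nn_integral_multc) simp
  finally show ?case by (simp del: leb.simps)
next
  case (Suc n)
  note [measurable] = Suc.prems
  have [measurable]: "(\<lambda>x i. x (m + i)) \<in> borel_measurable (borel :: (nat \<Rightarrow> real) measure)"
    by (rule measurable_coordinatewise_then_product) measurable
  have *: "(\<lambda>i. (x(m + n := t)) (m + i)) = (\<lambda>i. x (m + i))(n := t)" for x :: "nat \<Rightarrow> real" and t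
    by auto
  have "(\<integral>\<^sup>+x. f x * g (\<lambda>i. x (m + i)) \<partial>leb (Suc (m + n)))
      = (\<integral>\<^sup>+t. \<integral>\<^sup>+x. f x * g ((\<lambda>i. x (m + i))(n := t)) \<partial>leb (m + n) \<partial>lborel)"
    by (subst nn_integral_leb_Suc(2)) (simp_all only: * dep le_add1, measurable)
  also have "\<dots> = (\<integral>\<^sup>+t. (\<integral>\<^sup>+x. f x \<partial>leb m) * (\<integral>\<^sup>+x. g (x(n := t)) \<partial>leb n) \<partial>lborel)"
    by (intro nn_integral_cong Suc.IH) measurable
  also have "\<dots> = (\<integral>\<^sup>+x. f x \<partial>leb m) * (\<integral>\<^sup>+x. g x \<partial>leb (Suc n))"
    by (subst nn_integral_leb_Suc(2)) (auto intro!: nn_integral_cmult)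
  finally show ?case by (simp del: leb.simps)
qed

section \<open>Exponential decay and integrals of derivatives\<close>

lemma nn_integral_exp_abs:
  assumes "c > 0"
  shows "(\<integral>\<^sup>+t. ennreal (exp (- c * \<bar>t\<bar>)) \<partial>lborel) < \<infinity>"
proof -
  have lim: "((\<lambda>t. - exp (- c * t) / c) \<longlongrightarrow> 0) at_top"
  proof -
    have "filterlim (\<lambda>t. - c * t) at_bot at_top"
      using assms by (intro filterlim_tendsto_neg_mult_at_bot[OF tendsto_const _ filterlim_ident]) auto
    then have "((\<lambda>t. exp (- c * t)) \<longlongrightarrow> 0) at_top"
      by (rule filterlim_compose[OF exp_at_bot])
    then show ?thesis using tendsto_divide[OF tendsto_minus tendsto_const, of "\<lambda>t. exp (- c * t)" 0 at_top c] assms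
      by simp
  qed
  have half: "(\<integral>\<^sup>+t. ennreal (exp (- c * t)) * indicator {0..} t \<partial>lborel) = ennreal (0 - (- exp (- c * 0) / c))"
    by (rule nn_integral_FTC_atLeast[OF _ _ _ lim])
       (use assms in \<open>auto intro!: derivative_eq_intros\<close>)
  have "(\<integral>\<^sup>+t. ennreal (exp (- c * \<bar>t\<bar>)) \<partial>lborel)
     \<le> (\<integral>\<^sup>+t. ennreal (exp (- c * t)) * indicator {0..} t + ennreal (exp (- c * (- t))) * indicator {0..} (- t) \<partial>lborel)"
    by (rule nn_integral_mono) (auto simp: indicator_def)
  also have "\<dots> = (\<integral>\<^sup>+t. ennreal (exp (- c * t)) * indicator {0..} t \<partial>lborel)
      + (\<integral>\<^sup>+t. ennreal (exp (- c * (- t))) * indicator {0..} (- t) \<partial>lborel)"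
    by (rule nn_integral_add) auto
  also have "(\<integral>\<^sup>+t. ennreal (exp (- c * (- t))) * indicator {0..} (- t) \<partial>lborel)
      = (\<integral>\<^sup>+t. ennreal (exp (- c * t)) * indicator {0..} t \<partial>lborel)"
    by (subst (2) nn_integral_real_affine[where c="-1" and t=0]) auto
  finally show ?thesis unfolding half by (simp add: le_less_trans ennreal_less_top)
qed

lemma ell1_upd [simp]: "ell1 (Suc n) (x(n := t)) = ell1 n x + \<bar>t\<bar>"
  unfolding ell1_def by (auto intro: sum.cong)

lemma ell1_nonneg [simp]: "0 \<le> ell1 n x"
  unfolding ell1_def by (simp add: sum_nonneg)

lemma ell1_upd_lt [simp]: "n \<le> j \<Longrightarrow> ell1 n (x(j := t)) = ell1 n x"
  unfolding ell1_def by (auto intro: sum.cong)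

lemma nn_integral_leb_exp:
  assumes "c > 0"
  shows "(\<integral>\<^sup>+x. ennreal (exp (- c * ell1 n x)) \<partial>leb n) < \<infinity>"
proof (induction n)
  case 0
  have "(\<lambda>x. ennreal (exp (- c * ell1 0 x))) \<in> borel_measurable borel" by measurable
  from nn_integral_leb_0[OF this] show ?case by (simp only: ell1_def) simp
next
  case (Suc n)
  have "(\<integral>\<^sup>+x. ennreal (exp (- c * ell1 (Suc n) x)) \<partial>leb (Suc n))
     = (\<integral>\<^sup>+x. \<integral>\<^sup>+t. ennreal (exp (- c * ell1 n x)) * ennreal (exp (- c * \<bar>t\<bar>)) \<partial>lborel \<partial>leb n)"
    by (subst nn_integral_leb_Suc(1))
       (simp_all add: ring_distribs exp_add exp_diff exp_minus field_simps flip: ennreal_mult)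
  also have "\<dots> = (\<integral>\<^sup>+x. ennreal (exp (- c * ell1 n x)) \<partial>leb n) * (\<integral>\<^sup>+t. ennreal (exp (- c * \<bar>t\<bar>)) \<partial>lborel)"
    by (simp add: nn_integral_cmult nn_integral_multc)
  also have "\<dots> < \<infinity>" using Suc nn_integral_exp_abs[OF assms] by (simp add: ennreal_mult_less_top)
  finally show ?case .
qed

lemma integrable_leb_exp: "c > 0 \<Longrightarrow> integrable (leb n) (\<lambda>x. A * exp (- c * ell1 n x))"
  using nn_integral_leb_exp[of c n]
  by (intro integrable_mult_right) (auto simp: integrable_iff_bounded)

lemma integrable_exp_abs: "c > 0 \<Longrightarrow> integrable lborel (\<lambda>t::real. A * exp (- c * \<bar>t\<bar>))"
  using nn_integral_exp_abs[of c]
  by (intro integrable_mult_right) (auto simp: integrable_iff_bounded)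

text \<open>The fundamental theorem on the whole line: the exponential bound sends \<open>f\<close>
  to 0 at both ends.\<close>

lemma integral_deriv_line_zero:
  fixes f :: "real \<Rightarrow> complex"
  assumes d: "\<And>t. (f has_vector_derivative f' t) (at t)" and c: "continuous_on UNIV f'"
    and b: "\<And>t. norm (f t) \<le> A * exp (- c * \<bar>t\<bar>)" "\<And>t. norm (f' t) \<le> A * exp (- c * \<bar>t\<bar>)" and "c > 0"
  shows "(\<integral>t. f' t \<partial>lborel) = 0"
proof -
  have lim1: "filterlim (\<lambda>t. - c * t) at_bot at_top"
    using \<open>c > 0\<close> by (intro filterlim_tendsto_neg_mult_at_bot[OF tendsto_const _ filterlim_ident]) auto
  have lim2: "filterlim (\<lambda>t. - c * \<bar>t\<bar>) at_bot at_top"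
    using eventually_ge_at_top[of 0] by (rule filterlim_mono_eventually[OF lim1 order_refl order_refl, OF eventually_mono]) auto
  then have "filterlim (\<lambda>t. - c * \<bar>t\<bar>) at_bot at_bot"
    unfolding filterlim_at_bot_mirror by simp
  note lim = lim2 this
  have lim0: "((\<lambda>t. A * exp (- c * \<bar>t\<bar>)) \<longlongrightarrow> 0) F" if "filterlim (\<lambda>t. - c * \<bar>t\<bar>) at_bot F" for F
    using tendsto_mult[OF tendsto_const filterlim_compose[OF exp_at_bot that], of A] by simp
  have top: "(f \<longlongrightarrow> 0) at_top" "(f \<longlongrightarrow> 0) at_bot"
    by (rule Lim_null_comparison[OF always_eventually lim0], use b lim in blast, use lim in blast)+
  have int: "integrable lborel f'"
    by (rule Bochner_Integration.integrable_bound[OF integrable_exp_abs[OF \<open>c > 0\<close>, of A]])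
       (use c b(2) in \<open>auto intro!: borel_measurable_continuous_onI order_trans[OF b(2)]\<close>)
  have "(LBINT x=-\<infinity>..\<infinity>. f' x) = 0 - 0"
    by (rule interval_integral_FTC_integrable)
       (use d c int top in \<open>auto simp: continuous_on_eq_continuous_at ereal_tendsto_simps1 set_integrable_def\<close>)
  then show ?thesis by (simp add: interval_lebesgue_integral_def set_lebesgue_integral_def)
qed

text \<open>Coordinatewise derivatives suffice throughout, so no norm on the function space is needed.\<close>

definition has_pd :: "nat \<Rightarrow> ((nat \<Rightarrow> real) \<Rightarrow> complex) \<Rightarrow> ((nat \<Rightarrow> real) \<Rightarrow> complex) \<Rightarrow> bool" where
  "has_pd j f f' \<longleftrightarrow> (\<forall>p. ((\<lambda>t. f (p(j := t))) has_vector_derivative f' p) (at (p j)))"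

lemma has_pd_line: "has_pd j f f' \<Longrightarrow> ((\<lambda>t. f (p(j := t))) has_vector_derivative f' (p(j := t))) (at t)"
  unfolding has_pd_def by (drule spec[of _ "p(j := t)"]) simp

lemma continuous_on_line:
  fixes f :: "(nat \<Rightarrow> real) \<Rightarrow> 'b::topological_space"
  assumes "continuous_on UNIV f" shows "continuous_on S (\<lambda>t. f (p(j := t)))"
proof -
  have "continuous_on S (\<lambda>t. p(j := t))"
  proof (rule continuous_on_coordinatewise_then_product)
    fix i show "continuous_on S (\<lambda>t. (p(j := t)) i)"
      by (cases "i = j") (auto intro!: continuous_intros)
  qed
  then show ?thesis by (rule continuous_on_compose2[OF assms]) auto
qed

lemma continuous_on_slice:
  fixes f :: "(nat \<Rightarrow> real) \<Rightarrow> 'b::topological_space"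
  assumes "continuous_on UNIV f" shows "continuous_on UNIV (\<lambda>x. f (x(j := t)))"
proof -
  have "continuous_on UNIV (\<lambda>x :: nat \<Rightarrow> real. x(j := t))"
  proof (rule continuous_on_coordinatewise_then_product)
    fix i show "continuous_on UNIV (\<lambda>x :: nat \<Rightarrow> real. (x(j := t)) i)"
      by (cases "i = j") (auto intro!: continuous_intros)
  qed
  then show ?thesis by (rule continuous_on_compose2[OF assms]) auto
qed

text \<open>If \<open>j\<close> is the last coordinate, the innermost integral is already zero.
  Otherwise the last coordinate is frozen at \<open>t\<close> and its factor
  \<open>exp (- c * \<bar>t\<bar>)\<close> goes into \<open>A\<close>, which is why the induction
  varies \<open>A\<close>.\<close>

lemma integral_pd_zero:
  assumes "has_pd j f f'" "continuous_on UNIV f'" "j < n"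
    and "\<And>x. norm (f x) \<le> A * exp (- c * ell1 n x)" "\<And>x. norm (f' x) \<le> A * exp (- c * ell1 n x)"
    and "c > 0" "A \<ge> 0"
  shows "(\<integral>x. f' x \<partial>leb n) = 0"
  using assms
proof (induction n arbitrary: f f' A)
  case (Suc n)
  have int: "integrable (leb (Suc n)) f'"
    by (rule Bochner_Integration.integrable_bound[OF integrable_leb_exp[OF \<open>c > 0\<close>, of "Suc n" A]])
       (use Suc.prems in \<open>auto intro!: continuous_imp_borel_fun order_trans[OF Suc.prems(5)] simp: measurable_cong_sets[OF sets_leb refl]\<close>)
  have ex: "A * exp (- c * (ell1 n x + \<bar>t\<bar>)) = (A * exp (- c * ell1 n x)) * exp (- c * \<bar>t\<bar>)"
    "A * exp (- c * (ell1 n x + \<bar>t\<bar>)) = (A * exp (- c * \<bar>t\<bar>)) * exp (- c * ell1 n x)" for x t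
    by (simp_all add: ring_distribs exp_add exp_diff exp_minus field_simps)
  show ?case
  proof (cases "j = n")
    case True
    have "(\<integral>t. f' (x(n := t)) \<partial>lborel) = 0" for x
    proof (rule integral_deriv_line_zero)
      show "((\<lambda>t. f (x(n := t))) has_vector_derivative f' (x(n := t))) (at t)" for t
        using Suc.prems(1) True by (auto intro: has_pd_line)
      show "continuous_on UNIV (\<lambda>t. f' (x(n := t)))"
        using Suc.prems by (intro continuous_on_line)
      show "norm (f (x(n := t))) \<le> (A * exp (- c * ell1 n x)) * exp (- c * \<bar>t\<bar>)"
        "norm (f' (x(n := t))) \<le> (A * exp (- c * ell1 n x)) * exp (- c * \<bar>t\<bar>)" for t
        using Suc.prems(4,5)[of "x(n := t)"] by (simp_all only: ell1_upd ex(1))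
    qed fact
    then show ?thesis by (simp add: integral_leb_Suc(1)[OF int])
  next
    case False
    have "(\<integral>x. f' (x(n := t)) \<partial>leb n) = 0" for t
    proof (rule Suc.IH)
      show "has_pd j (\<lambda>x. f (x(n := t))) (\<lambda>x. f' (x(n := t)))"
        unfolding has_pd_def
      proof
        fix p :: "nat \<Rightarrow> real"
        have "((\<lambda>s. f ((p(n := t))(j := s))) has_vector_derivative f' (p(n := t))) (at (p j))"
          using Suc.prems(1) False unfolding has_pd_def by (drule_tac spec[of _ "p(n := t)"]) simp
        then show "((\<lambda>s. f ((p(j := s))(n := t))) has_vector_derivative f' (p(n := t))) (at (p j))"
          using False by (simp add: fun_upd_twist)
      qed
      show "continuous_on UNIV (\<lambda>x. f' (x(n := t)))"
        by (intro continuous_on_slice Suc.prems)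
      show "j < n" using Suc.prems False by simp
      show "norm (f (x(n := t))) \<le> (A * exp (- c * \<bar>t\<bar>)) * exp (- c * ell1 n x)"
        "norm (f' (x(n := t))) \<le> (A * exp (- c * \<bar>t\<bar>)) * exp (- c * ell1 n x)" for x
        using Suc.prems(4,5)[of "x(n := t)"] by (simp_all only: ell1_upd ex(2))
    qed (use Suc.prems in auto)
    then show ?thesis by (simp add: integral_leb_Suc(2)[OF int])
  qed
qed simp

section \<open>Gaussian integrals in triangular coordinates\<close>

lemma nn_integral_gauss_line:
  assumes "r > 0"
  shows "(\<integral>\<^sup>+t. ennreal (exp (- (c + r * t)\<^sup>2 / 2)) \<partial>lborel) = ennreal (sqrt (2 * pi) / r)"
proof -
  have e: "exp (- (c + r * t)\<^sup>2 / 2) = sqrt (2 * pi) / r * normal_density (- c / r) (1 / r) t" for t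
  proof -
    have "(t - - c / r)\<^sup>2 / (2 * (1 / r)\<^sup>2) = (c + r * t)\<^sup>2 / 2"
      using assms by (simp add: field_simps power2_eq_square)
    then show ?thesis using assms
      by (simp add: normal_density_def real_sqrt_mult real_sqrt_divide field_simps)
  qed
  have "(\<integral>\<^sup>+t. ennreal (normal_density (- c / r) (1 / r) t) \<partial>lborel) = ennreal 1"
    using assms by (subst nn_integral_eq_integral) auto
  then show ?thesis unfolding e using assms
    by (subst ennreal_mult) (simp_all add: nn_integral_cmult)
qed

text \<open>Only the last linear form contains the last coordinate, so integrating that coordinate
  out gives a shifted line integral whose value does not depend on the shift. Ellipsoids are later
  given by triangular forms so that this computes their volume.\<close>

lemma nn_integral_gauss_triangular:
  assumes "\<And>i. i < n \<Longrightarrow> R i i > (0::real)"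
  shows "(\<integral>\<^sup>+x. ennreal (exp (- (\<Sum>i<n. (\<Sum>j\<le>i. R i j * x j)\<^sup>2) / 2)) \<partial>leb n) = ennreal (\<Prod>i<n. sqrt (2 * pi) / R i i)"
  using assms
proof (induction n)
  case 0
  have "(\<lambda>x. ennreal (exp (- (\<Sum>i<0. (\<Sum>j\<le>i. R i j * x j)\<^sup>2) / 2))) \<in> borel_measurable borel" by measurable
  from nn_integral_leb_0[OF this] show ?case by simp
next
  case (Suc n)
  let ?q = "\<lambda>x. exp (- (\<Sum>i<n. (\<Sum>j\<le>i. R i j * x j)\<^sup>2) / 2)"
  let ?l = "\<lambda>x t. exp (- ((\<Sum>j<n. R n j * x j) + R n n * t)\<^sup>2 / 2)"
  have u: "(\<Sum>j\<le>i. R i j * (x(n := t)) j) = (\<Sum>j\<le>i. R i j * x j)" if "i < n" for i x t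
    using that by (intro sum.cong) auto
  have v: "(\<Sum>j\<le>n. R n j * (x(n := t)) j) = (\<Sum>j<n. R n j * x j) + R n n * t" for x t
    by (simp add: lessThan_Suc_atMost[symmetric])
  have s: "exp (- (\<Sum>i<Suc n. (\<Sum>j\<le>i. R i j * (x(n := t)) j)\<^sup>2) / 2) = ?q x * ?l x t" for x t
  proof -
    have "(\<Sum>i<n. (\<Sum>j\<le>i. R i j * (x(n := t)) j)\<^sup>2) = (\<Sum>i<n. (\<Sum>j\<le>i. R i j * x j)\<^sup>2)"
      by (intro sum.cong) (auto simp: u simp del: fun_upd_apply)
    then show ?thesis
      by (simp only: v sum.lessThan_Suc flip: exp_add) (simp add: field_simps del: fun_upd_apply)
  qed
  have l: "(\<integral>\<^sup>+t. ennreal (?q x * ?l x t) \<partial>lborel) = ennreal (?q x) * ennreal (sqrt (2 * pi) / R n n)" for x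
  proof -
    have "(\<integral>\<^sup>+t. ennreal (?q x * ?l x t) \<partial>lborel) = (\<integral>\<^sup>+t. ennreal (?q x) * ennreal (?l x t) \<partial>lborel)"
      by (subst ennreal_mult) auto
    also have "\<dots> = ennreal (?q x) * (\<integral>\<^sup>+t. ennreal (?l x t) \<partial>lborel)"
      by (intro nn_integral_cmult measurable_compose[OF _ measurable_ennreal] borel_measurable_continuous_onI continuous_intros)
         (auto intro!: borel_measurable_continuous_onI continuous_intros)
    also have "(\<integral>\<^sup>+t. ennreal (?l x t) \<partial>lborel) = ennreal (sqrt (2 * pi) / R n n)"
      by (rule nn_integral_gauss_line) (use Suc.prems in auto)
    finally show ?thesis .
  qed
  have "(\<integral>\<^sup>+x. ennreal (exp (- (\<Sum>i<Suc n. (\<Sum>j\<le>i. R i j * x j)\<^sup>2) / 2)) \<partial>leb (Suc n))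
     = (\<integral>\<^sup>+x. \<integral>\<^sup>+t. ennreal (?q x * ?l x t) \<partial>lborel \<partial>leb n)"
  proof -
    have m: "(\<lambda>x. ennreal (exp (- (\<Sum>i<Suc n. (\<Sum>j\<le>i. R i j * x j)\<^sup>2) / 2))) \<in> borel_measurable borel"
      by measurable
    show ?thesis by (rule trans[OF nn_integral_leb_Suc(1)[OF m]]) (simp only: s)
  qed
  also have "\<dots> = (\<integral>\<^sup>+x. ennreal (?q x) * ennreal (sqrt (2 * pi) / R n n) \<partial>leb n)"
    by (simp only: l)
  also have "\<dots> = (\<integral>\<^sup>+x. ennreal (?q x) \<partial>leb n) * ennreal (sqrt (2 * pi) / R n n)"
    by (rule nn_integral_multc) measurable
  also have "(\<integral>\<^sup>+x. ennreal (?q x) \<partial>leb n) = ennreal (\<Prod>i<n. sqrt (2 * pi) / R i i)"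
    by (rule Suc.IH) (use Suc.prems in auto)
  also have "ennreal (\<Prod>i<n. sqrt (2 * pi) / R i i) * ennreal (sqrt (2 * pi) / R n n) = ennreal (\<Prod>i<Suc n. sqrt (2 * pi) / R i i)"
    using Suc.prems[of n] by (subst ennreal_mult''[symmetric]) (auto simp: less_imp_le)
  finally show ?case .
qed

section \<open>Integrals of closed forms under deformation\<close>

text \<open>The Leibniz sum over functions of two indices: the proof of closedness rearranges its
  terms one permutation at a time, and the entries may depend on a point.\<close>

definition ldet :: "nat \<Rightarrow> (nat \<Rightarrow> nat \<Rightarrow> 'a) \<Rightarrow> 'a::comm_ring_1" where
  "ldet n a = (\<Sum>\<sigma> | \<sigma> permutes {..<n}. of_int (sign \<sigma>) * (\<Prod>k<n. a k (\<sigma> k)))"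

lemma ldet_eq_det: "ldet n a = Determinant.det (Matrix.mat n n (\<lambda>(i, j). a i j))"
proof -
  have "(\<Prod>k<n. a k (\<sigma> k)) = (\<Prod>k<n. Matrix.mat n n (\<lambda>(i, j). a i j) $$ (k, \<sigma> k))"
    if "\<sigma> permutes {..<n}" for \<sigma>
  proof (rule prod.cong[OF refl])
    fix k assume "k \<in> {..<n}"
    then show "a k (\<sigma> k) = Matrix.mat n n (\<lambda>(i, j). a i j) $$ (k, \<sigma> k)"
      using permutes_in_image[OF that, of k] by simp
  qed
  then show ?thesis
    unfolding ldet_def Determinant.det_def by (simp add: atLeast0LessThan)
qed

text \<open>Composition with the transposition is a sign-reversing involution on the permutations,
  so the sum equals its own negative.\<close>

lemma sum_permutes_transpose_zero:
  fixes f :: "(nat \<Rightarrow> nat) \<Rightarrow> 'a::{idom, ring_char_0}"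
  assumes "finite S" "a \<in> S" "b \<in> S" "a \<noteq> b"
    and f: "\<And>\<sigma>. \<sigma> permutes S \<Longrightarrow> f (\<sigma> \<circ> Transposition.transpose a b) = f \<sigma>"
  shows "(\<Sum>\<sigma> | \<sigma> permutes S. of_int (sign \<sigma>) * f \<sigma>) = 0"
proof -
  let ?t = "Transposition.transpose a b" and ?s = "\<Sum>\<sigma> | \<sigma> permutes S. of_int (sign \<sigma>) * f \<sigma>"
  have t: "?t permutes S" using assms by (intro permutes_swap_id)
  have "?s = (\<Sum>\<sigma> | \<sigma> permutes S. of_int (sign (\<sigma> \<circ> ?t)) * f (\<sigma> \<circ> ?t))"
  proof (rule sum.reindex_bij_witness[of _ "\<lambda>\<sigma>. \<sigma> \<circ> ?t" "\<lambda>\<sigma>. \<sigma> \<circ> ?t"])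
    fix \<sigma> assume "\<sigma> \<in> {\<sigma>. \<sigma> permutes S}"
    then show "\<sigma> \<circ> ?t \<in> {\<sigma>. \<sigma> permutes S}" "\<sigma> \<circ> ?t \<in> {\<sigma>. \<sigma> permutes S}"
      using permutes_compose[OF t] by simp_all
  qed (simp_all add: comp_assoc)
  also have "\<dots> = (\<Sum>\<sigma> | \<sigma> permutes S. - (of_int (sign \<sigma>) * f \<sigma>))"
  proof (rule sum.cong[OF refl])
    fix \<sigma> assume "\<sigma> \<in> {\<sigma>. \<sigma> permutes S}"
    then have s: "\<sigma> permutes S" by simp
    have "sign (\<sigma> \<circ> ?t) = - sign \<sigma>"
      using assms(4) sign_compose[OF permutes_imp_permutation[OF assms(1) s] permutation_swap_id]
      by (simp add: sign_swap_id)
    then show "of_int (sign (\<sigma> \<circ> ?t)) * f (\<sigma> \<circ> ?t) = - (of_int (sign \<sigma>) * f \<sigma>)"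
      by (simp add: f[OF s])
  qed
  also have "\<dots> = - ?s" by (simp add: sum_negf)
  finally have "?s + ?s = 0" by (simp only: eq_neg_iff_add_eq_0)
  then have "2 * ?s = 0" by (simp only: mult_2)
  then show ?thesis by (simp only: mult_eq_0_iff) simp
qed

text \<open>Half of the decay rate pays for the polynomial: \<open>b\<close> is so small that
  \<open>b * m\<close> is at most \<open>c / 2\<close>, while \<open>1 + t\<close> is at most
  \<open>exp (b * t) / b\<close>.\<close>

lemma poly_exp_bound:
  assumes "c > 0"
  obtains K :: real where "K \<ge> 0" "\<And>t. t \<ge> 0 \<Longrightarrow> (1 + t) ^ m * exp (- c * t) \<le> K * exp (- (c / 2) * t)"
proof
  define b where "b = min 1 (c / (2 * (real m + 1)))"
  have b: "b > 0" "b \<le> 1" and bm: "real m * b \<le> c / 2"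
  proof -
    show "b > 0" "b \<le> 1" using assms by (auto simp: b_def)
    have "real m * b \<le> real m * (c / (2 * (real m + 1)))" by (intro mult_left_mono) (auto simp: b_def)
    also have "\<dots> \<le> c / 2" using assms by (simp add: field_simps)
    finally show "real m * b \<le> c / 2" .
  qed
  show "(1 / b) ^ m \<ge> 0" using b by simp
  fix t :: real assume t: "t \<ge> 0"
  have "1 + t \<le> 1 / b * exp (b * t)"
  proof -
    have "b * (1 + t) \<le> 1 + b * t" using b by (simp add: algebra_simps)
    also have "\<dots> \<le> exp (b * t)" by (rule exp_ge_add_one_self)
    finally show ?thesis using b by (simp add: field_simps)
  qed
  then have "(1 + t) ^ m \<le> (1 / b * exp (b * t)) ^ m" using t by (intro power_mono) auto
  also have "\<dots> = (1 / b) ^ m * exp (real m * b * t)"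
    by (simp only: power_mult_distrib exp_of_nat_mult[symmetric] mult.assoc)
  also have "\<dots> \<le> (1 / b) ^ m * exp (c / 2 * t)"
    using mult_right_mono[OF bm t] b by (intro mult_left_mono) auto
  finally have "(1 + t) ^ m * exp (- c * t) \<le> (1 / b) ^ m * exp (c / 2 * t) * exp (- c * t)"
    by (rule mult_right_mono) simp
  also have "\<dots> = (1 / b) ^ m * exp (- (c / 2) * t)"
    by (simp add: mult.assoc flip: exp_add)
  finally show "(1 + t) ^ m * exp (- c * t) \<le> (1 / b) ^ m * exp (- (c / 2) * t)" .
qed

text \<open>The form \<open>G dP\<^sub>0 \<and> \<dots> \<and> dP\<^bsub>N-1\<^esub>\<close> on \<open>\<real>\<^bsup>N+1\<^esup>\<close> is closed when \<open>dG\<close> is a combination of the \<open>dP\<^sub>k\<close>.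
  Its components \<open>\<Phi> j\<close> are written as sums over the permutations \<open>\<sigma>\<close> of \<open>{..N}\<close> with \<open>\<sigma> N = j\<close>, so that
  closedness becomes cancellation of \<open>\<sigma>\<close> against \<open>\<sigma> \<circ> Transposition.transpose a b\<close>.\<close>

locale closed_form =
  fixes N :: nat and dP :: "nat \<Rightarrow> nat \<Rightarrow> (nat \<Rightarrow> real) \<Rightarrow> complex"
    and ddP :: "nat \<Rightarrow> nat \<Rightarrow> nat \<Rightarrow> (nat \<Rightarrow> real) \<Rightarrow> complex"
    and G :: "(nat \<Rightarrow> real) \<Rightarrow> complex" and dG :: "nat \<Rightarrow> (nat \<Rightarrow> real) \<Rightarrow> complex"
    and C A c :: real
  assumes pd_dP: "\<And>k j l. k < N \<Longrightarrow> j \<le> N \<Longrightarrow> l \<le> N \<Longrightarrow> has_pd l (dP k j) (ddP k j l)"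
    and sym: "\<And>k j l p. k < N \<Longrightarrow> j \<le> N \<Longrightarrow> l \<le> N \<Longrightarrow> ddP k j l p = ddP k l j p"
    and pd_G: "\<And>j. j \<le> N \<Longrightarrow> has_pd j G (\<lambda>p. \<Sum>l<N. dG l p * dP l j p)"
    and cont: "continuous_on UNIV G" "\<And>l. l < N \<Longrightarrow> continuous_on UNIV (dG l)"
      "\<And>k j. k < N \<Longrightarrow> j \<le> N \<Longrightarrow> continuous_on UNIV (dP k j)"
      "\<And>k j l. k < N \<Longrightarrow> j \<le> N \<Longrightarrow> l \<le> N \<Longrightarrow> continuous_on UNIV (ddP k j l)"
    and bdP: "\<And>k j p. k < N \<Longrightarrow> j \<le> N \<Longrightarrow> 0 \<le> p N \<Longrightarrow> p N \<le> 1 \<Longrightarrow> norm (dP k j p) \<le> C * (1 + ell1 N p)"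
    and bddP: "\<And>k j l p. k < N \<Longrightarrow> j \<le> N \<Longrightarrow> l \<le> N \<Longrightarrow> 0 \<le> p N \<Longrightarrow> p N \<le> 1 \<Longrightarrow> norm (ddP k j l p) \<le> C * (1 + ell1 N p)"
    and bG: "\<And>p. 0 \<le> p N \<Longrightarrow> p N \<le> 1 \<Longrightarrow> norm (G p) \<le> A * exp (- c * ell1 N p)"
    and bdG: "\<And>l p. l < N \<Longrightarrow> 0 \<le> p N \<Longrightarrow> p N \<le> 1 \<Longrightarrow> norm (dG l p) \<le> A * exp (- c * ell1 N p)"
    and C: "C \<ge> 1" and A: "A \<ge> 0" and c: "c > 0"
begin

text \<open>Coordinate \<open>N\<close> is the time of a deformation; those below \<open>N\<close>
  are space. \<open>T\<close> is the term of one permutation, and \<open>\<sigma> N\<close> is the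
  coordinate missing from its wedge product; \<open>DT\<close> is what the product rule
  gives.\<close>

definition "T \<sigma> p = G p * (\<Prod>k<N. dP k (\<sigma> k) p)"
definition "DT \<sigma> j p = (\<Sum>l<N. dG l p * dP l j p) * (\<Prod>k<N. dP k (\<sigma> k) p)
    + G p * (\<Sum>i<N. ddP i (\<sigma> i) j p * (\<Prod>k\<in>{..<N} - {i}. dP k (\<sigma> k) p))"
definition "Per j = {\<sigma>. \<sigma> permutes {..N} \<and> \<sigma> N = j}"
definition "\<Phi> j p = (\<Sum>\<sigma>\<in>Per j. of_int (sign \<sigma>) * T \<sigma> p)"
definition "D\<Phi> j p = (\<Sum>\<sigma>\<in>Per j. of_int (sign \<sigma>) * DT \<sigma> j p)"

lemma finite_Per [simp]: "finite (Per j)"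
  unfolding Per_def by (rule finite_subset[OF _ finite_permutations[of "{..N}"]]) auto

lemma perm_le: "\<sigma> permutes {..N} \<Longrightarrow> k \<le> N \<Longrightarrow> \<sigma> k \<le> N"
  using permutes_in_image[of \<sigma> "{..N}" k] by auto

lemma pd_T:
  assumes "\<sigma> permutes {..N}" "j \<le> N"
  shows "has_pd j (T \<sigma>) (DT \<sigma> j)"
  unfolding has_pd_def
proof
  fix p
  have 1: "((\<lambda>t. G (p(j := t))) has_vector_derivative (\<Sum>l<N. dG l p * dP l j p)) (at (p j))"
    using pd_G[OF assms(2)] unfolding has_pd_def by blast
  have d: "((\<lambda>t. dP k (\<sigma> k) (p(j := t))) has_vector_derivative ddP k (\<sigma> k) j p) (at (p j))" if "k < N" for k
    using pd_dP[OF that _ assms(2), of "\<sigma> k"] perm_le[OF assms(1), of k] that unfolding has_pd_def by auto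
  have "((\<lambda>t. \<Prod>k<N. dP k (\<sigma> k) (p(j := t))) has_derivative
      (\<lambda>y. \<Sum>i<N. (y *\<^sub>R ddP i (\<sigma> i) j p) * (\<Prod>k\<in>{..<N} - {i}. dP k (\<sigma> k) (p(j := p j))))) (at (p j))"
    by (rule has_derivative_prod) (use d in \<open>auto simp: has_vector_derivative_def\<close>)
  then have 2: "((\<lambda>t. \<Prod>k<N. dP k (\<sigma> k) (p(j := t))) has_vector_derivative
      (\<Sum>i<N. ddP i (\<sigma> i) j p * (\<Prod>k\<in>{..<N} - {i}. dP k (\<sigma> k) p))) (at (p j))"
    by (simp add: has_vector_derivative_def scaleR_sum_right)
  show "((\<lambda>t. T \<sigma> (p(j := t))) has_vector_derivative DT \<sigma> j p) (at (p j))"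
    unfolding T_def DT_def
    using has_vector_derivative_mult[OF 1 2] by (simp add: add.commute)
qed

lemma pd_\<Phi>:
  assumes "j \<le> N" shows "has_pd j (\<Phi> j) (D\<Phi> j)"
  unfolding has_pd_def \<Phi>_def D\<Phi>_def
proof (intro allI has_vector_derivative_sum has_vector_derivative_mult_right)
  fix p \<sigma> assume "\<sigma> \<in> Per j"
  then have "has_pd j (T \<sigma>) (DT \<sigma> j)" using pd_T assms by (auto simp: Per_def)
  then show "((\<lambda>t. T \<sigma> (p(j := t))) has_vector_derivative DT \<sigma> j p) (at (p j))"
    unfolding has_pd_def by blast
qed

lemma cont_T: "\<sigma> permutes {..N} \<Longrightarrow> continuous_on UNIV (T \<sigma>)"
  unfolding T_def[abs_def] using perm_le by (intro continuous_intros cont) auto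

lemma cont_DT: "\<sigma> permutes {..N} \<Longrightarrow> j \<le> N \<Longrightarrow> continuous_on UNIV (DT \<sigma> j)"
  unfolding DT_def[abs_def] using perm_le by (intro continuous_intros cont) auto

lemma cont_\<Phi>: "continuous_on UNIV (\<Phi> j)" and cont_D\<Phi>: "j \<le> N \<Longrightarrow> continuous_on UNIV (D\<Phi> j)"
  unfolding \<Phi>_def[abs_def] D\<Phi>_def[abs_def]
  by (intro continuous_intros cont_T cont_DT; simp add: Per_def)+

text \<open>Differentiating \<open>G\<close> gives terms in which \<open>dP l\<close> occurs at both
  positions \<open>l\<close> and \<open>N\<close>; differentiating the factor \<open>i\<close> gives
  the second derivative \<open>ddP i\<close> at the positions \<open>i\<close> and \<open>N\<close>,
  symmetric by \<open>sym\<close>. Both are unchanged when the two positions are exchanged, so the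
  signed sums vanish.\<close>

lemma closed: "(\<Sum>j\<le>N. D\<Phi> j p) = 0"
proof -
  have "(\<Sum>j\<le>N. D\<Phi> j p) = (\<Sum>j\<le>N. \<Sum>\<sigma> | \<sigma> \<in> {\<sigma>. \<sigma> permutes {..N}} \<and> \<sigma> N = j. of_int (sign \<sigma>) * DT \<sigma> (\<sigma> N) p)"
    unfolding D\<Phi>_def Per_def by (intro sum.cong) auto
  also have "\<dots> = (\<Sum>\<sigma> | \<sigma> permutes {..N}. of_int (sign \<sigma>) * DT \<sigma> (\<sigma> N) p)"
    by (rule sum.group) (auto simp: finite_permutations perm_le)
  also have "\<dots> = (\<Sum>\<sigma> | \<sigma> permutes {..N}. (\<Sum>l<N. of_int (sign \<sigma>) * (dG l p * (dP l (\<sigma> N) p * (\<Prod>k<N. dP k (\<sigma> k) p))))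
     + (\<Sum>i<N. of_int (sign \<sigma>) * (G p * (ddP i (\<sigma> i) (\<sigma> N) p * (\<Prod>k\<in>{..<N} - {i}. dP k (\<sigma> k) p)))))"
    unfolding DT_def by (intro sum.cong refl) (simp add: ring_distribs sum_distrib_left sum_distrib_right mult_ac)
  also have "\<dots> = (\<Sum>l<N. \<Sum>\<sigma> | \<sigma> permutes {..N}. of_int (sign \<sigma>) * (dG l p * (dP l (\<sigma> N) p * (\<Prod>k<N. dP k (\<sigma> k) p))))
     + (\<Sum>i<N. \<Sum>\<sigma> | \<sigma> permutes {..N}. of_int (sign \<sigma>) * (G p * (ddP i (\<sigma> i) (\<sigma> N) p * (\<Prod>k\<in>{..<N} - {i}. dP k (\<sigma> k) p))))"
    unfolding sum.distrib by (intro arg_cong2[where f="(+)"] sum.swap)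
  also have "\<dots> = 0"
  proof (rule trans[OF arg_cong2[where f="(+)"] add_0_left]; rule sum.neutral; rule ballI)
    fix l assume "l \<in> {..<N}"
    then have l: "l < N" by simp
    show "(\<Sum>\<sigma> | \<sigma> permutes {..N}. of_int (sign \<sigma>) * (dG l p * (dP l (\<sigma> N) p * (\<Prod>k<N. dP k (\<sigma> k) p)))) = 0"
    proof (rule sum_permutes_transpose_zero[of _ l N])
      fix \<sigma> :: "nat \<Rightarrow> nat"
      have r: "(\<Prod>k<N. h k) = h l * (\<Prod>k\<in>{..<N} - {l}. h k)" for h :: "nat \<Rightarrow> complex"
        using l by (simp add: prod.remove)
      have "(\<Prod>k\<in>{..<N} - {l}. dP k ((\<sigma> \<circ> Transposition.transpose l N) k) p) = (\<Prod>k\<in>{..<N} - {l}. dP k (\<sigma> k) p)"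
        by (intro prod.cong) (auto simp: transpose_def)
      then show "dG l p * (dP l ((\<sigma> \<circ> Transposition.transpose l N) N) p * (\<Prod>k<N. dP k ((\<sigma> \<circ> Transposition.transpose l N) k) p))
        = dG l p * (dP l (\<sigma> N) p * (\<Prod>k<N. dP k (\<sigma> k) p))"
        unfolding r by (simp add: mult_ac)
    qed (use l in auto)
  next
    fix i assume "i \<in> {..<N}"
    then have i: "i < N" by simp
    show "(\<Sum>\<sigma> | \<sigma> permutes {..N}. of_int (sign \<sigma>) * (G p * (ddP i (\<sigma> i) (\<sigma> N) p * (\<Prod>k\<in>{..<N} - {i}. dP k (\<sigma> k) p)))) = 0"
    proof (rule sum_permutes_transpose_zero[of _ i N])
      fix \<sigma> assume s: "\<sigma> permutes {..N}"
      have "(\<Prod>k\<in>{..<N} - {i}. dP k ((\<sigma> \<circ> Transposition.transpose i N) k) p) = (\<Prod>k\<in>{..<N} - {i}. dP k (\<sigma> k) p)"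
        by (intro prod.cong) (auto simp: transpose_def)
      then show "G p * (ddP i ((\<sigma> \<circ> Transposition.transpose i N) i) ((\<sigma> \<circ> Transposition.transpose i N) N) p * (\<Prod>k\<in>{..<N} - {i}. dP k ((\<sigma> \<circ> Transposition.transpose i N) k) p))
        = G p * (ddP i (\<sigma> i) (\<sigma> N) p * (\<Prod>k\<in>{..<N} - {i}. dP k (\<sigma> k) p))"
        using sym[OF i perm_le[OF s] perm_le[OF s], of N i] i by simp
    qed (use i in auto)
  qed
  finally show ?thesis .
qed

text \<open>One bound for both functions: \<open>DT\<close> has \<open>N\<close> terms from the
  derivative of \<open>G\<close> and \<open>N\<close> from the factors, each bounded with at most
  \<open>Suc N\<close> powers of \<open>\<rho>\<close>. The summand 1 makes room for
  \<open>T\<close>, also when \<open>N = 0\<close>.\<close>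

lemma bound_T:
  assumes s: "\<sigma> permutes {..N}" and p: "0 \<le> p N" "p N \<le> 1" and j: "j \<le> N"
  defines "\<rho> \<equiv> C * (1 + ell1 N p)"
  shows "norm (T \<sigma> p) \<le> (2 * real N + 1) * A * exp (- c * ell1 N p) * \<rho> ^ Suc N"
    "norm (DT \<sigma> j p) \<le> (2 * real N + 1) * A * exp (- c * ell1 N p) * \<rho> ^ Suc N"
proof -
  have \<rho>: "\<rho> \<ge> 1" unfolding \<rho>_def using C mult_mono[of 1 C 1 "1 + ell1 N p"] by simp
  let ?E = "A * exp (- c * ell1 N p)"
  have E: "?E \<ge> 0" using A by simp
  have b1: "norm (dP k j p) \<le> \<rho>" if "k < N" "j \<le> N" for k j
    unfolding \<rho>_def by (rule bdP) (use that p in auto)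
  have b2: "norm (ddP k i j p) \<le> \<rho>" if "k < N" "i \<le> N" for k i
    unfolding \<rho>_def by (rule bddP) (use that p j in auto)
  have b3: "norm (G p) \<le> ?E" and b4: "\<And>l. l < N \<Longrightarrow> norm (dG l p) \<le> ?E"
    using bG[of p] bdG[of _ p] p by auto
  have P: "norm (\<Prod>k\<in>S. dP k (\<sigma> k) p) \<le> \<rho> ^ N" if "S \<subseteq> {..<N}" for S
  proof -
    have "norm (\<Prod>k\<in>S. dP k (\<sigma> k) p) \<le> (\<Prod>k\<in>S. \<rho>)"
      unfolding prod_norm[symmetric]
      using that by (intro prod_mono conjI norm_ge_zero b1 perm_le[OF s]) (auto simp: subset_iff less_imp_le)
    also have "\<dots> = \<rho> ^ card S" by simp
    also have "\<dots> \<le> \<rho> ^ N" using \<rho> card_mono[OF _ that] by (intro power_increasing) auto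
    finally show ?thesis .
  qed
  have le: "?E * \<rho> ^ N \<le> ?E * \<rho> ^ Suc N" using \<rho> E by (intro mult_left_mono power_increasing) auto
  have nn: "0 \<le> ?E * \<rho> ^ Suc N" using \<rho> by (intro mult_nonneg_nonneg[OF E]) auto
  have "norm (T \<sigma> p) \<le> ?E * \<rho> ^ N"
    unfolding T_def norm_mult by (rule mult_mono[OF b3 P[OF order_refl] E norm_ge_zero])
  also have "\<dots> \<le> 1 * (?E * \<rho> ^ Suc N)" using le by simp
  also have "\<dots> \<le> (2 * real N + 1) * (?E * \<rho> ^ Suc N)"
    using nn by (intro mult_right_mono) auto
  finally show "norm (T \<sigma> p) \<le> (2 * real N + 1) * A * exp (- c * ell1 N p) * \<rho> ^ Suc N" by (simp add: mult.assoc)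
  have "norm ((\<Sum>l<N. dG l p * dP l j p) * (\<Prod>k<N. dP k (\<sigma> k) p)) \<le> (\<Sum>l<N. ?E * \<rho>) * \<rho> ^ N"
    unfolding norm_mult
  proof (rule mult_mono[OF _ P[OF order_refl] _ norm_ge_zero])
    show "norm (\<Sum>l<N. dG l p * dP l j p) \<le> (\<Sum>l<N. ?E * \<rho>)"
    proof (intro order_trans[OF norm_sum] sum_mono, unfold norm_mult)
      fix l assume "l \<in> {..<N}"
      then show "norm (dG l p) * norm (dP l j p) \<le> ?E * \<rho>"
        using j by (intro mult_mono[OF b4 b1 E norm_ge_zero]) auto
    qed
    show "0 \<le> (\<Sum>l<N. ?E * \<rho>)" using \<rho> by (intro sum_nonneg mult_nonneg_nonneg[OF E]) auto
  qed
  moreover have "norm (G p * (\<Sum>i<N. ddP i (\<sigma> i) j p * (\<Prod>k\<in>{..<N} - {i}. dP k (\<sigma> k) p))) \<le> ?E * (\<Sum>i<N. \<rho> * \<rho> ^ N)"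
    unfolding norm_mult
  proof (rule mult_mono[OF b3 _ E norm_ge_zero])
    show "norm (\<Sum>i<N. ddP i (\<sigma> i) j p * (\<Prod>k\<in>{..<N} - {i}. dP k (\<sigma> k) p)) \<le> (\<Sum>i<N. \<rho> * \<rho> ^ N)"
    proof (intro order_trans[OF norm_sum] sum_mono, unfold norm_mult)
      fix i assume "i \<in> {..<N}"
      then show "norm (ddP i (\<sigma> i) j p) * norm (\<Prod>k\<in>{..<N} - {i}. dP k (\<sigma> k) p) \<le> \<rho> * \<rho> ^ N"
        using \<rho> perm_le[OF s, of i] by (intro mult_mono[OF b2 P]) auto
    qed
  qed
  ultimately have "norm (DT \<sigma> j p) \<le> (\<Sum>l<N. ?E * \<rho>) * \<rho> ^ N + ?E * (\<Sum>i<N. \<rho> * \<rho> ^ N)"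
    unfolding DT_def by (intro order_trans[OF norm_triangle_ineq] add_mono)
  also have "\<dots> = 2 * real N * (?E * \<rho> ^ Suc N)" by (simp add: field_simps)
  also have "\<dots> \<le> (2 * real N + 1) * (?E * \<rho> ^ Suc N)"
    using nn by (intro mult_right_mono) auto
  finally show "norm (DT \<sigma> j p) \<le> (2 * real N + 1) * A * exp (- c * ell1 N p) * \<rho> ^ Suc N" by (simp add: mult.assoc)
qed

lemma bound_\<Phi>:
  obtains M where "M \<ge> 0"
    "\<And>j (p :: nat \<Rightarrow> real). j \<le> N \<Longrightarrow> 0 \<le> p N \<Longrightarrow> p N \<le> 1 \<Longrightarrow> norm (\<Phi> j p) \<le> M * exp (- (c / 2) * ell1 N p)"
    "\<And>j (p :: nat \<Rightarrow> real). j \<le> N \<Longrightarrow> 0 \<le> p N \<Longrightarrow> p N \<le> 1 \<Longrightarrow> norm (D\<Phi> j p) \<le> M * exp (- (c / 2) * ell1 N p)"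
proof -
  obtain K where K: "K \<ge> 0" "\<And>t. t \<ge> 0 \<Longrightarrow> (1 + t) ^ Suc N * exp (- c * t) \<le> K * exp (- (c / 2) * t)"
    using poly_exp_bound[OF c, of "Suc N"] by metis
  define L where "L = (2 * real N + 1) * A * C ^ Suc N"
  have L: "L \<ge> 0" using A C by (auto simp: L_def)
  define Q where "Q = real (card {\<sigma>. \<sigma> permutes {..N}})"
  have e: "(2 * real N + 1) * A * exp (- c * ell1 N p) * (C * (1 + ell1 N p)) ^ Suc N \<le> L * K * exp (- (c / 2) * ell1 N p)" for p
  proof -
    have "(2 * real N + 1) * A * exp (- c * ell1 N p) * (C * (1 + ell1 N p)) ^ Suc N = L * ((1 + ell1 N p) ^ Suc N * exp (- c * ell1 N p))"
      unfolding L_def by (simp add: power_mult_distrib mult_ac)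
    also have "\<dots> \<le> L * (K * exp (- (c / 2) * ell1 N p))" using L K(2) by (intro mult_left_mono) auto
    finally show ?thesis by (simp add: mult.assoc)
  qed
  have g: "norm (\<Sum>\<sigma>\<in>Per j. of_int (sign \<sigma>) * h \<sigma>) \<le> Q * (L * K) * exp (- (c / 2) * ell1 N p)"
    if "\<And>\<sigma>. \<sigma> permutes {..N} \<Longrightarrow> norm (h \<sigma>) \<le> L * K * exp (- (c / 2) * ell1 N p)" for h :: "(nat \<Rightarrow> nat) \<Rightarrow> complex" and j p
  proof -
    have "norm (\<Sum>\<sigma>\<in>Per j. of_int (sign \<sigma>) * h \<sigma>) \<le> (\<Sum>\<sigma>\<in>Per j. L * K * exp (- (c / 2) * ell1 N p))"
      using that by (intro order_trans[OF norm_sum] sum_mono) (auto simp: norm_mult sign_def Per_def)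
    also have "\<dots> = real (card (Per j)) * (L * K * exp (- (c / 2) * ell1 N p))" by simp
    also have "\<dots> \<le> Q * (L * K * exp (- (c / 2) * ell1 N p))"
      unfolding Q_def using L K(1)
      by (intro mult_right_mono of_nat_mono card_mono) (auto simp: finite_permutations Per_def)
    finally show ?thesis by (simp add: mult.assoc)
  qed
  show ?thesis
  proof (rule that[of "Q * (L * K)"])
    show "Q * (L * K) \<ge> 0" using L K by (auto simp: Q_def)
    fix j and p :: "nat \<Rightarrow> real" assume jp: "j \<le> N" "0 \<le> p N" "p N \<le> 1"
    show "norm (\<Phi> j p) \<le> Q * (L * K) * exp (- (c / 2) * ell1 N p)"
      unfolding \<Phi>_def by (intro g order_trans[OF bound_T(1)[where p=p and j=j] e]) (use jp in auto)
    show "norm (D\<Phi> j p) \<le> Q * (L * K) * exp (- (c / 2) * ell1 N p)"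
      unfolding D\<Phi>_def by (intro g order_trans[OF bound_T(2)[where p=p and j=j] e]) (use jp in auto)
  qed
qed

lemma borel_leb: "continuous_on UNIV f \<Longrightarrow> f \<in> borel_measurable (leb n)"
  for f :: "(nat \<Rightarrow> real) \<Rightarrow> complex"
  using continuous_imp_borel_fun[of f] by (simp add: measurable_cong_sets[OF sets_leb refl])

lemma integrable_slice:
  assumes "s \<in> {0..1}" "j \<le> N"
  shows "integrable (leb N) (\<lambda>x. \<Phi> j (x(N := s)))" "integrable (leb N) (\<lambda>x. D\<Phi> j (x(N := s)))"
proof -
  obtain M where M: "M \<ge> 0"
    "\<And>j (p :: nat \<Rightarrow> real). j \<le> N \<Longrightarrow> 0 \<le> p N \<Longrightarrow> p N \<le> 1 \<Longrightarrow> norm (\<Phi> j p) \<le> M * exp (- (c / 2) * ell1 N p)"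
    "\<And>j (p :: nat \<Rightarrow> real). j \<le> N \<Longrightarrow> 0 \<le> p N \<Longrightarrow> p N \<le> 1 \<Longrightarrow> norm (D\<Phi> j p) \<le> M * exp (- (c / 2) * ell1 N p)"
    using bound_\<Phi> by metis
  have c2: "c / 2 > 0" using c by simp
  show "integrable (leb N) (\<lambda>x. \<Phi> j (x(N := s)))"
  proof (rule Bochner_Integration.integrable_bound[OF integrable_leb_exp[OF c2, of N M]])
    show "(\<lambda>x. \<Phi> j (x(N := s))) \<in> borel_measurable (leb N)"
      by (rule borel_leb[OF continuous_on_slice[OF cont_\<Phi>]])
    show "AE x in leb N. norm (\<Phi> j (x(N := s))) \<le> norm (M * exp (- (c / 2) * ell1 N x))"
      using M(1) M(2)[OF assms(2), of "x(N := s)" for x] assms(1) by (intro AE_I2) simp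
  qed
  show "integrable (leb N) (\<lambda>x. D\<Phi> j (x(N := s)))"
  proof (rule Bochner_Integration.integrable_bound[OF integrable_leb_exp[OF c2, of N M]])
    show "(\<lambda>x. D\<Phi> j (x(N := s))) \<in> borel_measurable (leb N)"
      by (rule borel_leb[OF continuous_on_slice[OF cont_D\<Phi>[OF assms(2)]]])
    show "AE x in leb N. norm (D\<Phi> j (x(N := s))) \<le> norm (M * exp (- (c / 2) * ell1 N x))"
      using M(1) M(3)[OF assms(2), of "x(N := s)" for x] assms(1) by (intro AE_I2) simp
  qed
qed

text \<open>By closedness the time derivative of the last component is minus the sum of the space
  derivatives of the others, and these integrate to zero over a slice.\<close>

lemma integral_D\<Phi>_last:
  assumes s: "s \<in> {0..1}"
  shows "(\<integral>x. D\<Phi> N (x(N := s)) \<partial>leb N) = 0"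
proof -
  obtain M where M: "M \<ge> 0"
    "\<And>j (p :: nat \<Rightarrow> real). j \<le> N \<Longrightarrow> 0 \<le> p N \<Longrightarrow> p N \<le> 1 \<Longrightarrow> norm (\<Phi> j p) \<le> M * exp (- (c / 2) * ell1 N p)"
    "\<And>j (p :: nat \<Rightarrow> real). j \<le> N \<Longrightarrow> 0 \<le> p N \<Longrightarrow> p N \<le> 1 \<Longrightarrow> norm (D\<Phi> j p) \<le> M * exp (- (c / 2) * ell1 N p)"
    using bound_\<Phi> by metis
  have z: "(\<integral>x. D\<Phi> j (x(N := s)) \<partial>leb N) = 0" if j: "j < N" for j
  proof (rule integral_pd_zero[OF _ _ j])
    show "has_pd j (\<lambda>x. \<Phi> j (x(N := s))) (\<lambda>x. D\<Phi> j (x(N := s)))"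
      unfolding has_pd_def
    proof
      fix p :: "nat \<Rightarrow> real"
      have "((\<lambda>t. \<Phi> j ((p(N := s))(j := t))) has_vector_derivative D\<Phi> j (p(N := s))) (at (p j))"
        using pd_\<Phi>[of j] j unfolding has_pd_def by (auto dest!: spec[of _ "p(N := s)"])
      then show "((\<lambda>t. \<Phi> j ((p(j := t))(N := s))) has_vector_derivative D\<Phi> j (p(N := s))) (at (p j))"
        using j by (simp add: fun_upd_twist)
    qed
    show "continuous_on UNIV (\<lambda>x. D\<Phi> j (x(N := s)))"
      using j by (intro continuous_on_slice[OF cont_D\<Phi>]) auto
    show "norm (\<Phi> j (x(N := s))) \<le> M * exp (- (c / 2) * ell1 N x)"
      "norm (D\<Phi> j (x(N := s))) \<le> M * exp (- (c / 2) * ell1 N x)" for x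
      using M(2,3)[of j "x(N := s)"] s j by auto
  qed (use c M in auto)
  have "0 = (\<integral>x. (\<Sum>j\<le>N. D\<Phi> j (x(N := s))) \<partial>leb N)" by (simp add: closed)
  also have "\<dots> = (\<Sum>j\<le>N. \<integral>x. D\<Phi> j (x(N := s)) \<partial>leb N)"
    by (rule Bochner_Integration.integral_sum) (use integrable_slice(2)[OF s] in auto)
  also have "\<dots> = (\<integral>x. D\<Phi> N (x(N := s)) \<partial>leb N)"
    using z by (simp add: lessThan_Suc_atMost[symmetric])
  finally show ?thesis by simp
qed

text \<open>The time derivative of the last component is integrated over space and the unit time
  interval in both orders: space first gives 0, time first gives the difference of the end
  slices.\<close>

theorem integral_const: "(\<integral>x. \<Phi> N (x(N := 1)) \<partial>leb N) = (\<integral>x. \<Phi> N (x(N := 0)) \<partial>leb N)"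
proof -
  obtain M where M: "M \<ge> 0"
    "\<And>j (p :: nat \<Rightarrow> real). j \<le> N \<Longrightarrow> 0 \<le> p N \<Longrightarrow> p N \<le> 1 \<Longrightarrow> norm (\<Phi> j p) \<le> M * exp (- (c / 2) * ell1 N p)"
    "\<And>j (p :: nat \<Rightarrow> real). j \<le> N \<Longrightarrow> 0 \<le> p N \<Longrightarrow> p N \<le> 1 \<Longrightarrow> norm (D\<Phi> j p) \<le> M * exp (- (c / 2) * ell1 N p)"
    using bound_\<Phi> by metis
  have c2: "c / 2 > 0" using c by simp
  let ?f = "\<lambda>x. indicator {0..1} (x N) *\<^sub>R D\<Phi> N x"
  have int: "integrable (leb (Suc N)) ?f"
  \<comment> \<open>\<open>ell1 (Suc N)\<close> also counts the time coordinate, which is at most 1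
    where the indicator is nonzero; the factor \<open>exp (c / 2)\<close> compensates for
    it.\<close>
  proof (rule Bochner_Integration.integrable_bound[OF integrable_leb_exp[OF c2, of "Suc N" "M * exp (c / 2)"]])
    have [measurable]: "D\<Phi> N \<in> borel_measurable (leb (Suc N))" by (intro borel_leb cont_D\<Phi>) simp
    have [measurable]: "(\<lambda>x. x N) \<in> borel_measurable (leb (Suc N))" by measurable
    show "?f \<in> borel_measurable (leb (Suc N))" by measurable
    show "AE x in leb (Suc N). norm (?f x) \<le> norm (M * exp (c / 2) * exp (- (c / 2) * ell1 (Suc N) x))"
    proof (rule AE_I2)
      fix x :: "nat \<Rightarrow> real"
      show "norm (?f x) \<le> norm (M * exp (c / 2) * exp (- (c / 2) * ell1 (Suc N) x))"
      proof (cases "x N \<in> {0..1}")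
        case True
        have "norm (D\<Phi> N x) \<le> M * exp (- (c / 2) * ell1 N x)" using M(3)[of N x] True by simp
        also have "\<dots> \<le> M * exp (c / 2 - (c / 2) * ell1 (Suc N) x)"
          using M(1) True c by (intro mult_left_mono) (auto simp: ell1_def field_simps)
        also have "\<dots> = M * exp (c / 2) * exp (- (c / 2) * ell1 (Suc N) x)"
          by (simp add: mult.assoc flip: exp_add)
        finally show ?thesis using True M(1) by simp
      qed (use M(1) in auto)
    qed
  qed
  have "(\<integral>x. ?f x \<partial>leb (Suc N)) = (\<integral>t. \<integral>x. indicator {0..1} t *\<^sub>R D\<Phi> N (x(N := t)) \<partial>leb N \<partial>lborel)"
    using integral_leb_Suc(2)[OF int] by (simp only: fun_upd_same)
  also have "\<dots> = (\<integral>t. 0 \<partial>(lborel :: real measure))"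
    by (rule Bochner_Integration.integral_cong[OF refl]) (auto simp: indicator_def integral_D\<Phi>_last)
  finally have "0 = (\<integral>x. ?f x \<partial>leb (Suc N))" by simp
  also have "\<dots> = (\<integral>x. \<integral>t. indicator {0..1} t *\<^sub>R D\<Phi> N (x(N := t)) \<partial>lborel \<partial>leb N)"
    using integral_leb_Suc(1)[OF int] by (simp only: fun_upd_same)
  also have "\<dots> = (\<integral>x. \<Phi> N (x(N := 1)) - \<Phi> N (x(N := 0)) \<partial>leb N)"
  proof (rule Bochner_Integration.integral_cong[OF refl])
    fix x :: "nat \<Rightarrow> real"
    show "(\<integral>t. indicator {0..1} t *\<^sub>R D\<Phi> N (x(N := t)) \<partial>lborel) = \<Phi> N (x(N := 1)) - \<Phi> N (x(N := 0))"
    proof (rule integral_FTC_Icc)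
      show "((\<lambda>t. \<Phi> N (x(N := t))) has_vector_derivative D\<Phi> N (x(N := t))) (at t within {0..1})" for t
        by (rule has_vector_derivative_at_within[OF has_pd_line[OF pd_\<Phi>[OF order_refl]]])
      show "continuous_on {0..1} (\<lambda>t. D\<Phi> N (x(N := t)))"
        by (rule continuous_on_line[OF cont_D\<Phi>[OF order_refl]])
    qed simp
  qed
  also have "\<dots> = (\<integral>x. \<Phi> N (x(N := 1)) \<partial>leb N) - (\<integral>x. \<Phi> N (x(N := 0)) \<partial>leb N)"
    by (rule Bochner_Integration.integral_diff) (use integrable_slice(1)[of _ N] in auto)
  finally show ?thesis by simp
qed

text \<open>For \<open>\<sigma> N = N\<close> what remains is a permutation of
  \<open>{..<N}\<close>, so on a slice of constant time the form is \<open>G\<close> times a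
  Jacobian determinant.\<close>

lemma \<Phi>_last: "\<Phi> N p = G p * ldet N (\<lambda>k j. dP k j p)"
proof -
  have "Per N = {\<sigma>. \<sigma> permutes {..<N}}"
  proof (intro equalityI subsetI)
    fix \<sigma> assume "\<sigma> \<in> Per N"
    then have s: "\<sigma> permutes {..N}" "\<sigma> N = N" by (simp_all add: Per_def)
    have "\<sigma> permutes {..<N}"
    proof (rule permutes_superset[OF s(1)])
      fix x assume "x \<in> {..N} - {..<N}"
      then have "x = N" by auto
      then show "\<sigma> x = x" using s(2) by simp
    qed
    then show "\<sigma> \<in> {\<sigma>. \<sigma> permutes {..<N}}" by simp
  next
    fix \<sigma> assume "\<sigma> \<in> {\<sigma>. \<sigma> permutes {..<N}}"
    then have s: "\<sigma> permutes {..<N}" by simp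
    have "\<sigma> permutes {..N}" by (rule permutes_subset[OF s]) auto
    moreover have "\<sigma> N = N" by (rule permutes_not_in[OF s]) simp
    ultimately show "\<sigma> \<in> Per N" by (simp add: Per_def)
  qed
  then show ?thesis unfolding \<Phi>_def ldet_def T_def by (simp only: sum_distrib_left mult.left_commute)
qed

end

section \<open>Deformation of a map to the identity\<close>

lemma ldet_one: "ldet n (\<lambda>k j. if j = k then 1 else 0) = 1"
proof -
  have "Matrix.mat n n (\<lambda>(k, j). if j = k then 1 else 0) = (1\<^sub>m n :: 'a mat)"
    by (rule eq_matI) auto
  then show ?thesis by (simp add: ldet_eq_det)
qed

lemma ldet_cong: "(\<And>k j. k < n \<Longrightarrow> j < n \<Longrightarrow> a k j = b k j) \<Longrightarrow> ldet n a = ldet n b"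
  unfolding ldet_eq_det by (intro arg_cong[where f=Determinant.det] cong_mat) auto

lemma has_pd_add: "has_pd j f f' \<Longrightarrow> has_pd j g g' \<Longrightarrow> has_pd j (\<lambda>p. f p + g p) (\<lambda>p. f' p + g' p)"
  unfolding has_pd_def by (auto intro: has_vector_derivative_add)

lemma has_pd_diff: "has_pd j f f' \<Longrightarrow> has_pd j g g' \<Longrightarrow> has_pd j (\<lambda>p. f p - g p) (\<lambda>p. f' p - g' p)"
  unfolding has_pd_def by (auto intro: has_vector_derivative_diff)

lemma has_pd_mult: "has_pd j f f' \<Longrightarrow> has_pd j g g' \<Longrightarrow> has_pd j (\<lambda>p. f p * g p) (\<lambda>p. f p * g' p + f' p * g p)"
  unfolding has_pd_def
proof
  fix p
  assume "\<forall>p. ((\<lambda>t. f (p(j := t))) has_vector_derivative f' p) (at (p j))"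
    "\<forall>p. ((\<lambda>t. g (p(j := t))) has_vector_derivative g' p) (at (p j))"
  then have "((\<lambda>t. f (p(j := t))) has_vector_derivative f' p) (at (p j))"
    "((\<lambda>t. g (p(j := t))) has_vector_derivative g' p) (at (p j))" by blast+
  from has_vector_derivative_mult[OF this]
  show "((\<lambda>t. f (p(j := t)) * g (p(j := t))) has_vector_derivative f p * g' p + f' p * g p) (at (p j))" by simp
qed

lemma has_pd_const: "has_pd j (\<lambda>p. a) (\<lambda>p. 0)"
  unfolding has_pd_def by auto

lemma has_pd_coord: "has_pd j (\<lambda>p. complex_of_real (p i)) (\<lambda>p. if i = j then 1 else 0)"
proof -
  have "((\<lambda>t. complex_of_real t) has_vector_derivative 1) (at s)" for s
    using bounded_linear.has_vector_derivative[OF bounded_linear_of_real has_vector_derivative_id] by auto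
  then show ?thesis unfolding has_pd_def by (cases "i = j") auto
qed

lemma has_pd_indep:
  assumes "\<And>p t. f (p(j := t)) = f p" shows "has_pd j f (\<lambda>p. 0)"
  unfolding has_pd_def by (simp add: assms)

lemma has_pd_eq: "has_pd j f f' \<Longrightarrow> (\<And>p. f p = g p) \<Longrightarrow> (\<And>p. f' p = g' p) \<Longrightarrow> has_pd j g g'"
  unfolding has_pd_def by simp

lemma coord_le_ell1: "k < n \<Longrightarrow> \<bar>p k\<bar> \<le> ell1 n p"
  unfolding ell1_def using member_le_sum[of k "{..<n}" "\<lambda>i. \<bar>p i\<bar>"] by auto

lemma homotopy:
  fixes B :: "nat \<Rightarrow> (nat \<Rightarrow> real) \<Rightarrow> complex" and b :: "nat \<Rightarrow> nat \<Rightarrow> (nat \<Rightarrow> real) \<Rightarrow> complex" and N :: nat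
  defines "dP \<equiv> \<lambda>k j p. if j < N then (1 - complex_of_real (p N)) * (if k = j then 1 else 0) + complex_of_real (p N) * b k j p
       else B k p - complex_of_real (p k)"
  assumes pdB: "\<And>k j. k < N \<Longrightarrow> j < N \<Longrightarrow> has_pd j (B k) (b k j)"
    and pdb: "\<And>k j l. k < N \<Longrightarrow> j < N \<Longrightarrow> l < N \<Longrightarrow> has_pd l (b k j) (bb k j l)"
    and sym: "\<And>k j l p. k < N \<Longrightarrow> j < N \<Longrightarrow> l < N \<Longrightarrow> bb k j l p = bb k l j p"
    and indep: "\<And>k p t. k < N \<Longrightarrow> B k (p(N := t)) = B k p" "\<And>k j p t. k < N \<Longrightarrow> j < N \<Longrightarrow> b k j (p(N := t)) = b k j p"
    and cont: "\<And>k. k < N \<Longrightarrow> continuous_on UNIV (B k)" "\<And>k j. k < N \<Longrightarrow> j < N \<Longrightarrow> continuous_on UNIV (b k j)"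
      "\<And>k j l. k < N \<Longrightarrow> j < N \<Longrightarrow> l < N \<Longrightarrow> continuous_on UNIV (bb k j l)"
      "continuous_on UNIV G" "\<And>l. l < N \<Longrightarrow> continuous_on UNIV (dG l)"
    and bounds: "\<And>k p. k < N \<Longrightarrow> norm (B k p) \<le> C * (1 + ell1 N p)" "\<And>k j p. k < N \<Longrightarrow> j < N \<Longrightarrow> norm (b k j p) \<le> C"
      "\<And>k j l p. k < N \<Longrightarrow> j < N \<Longrightarrow> l < N \<Longrightarrow> norm (bb k j l p) \<le> C"
    and pd_G: "\<And>j. j \<le> N \<Longrightarrow> has_pd j G (\<lambda>p. \<Sum>l<N. dG l p * dP l j p)"
    and bG: "\<And>p. 0 \<le> p N \<Longrightarrow> p N \<le> 1 \<Longrightarrow> norm (G p) \<le> A * exp (- c * ell1 N p)"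
    and bdG: "\<And>l p. l < N \<Longrightarrow> 0 \<le> p N \<Longrightarrow> p N \<le> 1 \<Longrightarrow> norm (dG l p) \<le> A * exp (- c * ell1 N p)"
    and C: "C \<ge> 1" and A: "A \<ge> 0" and c: "c > 0"
  shows "(\<integral>x. G (x(N := 1)) * ldet N (\<lambda>k j. b k j x) \<partial>leb N) = (\<integral>x. G (x(N := 0)) \<partial>leb N)
    \<and> integrable (leb N) (\<lambda>x. G (x(N := 1)) * ldet N (\<lambda>k j. b k j x))"
proof -
  define d :: "nat \<Rightarrow> nat \<Rightarrow> complex" where "d k j = (if k = j then 1 else 0)" for k j
  define ddP where "ddP k j l p = (if j < N then (if l < N then complex_of_real (p N) * bb k j l p else b k j p - d k j)
    else (if l < N then b k l p - d k l else 0))" for k j l p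
  have nd: "norm (d k j) \<le> 1" for k j by (simp add: d_def)
  have C1: "C \<le> C * (1 + ell1 N p)" "1 \<le> 1 + ell1 N p" for p using C by (auto simp: mult_le_cancel_left1)
  interpret closed_form N dP ddP G dG "C + 1" A c
  proof
    fix k j l assume k: "k < N" and j: "j \<le> N" and l: "l \<le> N"
    have s1: "has_pd l (\<lambda>p. complex_of_real (p N)) (\<lambda>p. if l = N then 1 else 0)"
      using has_pd_coord[of l N] by (rule has_pd_eq) auto
    show "has_pd l (dP k j) (ddP k j l)"
    proof (cases "j < N")
      case True
      have b1: "has_pd l (b k j) (\<lambda>p. if l < N then bb k j l p else 0)"
      proof (cases "l < N")
        case True
        then show ?thesis using pdb[OF k \<open>j < N\<close> True] by simp
      next
        case False
        then have "l = N" using l by simp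
        then show ?thesis using indep(2)[OF k \<open>j < N\<close>] by (auto intro: has_pd_indep)
      qed
      show ?thesis
        by (rule has_pd_eq[OF has_pd_add[OF has_pd_mult[OF has_pd_diff[OF has_pd_const[of _ 1] s1] has_pd_const[of _ "d k j"]]
            has_pd_mult[OF s1 b1]]])
          (use True l in \<open>auto simp: dP_def ddP_def d_def\<close>)
    next
      case False
      then have jN: "j = N" using j by simp
      have b1: "has_pd l (B k) (\<lambda>p. if l < N then b k l p else 0)"
      proof (cases "l < N")
        case True
        then show ?thesis using pdB[OF k True] by simp
      next
        case False
        then have "l = N" using l by simp
        then show ?thesis using indep(1)[OF k] by (auto intro: has_pd_indep)
      qed
      show ?thesis
        by (rule has_pd_eq[OF has_pd_diff[OF b1 has_pd_coord[of l k]]])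
          (use jN k l in \<open>auto simp: dP_def ddP_def d_def\<close>)
    qed
    show "ddP k j l p = ddP k l j p" for p
      using sym[OF k, of j l p] j l by (auto simp: ddP_def)
    show "continuous_on UNIV (ddP k j l)"
      unfolding ddP_def[abs_def] using k
      by (cases "j < N"; cases "l < N") (auto intro!: continuous_intros cont)
    show "norm (ddP k j l p) \<le> (C + 1) * (1 + ell1 N p)" if p: "0 \<le> p N" "p N \<le> 1" for p
    proof -
      have "norm (ddP k j l p) \<le> C + 1"
      proof (cases "j < N \<and> l < N")
        case True
        have "norm (complex_of_real (p N) * bb k j l p) \<le> 1 * C"
          unfolding norm_mult using p bounds(3)[OF k, of j l p] True by (intro mult_mono) auto
        then show ?thesis using True by (simp add: ddP_def)
      next
        case False
        then show ?thesis
          using bounds(2)[OF k, of j p] bounds(2)[OF k, of l p] nd[of k j] nd[of k l] C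
            norm_triangle_ineq4[of "b k j p" "d k j"] norm_triangle_ineq4[of "b k l p" "d k l"]
          by (auto simp: ddP_def)
      qed
      also have "\<dots> \<le> (C + 1) * (1 + ell1 N p)" using C by (auto simp: mult_le_cancel_left1)
      finally show ?thesis .
    qed
  next
    fix k j assume k: "k < N" and j: "j \<le> N"
    show "continuous_on UNIV (dP k j)"
      unfolding dP_def using k by (cases "j < N") (auto intro!: continuous_intros cont)
    show "norm (dP k j p) \<le> (C + 1) * (1 + ell1 N p)" if p: "0 \<le> p N" "p N \<le> 1" for p
    proof (cases "j < N")
      case True
      have "norm ((1 - complex_of_real (p N)) * d k j) \<le> 1 * 1"
        unfolding norm_mult using p nd[of k j] norm_of_real[of "1 - p N", where 'a=complex] by (intro mult_mono) auto
      moreover have "norm (complex_of_real (p N) * b k j p) \<le> 1 * C"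
        unfolding norm_mult using p bounds(2)[OF k True, of p] by (intro mult_mono) auto
      ultimately have "norm (dP k j p) \<le> C + 1"
        using True norm_triangle_ineq[of "(1 - complex_of_real (p N)) * d k j" "complex_of_real (p N) * b k j p"]
        by (simp add: dP_def d_def)
      also have "\<dots> \<le> (C + 1) * (1 + ell1 N p)" using C by (auto simp: mult_le_cancel_left1)
      finally show ?thesis .
    next
      case False
      have "norm (dP k j p) \<le> norm (B k p) + \<bar>p k\<bar>"
        using False norm_triangle_ineq4[of "B k p" "complex_of_real (p k)"] by (simp add: dP_def)
      also have "\<dots> \<le> C * (1 + ell1 N p) + (1 + ell1 N p)"
        using bounds(1)[OF k, of p] coord_le_ell1[OF k, of p] by linarith
      finally show ?thesis by (simp add: algebra_simps)
    qed
  qed (use pd_G bG bdG cont C A c in auto)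
  have 1: "\<Phi> N (x(N := 1)) = G (x(N := 1)) * ldet N (\<lambda>k j. b k j x)" for x
    unfolding \<Phi>_last by (intro arg_cong2[where f="(*)"] refl ldet_cong) (auto simp: dP_def indep)
  have 0: "\<Phi> N (x(N := 0)) = G (x(N := 0))" for x
  proof -
    have "ldet N (\<lambda>k j. dP k j (x(N := 0))) = ldet N (\<lambda>k j. if j = k then 1 else 0)"
      by (intro ldet_cong) (auto simp: dP_def)
    then show ?thesis unfolding \<Phi>_last by (simp add: ldet_one)
  qed
  have "integrable (leb N) (\<lambda>x. G (x(N := 1)) * ldet N (\<lambda>k j. b k j x))"
    using integrable_slice(1)[of 1 N] unfolding 1 by simp
  then show ?thesis using integral_const unfolding 0 1 by (rule conjI[rotated])
qed

definition has_rpd :: "nat \<Rightarrow> ((nat \<Rightarrow> real) \<Rightarrow> real) \<Rightarrow> ((nat \<Rightarrow> real) \<Rightarrow> real) \<Rightarrow> bool" where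
  "has_rpd j f f' \<longleftrightarrow> (\<forall>p. ((\<lambda>t. f (p(j := t))) has_real_derivative f' p) (at (p j)))"

lemma has_vector_derivative_of_real:
  assumes "(f has_real_derivative d) (at t)"
  shows "((\<lambda>t. complex_of_real (f t)) has_vector_derivative complex_of_real d) (at t)"
  using bounded_linear.has_vector_derivative[OF bounded_linear_of_real] assms
  by (auto simp: has_real_derivative_iff_has_vector_derivative)

lemma has_rpd_imp_has_pd: "has_rpd j f f' \<Longrightarrow> has_pd j (\<lambda>p. complex_of_real (f p)) (\<lambda>p. complex_of_real (f' p))"
  unfolding has_rpd_def has_pd_def by (auto intro: has_vector_derivative_of_real)

lemma ldet_of_real: "ldet n (\<lambda>k j. complex_of_real (a k j)) = complex_of_real (ldet n a)"
  unfolding ldet_def by simp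

text \<open>Change of variables without any injectivity: \<open>B\<close> is deformed linearly to the identity.\<close>

lemma homotopy_real:
  fixes B :: "nat \<Rightarrow> (nat \<Rightarrow> real) \<Rightarrow> real" and g :: "(nat \<Rightarrow> real) \<Rightarrow> real"
  assumes pdB: "\<And>k j. k < N \<Longrightarrow> j < N \<Longrightarrow> has_rpd j (B k) (b k j)"
    and pdb: "\<And>k j l. k < N \<Longrightarrow> j < N \<Longrightarrow> l < N \<Longrightarrow> has_rpd l (b k j) (bb k j l)"
    and sym: "\<And>k j l p. k < N \<Longrightarrow> j < N \<Longrightarrow> l < N \<Longrightarrow> bb k j l p = bb k l j p"
    and indep: "\<And>k p t. k < N \<Longrightarrow> B k (p(N := t)) = B k p" "\<And>k j p t. k < N \<Longrightarrow> j < N \<Longrightarrow> b k j (p(N := t)) = b k j p"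
    and cont: "\<And>k. k < N \<Longrightarrow> continuous_on UNIV (B k)" "\<And>k j. k < N \<Longrightarrow> j < N \<Longrightarrow> continuous_on UNIV (b k j)"
      "\<And>k j l. k < N \<Longrightarrow> j < N \<Longrightarrow> l < N \<Longrightarrow> continuous_on UNIV (bb k j l)"
      "continuous_on UNIV g" "\<And>l. l < N \<Longrightarrow> continuous_on UNIV (g' l)"
    and bounds: "\<And>k p. k < N \<Longrightarrow> \<bar>B k p\<bar> \<le> C * (1 + ell1 N p)" "\<And>k j p. k < N \<Longrightarrow> j < N \<Longrightarrow> \<bar>b k j p\<bar> \<le> C"
      "\<And>k j l p. k < N \<Longrightarrow> j < N \<Longrightarrow> l < N \<Longrightarrow> \<bar>bb k j l p\<bar> \<le> C"
    and g_dep: "\<And>y z. (\<And>i. i < N \<Longrightarrow> y i = z i) \<Longrightarrow> g y = g z"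
    and g': "\<And>X X' t. (\<And>l. l < N \<Longrightarrow> ((\<lambda>s. X s l) has_real_derivative X' l) (at t)) \<Longrightarrow>
       ((\<lambda>s. g (X s)) has_real_derivative (\<Sum>l<N. g' l (X t) * X' l)) (at (t::real))"
    and bg: "\<And>y. \<bar>g y\<bar> \<le> A * exp (- c * ell1 N y)" "\<And>l y. l < N \<Longrightarrow> \<bar>g' l y\<bar> \<le> A * exp (- c * ell1 N y)"
    and coercive: "\<And>s p. 0 \<le> s \<Longrightarrow> s \<le> 1 \<Longrightarrow> a * ell1 N p - M \<le> ell1 N (\<lambda>k. (1 - s) * p k + s * B k p)"
    and C: "C \<ge> 1" and A: "A \<ge> 0" and c: "c > 0" and a: "a > 0"
  shows "(\<integral>x. g (\<lambda>k. B k x) * ldet N (\<lambda>k j. b k j x) \<partial>leb N) = (\<integral>x. g x \<partial>leb N)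
    \<and> integrable (leb N) (\<lambda>x. g (\<lambda>k. B k x) * ldet N (\<lambda>k j. b k j x))"
proof -
  \<comment> \<open>The deformed point. Nothing is known of \<open>B k\<close> for \<open>k\<close>
    from \<open>N\<close> on, so these coordinates are set to 0 to make \<open>X\<close> continuous;
    \<open>g\<close> ignores them by \<open>g_dep\<close>.\<close>
  define X where "X p = (\<lambda>k. if k < N then (1 - p N) * p k + p N * B k p else 0)" for p :: "nat \<Rightarrow> real"
  define G where "G p = complex_of_real (g (X p))" for p
  define dG where "dG l p = complex_of_real (g' l (X p))" for l p
  have gX: "g (X p) = g (\<lambda>k. (1 - p N) * p k + p N * B k p)" for p
    by (rule g_dep) (auto simp: X_def)
  have cX: "continuous_on UNIV X"
    unfolding X_def[abs_def]
  proof (rule continuous_on_coordinatewise_then_product)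
    fix i show "continuous_on UNIV (\<lambda>p. if i < N then (1 - p N) * p i + p N * B i p else 0)"
      by (cases "i < N") (auto intro!: continuous_intros cont)
  qed
  have dB: "((\<lambda>s. X (p(j := s)) l) has_real_derivative
      (if j < N then (1 - p N) * (if l = j then 1 else 0) + p N * b l j p else B l p - p l)) (at (p j))"
    if "l < N" "j \<le> N" for l j p
  proof (cases "j < N")
    case True
    have "((\<lambda>s. B l (p(j := s))) has_real_derivative b l j p) (at (p j))"
      using pdB[OF that(1) True] by (auto simp: has_rpd_def)
    moreover have "((\<lambda>s. (p(j := s)) l) has_real_derivative (if l = j then 1 else 0)) (at (p j))"
      by auto
    ultimately show ?thesis using that True
      by (auto simp: X_def intro!: derivative_eq_intros)
  next
    case False
    then have "j = N" using that by simp
    then show ?thesis using that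
      by (auto simp: X_def indep algebra_simps intro!: derivative_eq_intros)
  qed
  have ell: "a * ell1 N p - M \<le> ell1 N (X p)" if "0 \<le> p N" "p N \<le> 1" for p
  proof -
    have "ell1 N (X p) = ell1 N (\<lambda>k. (1 - p N) * p k + p N * B k p)"
      unfolding ell1_def by (intro sum.cong) (auto simp: X_def)
    then show ?thesis using coercive[OF that] by simp
  qed
  \<comment> \<open>Coercivity turns decay in the deformed point into decay in \<open>p\<close>, at
    the rate \<open>c * a\<close>.\<close>
  have bnd: "A * exp (- c * ell1 N (X p)) \<le> (A * exp (c * M)) * exp (- (c * a) * ell1 N p)" if "0 \<le> p N" "p N \<le> 1" for p
  proof -
    have "- c * ell1 N (X p) \<le> c * M + - (c * a) * ell1 N p"
      using mult_left_mono[OF ell[of p], of c] that c by (simp add: algebra_simps)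
    then have "exp (- c * ell1 N (X p)) \<le> exp (c * M + - (c * a) * ell1 N p)" by simp
    then have "exp (- c * ell1 N (X p)) \<le> exp (c * M) * exp (- (c * a) * ell1 N p)" by (simp only: exp_add)
    from mult_left_mono[OF this A] show ?thesis by (simp only: mult.assoc)
  qed
  have H: "(\<integral>x. G (x(N := 1)) * ldet N (\<lambda>k j. complex_of_real (b k j x)) \<partial>leb N) = (\<integral>x. G (x(N := 0)) \<partial>leb N)
    \<and> integrable (leb N) (\<lambda>x. G (x(N := 1)) * ldet N (\<lambda>k j. complex_of_real (b k j x)))"
  proof (rule homotopy[where B="\<lambda>k p. complex_of_real (B k p)" and bb="\<lambda>k j l p. complex_of_real (bb k j l p)"
        and dG=dG and C=C and c="c * a" and A="A * exp (c * M)"])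
    fix j assume j: "j \<le> N"
    show "has_pd j G (\<lambda>p. \<Sum>l<N. dG l p * (if j < N then (1 - complex_of_real (p N)) * (if l = j then 1 else 0)
       + complex_of_real (p N) * complex_of_real (b l j p) else complex_of_real (B l p) - complex_of_real (p l)))"
      (is "has_pd j G ?D")
      unfolding has_pd_def
    proof
      fix p
      let ?X' = "\<lambda>l. if j < N then (1 - p N) * (if l = j then 1 else 0) + p N * b l j p else B l p - p l"
      have "((\<lambda>s. g (X (p(j := s)))) has_real_derivative (\<Sum>l<N. g' l (X (p(j := p j))) * ?X' l)) (at (p j))"
        by (rule g'[of "\<lambda>s. X (p(j := s))" ?X']) (use dB j in auto)
      then have "((\<lambda>s. complex_of_real (g (X (p(j := s))))) has_vector_derivative
          complex_of_real (\<Sum>l<N. g' l (X (p(j := p j))) * ?X' l)) (at (p j))"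
        by (rule has_vector_derivative_of_real)
      moreover have "complex_of_real (\<Sum>l<N. g' l (X (p(j := p j))) * ?X' l) = ?D p"
        unfolding dG_def of_real_sum by (intro sum.cong refl) auto
      ultimately show "((\<lambda>t. G (p(j := t))) has_vector_derivative ?D p) (at (p j))"
        by (simp add: G_def)
    qed
  next
    fix p :: "nat \<Rightarrow> real" assume p: "0 \<le> p N" "p N \<le> 1"
    show "norm (G p) \<le> A * exp (c * M) * exp (- (c * a) * ell1 N p)"
      using order_trans[OF bg(1) bnd[of p]] p by (simp add: G_def)
    fix l assume "l < N"
    then show "norm (dG l p) \<le> A * exp (c * M) * exp (- (c * a) * ell1 N p)"
      using order_trans[OF bg(2) bnd[of p]] p by (simp add: dG_def)
  next
    show "continuous_on UNIV G" unfolding G_def[abs_def]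
      by (intro continuous_intros continuous_on_compose2[OF cont(4) cX]) auto
    fix l assume "l < N"
    then show "continuous_on UNIV (dG l)" unfolding dG_def[abs_def]
      by (intro continuous_intros continuous_on_compose2[OF cont(5) cX]) auto
  qed (use sym indep bounds C A c a in \<open>auto intro!: has_rpd_imp_has_pd pdB pdb continuous_on_of_real cont simp del: fun_upd_apply\<close>)
  have G1: "G (x(N := 1)) = complex_of_real (g (\<lambda>k. B k x))" for x
  proof -
    have "g (X (x(N := 1))) = g (\<lambda>k. B k x)" by (rule g_dep) (auto simp: X_def indep)
    then show ?thesis by (simp add: G_def)
  qed
  have G0: "G (x(N := 0)) = complex_of_real (g x)" for x
  proof -
    have "g (X (x(N := 0))) = g x" by (rule g_dep) (auto simp: X_def)
    then show ?thesis by (simp add: G_def)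
  qed
  have e: "complex_of_real (g (\<lambda>k. B k x)) * ldet N (\<lambda>k j. complex_of_real (b k j x))
     = complex_of_real (g (\<lambda>k. B k x) * ldet N (\<lambda>k j. b k j x))" for x
    by (simp add: ldet_of_real)
  show ?thesis
    using H unfolding G1 G0 e
    by (simp only: integral_complex_of_real of_real_eq_iff complex_of_real_integrable_eq)
qed

section \<open>Logarithmic moment generating functions\<close>

definition dot :: "nat \<Rightarrow> (nat \<Rightarrow> real) \<Rightarrow> (nat \<Rightarrow> real) \<Rightarrow> real" where
  "dot n v x = (\<Sum>i<n. v i * x i)"

lemma dot_add: "dot n v (\<lambda>i. x i + y i) = dot n v x + dot n v y"
  by (simp add: dot_def sum.distrib ring_distribs)

lemma dot_scale: "dot n v (\<lambda>i. a * x i) = a * dot n v x"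
  by (simp add: dot_def sum_distrib_left mult_ac)

lemma dot_diff: "dot n v (\<lambda>i. x i - y i) = dot n v x - dot n v y"
  by (simp add: dot_def sum_subtractf ring_distribs)

lemma dot_commute: "dot n x y = dot n y x"
  by (simp add: dot_def mult.commute)

lemma dot_zero [simp]: "dot n v (\<lambda>_. 0) = 0"
  by (simp add: dot_def)

lemma dot_cong: "(\<And>i. i < n \<Longrightarrow> x i = y i) \<Longrightarrow> dot n v x = dot n v y"
  by (simp add: dot_def)

lemma continuous_on_dot [continuous_intros]: "continuous_on S (dot n v)"
  unfolding dot_def[abs_def] by (intro continuous_intros)

lemma dot_path:
  assumes "\<And>i. i < n \<Longrightarrow> ((\<lambda>s. X s i) has_real_derivative X' i) (at t)"
  shows "((\<lambda>s. dot n v (X s)) has_real_derivative dot n v X') (at t)"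
  unfolding dot_def by (rule DERIV_sum) (use assms in \<open>auto intro!: DERIV_cmult\<close>)

text \<open>Log-sum-exp over a finite set. \<open>F\<close> is normalized to vanish at 0, and
  \<open>gr\<close>, \<open>H\<close>, \<open>T3\<close> are the cumulants of orders 1 to 3 of the
  tilted distribution, that is, the derivatives of \<open>F\<close>; \<open>T3\<close> is written as
  the product rule produces it from \<open>H\<close>.\<close>

locale lse =
  fixes n :: nat and V :: "(nat \<Rightarrow> real) set"
  assumes finV: "finite V" and neV: "V \<noteq> {}"
begin

definition "Z x = (\<Sum>v\<in>V. exp (dot n v x))"
definition "E f x = (\<Sum>v\<in>V. f v * exp (dot n v x)) / Z x" for f :: "(nat \<Rightarrow> real) \<Rightarrow> real"
definition "F x = ln (Z x / real (card V))"
definition "gr i x = E (\<lambda>v. v i) x"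
definition "H i j x = E (\<lambda>v. v i * v j) x - E (\<lambda>v. v i) x * E (\<lambda>v. v j) x"
definition "T3 i j l x = E (\<lambda>v. v i * v j * v l) x - E (\<lambda>v. v i * v j) x * E (\<lambda>v. v l) x
   - (E (\<lambda>v. v i * v l) x - E (\<lambda>v. v i) x * E (\<lambda>v. v l) x) * E (\<lambda>v. v j) x
   - E (\<lambda>v. v i) x * (E (\<lambda>v. v j * v l) x - E (\<lambda>v. v j) x * E (\<lambda>v. v l) x)"

lemma Z_pos: "Z x > 0"
  unfolding Z_def using finV neV by (intro sum_pos) auto

lemma Z_nz [simp]: "Z x \<noteq> 0" using Z_pos[of x] by simp

lemma card_pos: "real (card V) > 0"
  using finV neV by (simp add: card_gt_0_iff)

lemma E_add: "E (\<lambda>v. f v + g v) x = E f x + E g x"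
  by (simp add: E_def sum.distrib ring_distribs add_divide_distrib)

lemma E_diff: "E (\<lambda>v. f v - g v) x = E f x - E g x"
  by (simp add: E_def sum_subtractf ring_distribs diff_divide_distrib)

lemma E_cmult: "E (\<lambda>v. a * f v) x = a * E f x"
  by (simp add: E_def sum_distrib_left mult.assoc)

lemma E_const: "E (\<lambda>v. a) x = a"
  using Z_pos[of x] by (simp add: E_def Z_def flip: sum_distrib_left)

lemma E_sum: "E (\<lambda>v. \<Sum>i\<in>I. f i v) x = (\<Sum>i\<in>I. E (f i) x)"
proof -
  have "(\<Sum>v\<in>V. (\<Sum>i\<in>I. f i v) * exp (dot n v x)) = (\<Sum>i\<in>I. \<Sum>v\<in>V. f i v * exp (dot n v x))"
    unfolding sum_distrib_right by (rule sum.swap)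
  then show ?thesis by (simp add: E_def sum_divide_distrib)
qed

lemma E_mono: "(\<And>v. v \<in> V \<Longrightarrow> f v \<le> g v) \<Longrightarrow> E f x \<le> E g x"
  unfolding E_def using Z_pos[of x] by (intro divide_right_mono sum_mono mult_right_mono) auto

lemma E_cong: "(\<And>v. v \<in> V \<Longrightarrow> f v = g v) \<Longrightarrow> E f x = E g x"
  unfolding E_def by simp

lemma E_abs_le: "(\<And>v. v \<in> V \<Longrightarrow> \<bar>f v\<bar> \<le> a) \<Longrightarrow> \<bar>E f x\<bar> \<le> a"
  using E_mono[of f "\<lambda>_. a" x] E_mono[of "\<lambda>_. - a" f x] by (fastforce simp: E_const abs_le_iff)

lemma Z_cong: "(\<And>i. i < n \<Longrightarrow> x i = y i) \<Longrightarrow> Z x = Z y"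
  unfolding Z_def by (intro sum.cong refl arg_cong[where f=exp] dot_cong)

lemma E_dep: "(\<And>i. i < n \<Longrightarrow> x i = y i) \<Longrightarrow> E f x = E f y"
  unfolding E_def using Z_cong[of x y] dot_cong[of n x y] by simp

lemma F_dep: "(\<And>i. i < n \<Longrightarrow> x i = y i) \<Longrightarrow> F x = F y"
  unfolding F_def using Z_cong[of x y] by simp

lemma cont_Z [continuous_intros]: "continuous_on S Z"
  unfolding Z_def[abs_def] by (intro continuous_intros)

lemma cont_E [continuous_intros]: "continuous_on S (E f)"
  unfolding E_def[abs_def] by (intro continuous_intros) auto

lemma cont_F [continuous_intros]: "continuous_on S F"
  unfolding F_def[abs_def] using Z_pos card_pos by (intro continuous_intros) (auto simp: less_imp_neq)

text \<open>Derivatives along curves, since \<open>homotopy_real\<close> asks for the chain rule,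
  which partial derivatives alone do not give.\<close>

lemma Z_path:
  assumes "\<And>i. i < n \<Longrightarrow> ((\<lambda>s. X s i) has_real_derivative X' i) (at t)"
  shows "((\<lambda>s. Z (X s)) has_real_derivative Z (X t) * E (\<lambda>v. dot n v X') (X t)) (at t)"
proof -
  have "((\<lambda>s. Z (X s)) has_real_derivative (\<Sum>v\<in>V. exp (dot n v (X t)) * dot n v X')) (at t)"
    unfolding Z_def
    by (rule DERIV_sum) (use dot_path[of n X X' t, OF assms] in \<open>auto intro!: DERIV_fun_exp\<close>)
  also have "(\<Sum>v\<in>V. exp (dot n v (X t)) * dot n v X') = Z (X t) * E (\<lambda>v. dot n v X') (X t)"
    by (simp add: E_def mult.commute)
  finally show ?thesis .
qed

lemma E_path:
  assumes "\<And>i. i < n \<Longrightarrow> ((\<lambda>s. X s i) has_real_derivative X' i) (at t)"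
  shows "((\<lambda>s. E f (X s)) has_real_derivative
    E (\<lambda>v. f v * dot n v X') (X t) - E f (X t) * E (\<lambda>v. dot n v X') (X t)) (at t)"
proof -
  have 1: "((\<lambda>s. \<Sum>v\<in>V. f v * exp (dot n v (X s))) has_real_derivative (\<Sum>v\<in>V. f v * (exp (dot n v (X t)) * dot n v X'))) (at t)"
    by (rule DERIV_sum) (use dot_path[of n X X' t, OF assms] in \<open>auto intro!: DERIV_fun_exp DERIV_cmult\<close>)
  have 2: "(\<Sum>v\<in>V. f v * (exp (dot n v (X t)) * dot n v X')) = Z (X t) * E (\<lambda>v. f v * dot n v X') (X t)"
    by (simp add: E_def mult_ac)
  have 3: "(\<Sum>v\<in>V. f v * exp (dot n v (X t))) = Z (X t) * E f (X t)"
    by (simp add: E_def)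
  show ?thesis
    unfolding E_def[of f "X _"]
    by (rule DERIV_cong[OF DERIV_quotient[OF 1 Z_path[OF assms]]]; (simp only: 2 3)?)
       (auto simp: field_simps)
qed

lemma E_dot: "E (\<lambda>v. f v * dot n v y) x = (\<Sum>i<n. E (\<lambda>v. f v * v i) x * y i)"
proof -
  have "(\<lambda>v. f v * dot n v y) = (\<lambda>v. \<Sum>i<n. y i * (f v * v i))"
    by (simp add: dot_def sum_distrib_left mult_ac)
  then show ?thesis by (simp add: E_sum E_cmult mult.commute)
qed

lemma E_dot1: "E (\<lambda>v. dot n v y) x = (\<Sum>i<n. gr i x * y i)"
  using E_dot[of "\<lambda>_. 1" y x] by (simp add: gr_def)

lemma F_path:
  assumes "\<And>i. i < n \<Longrightarrow> ((\<lambda>s. X s i) has_real_derivative X' i) (at t)"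
  shows "((\<lambda>s. F (X s)) has_real_derivative (\<Sum>i<n. gr i (X t) * X' i)) (at t)"
proof -
  have "((\<lambda>s. F (X s)) has_real_derivative (1 / (Z (X t) / real (card V))) *
      (Z (X t) * E (\<lambda>v. dot n v X') (X t) / real (card V))) (at t)"
    unfolding F_def using Z_pos card_pos
    by (intro DERIV_chain2[OF DERIV_ln_divide] DERIV_cdivide Z_path assms) simp
  also have "(1 / (Z (X t) / real (card V))) * (Z (X t) * E (\<lambda>v. dot n v X') (X t) / real (card V)) = (\<Sum>i<n. gr i (X t) * X' i)"
    using card_pos by (simp add: E_dot1)
  finally show ?thesis .
qed

lemma coord_path: "((\<lambda>t. (p(j := t)) i) has_real_derivative (if i = j then 1 else 0)) (at s)"
  by auto

lemma E_rpd:
  assumes "j < n"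
  shows "has_rpd j (E f) (\<lambda>x. E (\<lambda>v. f v * v j) x - E f x * E (\<lambda>v. v j) x)"
  unfolding has_rpd_def
proof
  fix p :: "nat \<Rightarrow> real"
  have d: "dot n v (\<lambda>i. if i = j then 1 else 0) = v j" for v
    using assms by (simp add: dot_def if_distrib cong: if_cong)
  show "((\<lambda>t. E f (p(j := t))) has_real_derivative E (\<lambda>v. f v * v j) p - E f p * E (\<lambda>v. v j) p) (at (p j))"
    using E_path[of "\<lambda>t. p(j := t)" "\<lambda>i. if i = j then 1 else 0" "p j" f, OF coord_path] by (simp add: d)
qed

lemma gr_rpd: "j < n \<Longrightarrow> has_rpd j (gr i) (H i j)"
  using E_rpd[of j "\<lambda>v. v i"] by (simp add: gr_def[abs_def] H_def[abs_def])

lemma H_rpd: assumes "l < n" shows "has_rpd l (H i j) (T3 i j l)"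
  unfolding has_rpd_def
proof
  fix p
  have e: "((\<lambda>t. E f (p(l := t))) has_real_derivative E (\<lambda>v. f v * v l) p - E f p * E (\<lambda>v. v l) p) (at (p l))" for f
    using E_rpd[OF assms, of f] by (simp add: has_rpd_def)
  show "((\<lambda>t. H i j (p(l := t))) has_real_derivative T3 i j l p) (at (p l))"
    unfolding H_def
    by (rule DERIV_cong[OF DERIV_diff[OF e DERIV_mult[OF e e]]]) (simp add: T3_def algebra_simps)
qed

lemma T3_sym: "T3 i j l x = T3 i l j x"
  by (simp add: T3_def algebra_simps)

lemma H_sym: "H i j x = H j i x"
  by (simp add: H_def algebra_simps)

lemma cont_gr [continuous_intros]: "continuous_on S (gr i)"
  unfolding gr_def[abs_def] by (intro continuous_intros)

lemma cont_H [continuous_intros]: "continuous_on S (H i j)"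
  unfolding H_def[abs_def] by (intro continuous_intros)

lemma cont_T3 [continuous_intros]: "continuous_on S (T3 i j l)"
  unfolding T3_def[abs_def] by (intro continuous_intros)

text \<open>Means over a finite set are bounded by the largest value. The factor 6 counts the
  products of three coordinates in \<open>T3\<close>: 1 + 1 + 2 + 2.\<close>

lemma bounded:
  "\<exists>M\<ge>1. (\<forall>v\<in>V. \<forall>i<n. \<bar>v i\<bar> \<le> M) \<and> (\<forall>i<n. \<forall>x. \<bar>gr i x\<bar> \<le> M) \<and>
    (\<forall>i<n. \<forall>j<n. \<forall>x. \<bar>H i j x\<bar> \<le> M) \<and> (\<forall>i<n. \<forall>j<n. \<forall>l<n. \<forall>x. \<bar>T3 i j l x\<bar> \<le> M)"
proof -
  define m where "m = 1 + (\<Sum>v\<in>V. ell1 n v)"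
  have m1: "m \<ge> 1" unfolding m_def by (simp add: sum_nonneg)
  have vi: "\<bar>v i\<bar> \<le> m" if "v \<in> V" "i < n" for v i
    using coord_le_ell1[OF that(2), of v] member_le_sum[OF that(1), of "ell1 n"] finV by (simp add: m_def)
  have mm: "\<bar>a * b\<bar> \<le> u * w" if "\<bar>a\<bar> \<le> u" "\<bar>b\<bar> \<le> w" for a b u w :: real
    unfolding abs_mult using that by (intro mult_mono) auto
  have e1: "\<bar>E (\<lambda>v. v i) x\<bar> \<le> m" if "i < n" for i x
    using that by (intro E_abs_le vi)
  have e2: "\<bar>E (\<lambda>v. v i * v j) x\<bar> \<le> m * m" if "i < n" "j < n" for i j x
    using that by (intro E_abs_le mm vi)
  have e3: "\<bar>E (\<lambda>v. v i * v j * v l) x\<bar> \<le> m * m * m" if "i < n" "j < n" "l < n" for i j l x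
    using that by (intro E_abs_le mm vi)
  have p: "m \<le> m * m" "m * m \<le> m * m * m" "m \<le> m * m * m"
  proof -
    show "m \<le> m * m" using m1 mult_left_mono[of 1 m m] by simp
    then show "m * m \<le> m * m * m" using m1 mult_right_mono[of m "m * m" m] by simp
    with \<open>m \<le> m * m\<close> show "m \<le> m * m * m" by linarith
  qed
  show ?thesis
  proof (intro exI[of _ "6 * (m * m * m)"] conjI ballI allI impI)
    show "6 * (m * m * m) \<ge> 1" using p m1 by linarith
    show "\<bar>v i\<bar> \<le> 6 * (m * m * m)" if "v \<in> V" "i < n" for v i
      using vi[OF that] p m1 by linarith
    show "\<bar>gr i x\<bar> \<le> 6 * (m * m * m)" if "i < n" for i x
      using e1[OF that, of x] p m1 unfolding gr_def by linarith
    show "\<bar>H i j x\<bar> \<le> 6 * (m * m * m)" if "i < n" "j < n" for i j x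
      using e2[OF that, of x] mm[OF e1[OF that(1), of x] e1[OF that(2), of x]] p m1 unfolding H_def by linarith
    show "\<bar>T3 i j l x\<bar> \<le> 6 * (m * m * m)" if "i < n" "j < n" "l < n" for i j l x
    proof -
      have "\<bar>E (\<lambda>v. v i * v j * v l) x\<bar> \<le> m * m * m" by (rule e3[OF that])
      moreover have "\<bar>E (\<lambda>v. v i * v j) x * E (\<lambda>v. v l) x\<bar> \<le> m * m * m"
        by (rule mm[OF e2[OF that(1,2)] e1[OF that(3)]])
      moreover have "\<bar>(E (\<lambda>v. v i * v l) x - E (\<lambda>v. v i) x * E (\<lambda>v. v l) x) * E (\<lambda>v. v j) x\<bar> \<le> (2 * (m * m)) * m"
      proof (rule mm[OF _ e1[OF that(2)]])
        show "\<bar>E (\<lambda>v. v i * v l) x - E (\<lambda>v. v i) x * E (\<lambda>v. v l) x\<bar> \<le> 2 * (m * m)"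
          using e2[OF that(1,3), of x] mm[OF e1[OF that(1), of x] e1[OF that(3), of x]] by linarith
      qed
      moreover have "\<bar>E (\<lambda>v. v i) x * (E (\<lambda>v. v j * v l) x - E (\<lambda>v. v j) x * E (\<lambda>v. v l) x)\<bar> \<le> m * (2 * (m * m))"
      proof (rule mm[OF e1[OF that(1)]])
        show "\<bar>E (\<lambda>v. v j * v l) x - E (\<lambda>v. v j) x * E (\<lambda>v. v l) x\<bar> \<le> 2 * (m * m)"
          using e2[OF that(2,3), of x] mm[OF e1[OF that(2), of x] e1[OF that(3), of x]] by linarith
      qed
      ultimately show ?thesis unfolding T3_def by (simp add: mult.assoc)
    qed
  qed
qed

text \<open>Convexity of \<open>F\<close> as an instance of Jensen's inequality:
  \<open>Z w / Z x\<close> is the tilted mean of \<open>exp (u v)\<close>, and \<open>exp\<close>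
  lies above its tangent at the mean \<open>m\<close> of \<open>u\<close>.\<close>

lemma F_gradient: "F w \<ge> F x + (\<Sum>i<n. gr i x * (w i - x i))"
proof -
  define u where "u v = dot n v (\<lambda>i. w i - x i)" for v
  define m where "m = E u x"
  have "E (\<lambda>v. exp m * (1 + (u v - m))) x \<le> E (\<lambda>v. exp (u v)) x"
  proof (rule E_mono)
    fix v
    have "exp m * (1 + (u v - m)) \<le> exp m * exp (u v - m)"
      by (intro mult_left_mono exp_ge_add_one_self) auto
    then show "exp m * (1 + (u v - m)) \<le> exp (u v)" by (simp flip: exp_add)
  qed
  also have "E (\<lambda>v. exp (u v)) x = Z w / Z x"
    unfolding E_def Z_def[of w] by (simp add: u_def dot_diff flip: exp_add)
  finally have "exp m \<le> Z w / Z x"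
    by (simp add: E_cmult E_add E_diff E_const m_def)
  then have "m \<le> ln (Z w / Z x)" using Z_pos[of w] Z_pos[of x] by (simp add: ln_ge_iff)
  also have "\<dots> = F w - F x" using Z_pos[of w] Z_pos[of x] card_pos by (simp add: F_def ln_div)
  finally show ?thesis by (simp add: m_def u_def[abs_def] E_dot1)
qed

lemma H_quadratic: "(\<Sum>i<n. \<Sum>j<n. u i * H i j x * u j) = E (\<lambda>v. (dot n u v - (\<Sum>i<n. u i * gr i x))\<^sup>2) x"
proof -
  define m where "m = (\<Sum>i<n. u i * gr i x)"
  have m: "E (\<lambda>v. dot n u v) x = m"
    unfolding m_def gr_def dot_def by (simp add: E_sum E_cmult)
  have 1: "E (\<lambda>v. (dot n u v)\<^sup>2) x = (\<Sum>i<n. \<Sum>j<n. u i * E (\<lambda>v. v i * v j) x * u j)"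
  proof -
    have "(\<lambda>v. (dot n u v)\<^sup>2) = (\<lambda>v. \<Sum>i<n. \<Sum>j<n. (u i * u j) * (v i * v j))"
      by (simp add: dot_def power2_eq_square sum_product mult_ac)
    then have "E (\<lambda>v. (dot n u v)\<^sup>2) x = (\<Sum>i<n. \<Sum>j<n. (u i * u j) * E (\<lambda>v. v i * v j) x)"
      by (simp only: E_sum E_cmult)
    then show ?thesis by (simp add: mult_ac)
  qed
  have "E (\<lambda>v. (dot n u v - m)\<^sup>2) x = E (\<lambda>v. (dot n u v)\<^sup>2 - (2 * m) * dot n u v + m\<^sup>2) x"
    by (rule E_cong) (simp add: power2_diff)
  also have "\<dots> = E (\<lambda>v. (dot n u v)\<^sup>2) x - (2 * m) * m + m\<^sup>2"
    by (simp only: E_add E_diff E_cmult E_const m)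
  also have "\<dots> = (\<Sum>i<n. \<Sum>j<n. u i * E (\<lambda>v. v i * v j) x * u j) - m * m"
    by (simp only: 1) (simp add: power2_eq_square)
  also have "m * m = (\<Sum>i<n. \<Sum>j<n. u i * (gr i x * gr j x) * u j)"
    unfolding m_def by (simp add: sum_product mult_ac)
  finally show ?thesis unfolding m_def[symmetric]
    by (simp add: H_def gr_def sum_subtractf algebra_simps)
qed

lemma H_nonneg: "(\<Sum>i<n. \<Sum>j<n. u i * H i j x * u j) \<ge> 0"
  unfolding H_quadratic using E_mono[of "\<lambda>_. 0"] by (simp add: E_const)

end

context lse begin

text \<open>This is \<open>exp (- F)\<close>, a smooth substitute for the indicator function of the
  polar of \<open>V\<close>, integrable once \<open>V\<close> spans.\<close>

definition "k0 x = real (card V) / Z x"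

lemma k0_pos: "k0 x > 0"
  unfolding k0_def using Z_pos card_pos by simp

lemma k0_dep: "(\<And>i. i < n \<Longrightarrow> x i = y i) \<Longrightarrow> k0 x = k0 y"
  unfolding k0_def using Z_cong[of x y] by simp

lemma k0_eq: "k0 x = exp (- F x)"
  unfolding k0_def F_def using Z_pos[of x] card_pos by (simp add: exp_minus)

lemma cont_k0 [continuous_intros]: "continuous_on S k0"
  unfolding k0_def[abs_def] by (intro continuous_intros) auto

lemma k0_path:
  assumes "\<And>i. i < n \<Longrightarrow> ((\<lambda>s. X s i) has_real_derivative X' i) (at t)"
  shows "((\<lambda>s. k0 (X s)) has_real_derivative (\<Sum>i<n. (- k0 (X t) * gr i (X t)) * X' i)) (at t)"
proof -
  have "((\<lambda>s. exp (- F (X s))) has_real_derivative exp (- F (X t)) * - (\<Sum>i<n. gr i (X t) * X' i)) (at t)"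
    by (intro DERIV_fun_exp DERIV_minus F_path assms)
  then show ?thesis unfolding k0_eq[symmetric] by (simp add: sum_distrib_left sum_negf mult.assoc)
qed

lemma k0_bound:
  assumes "v \<in> V" "a \<le> dot n v y" shows "k0 y \<le> real (card V) * exp (- a)"
proof -
  have "exp a \<le> exp (dot n v y)" using assms by simp
  also have "\<dots> \<le> Z y" unfolding Z_def using assms finV by (intro member_le_sum) auto
  finally have "real (card V) / Z y \<le> real (card V) / exp a"
    using Z_pos by (intro divide_left_mono mult_pos_pos) auto
  then show ?thesis by (simp add: k0_def exp_minus field_simps)
qed

end

text \<open>Boundary decay of \<open>k0\<close> and the linear term \<open>\<delta> x\<close> make the deformation of the gradient map proper.\<close>

lemma integral_gradient_map:
  assumes "lse Y" "lse W" and span: "\<And>y. \<exists>w\<in>W. c * ell1 n y \<le> dot n w y"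
    and c: "c > 0" and \<delta>: "0 < \<delta>" "\<delta> \<le> 1"
  shows "(\<integral>x. lse.k0 n W (\<lambda>k. lse.gr n Y k x + \<delta> * x k) *
      ldet n (\<lambda>k j. lse.H n Y k j x + (if k = j then \<delta> else 0)) \<partial>leb n) = (\<integral>x. lse.k0 n W x \<partial>leb n)
    \<and> integrable (leb n) (\<lambda>x. lse.k0 n W (\<lambda>k. lse.gr n Y k x + \<delta> * x k) *
      ldet n (\<lambda>k j. lse.H n Y k j x + (if k = j then \<delta> else 0)))"
proof -
  interpret Y: lse n Y by (rule assms(1))
  interpret W: lse n W by (rule assms(2))
  obtain M where M0: "M \<ge> 1" "\<forall>v\<in>Y. \<forall>i<n. \<bar>v i\<bar> \<le> M" "\<forall>i<n. \<forall>x. \<bar>Y.gr i x\<bar> \<le> M"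
    "\<forall>i<n. \<forall>j<n. \<forall>x. \<bar>Y.H i j x\<bar> \<le> M" "\<forall>i<n. \<forall>j<n. \<forall>l<n. \<forall>x. \<bar>Y.T3 i j l x\<bar> \<le> M"
    using Y.bounded by (elim exE conjE)
  then have M: "M \<ge> 1" "\<And>i x. i < n \<Longrightarrow> \<bar>Y.gr i x\<bar> \<le> M" "\<And>i j x. i < n \<Longrightarrow> j < n \<Longrightarrow> \<bar>Y.H i j x\<bar> \<le> M"
    "\<And>i j l x. i < n \<Longrightarrow> j < n \<Longrightarrow> l < n \<Longrightarrow> \<bar>Y.T3 i j l x\<bar> \<le> M"
    by simp_all
  obtain K where K0: "K \<ge> 1" "\<forall>i<n. \<forall>x. \<bar>W.gr i x\<bar> \<le> K"
    using W.bounded by (elim exE conjE)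
  then have K: "K \<ge> 1" "\<And>i x. i < n \<Longrightarrow> \<bar>W.gr i x\<bar> \<le> K" by simp_all
  have kb: "W.k0 y \<le> real (card W) * exp (- c * ell1 n y)" for y
    using span[of y] W.k0_bound[of _ "c * ell1 n y" y] by auto
  show ?thesis
  proof (rule homotopy_real[where g="W.k0" and g'="\<lambda>l y. - W.k0 y * W.gr l y" and B="\<lambda>k x. Y.gr k x + \<delta> * x k"
        and b="\<lambda>k j x. Y.H k j x + (if k = j then \<delta> else 0)" and bb="Y.T3" and C="M + 2"
        and A="real (card W) * K" and c=c and a=\<delta> and M="real n * M"])
    fix k j assume kj: "k < n" "j < n"
    show "has_rpd j (\<lambda>x. Y.gr k x + \<delta> * x k) (\<lambda>x. Y.H k j x + (if k = j then \<delta> else 0))"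
      unfolding has_rpd_def
    proof
      fix p
      have "((\<lambda>t. Y.gr k (p(j := t))) has_real_derivative Y.H k j p) (at (p j))"
        using Y.gr_rpd[OF kj(2), of k] by (simp add: has_rpd_def)
      then show "((\<lambda>t. Y.gr k (p(j := t)) + \<delta> * (p(j := t)) k) has_real_derivative Y.H k j p + (if k = j then \<delta> else 0)) (at (p j))"
        by (rule DERIV_add) (auto intro!: derivative_eq_intros)
    qed
    show "continuous_on UNIV (\<lambda>x. Y.H k j x + (if k = j then \<delta> else 0))"
      by (intro continuous_intros)
    show "\<bar>Y.H k j p + (if k = j then \<delta> else 0)\<bar> \<le> M + 2" for p
      using M(3)[OF kj, of p] \<delta> by auto
    show "Y.H k j (p(n := t)) + (if k = j then \<delta> else 0) = Y.H k j p + (if k = j then \<delta> else 0)" for p t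
    proof -
      have "Y.E f (p(n := t)) = Y.E f p" for f by (rule Y.E_dep) auto
      then show ?thesis by (simp only: Y.H_def)
    qed
    fix l assume l: "l < n"
    show "has_rpd l (\<lambda>x. Y.H k j x + (if k = j then \<delta> else 0)) (Y.T3 k j l)"
      unfolding has_rpd_def
    proof
      fix p
      have "((\<lambda>t. Y.H k j (p(l := t))) has_real_derivative Y.T3 k j l p) (at (p l))"
        using Y.H_rpd[OF l, of k j] by (simp add: has_rpd_def)
      from DERIV_add[OF this DERIV_const]
      show "((\<lambda>t. Y.H k j (p(l := t)) + (if k = j then \<delta> else 0)) has_real_derivative Y.T3 k j l p) (at (p l))"
        by simp
    qed
    show "Y.T3 k j l p = Y.T3 k l j p" for p by (rule Y.T3_sym)
    show "continuous_on UNIV (Y.T3 k j l)" by (intro continuous_intros)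
    show "\<bar>Y.T3 k j l p\<bar> \<le> M + 2" for p using M(4)[OF kj l, of p] by simp
  next
    fix k assume k: "k < n"
    show "Y.gr k (p(n := t)) + \<delta> * (p(n := t)) k = Y.gr k p + \<delta> * p k" for p t
    proof -
      have "Y.gr k (p(n := t)) = Y.gr k p" unfolding Y.gr_def by (rule Y.E_dep) auto
      then show ?thesis using k by simp
    qed
    show "continuous_on UNIV (\<lambda>x. Y.gr k x + \<delta> * x k)" by (intro continuous_intros)
    show "\<bar>Y.gr k p + \<delta> * p k\<bar> \<le> (M + 2) * (1 + ell1 n p)" for p
    proof -
      have "\<bar>\<delta> * p k\<bar> \<le> ell1 n p"
        using coord_le_ell1[OF k, of p] \<delta> mult_right_mono[of \<delta> 1 "\<bar>p k\<bar>"] by (simp add: abs_mult)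
      then have "\<bar>Y.gr k p + \<delta> * p k\<bar> \<le> M + ell1 n p"
        using M(2)[OF k, of p] by linarith
      also have "\<dots> \<le> (M + 2) * (1 + ell1 n p)" using M(1) by (simp add: algebra_simps)
      finally show ?thesis .
    qed
    show "continuous_on UNIV (\<lambda>y. - W.k0 y * W.gr k y)" by (intro continuous_intros)
    show "\<bar>- W.k0 y * W.gr k y\<bar> \<le> real (card W) * K * exp (- c * ell1 n y)" for y
    proof -
      have "\<bar>- W.k0 y * W.gr k y\<bar> \<le> (real (card W) * exp (- c * ell1 n y)) * K"
        unfolding abs_mult using kb[of y] K(2)[OF k, of y] W.k0_pos[of y] by (intro mult_mono) auto
      then show ?thesis by (simp add: mult_ac)
    qed
  next
    show "continuous_on UNIV W.k0" by (intro continuous_intros)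
    fix y
    have "\<bar>W.k0 y\<bar> \<le> real (card W) * exp (- c * ell1 n y)" using kb[of y] W.k0_pos[of y] by simp
    also have "\<dots> \<le> (real (card W) * exp (- c * ell1 n y)) * K"
      using mult_left_mono[OF K(1), of "real (card W) * exp (- c * ell1 n y)"] by simp
    finally show "\<bar>W.k0 y\<bar> \<le> real (card W) * K * exp (- c * ell1 n y)" by (simp add: mult_ac)
  next
    fix y z :: "nat \<Rightarrow> real" assume "\<And>i. i < n \<Longrightarrow> y i = z i"
    then show "W.k0 y = W.k0 z" by (rule W.k0_dep)
  next
    fix X :: "real \<Rightarrow> nat \<Rightarrow> real" and X' t
    assume "\<And>l. l < n \<Longrightarrow> ((\<lambda>s. X s l) has_real_derivative X' l) (at t)"
    then show "((\<lambda>s. W.k0 (X s)) has_real_derivative (\<Sum>l<n. - W.k0 (X t) * W.gr l (X t) * X' l)) (at t)"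
      by (rule W.k0_path)
  next
    fix s :: real and p :: "nat \<Rightarrow> real" assume s: "0 \<le> s" "s \<le> 1"
    \<comment> \<open>The gradient contributes at most \<open>M\<close>, and the linear part has the
      coefficient \<open>1 - s + s * \<delta>\<close>, which is at least \<open>\<delta>\<close> at
      every time.\<close>
    have "\<delta> * \<bar>p k\<bar> - M \<le> \<bar>(1 - s) * p k + s * (Y.gr k p + \<delta> * p k)\<bar>" if "k < n" for k
    proof -
      have "s * \<bar>Y.gr k p\<bar> \<le> 1 * M" using s M(2)[OF that, of p] by (intro mult_mono) auto
      then have 1: "\<bar>s * Y.gr k p\<bar> \<le> M" using s by (simp add: abs_mult)
      have "s * (1 - \<delta>) \<le> 1 * (1 - \<delta>)" using s \<delta> by (intro mult_right_mono) auto
      then have "\<delta> \<le> 1 - s + s * \<delta>" by (simp add: algebra_simps)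
      then have "\<delta> * \<bar>p k\<bar> \<le> \<bar>(1 - s + s * \<delta>) * p k\<bar>"
        using \<delta> by (simp add: abs_mult mult_right_mono)
      moreover have "(1 - s) * p k + s * (Y.gr k p + \<delta> * p k) = (1 - s + s * \<delta>) * p k + s * Y.gr k p"
        by (simp add: algebra_simps)
      ultimately show ?thesis using 1 by linarith
    qed
    then have "(\<Sum>k<n. \<delta> * \<bar>p k\<bar> - M) \<le> ell1 n (\<lambda>k. (1 - s) * p k + s * (Y.gr k p + \<delta> * p k))"
      unfolding ell1_def by (intro sum_mono) auto
    then show "\<delta> * ell1 n p - real n * M \<le> ell1 n (\<lambda>k. (1 - s) * p k + s * (Y.gr k p + \<delta> * p k))"
      by (simp add: sum_subtractf ell1_def sum_distrib_left)
  qed (use M(1) K(1) c \<delta> in auto)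
qed

section \<open>Determinants: products and positivity along a path\<close>

lemma sum_lessThan_add: "(\<Sum>l<n + m. f l) = (\<Sum>l<n. f l) + (\<Sum>l<m. f (n + l))" for f :: "nat \<Rightarrow> 'a::comm_monoid_add"
  by (induction m) (simp_all add: add.assoc)

lemma sum_double: "(\<Sum>l<n + n. f l) = (\<Sum>l<n. f l) + (\<Sum>l<n. f (n + l))" for f :: "nat \<Rightarrow> 'a::comm_monoid_add"
  by (rule sum_lessThan_add)

lemma det_mat_mult:
  "ldet n (\<lambda>i j. \<Sum>k<n. a i k * b k j) = ldet n a * ldet n b"
proof -
  have "Matrix.mat n n (\<lambda>(i, j). \<Sum>k<n. a i k * b k j) = Matrix.mat n n (\<lambda>(i, j). a i j) * Matrix.mat n n (\<lambda>(i, j). b i j)"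
    by (rule eq_matI) (simp_all add: scalar_prod_def atLeast0LessThan)
  then show ?thesis unfolding ldet_eq_det
    by (simp only:) (rule det_mult, rule mat_carrier, rule mat_carrier)
qed

lemma ldet_transpose: "ldet n (\<lambda>i j. a j i) = ldet n a"
proof -
  have "Matrix.mat n n (\<lambda>(i, j). a j i) = transpose_mat (Matrix.mat n n (\<lambda>(i, j). a i j))"
    by (rule eq_matI) auto
  then show ?thesis unfolding ldet_eq_det
    by (simp only:) (rule Determinant.det_transpose, rule mat_carrier)
qed

lemma ldet_scalar: "ldet n (\<lambda>i j. if i = j then a else 0) = a ^ n"
proof -
  have "Matrix.mat n n (\<lambda>(i, j). if i = j then a else 0) = a \<cdot>\<^sub>m 1\<^sub>m n"
    by (rule eq_matI) auto
  then show ?thesis unfolding ldet_eq_det by simp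
qed

lemma ldet_nonzero:
  fixes a :: "nat \<Rightarrow> nat \<Rightarrow> 'a::field"
  assumes "\<And>v. (\<And>i. i < n \<Longrightarrow> (\<Sum>j<n. a i j * v j) = 0) \<Longrightarrow> (\<And>i. i < n \<Longrightarrow> v i = 0)"
  shows "ldet n a \<noteq> 0"
proof
  assume "ldet n a = 0"
  then obtain v where v: "v \<in> carrier_vec n" "v \<noteq> 0\<^sub>v n"
    "Matrix.mat n n (\<lambda>(i, j). a i j) *\<^sub>v v = 0\<^sub>v n"
    unfolding ldet_eq_det by (subst (asm) det_0_iff_vec_prod_zero_field[of _ n]) auto
  have "(\<Sum>j<n. a i j * vec_index v j) = 0" if "i < n" for i
  proof -
    have "vec_index (Matrix.mat n n (\<lambda>(i, j). a i j) *\<^sub>v v) i = (\<Sum>j<n. a i j * vec_index v j)"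
      using that v(1) by (simp add: scalar_prod_def atLeast0LessThan)
    then show ?thesis using v(3) that by simp
  qed
  from assms[OF this] have "v = 0\<^sub>v n" using v(1) by (intro eq_vecI) auto
  then show False using v(2) by simp
qed

lemma continuous_on_ldet:
  fixes a :: "'b::topological_space \<Rightarrow> nat \<Rightarrow> nat \<Rightarrow> real"
  assumes "\<And>i j. i < n \<Longrightarrow> j < n \<Longrightarrow> continuous_on S (\<lambda>s. a s i j)"
  shows "continuous_on S (\<lambda>s. ldet n (a s))"
  unfolding ldet_def
proof (intro continuous_intros)
  fix \<sigma> k assume "\<sigma> \<in> {\<sigma>. \<sigma> permutes {..<n}}" "k \<in> {..<n}"
  then show "continuous_on S (\<lambda>s. a s k (\<sigma> k))"
    using permutes_in_image[of \<sigma> "{..<n}" k] by (intro assms) auto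
qed

text \<open>On the segment from the identity matrix to \<open>a\<close> the determinant starts at 1
  and never vanishes, so it stays positive.\<close>

lemma ldet_pos_of_path:
  fixes a :: "nat \<Rightarrow> nat \<Rightarrow> real"
  assumes "\<And>s v. 0 \<le> s \<Longrightarrow> s \<le> 1 \<Longrightarrow>
     (\<And>i. i < n \<Longrightarrow> (1 - s) * v i + s * (\<Sum>j<n. a i j * v j) = 0) \<Longrightarrow> (\<And>i. i < n \<Longrightarrow> v i = 0)"
  shows "ldet n a > 0"
proof -
  define m where "m s i j = (1 - s) * (if j = i then 1 else 0) + s * a i j" for s i j
  have nz: "ldet n (m s) \<noteq> 0" if s: "0 \<le> s" "s \<le> 1" for s
  proof (rule ldet_nonzero)
    fix v i assume v: "\<And>i. i < n \<Longrightarrow> (\<Sum>j<n. m s i j * v j) = 0" and i: "i < n"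
    show "v i = 0"
    proof (rule assms[OF s _ i])
      fix i assume i: "i < n"
      have "(\<Sum>j<n. m s i j * v j) = (1 - s) * (\<Sum>j<n. (if j = i then 1 else 0) * v j) + s * (\<Sum>j<n. a i j * v j)"
        by (simp add: m_def sum.distrib sum_distrib_left ring_distribs mult.assoc)
      also have "(\<Sum>j<n. (if j = i then 1 else 0) * v j) = v i"
        using i by (simp add: if_distrib[of "\<lambda>u. u * _"] cong: if_cong)
      finally show "(1 - s) * v i + s * (\<Sum>j<n. a i j * v j) = 0" using v[OF i] by simp
    qed
  qed
  have cont: "continuous_on {0..1} (\<lambda>s. ldet n (m s))"
  proof (rule continuous_on_ldet)
    show "continuous_on {0..1} (\<lambda>s. m s i j)" for i j
      unfolding m_def by (intro continuous_intros)
  qed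
  have m0: "ldet n (m 0) = 1" using ldet_one[of n, where 'a=real] ldet_cong[of n "m 0" "\<lambda>k j. if j = k then 1 else 0"]
    by (simp add: m_def)
  have m1: "ldet n (m 1) = ldet n a" by (rule ldet_cong) (simp add: m_def)
  show ?thesis
  proof (rule ccontr)
    assume "\<not> ldet n a > 0"
    then have "\<exists>s\<ge>0. s \<le> 1 \<and> ldet n (m s) = 0"
      using cont m0 m1 by (intro IVT2') simp_all
    then show False using nz by blast
  qed
qed

section \<open>The Bourgain-Milman inequality\<close>

text \<open>A pair of points of dimension \<open>n\<close> is stored in one function
  \<open>p\<close>. The second point is \<open>sh n p\<close>; the first is \<open>p\<close> itself,
  because functions on the first \<open>n\<close> coordinates ignore the rest.\<close>

definition sh :: "nat \<Rightarrow> (nat \<Rightarrow> real) \<Rightarrow> nat \<Rightarrow> real" where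
  "sh n p = (\<lambda>i. p (n + i))"

definition blk :: "nat \<Rightarrow> (nat \<Rightarrow> nat \<Rightarrow> 'a) \<Rightarrow> (nat \<Rightarrow> nat \<Rightarrow> 'a) \<Rightarrow> (nat \<Rightarrow> nat \<Rightarrow> 'a) \<Rightarrow> (nat \<Rightarrow> nat \<Rightarrow> 'a) \<Rightarrow> nat \<Rightarrow> nat \<Rightarrow> 'a" where
  "blk n P Q R S k j = (if k < n then (if j < n then P k j else Q k (j - n)) else (if j < n then R (k - n) j else S (k - n) (j - n)))"

definition idm :: "'a::comm_ring_1 \<Rightarrow> nat \<Rightarrow> nat \<Rightarrow> 'a" where
  "idm c i j = (if i = j then c else 0)"

lemma idm_left: "i < n \<Longrightarrow> (\<Sum>l<n. idm c i l * X l j) = c * X i j"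
  by (simp add: idm_def if_distrib[of "\<lambda>u. u * _"] cong: if_cong)

lemma idm_right: "j < n \<Longrightarrow> (\<Sum>l<n. X i l * idm c l j) = X i j * c"
  by (simp add: idm_def if_distrib[of "\<lambda>u. _ * u"] cong: if_cong)

lemma ldet_blk_left:
  "ldet (n + n) (blk n (idm c1) (idm c2) (idm c3) (idm c4)) * ldet (n + n) (blk n P Q R S)
   = ldet (n + n) (blk n (\<lambda>i j. c1 * P i j + c2 * R i j) (\<lambda>i j. c1 * Q i j + c2 * S i j)
       (\<lambda>i j. c3 * P i j + c4 * R i j) (\<lambda>i j. c3 * Q i j + c4 * S i j))"
  unfolding det_mat_mult[symmetric]
proof (rule ldet_cong)
  fix k j assume "k < n + n" "j < n + n"
  then show "(\<Sum>l<n + n. blk n (idm c1) (idm c2) (idm c3) (idm c4) k l * blk n P Q R S l j)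
    = blk n (\<lambda>i j. c1 * P i j + c2 * R i j) (\<lambda>i j. c1 * Q i j + c2 * S i j)
       (\<lambda>i j. c3 * P i j + c4 * R i j) (\<lambda>i j. c3 * Q i j + c4 * S i j) k j"
    unfolding sum_double by (cases "k < n"; cases "j < n") (simp_all add: blk_def idm_left)
qed

lemma ldet_blk_right:
  "ldet (n + n) (blk n P Q R S) * ldet (n + n) (blk n (idm c1) (idm 0) (idm 0) (idm c2))
   = ldet (n + n) (blk n (\<lambda>i j. P i j * c1) (\<lambda>i j. Q i j * c2) (\<lambda>i j. R i j * c1) (\<lambda>i j. S i j * c2))"
  unfolding det_mat_mult[symmetric]
proof (rule ldet_cong)
  fix k j assume "k < n + n" "j < n + n"
  then show "(\<Sum>l<n + n. blk n P Q R S k l * blk n (idm c1) (idm 0) (idm 0) (idm c2) l j)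
    = blk n (\<lambda>i j. P i j * c1) (\<lambda>i j. Q i j * c2) (\<lambda>i j. R i j * c1) (\<lambda>i j. S i j * c2) k j"
    unfolding sum_double by (cases "k < n"; cases "j < n") (simp_all add: blk_def idm_right)
qed

text \<open>\<open>MT\<close> is the derivative of \<open>(x\<^sub>1, x\<^sub>2) \<mapsto> ((x\<^sub>1 + x\<^sub>2)/2, (y\<^sub>2 - y\<^sub>1)/2)\<close> and \<open>MU\<close> that of
  \<open>(x\<^sub>1, x\<^sub>2) \<mapsto> ((x\<^sub>1 + y\<^sub>1) - \<i>(x\<^sub>2 - y\<^sub>2), (x\<^sub>2 + y\<^sub>2) + \<i>(x\<^sub>1 - y\<^sub>1))/2\<close>, where \<open>y\<^sub>i\<close> is a gradient at \<open>x\<^sub>i\<close> with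
  derivative \<open>A\<^sub>i\<close>. Both are Wick rotations of each other, so their determinants are proportional.\<close>

definition MT :: "nat \<Rightarrow> (nat \<Rightarrow> nat \<Rightarrow> 'a::{field}) \<Rightarrow> (nat \<Rightarrow> nat \<Rightarrow> 'a) \<Rightarrow> nat \<Rightarrow> nat \<Rightarrow> 'a" where
  "MT n A1 A2 = blk n (idm (1/2)) (idm (1/2)) (\<lambda>i j. - (A1 i j) / 2) (\<lambda>i j. A2 i j / 2)"

definition MU :: "nat \<Rightarrow> (nat \<Rightarrow> nat \<Rightarrow> complex) \<Rightarrow> (nat \<Rightarrow> nat \<Rightarrow> complex) \<Rightarrow> nat \<Rightarrow> nat \<Rightarrow> complex" where
  "MU n A1 A2 = blk n (\<lambda>i j. (idm 1 i j + A1 i j) / 2) (\<lambda>i j. - \<i> * (idm 1 i j - A2 i j) / 2)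
     (\<lambda>i j. \<i> * (idm 1 i j - A1 i j) / 2) (\<lambda>i j. (idm 1 i j + A2 i j) / 2)"

text \<open>\<open>MU\<close> is \<open>MT\<close> multiplied on both sides by constant block
  matrices, with determinants \<open>c\<close> and \<open>r\<close>. The constant is eliminated by
  taking the identity for \<open>A1\<close> and \<open>A2\<close>, where \<open>MU\<close> is the
  identity.\<close>

lemma ldet_MU_MT:
  fixes A1 A2 :: "nat \<Rightarrow> nat \<Rightarrow> complex"
  shows "ldet (n + n) (MU n A1 A2) * ldet (n + n) (MT n (idm 1) (idm 1)) = ldet (n + n) (MT n A1 A2)"
proof -
  define c where "c = ldet (n + n) (blk n (idm ((1 - \<i>) / 2)) (idm (- (1 - \<i>) / 2)) (idm ((1 + \<i>) / 2)) (idm ((1 + \<i>) / 2)))"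
  define r where "r = ldet (n + n) (blk n (idm (1 + \<i>)) (idm 0) (idm 0) (idm (1 - \<i>)))"
  have sq: "(1 + \<i>) * (1 + \<i>) = 2 * \<i>" "(1 - \<i>) * (1 - \<i>) = - 2 * \<i>" "(1 + \<i>) * (1 - \<i>) = 2" "(1 - \<i>) * (1 + \<i>) = 2"
    by (simp_all add: algebra_simps)
  have *: "ldet (n + n) (MU n B1 B2) = c * ldet (n + n) (MT n B1 B2) * r" for B1 B2 :: "nat \<Rightarrow> nat \<Rightarrow> complex"
  proof -
    have "c * ldet (n + n) (MT n B1 B2) * r = ldet (n + n)
       (blk n (\<lambda>i j. ((1 - \<i>) / 2 * idm (1/2) i j + - (1 - \<i>) / 2 * (- B1 i j / 2)) * (1 + \<i>))
         (\<lambda>i j. ((1 - \<i>) / 2 * idm (1/2) i j + - (1 - \<i>) / 2 * (B2 i j / 2)) * (1 - \<i>))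
         (\<lambda>i j. ((1 + \<i>) / 2 * idm (1/2) i j + (1 + \<i>) / 2 * (- B1 i j / 2)) * (1 + \<i>))
         (\<lambda>i j. ((1 + \<i>) / 2 * idm (1/2) i j + (1 + \<i>) / 2 * (B2 i j / 2)) * (1 - \<i>)))"
      unfolding c_def r_def MT_def ldet_blk_left ldet_blk_right ..
    also have "\<dots> = ldet (n + n) (MU n B1 B2)"
    proof -
      have "((1 - \<i>) / 2 * idm (1/2) i j + - (1 - \<i>) / 2 * (- B1 i j / 2)) * (1 + \<i>) = (idm 1 i j + B1 i j) / 2"
        "((1 - \<i>) / 2 * idm (1/2) i j + - (1 - \<i>) / 2 * (B2 i j / 2)) * (1 - \<i>) = - \<i> * (idm 1 i j - B2 i j) / 2"
        "((1 + \<i>) / 2 * idm (1/2) i j + (1 + \<i>) / 2 * (- B1 i j / 2)) * (1 + \<i>) = \<i> * (idm 1 i j - B1 i j) / 2"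
        "((1 + \<i>) / 2 * idm (1/2) i j + (1 + \<i>) / 2 * (B2 i j / 2)) * (1 - \<i>) = (idm 1 i j + B2 i j) / 2" for i j
        by (cases "i = j"; simp add: idm_def complex_eq_iff field_simps)+
      then show ?thesis by (simp only: MU_def)
    qed
    finally show ?thesis by simp
  qed
  have "ldet (n + n) (MU n (idm 1) (idm 1)) = ldet (n + n) (\<lambda>k j. if j = k then 1 else 0)"
    by (rule ldet_cong) (auto simp: MU_def blk_def idm_def)
  then have 1: "c * ldet (n + n) (MT n (idm 1) (idm 1)) * r = 1" by (simp add: * ldet_one)
  have "ldet (n + n) (MU n A1 A2) * ldet (n + n) (MT n (idm 1) (idm 1))
     = ldet (n + n) (MT n A1 A2) * (c * ldet (n + n) (MT n (idm 1) (idm 1)) * r)"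
    unfolding * by (simp only: mult_ac)
  then show ?thesis unfolding 1 by simp
qed

text \<open>For a kernel vector on the path to the identity, the upper half gives
  \<open>v1 = - (b / a) * v2\<close>. Pairing the lower half with \<open>v2\<close> then gives a
  vanishing sum of nonnegative terms, one of which is definite: the first for \<open>s = 0\<close>,
  the one with \<open>A2\<close> otherwise.\<close>

lemma ldet_MT_pos:
  fixes A1 A2 :: "nat \<Rightarrow> nat \<Rightarrow> real"
  assumes A1: "\<And>u. (\<Sum>i<n. \<Sum>j<n. u i * A1 i j * u j) \<ge> 0" and A2: "\<And>u i. i < n \<Longrightarrow> u i \<noteq> 0 \<Longrightarrow> (\<Sum>i<n. \<Sum>j<n. u i * A2 i j * u j) > 0"
  shows "ldet (n + n) (MT n A1 A2) > 0"
proof (rule ldet_pos_of_path)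
  fix s :: real and v i assume s: "0 \<le> s" "s \<le> 1" and i: "i < n + n"
    and v: "\<And>i. i < n + n \<Longrightarrow> (1 - s) * v i + s * (\<Sum>j<n + n. MT n A1 A2 i j * v j) = 0"
  define v1 v2 where "v1 = v" and "v2 = sh n v"
  define a b where "a = 1 - s / 2" and "b = s / 2"
  have ab: "a \<ge> 1 / 2" "b \<ge> 0" using s by (auto simp: a_def b_def)
  have 1: "a * v1 i + b * v2 i = 0" if "i < n" for i
  proof -
    have e: "(\<Sum>j<n. MT n A1 A2 i j * v j) = 1 / 2 * v i" "(\<Sum>j<n. MT n A1 A2 i (n + j) * v (n + j)) = 1 / 2 * v (n + i)"
      using that idm_left[OF that, of "1/2" "\<lambda>j _. v j"] idm_left[OF that, of "1/2" "\<lambda>j _. v (n + j)"]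
      by (simp_all add: MT_def blk_def)
    have "(1 - s) * v i + s * (1 / 2 * v i + 1 / 2 * v (n + i)) = 0"
      using v[of i] that unfolding sum_double e by simp
    then show ?thesis
      by (simp add: v1_def v2_def sh_def a_def b_def algebra_simps)
  qed
  have 2: "(1 - s) * v2 i + b * ((\<Sum>j<n. A2 i j * v2 j) - (\<Sum>j<n. A1 i j * v1 j)) = 0" if "i < n" for i
  proof -
    have e: "(\<Sum>j<n. MT n A1 A2 (n + i) j * v j) = - (1 / 2) * (\<Sum>j<n. A1 i j * v1 j)"
      "(\<Sum>j<n. MT n A1 A2 (n + i) (n + j) * v (n + j)) = (1 / 2) * (\<Sum>j<n. A2 i j * v2 j)"
      unfolding sum_distrib_left v1_def v2_def sh_def
      by (intro sum.cong; simp add: MT_def blk_def)+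
    have "(1 - s) * v (n + i) + s * (- (1 / 2) * (\<Sum>j<n. A1 i j * v1 j) + (1 / 2) * (\<Sum>j<n. A2 i j * v2 j)) = 0"
      using v[of "n + i"] that unfolding sum_double e by simp
    then show ?thesis by (simp add: b_def v2_def sh_def algebra_simps)
  qed
  have v1: "v1 i = - (b / a) * v2 i" if "i < n" for i
    using 1[OF that] ab by (simp add: field_simps)
  have 3: "(1 - s) * v2 i * v2 i + b * (\<Sum>j<n. v2 i * A2 i j * v2 j) + (b * (b / a)) * (\<Sum>j<n. v2 i * A1 i j * v2 j) = 0" if "i < n" for i
  proof -
    have "(\<Sum>j<n. A1 i j * v1 j) = - (b / a) * (\<Sum>j<n. A1 i j * v2 j)"
      unfolding sum_distrib_left by (intro sum.cong) (auto simp: v1)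
    with 2[OF that] have "v2 i * ((1 - s) * v2 i + b * (\<Sum>j<n. A2 i j * v2 j) + (b * (b / a)) * (\<Sum>j<n. A1 i j * v2 j)) = 0"
      by (simp add: algebra_simps)
    then show ?thesis by (simp add: sum_distrib_left algebra_simps)
  qed
  have "(\<Sum>i<n. (1 - s) * v2 i * v2 i + b * (\<Sum>j<n. v2 i * A2 i j * v2 j) + (b * (b / a)) * (\<Sum>j<n. v2 i * A1 i j * v2 j)) = 0"
    using 3 by (intro sum.neutral) auto
  then have 4: "(\<Sum>i<n. (1 - s) * v2 i * v2 i) + b * (\<Sum>i<n. \<Sum>j<n. v2 i * A2 i j * v2 j)
      + (b * (b / a)) * (\<Sum>i<n. \<Sum>j<n. v2 i * A1 i j * v2 j) = 0"
    by (simp only: sum.distrib sum_distrib_left[symmetric])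
  have p1: "(\<Sum>i<n. (1 - s) * v2 i * v2 i) \<ge> 0"
    using s by (intro sum_nonneg) (auto simp: mult.assoc)
  have p2: "b * (\<Sum>i<n. \<Sum>j<n. v2 i * A2 i j * v2 j) \<ge> 0"
  proof (cases "\<exists>i<n. v2 i \<noteq> 0")
    case True
    then obtain i where "i < n" "v2 i \<noteq> 0" by blast
    then show ?thesis using A2[of i v2] ab by (intro mult_nonneg_nonneg) auto
  next
    case False
    then show ?thesis by simp
  qed
  have p3: "(b * (b / a)) * (\<Sum>i<n. \<Sum>j<n. v2 i * A1 i j * v2 j) \<ge> 0"
    using A1[of v2] ab by (intro mult_nonneg_nonneg) auto
  have z2: "v2 i = 0" if i: "i < n" for i
  proof (rule ccontr)
    assume nz: "v2 i \<noteq> 0"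
    show False
    proof (cases "s = 0")
      case True
      have "(\<Sum>i<n. v2 i * v2 i) > 0"
        using nz i by (intro sum_pos2[of _ i]) (auto simp: zero_less_mult_iff)
      then show False using 4 p2 p3 True by simp
    next
      case False
      then have "b > 0" using s by (simp add: b_def)
      then have "b * (\<Sum>i<n. \<Sum>j<n. v2 i * A2 i j * v2 j) > 0" using A2[of i v2, OF i nz] by simp
      then show False using 4 p1 p3 by linarith
    qed
  qed
  show "v i = 0"
  proof (cases "i < n")
    case True
    then show ?thesis using v1[OF True] z2[OF True] by (simp add: v1_def)
  next
    case False
    then have "v2 (i - n) = 0" using i by (intro z2) auto
    then show ?thesis using False by (simp add: v2_def sh_def)
  qed
qed

text \<open>The matrix times its transpose is half the identity, which determines the square;
  positivity selects the root.\<close>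

lemma ldet_MT_id: "ldet (n + n) (MT n (idm 1) (idm 1) :: nat \<Rightarrow> nat \<Rightarrow> real) = (1 / 2) ^ n"
proof -
  let ?M = "MT n (idm 1) (idm 1) :: nat \<Rightarrow> nat \<Rightarrow> real"
  have M: "ldet (n + n) ?M = ldet (n + n) (blk n (idm (1/2)) (idm (1/2)) (idm (- 1/2)) (idm (1/2)))"
    by (rule ldet_cong) (auto simp: MT_def blk_def idm_def)
  have Mt: "ldet (n + n) (\<lambda>i j. ?M j i) = ldet (n + n) (blk n (idm (1/2)) (idm (- 1/2)) (idm (1/2)) (idm (1/2)))"
    by (rule ldet_cong) (auto simp: MT_def blk_def idm_def)
  have "ldet (n + n) ?M * ldet (n + n) (\<lambda>i j. ?M j i) = ldet (n + n) (\<lambda>i j. if i = j then 1 / 2 else 0)"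
    unfolding M Mt ldet_blk_left
  proof (rule ldet_cong)
    fix k j assume kj: "k < n + n" "j < n + n"
    show "blk n (\<lambda>i j. 1 / 2 * idm (1 / 2) i j + 1 / 2 * idm (1 / 2) i j) (\<lambda>i j. 1 / 2 * idm (- 1 / 2) i j + 1 / 2 * idm (1 / 2) i j)
       (\<lambda>i j. - 1 / 2 * idm (1 / 2) i j + 1 / 2 * idm (1 / 2) i j) (\<lambda>i j. - 1 / 2 * idm (- 1 / 2) i j + 1 / 2 * idm (1 / 2) i j) k j
      = (if k = j then 1 / 2 else (0 :: real))"
    proof (cases "k < n")
      case True
      then show ?thesis by (cases "j < n") (simp_all add: blk_def idm_def)
    next
      case False
      then show ?thesis using kj by (cases "j < n") (auto simp: blk_def idm_def)
    qed
  qed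
  then have "(ldet (n + n) ?M)\<^sup>2 = ((1 / 2) ^ n)\<^sup>2"
    unfolding ldet_transpose[of "n + n" ?M] ldet_scalar by (simp add: power2_eq_square power_add)
  moreover have "ldet (n + n) ?M > 0"
  proof (rule ldet_MT_pos)
    have q: "(\<Sum>i<n. \<Sum>j<n. u i * idm 1 i j * u j) = (\<Sum>i<n. (u i)\<^sup>2)" for u :: "nat \<Rightarrow> real"
      by (intro sum.cong) (auto simp: idm_def power2_eq_square if_distrib[of "\<lambda>u. u * _"] if_distrib[of "\<lambda>u. _ * u"] cong: if_cong)
    show "(\<Sum>i<n. \<Sum>j<n. u i * idm 1 i j * u j) \<ge> 0" for u :: "nat \<Rightarrow> real"
      unfolding q by (simp add: sum_nonneg)
    show "(\<Sum>i<n. \<Sum>j<n. u i * idm 1 i j * u j) > 0" if "i < n" "u i \<noteq> 0" for u :: "nat \<Rightarrow> real" and i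
      unfolding q using that by (intro sum_pos2[of _ i]) auto
  qed
  ultimately show ?thesis by (intro power2_eq_imp_eq[of _ "(1 / 2) ^ n"]) auto
qed

lemma ldet_MU:
  fixes A1 A2 :: "nat \<Rightarrow> nat \<Rightarrow> real"
  shows "ldet (n + n) (MU n (\<lambda>i j. of_real (A1 i j)) (\<lambda>i j. of_real (A2 i j))) = of_real (2 ^ n * ldet (n + n) (MT n A1 A2))"
proof -
  have r: "ldet (n + n) (MT n (\<lambda>i j. complex_of_real (B1 i j)) (\<lambda>i j. complex_of_real (B2 i j))) = of_real (ldet (n + n) (MT n B1 B2))"
    for B1 B2 :: "nat \<Rightarrow> nat \<Rightarrow> real"
    unfolding ldet_of_real[symmetric] by (rule ldet_cong) (auto simp: MT_def blk_def idm_def)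
  have i: "(\<lambda>i j. complex_of_real (idm 1 i j)) = idm 1"
    by (intro ext) (auto simp: idm_def)
  have t: "ldet (n + n) (MT n (idm 1) (idm 1)) = complex_of_real ((1 / 2) ^ n)"
    using r[of "idm 1" "idm 1"] unfolding i ldet_MT_id .
  let ?u = "ldet (n + n) (MU n (\<lambda>i j. of_real (A1 i j)) (\<lambda>i j. of_real (A2 i j)))"
  have "?u = ?u * complex_of_real ((1 / 2) ^ n) * complex_of_real (2 ^ n)"
    by (simp add: mult.assoc flip: of_real_mult power_mult_distrib)
  also have "?u * complex_of_real ((1 / 2) ^ n) = of_real (ldet (n + n) (MT n A1 A2))"
    using ldet_MU_MT[of n "\<lambda>i j. of_real (A1 i j)" "\<lambda>i j. of_real (A2 i j)"] unfolding t r .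
  finally show ?thesis by (simp only: of_real_mult mult.commute)
qed

section \<open>Regularized potentials and maps of the doubled space\<close>

lemma has_rpd_shift:
  assumes "has_rpd l f f'" shows "has_rpd (n + l) (\<lambda>p. f (sh n p)) (\<lambda>p. f' (sh n p))"
  unfolding has_rpd_def
proof
  fix p :: "nat \<Rightarrow> real"
  have e: "sh n (p(n + l := t)) = (sh n p)(l := t)" for t by (auto simp: sh_def)
  show "((\<lambda>t. f (sh n (p(n + l := t)))) has_real_derivative f' (sh n p)) (at (p (n + l)))"
    using assms[unfolded has_rpd_def, rule_format, of "sh n p"] unfolding e by (simp add: sh_def)
qed

lemma has_rpd_indep: "(\<And>p t. f (p(j := t)) = f p) \<Longrightarrow> has_rpd j f (\<lambda>_. 0)"
  unfolding has_rpd_def by simp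

lemma has_rpd_lin: "has_rpd j f f' \<Longrightarrow> has_rpd j g g' \<Longrightarrow> has_rpd j (\<lambda>p. a * f p + b * g p) (\<lambda>p. a * f' p + b * g' p)"
  unfolding has_rpd_def by (auto intro!: DERIV_add DERIV_cmult)

lemma has_rpd_add: "has_rpd j f f' \<Longrightarrow> has_rpd j g g' \<Longrightarrow> has_rpd j (\<lambda>p. f p + g p) (\<lambda>p. f' p + g' p)"
  unfolding has_rpd_def by (auto intro!: DERIV_add)

lemma has_rpd_coord: "has_rpd j (\<lambda>p. p i) (\<lambda>_. if i = j then 1 else 0)"
  unfolding has_rpd_def by auto

lemma has_rpd_eq: "has_rpd j f f' \<Longrightarrow> (\<And>p. f p = g p) \<Longrightarrow> (\<And>p. f' p = g' p) \<Longrightarrow> has_rpd j g g'"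
  unfolding has_rpd_def by simp

lemma continuous_on_sh [continuous_intros]: "continuous_on S (sh n)"
  unfolding sh_def by (intro continuous_on_coordinatewise_then_product continuous_on_coord)

lemma sh_measurable [measurable]: "sh n \<in> borel_measurable borel"
  by (intro continuous_imp_borel_fun continuous_intros)

lemma continuous_on_comp_sh:
  "continuous_on UNIV f \<Longrightarrow> continuous_on UNIV (\<lambda>p. f (sh n p))"
  by (rule continuous_on_compose2[OF _ continuous_on_sh]) auto

lemma ell1_double: "ell1 (n + n) p = ell1 n p + ell1 n (sh n p)"
  unfolding ell1_def sum_double sh_def ..

text \<open>Completing the square bounds
  \<open>a * \<bar>z i\<bar> - \<epsilon> / 2 * (z i)\<^sup>2\<close> by
  \<open>a\<^sup>2 / (2 * \<epsilon>)\<close>: quadratic exponents give exponential decay at every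
  rate \<open>a\<close>.\<close>

lemma quad_exp_bound:
  fixes \<epsilon> a :: real
  assumes "\<epsilon> > 0" "a \<ge> 0"
  shows "exp (- (\<epsilon> / 2) * (\<Sum>i<n. (z i)\<^sup>2)) \<le> exp (real n * (a\<^sup>2 / (2 * \<epsilon>))) * exp (- a * ell1 n z)"
proof -
  have "a * \<bar>z i\<bar> - \<epsilon> / 2 * (z i)\<^sup>2 \<le> a\<^sup>2 / (2 * \<epsilon>)" for i
  proof -
    have "0 \<le> (a - \<epsilon> * \<bar>z i\<bar>)\<^sup>2" by simp
    then have "2 * \<epsilon> * (a * \<bar>z i\<bar>) - \<epsilon>\<^sup>2 * (z i)\<^sup>2 \<le> a\<^sup>2"
      by (simp add: power2_diff power_mult_distrib mult_ac)
    then show ?thesis using assms by (simp add: field_simps power2_eq_square)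
  qed
  then have "(\<Sum>i<n. a * \<bar>z i\<bar> - \<epsilon> / 2 * (z i)\<^sup>2) \<le> (\<Sum>i<n. a\<^sup>2 / (2 * \<epsilon>))"
    by (intro sum_mono)
  then have "- (\<epsilon> / 2) * (\<Sum>i<n. (z i)\<^sup>2) \<le> real n * (a\<^sup>2 / (2 * \<epsilon>)) + - a * ell1 n z"
    by (simp add: sum_subtractf ell1_def sum_distrib_left sum_negf)
  then have "exp (- (\<epsilon> / 2) * (\<Sum>i<n. (z i)\<^sup>2)) \<le> exp (real n * (a\<^sup>2 / (2 * \<epsilon>)) + - a * ell1 n z)"
    by simp
  then show ?thesis by (simp only: exp_add)
qed

context lse begin

text \<open>The quadratic term makes the gradient \<open>gp\<close> a proper map and the Hessian
  \<open>hA\<close> definite. Later \<open>\<epsilon>\<close> is so small that it costs at most 1 on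
  the points of \<open>W\<close>.\<close>

definition "phi \<epsilon> x = F x + \<epsilon> / 2 * (\<Sum>i<n. (x i)\<^sup>2)"
definition "gp \<epsilon> i x = gr i x + \<epsilon> * x i"
definition "hA \<epsilon> i j x = H i j x + (if i = j then \<epsilon> else 0)"

lemma phi_dep: "(\<And>i. i < n \<Longrightarrow> x i = y i) \<Longrightarrow> phi \<epsilon> x = phi \<epsilon> y"
  unfolding phi_def using F_dep[of x y] by simp

lemma gr_dep: "(\<And>i. i < n \<Longrightarrow> x i = y i) \<Longrightarrow> gr k x = gr k y"
  unfolding gr_def by (rule E_dep)

lemma H_dep: "(\<And>i. i < n \<Longrightarrow> x i = y i) \<Longrightarrow> H k l x = H k l y"
  unfolding H_def using E_dep[of x y] by simp

lemma cont_phi [continuous_intros]: "continuous_on S (phi \<epsilon>)"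
  unfolding phi_def[abs_def] by (intro continuous_intros)

lemma phi_path:
  assumes "\<And>i. i < n \<Longrightarrow> ((\<lambda>s. X s i) has_real_derivative X' i) (at t)"
  shows "((\<lambda>s. phi \<epsilon> (X s)) has_real_derivative (\<Sum>i<n. gp \<epsilon> i (X t) * X' i)) (at t)"
proof -
  have "((\<lambda>s. \<Sum>i<n. (X s i)\<^sup>2) has_real_derivative (\<Sum>i<n. 2 * (X t i * X' i))) (at t)"
    by (rule DERIV_sum) (use assms in \<open>auto intro!: derivative_eq_intros\<close>)
  from DERIV_add[OF F_path[of X X' t, OF assms] DERIV_cmult[OF this, of "\<epsilon> / 2"]]
  have "((\<lambda>s. phi \<epsilon> (X s)) has_real_derivative (\<Sum>i<n. gr i (X t) * X' i) + \<epsilon> / 2 * (\<Sum>i<n. 2 * (X t i * X' i))) (at t)"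
    unfolding phi_def by simp
  also have "(\<Sum>i<n. gr i (X t) * X' i) + \<epsilon> / 2 * (\<Sum>i<n. 2 * (X t i * X' i)) = (\<Sum>i<n. gp \<epsilon> i (X t) * X' i)"
    unfolding gp_def sum_distrib_left sum.distrib[symmetric] by (intro sum.cong) (auto simp: algebra_simps)
  finally show ?thesis .
qed

lemma phi_gradient:
  assumes "\<epsilon> \<ge> 0"
  shows "phi \<epsilon> w \<ge> phi \<epsilon> x + (\<Sum>i<n. gp \<epsilon> i x * (w i - x i))"
proof -
  have "(\<Sum>i<n. \<epsilon> * x i * (w i - x i)) \<le> (\<Sum>i<n. \<epsilon> / 2 * (w i)\<^sup>2 - \<epsilon> / 2 * (x i)\<^sup>2)"
  proof (rule sum_mono)
    fix i
    have "0 \<le> \<epsilon> / 2 * (w i - x i)\<^sup>2" using assms by simp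
    then show "\<epsilon> * x i * (w i - x i) \<le> \<epsilon> / 2 * (w i)\<^sup>2 - \<epsilon> / 2 * (x i)\<^sup>2"
      by (simp add: power2_eq_square algebra_simps)
  qed
  moreover have "(\<Sum>i<n. gp \<epsilon> i x * (w i - x i)) = (\<Sum>i<n. gr i x * (w i - x i)) + (\<Sum>i<n. \<epsilon> * x i * (w i - x i))"
    unfolding gp_def sum.distrib[symmetric] by (intro sum.cong) (auto simp: algebra_simps)
  ultimately show ?thesis using F_gradient[of x w] unfolding phi_def
    by (simp add: sum_subtractf sum_distrib_left)
qed

lemma gp_rpd: "j < n \<Longrightarrow> has_rpd j (gp \<epsilon> i) (hA \<epsilon> i j)"
  using has_rpd_lin[OF gr_rpd[of j i] has_rpd_coord[of j i], where a=1 and b=\<epsilon>]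
  by (rule has_rpd_eq) (auto simp: gp_def hA_def)

lemma hA_rpd: assumes "l < n" shows "has_rpd l (hA \<epsilon> i j) (T3 i j l)"
  using has_rpd_add[OF H_rpd[OF assms, of i j] has_rpd_indep[of "\<lambda>_. if i = j then \<epsilon> else 0" l]]
  by (rule has_rpd_eq) (auto simp: hA_def)

lemma cont_gp [continuous_intros]: "continuous_on S (gp \<epsilon> i)"
  unfolding gp_def[abs_def] by (intro continuous_intros)

lemma cont_hA [continuous_intros]: "continuous_on S (hA \<epsilon> i j)"
  unfolding hA_def[abs_def] by (intro continuous_intros)

text \<open>All maps on \<open>\<real>\<^bsup>2n\<^esup>\<close> used below are combinations of \<open>x\<^sub>1, x\<^sub>2\<close> and of the gradients \<open>y\<^sub>1, y\<^sub>2\<close> there.\<close>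

definition "Lin \<epsilon> a b c d k p = (a * p k + b * p (n + k)) + (c * gp \<epsilon> k p + d * gp \<epsilon> k (sh n p))"
definition "dLin \<epsilon> a b c d k j p = (if j < n then a * (if k = j then 1 else 0) + c * hA \<epsilon> k j p
   else b * (if k = j - n then 1 else 0) + d * hA \<epsilon> k (j - n) (sh n p))"
definition "ddLin c d k j l p = (if j < n \<and> l < n then c * T3 k j l p
   else if \<not> j < n \<and> \<not> l < n then d * T3 k (j - n) (l - n) (sh n p) else 0)"

lemma gp_indep: "i < n \<Longrightarrow> n \<le> j \<Longrightarrow> gp \<epsilon> i (p(j := t)) = gp \<epsilon> i p"
  unfolding gp_def using gr_dep[of "p(j := t)" p i] by simp

lemma hA_indep: "n \<le> j \<Longrightarrow> hA \<epsilon> i k (p(j := t)) = hA \<epsilon> i k p"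
  unfolding hA_def using H_dep[of "p(j := t)" p i k] by simp

lemma sh_upd_lt: "j < n \<Longrightarrow> sh n (p(j := t)) = sh n p"
  by (auto simp: sh_def)

lemma sh_upd_ge: "n \<le> j \<Longrightarrow> sh n (p(j := t)) = (sh n p)(j - n := t)"
  by (rule ext) (auto simp: sh_def)

lemma Lin_rpd:
  assumes "k < n" "j < n + n"
  shows "has_rpd j (Lin \<epsilon> a b c d k) (dLin \<epsilon> a b c d k j)"
proof (cases "j < n")
  case True
  have "has_rpd j (\<lambda>p. gp \<epsilon> k (sh n p)) (\<lambda>_. 0)"
    by (rule has_rpd_indep) (simp add: sh_upd_lt True)
  from has_rpd_add[OF has_rpd_lin[OF has_rpd_coord[of j k] has_rpd_coord[of j "n + k"], of a b] has_rpd_lin[OF gp_rpd[OF True, of \<epsilon> k] this, of c d]]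
  show ?thesis by (rule has_rpd_eq) (use True in \<open>auto simp: Lin_def dLin_def\<close>)
next
  case False
  then obtain l where l: "j = n + l" "l < n" using assms by (metis add_less_cancel_left le_add_diff_inverse not_less)
  have "has_rpd j (gp \<epsilon> k) (\<lambda>_. 0)"
    by (rule has_rpd_indep) (use gp_indep assms l in simp)
  from has_rpd_add[OF has_rpd_lin[OF has_rpd_coord[of j k] has_rpd_coord[of j "n + k"], of a b]
      has_rpd_lin[OF this has_rpd_shift[OF gp_rpd[OF l(2), of \<epsilon> k], of n, folded l(1)], of c d]]
  show ?thesis by (rule has_rpd_eq) (use l assms in \<open>auto simp: Lin_def dLin_def\<close>)
qed

lemma dLin_rpd:
  assumes "k < n" "j < n + n" "l < n + n"
  shows "has_rpd l (dLin \<epsilon> a b c d k j) (ddLin c d k j l)"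
proof (cases "l < n")
  case l: True
  show ?thesis
  proof (cases "j < n")
    case True
    from has_rpd_lin[OF has_rpd_indep[of "\<lambda>_. if k = j then 1 else 0" l] hA_rpd[OF l, of \<epsilon> k j], of a c]
    show ?thesis by (rule has_rpd_eq) (use l True in \<open>auto simp: dLin_def ddLin_def\<close>)
  next
    case False
    have "has_rpd l (dLin \<epsilon> a b c d k j) (\<lambda>_. 0)"
      by (rule has_rpd_indep) (simp add: dLin_def False sh_upd_lt l)
    then show ?thesis by (rule has_rpd_eq) (use l False in \<open>auto simp: ddLin_def\<close>)
  qed
next
  case l: False
  then obtain l' where l': "l = n + l'" "l' < n" using assms by (metis add_less_cancel_left le_add_diff_inverse not_less)
  show ?thesis
  proof (cases "j < n")
    case True
    have "has_rpd l (dLin \<epsilon> a b c d k j) (\<lambda>_. 0)"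
      by (rule has_rpd_indep) (use l' True hA_indep in \<open>simp add: dLin_def\<close>)
    then show ?thesis by (rule has_rpd_eq) (use l True in \<open>auto simp: ddLin_def\<close>)
  next
    case False
    from has_rpd_lin[OF has_rpd_indep[of "\<lambda>_. if k = j - n then 1 else 0" l]
        has_rpd_shift[OF hA_rpd[OF l'(2), of \<epsilon> k "j - n"], of n, folded l'(1)], of b d]
    show ?thesis by (rule has_rpd_eq) (use l l' False in \<open>auto simp: dLin_def ddLin_def\<close>)
  qed
qed

lemma ddLin_sym: "ddLin c d k j l p = ddLin c d k l j p"
  unfolding ddLin_def using T3_sym[of k j l] T3_sym[of k "j - n" "l - n"] by auto

lemma Lin_indep:
  assumes "k < n" shows "Lin \<epsilon> a b c d k (p(n + n := t)) = Lin \<epsilon> a b c d k p"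
proof -
  have "gp \<epsilon> k (p(n + n := t)) = gp \<epsilon> k p" using assms by (intro gp_indep) auto
  moreover have "gp \<epsilon> k (sh n (p(n + n := t))) = gp \<epsilon> k (sh n p)"
    using assms by (simp add: sh_upd_ge gp_indep del: fun_upd_apply)
  ultimately show ?thesis using assms by (simp add: Lin_def)
qed

lemma dLin_indep: "dLin \<epsilon> a b c d k j (p(n + n := t)) = dLin \<epsilon> a b c d k j p"
  by (simp add: dLin_def sh_upd_ge hA_indep del: fun_upd_apply)

lemma cont_Lin: "continuous_on UNIV (Lin \<epsilon> a b c d k)"
  unfolding Lin_def[abs_def] by (intro continuous_intros continuous_on_comp_sh)

lemma cont_dLin: "continuous_on UNIV (dLin \<epsilon> a b c d k j)"
proof (cases "j < n")
  case True
  then show ?thesis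
    unfolding dLin_def[abs_def] by (simp only: if_True) (intro continuous_intros continuous_on_comp_sh)
next
  case False
  then show ?thesis
    unfolding dLin_def[abs_def] by (simp only: if_False) (intro continuous_intros continuous_on_comp_sh)
qed

lemma cont_ddLin: "continuous_on UNIV (ddLin c d k j l)"
proof -
  consider "j < n" "l < n" | "\<not> j < n" "\<not> l < n" | "(j < n) \<noteq> (l < n)" by blast
  then show ?thesis
    by cases (simp_all add: ddLin_def[abs_def], (intro continuous_intros continuous_on_comp_sh)+)
qed

text \<open>One constant for all coefficients of modulus at most 1, so that it serves both the real
  and the complex substitution.\<close>

lemma Lin_bounds:
  assumes e: "0 \<le> \<epsilon>" "\<epsilon> \<le> 1"
  obtains C where "C \<ge> 1" "\<And>a b c d k p. k < n \<Longrightarrow> \<bar>a\<bar> \<le> 1 \<Longrightarrow> \<bar>b\<bar> \<le> 1 \<Longrightarrow> \<bar>c\<bar> \<le> 1 \<Longrightarrow> \<bar>d\<bar> \<le> 1 \<Longrightarrow>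
      \<bar>Lin \<epsilon> a b c d k p\<bar> \<le> C * (1 + ell1 (n + n) p)"
    "\<And>a b c d k j p. k < n \<Longrightarrow> j < n + n \<Longrightarrow> \<bar>a\<bar> \<le> 1 \<Longrightarrow> \<bar>b\<bar> \<le> 1 \<Longrightarrow> \<bar>c\<bar> \<le> 1 \<Longrightarrow> \<bar>d\<bar> \<le> 1 \<Longrightarrow>
      \<bar>dLin \<epsilon> a b c d k j p\<bar> \<le> C"
    "\<And>c d k j l p. k < n \<Longrightarrow> j < n + n \<Longrightarrow> l < n + n \<Longrightarrow> \<bar>c\<bar> \<le> 1 \<Longrightarrow> \<bar>d\<bar> \<le> 1 \<Longrightarrow> \<bar>ddLin c d k j l p\<bar> \<le> C"
proof -
  obtain M where M0: "M \<ge> 1" "\<forall>v\<in>V. \<forall>i<n. \<bar>v i\<bar> \<le> M" "\<forall>i<n. \<forall>x. \<bar>gr i x\<bar> \<le> M"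
    "\<forall>i<n. \<forall>j<n. \<forall>x. \<bar>H i j x\<bar> \<le> M" "\<forall>i<n. \<forall>j<n. \<forall>l<n. \<forall>x. \<bar>T3 i j l x\<bar> \<le> M"
    using bounded by (elim exE conjE)
  have le1: "\<bar>a * x\<bar> \<le> y" if "\<bar>a\<bar> \<le> 1" "\<bar>x\<bar> \<le> y" for a x y :: real
    using mult_mono[OF that] by (simp add: abs_mult)
  have hA: "\<bar>hA \<epsilon> i j x\<bar> \<le> M + 1" if "i < n" "j < n" for i j x
    using M0(4)[rule_format, OF that, of x] e unfolding hA_def by auto
  have gpb: "\<bar>gp \<epsilon> i x\<bar> \<le> M + \<bar>x i\<bar>" if "i < n" for i x
    using M0(3)[rule_format, OF that, of x] le1[of \<epsilon> "x i" "\<bar>x i\<bar>"] e unfolding gp_def by linarith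
  show ?thesis
  proof (rule that[of "2 * M + 4"])
    show "2 * M + 4 \<ge> 1" using M0 by simp
  next
    fix a b c d :: real and k p assume k: "k < n" and a: "\<bar>a\<bar> \<le> 1" "\<bar>b\<bar> \<le> 1" "\<bar>c\<bar> \<le> 1" "\<bar>d\<bar> \<le> 1"
    have p: "\<bar>p k\<bar> \<le> ell1 (n + n) p" "\<bar>p (n + k)\<bar> \<le> ell1 (n + n) p"
      using k by (auto intro!: coord_le_ell1)
    have "\<bar>a * p k\<bar> \<le> ell1 (n + n) p" "\<bar>b * p (n + k)\<bar> \<le> ell1 (n + n) p" using a p by (auto intro!: le1)
    moreover have "\<bar>c * gp \<epsilon> k p\<bar> \<le> M + \<bar>p k\<bar>" "\<bar>d * gp \<epsilon> k (sh n p)\<bar> \<le> M + \<bar>sh n p k\<bar>"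
      by (intro le1 a gpb k)+
    ultimately have "\<bar>Lin \<epsilon> a b c d k p\<bar> \<le> 2 * M + 4 * ell1 (n + n) p"
      using p unfolding Lin_def by (simp add: sh_def)
    also have "\<dots> \<le> (2 * M + 4) * (1 + ell1 (n + n) p)"
      using M0(1) by (simp add: algebra_simps)
    finally show "\<bar>Lin \<epsilon> a b c d k p\<bar> \<le> (2 * M + 4) * (1 + ell1 (n + n) p)" .
  next
    fix a b c d :: real and k j p assume k: "k < n" "j < n + n" and a: "\<bar>a\<bar> \<le> 1" "\<bar>b\<bar> \<le> 1" "\<bar>c\<bar> \<le> 1" "\<bar>d\<bar> \<le> 1"
    show "\<bar>dLin \<epsilon> a b c d k j p\<bar> \<le> 2 * M + 4"
    proof (cases "j < n")
      case True
      have "\<bar>c * hA \<epsilon> k j p\<bar> \<le> M + 1" by (intro le1 a hA k True)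
      moreover have "\<bar>a * (if k = j then 1 else 0)\<bar> \<le> 1" by (intro le1 a) simp
      ultimately show ?thesis using True M0(1) unfolding dLin_def by (auto simp only: if_True if_False)
    next
      case False
      then have "j - n < n" using k by auto
      then have "\<bar>d * hA \<epsilon> k (j - n) (sh n p)\<bar> \<le> M + 1" by (intro le1 a hA k)
      moreover have "\<bar>b * (if k = j - n then 1 else 0)\<bar> \<le> 1" by (intro le1 a) simp
      ultimately show ?thesis using False M0(1) unfolding dLin_def by (auto simp only: if_True if_False)
    qed
  next
    fix c d :: real and k j l p assume k: "k < n" "j < n + n" "l < n + n" and a: "\<bar>c\<bar> \<le> 1" "\<bar>d\<bar> \<le> 1"
    have T: "\<bar>T3 k i m x\<bar> \<le> M" if "i < n" "m < n" for i m x
      using M0(5)[rule_format, OF k(1) that] .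
    have "\<bar>ddLin c d k j l p\<bar> \<le> M"
      unfolding ddLin_def using k M0(1) by (auto intro!: le1 a T)
    then show "\<bar>ddLin c d k j l p\<bar> \<le> 2 * M + 4" using M0(1) by simp
  qed
qed

end

lemma has_pd_exp:
  assumes "has_pd j f f'" shows "has_pd j (\<lambda>p. exp (f p)) (\<lambda>p. exp (f p) * f' p)"
  unfolding has_pd_def
proof
  fix p
  have "((\<lambda>t. f (p(j := t))) has_vector_derivative f' p) (at (p j))"
    using assms by (simp add: has_pd_def)
  from field_vector_diff_chain_at[OF this DERIV_exp]
  show "((\<lambda>t. exp (f (p(j := t)))) has_vector_derivative exp (f p) * f' p) (at (p j))"
    by (simp add: o_def mult.commute)
qed

lemma has_pd_sum: "(\<And>k. k \<in> I \<Longrightarrow> has_pd j (f k) (f' k)) \<Longrightarrow> has_pd j (\<lambda>p. \<Sum>k\<in>I. f k p) (\<lambda>p. \<Sum>k\<in>I. f' k p)"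
  unfolding has_pd_def by (auto intro!: has_vector_derivative_sum)

lemma has_pd_cmult: "has_pd j f f' \<Longrightarrow> has_pd j (\<lambda>p. a * f p) (\<lambda>p. a * f' p)"
  unfolding has_pd_def by (auto intro!: has_vector_derivative_mult_right)

lemma has_pd_homotopy:
  fixes B :: "(nat \<Rightarrow> real) \<Rightarrow> complex"
  assumes "\<And>j. j < N \<Longrightarrow> has_pd j B (b j)" "\<And>p t. B (p(N := t)) = B p" "k < N" "j \<le> N"
  shows "has_pd j (\<lambda>p. (1 - complex_of_real (p N)) * complex_of_real (p k) + complex_of_real (p N) * B p)
    (\<lambda>p. if j < N then (1 - complex_of_real (p N)) * (if k = j then 1 else 0) + complex_of_real (p N) * b j p
       else B p - complex_of_real (p k))"
proof -
  have s1: "has_pd j (\<lambda>p. complex_of_real (p N)) (\<lambda>p. if N = j then 1 else 0)" by (rule has_pd_coord)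
  have b: "has_pd j B (\<lambda>p. if j < N then b j p else 0)"
    using assms by (cases "j < N") (auto intro: has_pd_indep simp del: fun_upd_apply)
  show ?thesis
    by (rule has_pd_eq[OF has_pd_add[OF has_pd_mult[OF has_pd_diff[OF has_pd_const[of _ 1] s1] has_pd_coord[of j k]] has_pd_mult[OF s1 b]]])
       (use assms in \<open>auto simp: algebra_simps\<close>)
qed

lemma integral_gauss: "(\<integral>x. exp (- (\<Sum>k<n. (x k)\<^sup>2) / 2) \<partial>leb n) = sqrt (2 * pi) ^ n"
  and integrable_gauss: "integrable (leb n) (\<lambda>x. exp (- (\<Sum>k<n. (x k)\<^sup>2) / 2))"
proof -
  have e: "(\<Sum>j\<le>i. (if i = j then 1 else 0) * x j) = x i" for i :: nat and x :: "nat \<Rightarrow> real"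
    by (simp add: if_distrib[of "\<lambda>u. u * _"] cong: if_cong)
  have "(\<integral>\<^sup>+x. ennreal (exp (- (\<Sum>k<n. (x k)\<^sup>2) / 2)) \<partial>leb n) = ennreal (\<Prod>i<n. sqrt (2 * pi) / 1)"
    using nn_integral_gauss_triangular[of n "\<lambda>i j. if i = j then 1 else 0"] unfolding e by simp
  then have n: "(\<integral>\<^sup>+x. ennreal (exp (- (\<Sum>k<n. (x k)\<^sup>2) / 2)) \<partial>leb n) = ennreal (sqrt (2 * pi) ^ n)"
    by simp
  have m: "(\<lambda>x. exp (- (\<Sum>k<n. (x k)\<^sup>2) / 2)) \<in> borel_measurable (leb n)" by measurable
  show "integrable (leb n) (\<lambda>x. exp (- (\<Sum>k<n. (x k)\<^sup>2) / 2))"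
    using m n by (intro integrableI_nonneg) auto
  show "(\<integral>x. exp (- (\<Sum>k<n. (x k)\<^sup>2) / 2) \<partial>leb n) = sqrt (2 * pi) ^ n"
    using m n by (subst integral_eq_nn_integral) auto
qed

section \<open>The real substitution and its proper deformation\<close>

context lse begin

context
  fixes \<epsilon> :: real
  assumes sym: "\<And>v. v \<in> V \<Longrightarrow> (\<lambda>i. - v i) \<in> V" and e: "0 < \<epsilon>" "\<epsilon> \<le> 1"
begin

lemma Z_even: "Z (\<lambda>i. - x i) = Z x"
  unfolding Z_def
  by (rule sum.reindex_bij_witness[of _ "\<lambda>v i. - v i" "\<lambda>v i. - v i"])
     (auto simp: sym dot_def)

lemma F_even: "F (\<lambda>i. - x i) = F x"
  by (simp add: F_def Z_even)

lemma phi_even: "phi \<epsilon> (\<lambda>i. - x i) = phi \<epsilon> x"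
  by (simp add: phi_def F_even)

lemma F_zero: "F (\<lambda>_. 0) = 0"
  using card_pos by (simp add: F_def Z_def)

text \<open>The gradient inequalities at 0 for \<open>x\<close> and for \<open>- x\<close> have
  opposite linear terms, while \<open>F\<close> takes the same value at both points.\<close>

lemma F_nonneg: "F x \<ge> 0"
proof -
  have "F x \<ge> F (\<lambda>_. 0) + (\<Sum>i<n. gr i (\<lambda>_. 0) * (x i - 0))" by (rule F_gradient)
  moreover have "F (\<lambda>i. - x i) \<ge> F (\<lambda>_. 0) + (\<Sum>i<n. gr i (\<lambda>_. 0) * (- x i - 0))" by (rule F_gradient)
  ultimately show ?thesis by (simp add: F_zero F_even sum_negf)
qed

lemma gr_dot_nonneg: "(\<Sum>i<n. gr i x * x i) \<ge> 0"
  using F_gradient[of x "\<lambda>_. 0"] F_nonneg[of x] by (simp add: F_zero sum_negf)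

lemma exp_phi_bound:
  assumes "a \<ge> 0"
  shows "exp (- phi \<epsilon> z) \<le> exp (real n * (a\<^sup>2 / (2 * \<epsilon>))) * exp (- a * ell1 n z)"
proof -
  have "exp (- phi \<epsilon> z) \<le> exp (- (\<epsilon> / 2) * (\<Sum>i<n. (z i)\<^sup>2))"
    using F_nonneg[of z] by (simp add: phi_def)
  also have "\<dots> \<le> exp (real n * (a\<^sup>2 / (2 * \<epsilon>))) * exp (- a * ell1 n z)"
    using e assms by (intro quad_exp_bound) auto
  finally show ?thesis .
qed

definition "bT k j p = (if k < n then dLin \<epsilon> (1/2) (1/2) 0 0 k j p else dLin \<epsilon> 0 0 (- 1/2) (1/2) (k - n) j p)"
definition "BT k p = (if k < n then Lin \<epsilon> (1/2) (1/2) 0 0 k p else Lin \<epsilon> 0 0 (- 1/2) (1/2) (k - n) p)"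
definition "bbT k j l p = (if k < n then ddLin 0 0 k j l p else ddLin (- 1/2) (1/2) (k - n) j l p)"

lemma bT_MT: "k < n + n \<Longrightarrow> j < n + n \<Longrightarrow> bT k j p = MT n (\<lambda>i j. hA \<epsilon> i j p) (\<lambda>i j. hA \<epsilon> i j (sh n p)) k j"
  by (auto simp: bT_def dLin_def MT_def blk_def idm_def)

text \<open>For each \<open>k\<close> the deformed pair is, up to a bounded term \<open>r\<close>, a
  2 by 2 linear image of \<open>p k\<close> and \<open>p (n + k)\<close>. Its determinant
  \<open>D\<close> is at least \<open>\<epsilon> / 4\<close>, and Cramer's rule inverts it; adding
  the bounds for both unknowns leaves \<open>\<epsilon> / 8\<close>.\<close>

lemma coercive_T:
  obtains M where "M \<ge> 0"
    "\<And>s p. 0 \<le> s \<Longrightarrow> s \<le> 1 \<Longrightarrow> \<epsilon> / 8 * ell1 (n + n) p - M \<le> ell1 (n + n) (\<lambda>k. (1 - s) * p k + s * BT k p)"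
proof -
  obtain M where M0: "M \<ge> 1" "\<forall>v\<in>V. \<forall>i<n. \<bar>v i\<bar> \<le> M" "\<forall>i<n. \<forall>x. \<bar>gr i x\<bar> \<le> M"
    "\<forall>i<n. \<forall>j<n. \<forall>x. \<bar>H i j x\<bar> \<le> M" "\<forall>i<n. \<forall>j<n. \<forall>l<n. \<forall>x. \<bar>T3 i j l x\<bar> \<le> M"
    using bounded by (elim exE conjE)
  have key: "\<epsilon> / 8 * (\<bar>p k\<bar> + \<bar>p (n + k)\<bar>) - M \<le> \<bar>(1 - s) * p k + s * BT k p\<bar> + \<bar>(1 - s) * p (n + k) + s * BT (n + k) p\<bar>"
    if s: "0 \<le> s" "s \<le> 1" and k: "k < n" for s p k
  proof -
    define \<beta> where "\<beta> = s / 2"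
    define \<alpha> where "\<alpha> = 1 - \<beta>"
    define \<tau> where "\<tau> = 1 - s + \<beta> * \<epsilon>"
    define r where "r = \<beta> * (gr k (sh n p) - gr k p)"
    define X where "X = (1 - s) * p k + s * BT k p"
    define Y where "Y = (1 - s) * p (n + k) + s * BT (n + k) p"
    have X: "X = \<alpha> * p k + \<beta> * p (n + k)"
      using k by (simp add: X_def BT_def Lin_def \<alpha>_def \<beta>_def field_simps)
    have Y: "Y - r = \<tau> * p (n + k) - \<beta> * \<epsilon> * p k"
      by (simp add: Y_def BT_def Lin_def gp_def sh_def \<tau>_def \<beta>_def r_def field_simps)
    have b: "0 \<le> \<beta>" "\<beta> \<le> 1 / 2" and a: "1 / 2 \<le> \<alpha>" "\<alpha> \<le> 1" using s by (auto simp: \<alpha>_def \<beta>_def)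
    have be: "0 \<le> \<beta> * \<epsilon>" "\<beta> * \<epsilon> \<le> 1" using b e mult_mono[of \<beta> 1 \<epsilon> 1] by auto
    have "(1 - s) * (\<epsilon> / 2) \<le> (1 - s) * 1" using s e by (intro mult_left_mono) auto
    then have t: "\<epsilon> / 2 \<le> \<tau>" by (simp add: \<tau>_def \<beta>_def field_simps)
    have t1: "\<tau> \<le> 1"
      using mult_left_mono[of \<epsilon> 2 s] s e by (simp add: \<tau>_def \<beta>_def)
    define D where "D = \<alpha> * \<tau> + \<beta> * (\<beta> * \<epsilon>)"
    have "(1 / 2) * (\<epsilon> / 2) \<le> \<alpha> * \<tau>" using a t e by (intro mult_mono) auto
    moreover have "0 \<le> \<beta> * (\<beta> * \<epsilon>)" using b be by simp
    ultimately have D: "\<epsilon> / 4 \<le> D" by (simp add: D_def)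
    have le1: "\<bar>c * x\<bar> \<le> \<bar>x\<bar>" if "0 \<le> c" "c \<le> 1" for c x :: real
      using that mult_right_mono[of c 1 "\<bar>x\<bar>"] by (simp add: abs_mult)
    have r: "\<bar>r\<bar> \<le> M"
    proof -
      have "\<bar>gr k (sh n p) - gr k p\<bar> \<le> 2 * M"
        using M0(3)[rule_format, OF k, of p] M0(3)[rule_format, OF k, of "sh n p"] by linarith
      then have "\<bar>\<beta>\<bar> * \<bar>gr k (sh n p) - gr k p\<bar> \<le> (1 / 2) * (2 * M)"
        using b by (intro mult_mono) auto
      then show ?thesis by (simp add: r_def abs_mult)
    qed
    have d1: "D * p k = \<tau> * X - \<beta> * (Y - r)" unfolding X Y D_def by (simp add: algebra_simps)
    have d2: "D * p (n + k) = (\<beta> * \<epsilon>) * X + \<alpha> * (Y - r)" unfolding X Y D_def by (simp add: algebra_simps)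
    have "D * \<bar>p k\<bar> \<le> \<bar>X\<bar> + \<bar>Y - r\<bar>"
    proof -
      have "D * \<bar>p k\<bar> = \<bar>\<tau> * X - \<beta> * (Y - r)\<bar>" using d1 D e by (simp add: abs_mult flip: d1)
      then show ?thesis using le1[of \<tau> X] le1[of \<beta> "Y - r"] t t1 b e by linarith
    qed
    moreover have "D * \<bar>p (n + k)\<bar> \<le> \<bar>X\<bar> + \<bar>Y - r\<bar>"
    proof -
      have "D * \<bar>p (n + k)\<bar> = \<bar>(\<beta> * \<epsilon>) * X + \<alpha> * (Y - r)\<bar>" using d2 D e by (simp add: abs_mult flip: d2)
      then show ?thesis using le1[of "\<beta> * \<epsilon>" X] le1[of \<alpha> "Y - r"] be a by linarith
    qed
    moreover have "\<epsilon> / 4 * (\<bar>p k\<bar> + \<bar>p (n + k)\<bar>) \<le> D * (\<bar>p k\<bar> + \<bar>p (n + k)\<bar>)"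
      using D by (intro mult_right_mono) auto
    moreover have "\<bar>Y - r\<bar> \<le> \<bar>Y\<bar> + M" using r by linarith
    ultimately have "\<epsilon> / 4 * (\<bar>p k\<bar> + \<bar>p (n + k)\<bar>) \<le> 2 * (\<bar>X\<bar> + \<bar>Y\<bar> + M)"
      by (simp add: ring_distribs)
    then show ?thesis unfolding X_def[symmetric] Y_def[symmetric] by simp
  qed
  show ?thesis
  proof (rule that[of "real n * M"])
    show "real n * M \<ge> 0" using M0(1) by simp
    fix s p assume s: "0 \<le> s" "s \<le> (1::real)"
    have "(\<Sum>k<n. \<epsilon> / 8 * (\<bar>p k\<bar> + \<bar>p (n + k)\<bar>) - M)
       \<le> (\<Sum>k<n. \<bar>(1 - s) * p k + s * BT k p\<bar> + \<bar>(1 - s) * p (n + k) + s * BT (n + k) p\<bar>)"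
      by (intro sum_mono key s) auto
    then show "\<epsilon> / 8 * ell1 (n + n) p - real n * M \<le> ell1 (n + n) (\<lambda>k. (1 - s) * p k + s * BT k p)"
      unfolding ell1_def sum_double
      by (simp only: sum_subtractf sum.distrib sum_distrib_left[symmetric] sum_constant card_lessThan)
  qed
qed

text \<open>The integrand on the right is a product of functions of the two halves of the
  coordinates, so the integral will become a product of two volumes.\<close>

lemma integral_T:
  assumes "lse W" and span: "\<And>y. \<exists>w\<in>W. c * ell1 n y \<le> dot n w y" and c: "c > 0"
  defines "g \<equiv> \<lambda>z. exp (- phi \<epsilon> z) * lse.k0 n W (sh n z)"
  shows "(\<integral>p. g (\<lambda>k. BT k p) * ldet (n + n) (\<lambda>k j. bT k j p) \<partial>leb (n + n)) = (\<integral>p. g p \<partial>leb (n + n))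
    \<and> integrable (leb (n + n)) (\<lambda>p. g (\<lambda>k. BT k p) * ldet (n + n) (\<lambda>k j. bT k j p))"
proof -
  interpret W: lse n W by (rule assms(1))
  obtain K where K0: "K \<ge> 1" "\<forall>v\<in>W. \<forall>i<n. \<bar>v i\<bar> \<le> K" "\<forall>i<n. \<forall>x. \<bar>W.gr i x\<bar> \<le> K"
    using W.bounded by (elim exE conjE)
  obtain M where M0: "M \<ge> 1" "\<forall>v\<in>V. \<forall>i<n. \<bar>v i\<bar> \<le> M" "\<forall>i<n. \<forall>x. \<bar>gr i x\<bar> \<le> M"
    using bounded by (elim exE conjE)
  obtain C where C: "C \<ge> 1" "\<And>a b c d k p. k < n \<Longrightarrow> \<bar>a\<bar> \<le> 1 \<Longrightarrow> \<bar>b\<bar> \<le> 1 \<Longrightarrow> \<bar>c\<bar> \<le> 1 \<Longrightarrow> \<bar>d\<bar> \<le> 1 \<Longrightarrow>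
      \<bar>Lin \<epsilon> a b c d k p\<bar> \<le> C * (1 + ell1 (n + n) p)"
    "\<And>a b c d k j p. k < n \<Longrightarrow> j < n + n \<Longrightarrow> \<bar>a\<bar> \<le> 1 \<Longrightarrow> \<bar>b\<bar> \<le> 1 \<Longrightarrow> \<bar>c\<bar> \<le> 1 \<Longrightarrow> \<bar>d\<bar> \<le> 1 \<Longrightarrow>
      \<bar>dLin \<epsilon> a b c d k j p\<bar> \<le> C"
    "\<And>c d k j l p. k < n \<Longrightarrow> j < n + n \<Longrightarrow> l < n + n \<Longrightarrow> \<bar>c\<bar> \<le> 1 \<Longrightarrow> \<bar>d\<bar> \<le> 1 \<Longrightarrow> \<bar>ddLin c d k j l p\<bar> \<le> C"
    by (rule Lin_bounds[OF less_imp_le[OF e(1)] e(2)]) (assumption | rule)+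
  obtain L where L: "L \<ge> 0"
    "\<And>s p. 0 \<le> s \<Longrightarrow> s \<le> 1 \<Longrightarrow> \<epsilon> / 8 * ell1 (n + n) p - L \<le> ell1 (n + n) (\<lambda>k. (1 - s) * p k + s * BT k p)"
    using coercive_T by metis
  \<comment> \<open>Decay at the rate \<open>c + 1\<close> in the first half leaves a factor
    \<open>exp (- ell1 n z)\<close> to absorb the linear growth of \<open>gp\<close>.\<close>
  define E0 where "E0 = exp (real n * ((c + 1)\<^sup>2 / (2 * \<epsilon>)))"
  define A where "A = E0 * real (card W) * (M + K + 1)"
  have E0: "E0 > 0" by (simp add: E0_def)
  have kb: "W.k0 y \<le> real (card W) * exp (- c * ell1 n y)" for y
    using span[of y] W.k0_bound[of _ "c * ell1 n y" y] by auto
  have g0: "g z > 0" for z unfolding g_def using W.k0_pos by simp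
  have gb: "g z * (1 + ell1 n z) \<le> E0 * real (card W) * exp (- c * ell1 (n + n) z)" for z
  proof -
    have "g z \<le> (E0 * exp (- (c + 1) * ell1 n z)) * (real (card W) * exp (- c * ell1 n (sh n z)))"
      unfolding g_def E0_def using exp_phi_bound[of "c + 1" z] kb[of "sh n z"] c W.k0_pos[of "sh n z"]
      by (intro mult_mono) auto
    moreover have "1 + ell1 n z \<le> exp (ell1 n z)" by (rule exp_ge_add_one_self)
    ultimately have "g z * (1 + ell1 n z) \<le> (E0 * exp (- (c + 1) * ell1 n z)) * (real (card W) * exp (- c * ell1 n (sh n z))) * exp (ell1 n z)"
      using E0 by (intro mult_mono) auto
    also have "\<dots> = E0 * real (card W) * (exp (- (c + 1) * ell1 n z) * exp (- c * ell1 n (sh n z)) * exp (ell1 n z))"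
      by (simp only: mult_ac)
    also have "exp (- (c + 1) * ell1 n z) * exp (- c * ell1 n (sh n z)) * exp (ell1 n z) = exp (- c * ell1 (n + n) z)"
      by (simp add: ell1_double algebra_simps flip: exp_add)
    finally show ?thesis .
  qed
  have gA: "\<bar>g z * u\<bar> \<le> A * exp (- c * ell1 (n + n) z)" if u: "\<bar>u\<bar> \<le> (M + K + 1) * (1 + ell1 n z)" for z u
  proof -
    have "\<bar>g z * u\<bar> = g z * \<bar>u\<bar>" using g0[of z] by (simp add: abs_mult)
    also have "\<dots> \<le> g z * ((M + K + 1) * (1 + ell1 n z))" using u g0[of z] by (intro mult_left_mono) auto
    also have "\<dots> = (M + K + 1) * (g z * (1 + ell1 n z))" by (simp only: mult_ac)
    also have "\<dots> \<le> (M + K + 1) * (E0 * real (card W) * exp (- c * ell1 (n + n) z))"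
      using gb M0(1) K0(1) by (intro mult_left_mono) auto
    finally show ?thesis by (simp add: A_def mult_ac)
  qed
  define g' where "g' l z = (if l < n then g z * - gp \<epsilon> l z else g z * - W.gr (l - n) (sh n z))" for l z
  have big: "1 \<le> (M + K + 1) * (1 + ell1 n z)" "K \<le> (M + K + 1) * (1 + ell1 n z)" "M + ell1 n z \<le> (M + K + 1) * (1 + ell1 n z)" for z
  proof -
    have "0 \<le> M * ell1 n z" "0 \<le> K * ell1 n z" using M0(1) K0(1) by auto
    then show "1 \<le> (M + K + 1) * (1 + ell1 n z)" "K \<le> (M + K + 1) * (1 + ell1 n z)" "M + ell1 n z \<le> (M + K + 1) * (1 + ell1 n z)"
      using M0(1) K0(1) ell1_nonneg[of n z] by (simp_all add: algebra_simps)
  qed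
  show ?thesis
  proof (rule homotopy_real[where g=g and g'=g' and B=BT and b=bT and bb=bbT and C=C and A=A and c=c and a="\<epsilon> / 8" and M=L])
    fix k j l assume kj: "k < n + n" "j < n + n"
    show "has_rpd j (BT k) (bT k j)"
      by (cases "k < n") (use kj Lin_rpd in \<open>auto simp: BT_def[abs_def] bT_def[abs_def]\<close>)
    show "continuous_on UNIV (bT k j)"
      unfolding bT_def[abs_def] by (cases "k < n") (use cont_dLin in auto)
    show "bT k j (p(n + n := t)) = bT k j p" for p t
      by (simp add: bT_def dLin_indep del: fun_upd_apply)
    show "\<bar>bT k j p\<bar> \<le> C" for p
      unfolding bT_def using kj by (auto intro!: C(3))
    assume l: "l < n + n"
    show "has_rpd l (bT k j) (bbT k j l)"
      by (cases "k < n") (use kj l dLin_rpd in \<open>auto simp: bbT_def[abs_def] bT_def[abs_def]\<close>)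
    show "bbT k j l p = bbT k l j p" for p
      unfolding bbT_def using ddLin_sym by simp
    show "continuous_on UNIV (bbT k j l)"
      unfolding bbT_def[abs_def] by (cases "k < n") (use cont_ddLin in auto)
    show "\<bar>bbT k j l p\<bar> \<le> C" for p
      unfolding bbT_def using kj l by (auto intro!: C(4))
  next
    fix k assume k: "k < n + n"
    show "BT k (p(n + n := t)) = BT k p" for p t
      unfolding BT_def using Lin_indep[of k] Lin_indep[of "k - n"] k by (auto simp del: fun_upd_apply)
    show "continuous_on UNIV (BT k)"
      unfolding BT_def[abs_def] by (cases "k < n") (use cont_Lin in auto)
    show "\<bar>BT k p\<bar> \<le> C * (1 + ell1 (n + n) p)" for p
      unfolding BT_def using k by (auto intro!: C(2))
    show "continuous_on UNIV (g' k)"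
      unfolding g'_def[abs_def] g_def
      by (cases "k < n"; simp; intro continuous_intros continuous_on_comp_sh W.cont_k0 W.cont_gr)
    show "\<bar>g' k z\<bar> \<le> A * exp (- c * ell1 (n + n) z)" for z
    proof (cases "k < n")
      case True
      have "\<bar>\<epsilon> * z k\<bar> \<le> 1 * ell1 n z"
        unfolding abs_mult using e coord_le_ell1[OF True, of z] by (intro mult_mono) auto
      then have "\<bar>- gp \<epsilon> k z\<bar> \<le> M + ell1 n z"
        using M0(3)[rule_format, OF True, of z] unfolding gp_def by linarith
      then show ?thesis unfolding g'_def using True big(3)[of z] by (simp only: if_True) (rule gA, linarith)
    next
      case False
      then have "\<bar>- W.gr (k - n) (sh n z)\<bar> \<le> K"
        using K0(3)[rule_format, of "k - n" "sh n z"] k by auto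
      then show ?thesis unfolding g'_def using False big(2)[of z] by (simp only: if_False) (rule gA, linarith)
    qed
  next
    show "continuous_on UNIV g"
      unfolding g_def by (intro continuous_intros continuous_on_comp_sh W.cont_k0)
    show "\<bar>g z\<bar> \<le> A * exp (- c * ell1 (n + n) z)" for z
      using gA[of 1 z] big(1)[of z] by simp
  next
    fix y z :: "nat \<Rightarrow> real" assume yz: "\<And>i. i < n + n \<Longrightarrow> y i = z i"
    have "phi \<epsilon> y = phi \<epsilon> z" using yz by (intro phi_dep) auto
    moreover have "W.k0 (sh n y) = W.k0 (sh n z)" using yz by (intro W.k0_dep) (auto simp: sh_def)
    ultimately show "g y = g z" by (simp add: g_def)
  next
    fix X :: "real \<Rightarrow> nat \<Rightarrow> real" and X' t
    assume X: "\<And>l. l < n + n \<Longrightarrow> ((\<lambda>s. X s l) has_real_derivative X' l) (at t)"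
    have 1: "((\<lambda>s. exp (- phi \<epsilon> (X s))) has_real_derivative exp (- phi \<epsilon> (X t)) * - (\<Sum>i<n. gp \<epsilon> i (X t) * X' i)) (at t)"
      by (intro DERIV_fun_exp DERIV_minus phi_path X) simp
    have 2: "((\<lambda>s. W.k0 (sh n (X s))) has_real_derivative
        (\<Sum>i<n. (- W.k0 (sh n (X t)) * W.gr i (sh n (X t))) * X' (n + i))) (at t)"
      by (rule W.k0_path) (simp add: sh_def X)
    have "(\<Sum>l<n + n. g' l (X t) * X' l)
       = exp (- phi \<epsilon> (X t)) * - (\<Sum>i<n. gp \<epsilon> i (X t) * X' i) * W.k0 (sh n (X t))
       + (\<Sum>i<n. (- W.k0 (sh n (X t)) * W.gr i (sh n (X t))) * X' (n + i)) * exp (- phi \<epsilon> (X t))"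
      unfolding sum_double sum_negf[symmetric] sum_distrib_left sum_distrib_right
      by (intro arg_cong2[where f="(+)"] sum.cong) (auto simp: g'_def g_def)
    with DERIV_mult[OF 1 2] show "((\<lambda>s. g (X s)) has_real_derivative (\<Sum>l<n + n. g' l (X t) * X' l)) (at t)"
      by (simp add: g_def)
  next
    fix s :: real and p :: "nat \<Rightarrow> real" assume "0 \<le> s" "s \<le> 1"
    then show "\<epsilon> / 8 * ell1 (n + n) p - L \<le> ell1 (n + n) (\<lambda>k. (1 - s) * p k + s * BT k p)" by (rule L(2))
  next
    show "0 \<le> A" using E0 M0(1) K0(1) by (simp add: A_def)
  qed (use C(1) c e in auto)
qed

end

end

lemma lse_integrable_k0:
  assumes "lse W" and span: "\<And>y. \<exists>w\<in>W. c * ell1 n y \<le> dot n w y" and c: "c > 0"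
  shows "integrable (leb n) (lse.k0 n W)"
proof -
  interpret W: lse n W by (rule assms(1))
  have kb: "W.k0 y \<le> real (card W) * exp (- c * ell1 n y)" for y
    using span[of y] W.k0_bound[of _ "c * ell1 n y" y] by auto
  show ?thesis
  proof (rule Bochner_Integration.integrable_bound[OF integrable_leb_exp[OF c, of n "real (card W)"]])
    show "W.k0 \<in> borel_measurable (leb n)"
      using continuous_imp_borel_fun[OF W.cont_k0] by (simp add: measurable_cong_sets[OF sets_leb refl])
    show "AE x in leb n. norm (W.k0 x) \<le> norm (real (card W) * exp (- c * ell1 n x))"
      using kb W.k0_pos by (intro AE_I2) (simp add: less_imp_le)
  qed
qed

section \<open>The complex substitution\<close>

context lse begin

definition "BU \<epsilon> k p = (if k < n then complex_of_real (Lin \<epsilon> (1/2) 0 (1/2) 0 k p) + \<i> * complex_of_real (Lin \<epsilon> 0 (- 1/2) 0 (1/2) k p)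
   else complex_of_real (Lin \<epsilon> 0 (1/2) 0 (1/2) (k - n) p) + \<i> * complex_of_real (Lin \<epsilon> (1/2) 0 (- 1/2) 0 (k - n) p))"
definition "bU \<epsilon> k j p = (if k < n then complex_of_real (dLin \<epsilon> (1/2) 0 (1/2) 0 k j p) + \<i> * complex_of_real (dLin \<epsilon> 0 (- 1/2) 0 (1/2) k j p)
   else complex_of_real (dLin \<epsilon> 0 (1/2) 0 (1/2) (k - n) j p) + \<i> * complex_of_real (dLin \<epsilon> (1/2) 0 (- 1/2) 0 (k - n) j p))"
definition "bbU k j l p = (if k < n then complex_of_real (ddLin (1/2) 0 k j l p) + \<i> * complex_of_real (ddLin 0 (1/2) k j l p)
   else complex_of_real (ddLin 0 (1/2) (k - n) j l p) + \<i> * complex_of_real (ddLin (- 1/2) 0 (k - n) j l p))"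

context
  fixes \<epsilon> :: real
  assumes sym: "\<And>v. v \<in> V \<Longrightarrow> (\<lambda>i. - v i) \<in> V" and e: "0 < \<epsilon>" "\<epsilon> \<le> 1"
begin

lemma bU_MU: "k < n + n \<Longrightarrow> j < n + n \<Longrightarrow>
    bU \<epsilon> k j p = MU n (\<lambda>i j. of_real (hA \<epsilon> i j p)) (\<lambda>i j. of_real (hA \<epsilon> i j (sh n p))) k j"
proof (cases "k < n"; cases "j < n")
  assume a: "k < n + n" "j < n + n" "k < n" "j < n"
  then show ?thesis by (simp add: bU_def dLin_def MU_def blk_def idm_def add_divide_distrib)
next
  assume a: "k < n + n" "j < n + n" "k < n" "\<not> j < n"
  then show ?thesis by (simp add: bU_def dLin_def MU_def blk_def idm_def diff_divide_distrib right_diff_distrib)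
next
  assume a: "k < n + n" "j < n + n" "\<not> k < n" "j < n"
  then show ?thesis by (simp add: bU_def dLin_def MU_def blk_def idm_def diff_divide_distrib right_diff_distrib)
next
  assume a: "k < n + n" "j < n + n" "\<not> k < n" "\<not> j < n"
  then show ?thesis by (simp add: bU_def dLin_def MU_def blk_def idm_def add_divide_distrib)
qed

text \<open>The squared real part of \<open>P k\<close> is combined with the squared imaginary part
  of \<open>P (n + k)\<close>, and conversely. Each such difference of squares factors into a
  coordinate and its deformed gradient. At \<open>s = 1\<close> the complex Gaussian thus has the
  modulus \<open>exp (- S p / 2)\<close>.\<close>

lemma Re_square_sum:
  fixes p s
  defines "P \<equiv> \<lambda>k. (1 - complex_of_real s) * complex_of_real (p k) + complex_of_real s * BU \<epsilon> k p"
  shows "Re (\<Sum>k<n + n. (P k)\<^sup>2) = (\<Sum>k<n. p k * ((1 - s) * p k + s * gp \<epsilon> k p)) + (\<Sum>k<n. sh n p k * ((1 - s) * sh n p k + s * gp \<epsilon> k (sh n p)))"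
proof -
  have "Re ((P k)\<^sup>2) + Re ((P (n + k))\<^sup>2) = p k * ((1 - s) * p k + s * gp \<epsilon> k p) + sh n p k * ((1 - s) * sh n p k + s * gp \<epsilon> k (sh n p))"
    if "k < n" for k
  proof -
    define a b y1 y2 where "a = p k" and "b = p (n + k)" and "y1 = gp \<epsilon> k p" and "y2 = gp \<epsilon> k (sh n p)"
    have "Re (P k) = (1 - s) * a + s * (a / 2 + y1 / 2)" "Im (P k) = s * (- b / 2 + y2 / 2)"
      "Re (P (n + k)) = (1 - s) * b + s * (b / 2 + y2 / 2)" "Im (P (n + k)) = s * (a / 2 - y1 / 2)"
      using that by (simp_all add: P_def BU_def Lin_def a_def b_def y1_def y2_def)
    then have "Re ((P k)\<^sup>2) + Re ((P (n + k))\<^sup>2) = (((1 - s) * a + s * (a / 2 + y1 / 2))\<^sup>2 - (s * (a / 2 - y1 / 2))\<^sup>2)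
        + (((1 - s) * b + s * (b / 2 + y2 / 2))\<^sup>2 - (s * (- b / 2 + y2 / 2))\<^sup>2)"
      by (simp only: Re_power2)
    also have "((1 - s) * a + s * (a / 2 + y1 / 2))\<^sup>2 - (s * (a / 2 - y1 / 2))\<^sup>2 = a * ((1 - s) * a + s * y1)"
      unfolding power2_eq_square square_diff_square_factored by (intro arg_cong2[where f="(*)"]) (simp_all add: field_simps)
    also have "((1 - s) * b + s * (b / 2 + y2 / 2))\<^sup>2 - (s * (- b / 2 + y2 / 2))\<^sup>2 = ((1 - s) * b + s * y2) * b"
      unfolding power2_eq_square square_diff_square_factored by (intro arg_cong2[where f="(*)"]) (simp_all add: field_simps)
    finally show ?thesis by (simp add: a_def b_def y1_def y2_def sh_def mult.commute)
  qed
  note eq = this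
  have "Re (\<Sum>k<n + n. (P k)\<^sup>2) = (\<Sum>k<n. Re ((P k)\<^sup>2)) + (\<Sum>k<n. Re ((P (n + k))\<^sup>2))"
    unfolding sum_double by (simp only: plus_complex.sel Re_sum)
  also have "\<dots> = (\<Sum>k<n. p k * ((1 - s) * p k + s * gp \<epsilon> k p) + sh n p k * ((1 - s) * sh n p k + s * gp \<epsilon> k (sh n p)))"
    unfolding sum.distrib[symmetric] by (rule sum.cong[OF refl]) (simp only: eq lessThan_iff)
  finally show ?thesis by (simp only: sum.distrib)
qed

text \<open>By convexity and symmetry \<open>gr\<close> pairs nonnegatively with \<open>x\<close>,
  so the exponent has a quadratic lower bound that is uniform in the time \<open>s\<close>.\<close>

lemma y_dot_lower:
  assumes "0 \<le> s" "s \<le> 1"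
  shows "\<epsilon> * (\<Sum>k<n. (x k)\<^sup>2) \<le> (\<Sum>k<n. x k * ((1 - s) * x k + s * gp \<epsilon> k x))"
proof -
  have "(\<Sum>k<n. x k * ((1 - s) * x k + s * gp \<epsilon> k x)) = (1 - s + s * \<epsilon>) * (\<Sum>k<n. (x k)\<^sup>2) + s * (\<Sum>k<n. gr k x * x k)"
    unfolding sum_distrib_left sum.distrib[symmetric]
    by (intro sum.cong) (auto simp: gp_def power2_eq_square algebra_simps)
  moreover have "s * (\<Sum>k<n. gr k x * x k) \<ge> 0" using assms gr_dot_nonneg[OF sym e] by (intro mult_nonneg_nonneg) auto
  moreover have "\<epsilon> \<le> 1 - s + s * \<epsilon>"
    using mult_right_mono[of s 1 "1 - \<epsilon>"] assms e by (simp add: algebra_simps)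
  then have "\<epsilon> * (\<Sum>k<n. (x k)\<^sup>2) \<le> (1 - s + s * \<epsilon>) * (\<Sum>k<n. (x k)\<^sup>2)"
    by (intro mult_right_mono sum_nonneg) auto
  ultimately show ?thesis by linarith
qed

definition "S p = (\<Sum>k<n. p k * gp \<epsilon> k p) + (\<Sum>k<n. sh n p k * gp \<epsilon> k (sh n p))"

text \<open>\<open>Q\<close> is the Gaussian evaluated at the complex substituted point. Deforming
  the substitution to the identity leads to the standard Gaussian in \<open>2 * n\<close> real
  variables with the same integral.\<close>

lemma integral_U:
  "\<exists>Q. (\<forall>p. norm (Q p) = exp (- S p / 2)) \<and>
    (\<integral>p. Q p * ldet (n + n) (\<lambda>k j. bU \<epsilon> k j p) \<partial>leb (n + n)) = complex_of_real ((2 * pi) ^ n) \<and>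
    integrable (leb (n + n)) (\<lambda>p. Q p * ldet (n + n) (\<lambda>k j. bU \<epsilon> k j p))"
proof -
  let ?N = "n + n"
  obtain C where C: "C \<ge> 1" "\<And>a b c d k p. k < n \<Longrightarrow> \<bar>a\<bar> \<le> 1 \<Longrightarrow> \<bar>b\<bar> \<le> 1 \<Longrightarrow> \<bar>c\<bar> \<le> 1 \<Longrightarrow> \<bar>d\<bar> \<le> 1 \<Longrightarrow>
      \<bar>Lin \<epsilon> a b c d k p\<bar> \<le> C * (1 + ell1 (n + n) p)"
    "\<And>a b c d k j p. k < n \<Longrightarrow> j < n + n \<Longrightarrow> \<bar>a\<bar> \<le> 1 \<Longrightarrow> \<bar>b\<bar> \<le> 1 \<Longrightarrow> \<bar>c\<bar> \<le> 1 \<Longrightarrow> \<bar>d\<bar> \<le> 1 \<Longrightarrow>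
      \<bar>dLin \<epsilon> a b c d k j p\<bar> \<le> C"
    "\<And>c d k j l p. k < n \<Longrightarrow> j < n + n \<Longrightarrow> l < n + n \<Longrightarrow> \<bar>c\<bar> \<le> 1 \<Longrightarrow> \<bar>d\<bar> \<le> 1 \<Longrightarrow> \<bar>ddLin c d k j l p\<bar> \<le> C"
    by (rule Lin_bounds[OF less_imp_le[OF e(1)] e(2)]) (assumption | rule)+
  define P where "P k p = (1 - complex_of_real (p ?N)) * complex_of_real (p k) + complex_of_real (p ?N) * BU \<epsilon> k p" for k p
  define G where "G p = exp (- (1/2) * (\<Sum>k<?N. P k p * P k p))" for p
  define dG where "dG l p = - P l p * G p" for l p
  have nrm: "norm (complex_of_real a + \<i> * complex_of_real b) \<le> 2 * c" if "\<bar>a\<bar> \<le> c" "\<bar>b\<bar> \<le> c" for a b c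
    using norm_triangle_ineq[of "complex_of_real a" "\<i> * complex_of_real b"] that by (simp add: norm_mult)
  have pdB: "has_pd j (BU \<epsilon> k) (bU \<epsilon> k j)" if "k < ?N" "j < ?N" for k j
  proof (cases "k < n")
    case True
    from has_pd_add[OF has_rpd_imp_has_pd[OF Lin_rpd[OF True that(2), of \<epsilon> "1/2" 0 "1/2" 0]]
        has_pd_cmult[OF has_rpd_imp_has_pd[OF Lin_rpd[OF True that(2), of \<epsilon> 0 "- 1/2" 0 "1/2"]], of \<i>]]
    show ?thesis by (rule has_pd_eq) (use True in \<open>auto simp: BU_def bU_def\<close>)
  next
    case False
    then have k: "k - n < n" using that by auto
    from has_pd_add[OF has_rpd_imp_has_pd[OF Lin_rpd[OF k that(2), of \<epsilon> 0 "1/2" 0 "1/2"]]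
        has_pd_cmult[OF has_rpd_imp_has_pd[OF Lin_rpd[OF k that(2), of \<epsilon> "1/2" 0 "- 1/2" 0]], of \<i>]]
    show ?thesis by (rule has_pd_eq) (use False in \<open>auto simp: BU_def bU_def\<close>)
  qed
  have pdb: "has_pd l (bU \<epsilon> k j) (bbU k j l)" if "k < ?N" "j < ?N" "l < ?N" for k j l
  proof (cases "k < n")
    case True
    from has_pd_add[OF has_rpd_imp_has_pd[OF dLin_rpd[OF True that(2,3), of \<epsilon> "1/2" 0 "1/2" 0]]
        has_pd_cmult[OF has_rpd_imp_has_pd[OF dLin_rpd[OF True that(2,3), of \<epsilon> 0 "- 1/2" 0 "1/2"]], of \<i>]]
    show ?thesis by (rule has_pd_eq) (use True in \<open>auto simp: bbU_def bU_def\<close>)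
  next
    case False
    then have k: "k - n < n" using that by auto
    from has_pd_add[OF has_rpd_imp_has_pd[OF dLin_rpd[OF k that(2,3), of \<epsilon> 0 "1/2" 0 "1/2"]]
        has_pd_cmult[OF has_rpd_imp_has_pd[OF dLin_rpd[OF k that(2,3), of \<epsilon> "1/2" 0 "- 1/2" 0]], of \<i>]]
    show ?thesis by (rule has_pd_eq) (use False in \<open>auto simp: bbU_def bU_def\<close>)
  qed
  have indep: "BU \<epsilon> k (p(?N := t)) = BU \<epsilon> k p" "bU \<epsilon> k j (p(?N := t)) = bU \<epsilon> k j p" if "k < ?N" for k j p t
    unfolding BU_def bU_def using that Lin_indep[of k] Lin_indep[of "k - n"] dLin_indep
    by (auto simp del: fun_upd_apply)
  have cont: "continuous_on UNIV (BU \<epsilon> k)" "continuous_on UNIV (bU \<epsilon> k j)" "continuous_on UNIV (bbU k j l)" for k j l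
    unfolding BU_def[abs_def] bU_def[abs_def] bbU_def[abs_def]
    by (cases "k < n"; simp only: if_True if_False; intro continuous_intros cont_Lin cont_dLin cont_ddLin)+
  have contP: "continuous_on UNIV (P k)" for k
    unfolding P_def[abs_def] by (intro continuous_intros cont)
  have contG: "continuous_on UNIV G"
    unfolding G_def[abs_def] by (intro continuous_intros contP)
  have bB: "norm (BU \<epsilon> k p) \<le> 2 * C * (1 + ell1 ?N p)" if "k < ?N" for k p
  proof -
    have "norm (BU \<epsilon> k p) \<le> 2 * (C * (1 + ell1 ?N p))"
      unfolding BU_def using that by (cases "k < n"; simp only: if_True if_False; intro nrm C(2); simp)
    then show ?thesis by simp
  qed
  have bb: "norm (bU \<epsilon> k j p) \<le> 2 * C" if "k < ?N" "j < ?N" for k j p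
    unfolding bU_def using that by (cases "k < n"; simp only: if_True if_False; intro nrm C(3); simp)
  have bbb: "norm (bbU k j l p) \<le> 2 * C" if "k < ?N" "j < ?N" "l < ?N" for k j l p
    unfolding bbU_def using that by (cases "k < n"; simp only: if_True if_False; intro nrm C(4); simp)
  have normG: "norm (G p) = exp (- (1/2) * ((\<Sum>k<n. p k * ((1 - p ?N) * p k + p ?N * gp \<epsilon> k p))
      + (\<Sum>k<n. sh n p k * ((1 - p ?N) * sh n p k + p ?N * gp \<epsilon> k (sh n p)))))" for p
    unfolding Re_square_sum[where p=p and s="p ?N", symmetric] G_def P_def[symmetric] power2_eq_square[symmetric] norm_exp_eq_Re
    by simp
  define K where "K = exp (real ?N * (2\<^sup>2 / (2 * \<epsilon>)))"
  \<comment> \<open>The rate 2 leaves one unit of decay for the linear growth of \<open>P l\<close>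
    in \<open>dG l\<close>.\<close>
  have boundG: "norm (G p) \<le> K * exp (- 2 * ell1 ?N p)" if "0 \<le> p ?N" "p ?N \<le> 1" for p
  proof -
    have "norm (G p) \<le> exp (- (1/2) * (\<epsilon> * (\<Sum>k<n. (p k)\<^sup>2) + \<epsilon> * (\<Sum>k<n. (sh n p k)\<^sup>2)))"
      unfolding normG using y_dot_lower[OF that, of p] y_dot_lower[OF that, of "sh n p"] by simp
    also have "\<dots> = exp (- (\<epsilon> / 2) * (\<Sum>k<?N. (p k)\<^sup>2))"
      unfolding sum_double sh_def by (simp add: algebra_simps)
    also have "\<dots> \<le> K * exp (- 2 * ell1 ?N p)"
      unfolding K_def by (rule quad_exp_bound) (use e in auto)
    finally show ?thesis .
  qed
  have K: "K > 0" by (simp add: K_def)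
  have H: "(\<integral>x. G (x(?N := 1)) * ldet ?N (\<lambda>k j. bU \<epsilon> k j x) \<partial>leb ?N) = (\<integral>x. G (x(?N := 0)) \<partial>leb ?N)
    \<and> integrable (leb ?N) (\<lambda>x. G (x(?N := 1)) * ldet ?N (\<lambda>k j. bU \<epsilon> k j x))"
  proof (rule homotopy[where B="BU \<epsilon>" and b="bU \<epsilon>" and bb=bbU and dG=dG and C="2 * C" and c=1 and A="K * (2 * C + 1)"])
    fix j assume j: "j \<le> ?N"
    let ?dP = "\<lambda>k p. if j < ?N then (1 - complex_of_real (p ?N)) * (if k = j then 1 else 0) + complex_of_real (p ?N) * bU \<epsilon> k j p
       else BU \<epsilon> k p - complex_of_real (p k)"
    have P: "has_pd j (P k) (?dP k)" if "k < ?N" for k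
      unfolding P_def[abs_def] by (rule has_pd_homotopy[OF pdB indep(1) that j]) (use that in auto)
    have "has_pd j G (\<lambda>p. exp (- (1/2) * (\<Sum>k<?N. P k p * P k p)) * (- (1/2) * (\<Sum>k<?N. P k p * ?dP k p + ?dP k p * P k p)))"
      unfolding G_def[abs_def] by (intro has_pd_exp has_pd_cmult has_pd_sum has_pd_mult P) auto
    then show "has_pd j G (\<lambda>p. \<Sum>k<?N. dG k p * ?dP k p)"
    proof (rule has_pd_eq)
      fix p
      have "(\<Sum>k<?N. P k p * ?dP k p + ?dP k p * P k p) = 2 * (\<Sum>k<?N. P k p * ?dP k p)"
        unfolding sum_distrib_left by (intro sum.cong) auto
      then have "exp (- (1/2) * (\<Sum>k<?N. P k p * P k p)) * (- (1/2) * (\<Sum>k<?N. P k p * ?dP k p + ?dP k p * P k p))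
         = - G p * (\<Sum>k<?N. P k p * ?dP k p)" by (simp add: G_def)
      also have "\<dots> = (\<Sum>k<?N. dG k p * ?dP k p)"
        unfolding sum_distrib_left dG_def by (intro sum.cong) auto
      finally show "exp (- (1/2) * (\<Sum>k<?N. P k p * P k p)) * (- (1/2) * (\<Sum>k<?N. P k p * ?dP k p + ?dP k p * P k p))
         = (\<Sum>k<?N. dG k p * ?dP k p)" .
    qed simp
  next
    fix p :: "nat \<Rightarrow> real" assume p: "0 \<le> p ?N" "p ?N \<le> 1"
    have "norm (G p) \<le> K * exp (- 2 * ell1 ?N p)" by (rule boundG[of p]) fact+
    also have "\<dots> \<le> K * exp (- 1 * ell1 ?N p)" using K by (intro mult_left_mono) auto
    also have "\<dots> \<le> K * (2 * C + 1) * exp (- 1 * ell1 ?N p)"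
      using K C(1) by (simp add: mult_le_cancel_left1)
    finally show "norm (G p) \<le> K * (2 * C + 1) * exp (- 1 * ell1 ?N p)" .
    fix l assume l: "l < ?N"
    have "norm ((1 - complex_of_real (p ?N)) * complex_of_real (p l)) \<le> 1 * ell1 ?N p"
      unfolding norm_mult using p norm_of_real[of "1 - p ?N", where 'a=complex] coord_le_ell1[OF l, of p] by (intro mult_mono) auto
    moreover have "norm (complex_of_real (p ?N) * BU \<epsilon> l p) \<le> 1 * (2 * C * (1 + ell1 ?N p))"
      unfolding norm_mult using p bB[OF l, of p] by (intro mult_mono) auto
    ultimately have "norm (P l p) \<le> ell1 ?N p + 2 * C * (1 + ell1 ?N p)"
      unfolding P_def by (intro order_trans[OF norm_triangle_ineq]) linarith
    also have "\<dots> \<le> (2 * C + 1) * (1 + ell1 ?N p)" by (simp add: algebra_simps)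
    also have "\<dots> \<le> (2 * C + 1) * exp (ell1 ?N p)"
      using C(1) exp_ge_add_one_self[of "ell1 ?N p"] by (intro mult_left_mono) auto
    finally have "norm (P l p) * norm (G p) \<le> ((2 * C + 1) * exp (ell1 ?N p)) * (K * exp (- 2 * ell1 ?N p))"
      using boundG[of p] p C(1) by (intro mult_mono) auto
    also have "\<dots> = K * (2 * C + 1) * (exp (ell1 ?N p) * exp (- 2 * ell1 ?N p))" by (simp only: mult_ac)
    also have "exp (ell1 ?N p) * exp (- 2 * ell1 ?N p) = exp (- 1 * ell1 ?N p)" by (simp flip: exp_add)
    finally show "norm (dG l p) \<le> K * (2 * C + 1) * exp (- 1 * ell1 ?N p)" by (simp add: dG_def norm_mult)
  next
    show "continuous_on UNIV (dG l)" for l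
      unfolding dG_def[abs_def] by (intro continuous_intros contP contG)
    show "bbU k j l p = bbU k l j p" for k j l p
      unfolding bbU_def ddLin_sym[of _ _ _ j l] by (rule refl)
    show "1 \<le> 2 * C" "0 \<le> K * (2 * C + 1)" using C(1) K by simp_all
  qed ((rule pdB pdb indep cont contG bB bb bbb; assumption)+, simp)
  have G0: "G (x(?N := 0)) = complex_of_real (exp (- (\<Sum>k<?N. (x k)\<^sup>2) / 2))" for x
  proof -
    have "(\<Sum>k<?N. P k (x(?N := 0)) * P k (x(?N := 0))) = (\<Sum>k<?N. complex_of_real ((x k)\<^sup>2))"
      by (intro sum.cong) (auto simp: P_def power2_eq_square)
    then show ?thesis by (simp add: G_def exp_of_real[symmetric])
  qed
  have "(\<integral>x. G (x(?N := 0)) \<partial>leb ?N) = complex_of_real (sqrt (2 * pi) ^ ?N)"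
    unfolding G0 integral_complex_of_real integral_gauss ..
  also have "sqrt (2 * pi) ^ ?N = (sqrt (2 * pi) * sqrt (2 * pi)) ^ n"
    by (simp only: power_add power_mult_distrib)
  also have "sqrt (2 * pi) * sqrt (2 * pi) = 2 * pi" by simp
  finally have I: "(\<integral>x. G (x(?N := 0)) \<partial>leb ?N) = complex_of_real ((2 * pi) ^ n)" .
  have n1: "norm (G (x(?N := 1))) = exp (- S x / 2)" for x
  proof -
    have "gp \<epsilon> k (x(?N := 1)) = gp \<epsilon> k x" "gp \<epsilon> k (sh n (x(?N := 1))) = gp \<epsilon> k (sh n x)" if "k < n" for k
      using that by (simp_all add: gp_indep sh_upd_ge del: fun_upd_apply)
    then show ?thesis unfolding normG S_def by (simp add: sh_def algebra_simps)
  qed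
  show ?thesis
    by (rule exI[of _ "\<lambda>x. G (x(?N := 1))"], intro conjI allI n1 conjunct2[OF H] trans[OF conjunct1[OF H] I])
qed

text \<open>The convexity inequality of \<open>phi\<close> at \<open>x\<^sub>2\<close> tested with
  \<open>w\<close> is added to the one at \<open>x\<^sub>1\<close> tested with \<open>- w\<close>.
  As \<open>phi\<close> at the midpoint \<open>X\<close> is at most the mean of its values at the
  two points, this bounds \<open>dot n w Y\<close> for all \<open>w\<close>, hence \<open>k0\<close>
  of \<open>W\<close> at \<open>Y\<close> from below.\<close>

lemma exp_S_le:
  assumes "lse W" and \<kappa>: "\<And>w. w \<in> W \<Longrightarrow> phi \<epsilon> w \<le> \<kappa>"
  shows "exp (- S p / 2) \<le> exp \<kappa> * (exp (- phi \<epsilon> (\<lambda>k. BT \<epsilon> k p)) * lse.k0 n W (sh n (\<lambda>k. BT \<epsilon> k p)))"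
proof -
  interpret W: lse n W by (rule assms(1))
  define X where "X = (\<lambda>k. BT \<epsilon> k p)"
  define Y where "Y = sh n (\<lambda>k. BT \<epsilon> k p)"
  have X: "X i = (p i + sh n p i) / 2" if "i < n" for i
    using that by (simp add: X_def BT_def[OF sym e] Lin_def sh_def)
  have Y: "Y i = (gp \<epsilon> i (sh n p) - gp \<epsilon> i p) / 2" for i
    by (simp add: Y_def sh_def BT_def[OF sym e] Lin_def)
  have "phi \<epsilon> p \<ge> phi \<epsilon> X + (\<Sum>i<n. gp \<epsilon> i X * (p i - X i))"
    "phi \<epsilon> (sh n p) \<ge> phi \<epsilon> X + (\<Sum>i<n. gp \<epsilon> i X * (sh n p i - X i))"
    using e by (auto intro: phi_gradient)
  moreover have "(\<Sum>i<n. gp \<epsilon> i X * (p i - X i)) + (\<Sum>i<n. gp \<epsilon> i X * (sh n p i - X i)) = 0"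
    unfolding sum.distrib[symmetric] by (intro sum.neutral) (auto simp: X algebra_simps)
  ultimately have pX: "2 * phi \<epsilon> X \<le> phi \<epsilon> p + phi \<epsilon> (sh n p)" by linarith
  have dw: "dot n w Y \<le> \<kappa> + S p / 2 - phi \<epsilon> X" if w: "w \<in> W" for w
  proof -
    have "phi \<epsilon> w \<ge> phi \<epsilon> (sh n p) + (\<Sum>i<n. gp \<epsilon> i (sh n p) * (w i - sh n p i))"
      "phi \<epsilon> (\<lambda>i. - w i) \<ge> phi \<epsilon> p + (\<Sum>i<n. gp \<epsilon> i p * (- w i - p i))"
      using e by (auto intro: phi_gradient)
    moreover have "(\<Sum>i<n. gp \<epsilon> i (sh n p) * (w i - sh n p i)) + (\<Sum>i<n. gp \<epsilon> i p * (- w i - p i)) = 2 * dot n w Y - S p"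
      unfolding dot_def S_def sum_distrib_left sum.distrib[symmetric] sum_subtractf[symmetric]
      by (intro sum.cong) (auto simp: Y field_simps)
    ultimately show ?thesis using pX \<kappa>[OF w] phi_even[OF sym e, of w] by linarith
  qed
  have "W.Z Y \<le> (\<Sum>w\<in>W. exp (\<kappa> + S p / 2 - phi \<epsilon> X))"
    unfolding W.Z_def using dw by (intro sum_mono) simp
  then have "W.Z Y \<le> real (card W) * exp (\<kappa> + S p / 2 - phi \<epsilon> X)" by simp
  then have "exp (- (\<kappa> + S p / 2 - phi \<epsilon> X)) \<le> W.k0 Y"
    unfolding W.k0_def using W.Z_pos[of Y] by (simp add: exp_minus field_simps)
  then have "exp \<kappa> * (exp (- phi \<epsilon> X) * exp (- (\<kappa> + S p / 2 - phi \<epsilon> X))) \<le> exp \<kappa> * (exp (- phi \<epsilon> X) * W.k0 Y)"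
    by (intro mult_left_mono) auto
  then show ?thesis by (simp add: X_def Y_def flip: exp_add)
qed

lemma integrable_exp_phi: "integrable (leb n) (\<lambda>x. exp (- phi \<epsilon> x))"
proof (rule Bochner_Integration.integrable_bound[OF integrable_leb_exp[of 1 n "exp (real n * (1\<^sup>2 / (2 * \<epsilon>)))"]])
  have "continuous_on UNIV (\<lambda>x. exp (- phi \<epsilon> x))" by (intro continuous_intros)
  then show "(\<lambda>x. exp (- phi \<epsilon> x)) \<in> borel_measurable (leb n)"
    using continuous_imp_borel_fun by (auto simp: measurable_cong_sets[OF sets_leb refl])
  show "AE x in leb n. norm (exp (- phi \<epsilon> x)) \<le> norm (exp (real n * (1\<^sup>2 / (2 * \<epsilon>))) * exp (- 1 * ell1 n x))"
    using exp_phi_bound[OF sym e, of 1] by (intro AE_I2) simp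
qed simp

text \<open>The complex integral equals \<open>(2 * pi) ^ n\<close>. Its integrand is dominated by
  that of the real substitution, because the Jacobians agree up to \<open>2 ^ n\<close> and are
  positive; the real integral then splits into two factors.\<close>

theorem volume_product:
  assumes W: "lse W" and span: "\<And>y. \<exists>w\<in>W. c * ell1 n y \<le> dot n w y" and c: "c > 0"
    and \<kappa>: "\<And>w. w \<in> W \<Longrightarrow> phi \<epsilon> w \<le> \<kappa>"
  shows "pi ^ n \<le> exp \<kappa> * (\<integral>x. exp (- phi \<epsilon> x) \<partial>leb n) * (\<integral>x. lse.k0 n W x \<partial>leb n)"
proof -
  interpret W: lse n W by (rule W)
  let ?N = "n + n"
  define g where "g z = exp (- phi \<epsilon> z) * W.k0 (sh n z)" for z
  obtain Q where Q: "\<forall>p. norm (Q p) = exp (- S p / 2)"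
    "(\<integral>p. Q p * ldet ?N (\<lambda>k j. bU \<epsilon> k j p) \<partial>leb ?N) = complex_of_real ((2 * pi) ^ n)"
    "integrable (leb ?N) (\<lambda>p. Q p * ldet ?N (\<lambda>k j. bU \<epsilon> k j p))"
    using integral_U by (elim exE conjE)
  note T = integral_T[OF sym e W span c, folded g_def]
  have dT: "ldet ?N (\<lambda>k j. bT \<epsilon> k j p) = ldet ?N (MT n (\<lambda>i j. hA \<epsilon> i j p) (\<lambda>i j. hA \<epsilon> i j (sh n p)))" for p
    by (rule ldet_cong) (rule bT_MT[OF sym e])
  have dU: "ldet ?N (\<lambda>k j. bU \<epsilon> k j p) = of_real (2 ^ n * ldet ?N (\<lambda>k j. bT \<epsilon> k j p))" for p
  proof -
    have "ldet ?N (\<lambda>k j. bU \<epsilon> k j p) = ldet ?N (MU n (\<lambda>i j. of_real (hA \<epsilon> i j p)) (\<lambda>i j. of_real (hA \<epsilon> i j (sh n p))))"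
      by (rule ldet_cong) (rule bU_MU)
    then show ?thesis unfolding dT ldet_MU .
  qed
  have hA: "(\<Sum>i<n. \<Sum>j<n. u i * hA \<epsilon> i j x * u j) = (\<Sum>i<n. \<Sum>j<n. u i * H i j x * u j) + \<epsilon> * (\<Sum>i<n. (u i)\<^sup>2)" for u x
  proof -
    have "(\<Sum>j<n. u i * hA \<epsilon> i j x * u j) = (\<Sum>j<n. u i * H i j x * u j) + \<epsilon> * (u i)\<^sup>2" if "i < n" for i
    proof -
      have "(\<Sum>j<n. u i * hA \<epsilon> i j x * u j) = (\<Sum>j<n. u i * H i j x * u j + (if i = j then \<epsilon> * (u i)\<^sup>2 else 0))"
        by (intro sum.cong) (auto simp: hA_def power2_eq_square algebra_simps)
      then show ?thesis using that by (simp add: sum.distrib)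
    qed
    then show ?thesis by (simp add: sum.distrib sum_distrib_left)
  qed
  have dpos: "ldet ?N (\<lambda>k j. bT \<epsilon> k j p) > 0" for p
    unfolding dT
  proof (rule ldet_MT_pos)
    show "(\<Sum>i<n. \<Sum>j<n. u i * hA \<epsilon> i j p * u j) \<ge> 0" for u
    proof -
      have "0 \<le> (\<Sum>i<n. (u i)\<^sup>2)" by (intro sum_nonneg) simp
      then have "0 \<le> \<epsilon> * (\<Sum>i<n. (u i)\<^sup>2)" using e by simp
      then show ?thesis unfolding hA using H_nonneg[of u p] by linarith
    qed
    show "(\<Sum>i<n. \<Sum>j<n. u i * hA \<epsilon> i j (sh n p) * u j) > 0" if "i < n" "u i \<noteq> 0" for u i
    proof -
      have "(\<Sum>i<n. (u i)\<^sup>2) > 0" using that by (intro sum_pos2[of _ i]) auto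
      then have "0 < \<epsilon> * (\<Sum>i<n. (u i)\<^sup>2)" using e by simp
      then show ?thesis unfolding hA using H_nonneg[of u "sh n p"] by linarith
    qed
  qed
  have "(2 * pi) ^ n = norm (\<integral>p. Q p * ldet ?N (\<lambda>k j. bU \<epsilon> k j p) \<partial>leb ?N)"
    unfolding Q(2) norm_of_real by simp
  also have "\<dots> \<le> (\<integral>p. norm (Q p * ldet ?N (\<lambda>k j. bU \<epsilon> k j p)) \<partial>leb ?N)"
    by (rule integral_norm_bound)
  also have "\<dots> \<le> (\<integral>p. (2 ^ n * exp \<kappa>) * (g (\<lambda>k. BT \<epsilon> k p) * ldet ?N (\<lambda>k j. bT \<epsilon> k j p)) \<partial>leb ?N)"
  proof (rule integral_mono)
    show "integrable (leb ?N) (\<lambda>p. norm (Q p * ldet ?N (\<lambda>k j. bU \<epsilon> k j p)))"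
      using Q(3) by (rule integrable_norm)
    show "integrable (leb ?N) (\<lambda>p. (2 ^ n * exp \<kappa>) * (g (\<lambda>k. BT \<epsilon> k p) * ldet ?N (\<lambda>k j. bT \<epsilon> k j p)))"
      using T by (intro integrable_mult_right) (simp add: g_def)
    fix p
    have "norm (Q p * ldet ?N (\<lambda>k j. bU \<epsilon> k j p)) = exp (- S p / 2) * (2 ^ n * ldet ?N (\<lambda>k j. bT \<epsilon> k j p))"
      unfolding norm_mult Q(1)[rule_format] dU norm_of_real using dpos[of p] by simp
    also have "\<dots> \<le> (exp \<kappa> * g (\<lambda>k. BT \<epsilon> k p)) * (2 ^ n * ldet ?N (\<lambda>k j. bT \<epsilon> k j p))"
      unfolding g_def using exp_S_le[OF W \<kappa>, of p] dpos[of p] by (intro mult_right_mono) auto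
    finally show "norm (Q p * ldet ?N (\<lambda>k j. bU \<epsilon> k j p)) \<le> (2 ^ n * exp \<kappa>) * (g (\<lambda>k. BT \<epsilon> k p) * ldet ?N (\<lambda>k j. bT \<epsilon> k j p))"
      by (simp only: mult_ac)
  qed
  also have "\<dots> = (2 ^ n * exp \<kappa>) * (\<integral>p. g p \<partial>leb ?N)"
    using T by (simp add: g_def)
  also have "(\<integral>p. g p \<partial>leb ?N) = (\<integral>x. exp (- phi \<epsilon> x) \<partial>leb n) * (\<integral>x. W.k0 x \<partial>leb n)"
  proof -
    have m: "(\<lambda>x. exp (- phi \<epsilon> x)) \<in> borel_measurable borel" "W.k0 \<in> borel_measurable borel"
      by (intro continuous_imp_borel_fun continuous_intros W.cont_k0)+
    have mg: "g \<in> borel_measurable borel"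
      unfolding g_def[abs_def] by (intro continuous_imp_borel_fun continuous_intros continuous_on_comp_sh W.cont_k0)
    have dep: "phi \<epsilon> (x(j := t)) = phi \<epsilon> x" if "n \<le> j" for x j t using that by (intro phi_dep) auto
    have "(\<integral>\<^sup>+p. ennreal (g p) \<partial>leb ?N) = (\<integral>\<^sup>+p. ennreal (exp (- phi \<epsilon> p)) * ennreal (W.k0 (\<lambda>i. p (n + i))) \<partial>leb ?N)"
      unfolding g_def sh_def using W.k0_pos by (intro nn_integral_cong ennreal_mult) (auto simp: less_imp_le)
    also have "\<dots> = (\<integral>\<^sup>+x. ennreal (exp (- phi \<epsilon> x)) \<partial>leb n) * (\<integral>\<^sup>+x. ennreal (W.k0 x) \<partial>leb n)"
      by (rule nn_integral_leb_add) (use m dep in auto)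
    also have "(\<integral>\<^sup>+x. ennreal (exp (- phi \<epsilon> x)) \<partial>leb n) = ennreal (\<integral>x. exp (- phi \<epsilon> x) \<partial>leb n)"
      by (rule nn_integral_eq_integral[OF integrable_exp_phi]) auto
    also have "(\<integral>\<^sup>+x. ennreal (W.k0 x) \<partial>leb n) = ennreal (\<integral>x. W.k0 x \<partial>leb n)"
      by (rule nn_integral_eq_integral[OF lse_integrable_k0[OF W span c]]) (auto simp: W.k0_pos less_imp_le)
    finally have "(\<integral>\<^sup>+p. ennreal (g p) \<partial>leb ?N) = ennreal ((\<integral>x. exp (- phi \<epsilon> x) \<partial>leb n) * (\<integral>x. W.k0 x \<partial>leb n))"
      by (simp add: ennreal_mult' integral_nonneg W.k0_pos less_imp_le)
    moreover have "g p \<ge> 0" for p unfolding g_def using W.k0_pos by (simp add: less_imp_le)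
    ultimately show ?thesis
      using mg by (subst integral_eq_nn_integral)
        (auto simp: measurable_cong_sets[OF sets_leb refl] integral_nonneg W.k0_pos less_imp_le)
  qed
  finally have "2 ^ n * pi ^ n \<le> 2 ^ n * (exp \<kappa> * (\<integral>x. exp (- phi \<epsilon> x) \<partial>leb n) * (\<integral>x. W.k0 x \<partial>leb n))"
    by (simp add: power_mult_distrib mult.assoc)
  then show ?thesis by simp
qed

end

end

section \<open>Packing and symmetric convex bodies\<close>

lemma scaleR_apply [simp]: "(c *\<^sub>R x) i = c * x i" for x :: "nat \<Rightarrow> real"
  by (simp add: scaleR_fun_def)

lemma mem_real_space: "x \<in> real_space n \<longleftrightarrow> (\<forall>i\<ge>n. x i = 0)"
  by (simp add: real_space_def topspace_Euclidean_space)

lemma real_space_add: "x \<in> real_space n \<Longrightarrow> y \<in> real_space n \<Longrightarrow> x + y \<in> real_space n"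
  and real_space_diff: "x \<in> real_space n \<Longrightarrow> y \<in> real_space n \<Longrightarrow> x - y \<in> real_space n"
  and real_space_uminus: "x \<in> real_space n \<Longrightarrow> - x \<in> real_space n"
  and real_space_scaleR: "x \<in> real_space n \<Longrightarrow> c *\<^sub>R x \<in> real_space n"
  and real_space_zero: "0 \<in> real_space n"
  by (simp_all add: mem_real_space)

lemma sets_real_space [measurable]: "real_space n \<in> sets borel"
proof -
  have "{x :: nat \<Rightarrow> real. \<forall>i. n \<le> i \<longrightarrow> x i = 0} \<in> sets borel" by measurable
  then show ?thesis by (simp add: real_space_def topspace_Euclidean_space)
qed

lemma dot_plus: "dot n v (x + y) = dot n v x + dot n v y"
  and dot_minus: "dot n v (x - y) = dot n v x - dot n v y"
  and dot_neg: "dot n v (- x) = - dot n v x"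
  and dot_neg_left: "dot n (- v) x = - dot n v x"
  and dot_scaleR: "dot n v (c *\<^sub>R x) = c * dot n v x"
  and dot_scaleR_left: "dot n (c *\<^sub>R v) x = c * dot n v x"
  and dot_minus_left: "dot n (v - w) x = dot n v x - dot n w x"
  by (simp_all add: dot_def sum.distrib sum_subtractf sum_negf ring_distribs sum_distrib_left mult_ac)

lemma borel_affine [measurable]:
  "(\<lambda>x. a + c *\<^sub>R x) \<in> borel_measurable (borel :: (nat \<Rightarrow> real) measure)"
proof (rule measurable_coordinatewise_then_product)
  fix i
  have "(\<lambda>x :: nat \<Rightarrow> real. a i + c * x i) \<in> borel_measurable borel" by measurable
  then show "(\<lambda>x. (a + c *\<^sub>R x) i) \<in> borel_measurable borel" by simp
qed

lemma emeasure_leb_affine: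
  assumes "M \<in> sets borel" "c > 0" "a \<in> real_space n"
  shows "emeasure (leb n) M = ennreal (c ^ n) * emeasure (leb n) {x. a + c *\<^sub>R x \<in> M}"
    and "{x. a + c *\<^sub>R x \<in> M} \<in> sets borel"
proof -
  show s: "{x. a + c *\<^sub>R x \<in> M} \<in> sets borel"
    using measurable_sets[OF borel_affine assms(1), of a c] by (simp add: vimage_def)
  have "(\<integral>\<^sup>+x. indicator M x \<partial>leb n) = ennreal (c ^ n) * (\<integral>\<^sup>+x. indicator M (\<lambda>i. a i + c * x i) \<partial>leb n)"
    by (rule nn_integral_leb_translate) (use assms in auto)
  also have "(\<lambda>x. indicator M (\<lambda>i. a i + c * x i) :: ennreal) = indicator {x. a + c *\<^sub>R x \<in> M}"
    by (auto simp: fun_eq_iff indicator_def plus_fun_def scaleR_fun_def)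
  finally show "emeasure (leb n) M = ennreal (c ^ n) * emeasure (leb n) {x. a + c *\<^sub>R x \<in> M}"
    using assms s by simp
qed

lemma emeasure_leb_translate:
  assumes "M \<in> sets borel" "a \<in> real_space n"
  shows "emeasure (leb n) ((+) a ` M) = emeasure (leb n) M" "(+) a ` M \<in> sets borel"
proof -
  have "(+) a ` M = {x. (- a) + 1 *\<^sub>R x \<in> M}"
    by (force simp: image_iff intro: exI[of _ "_ - a"] bexI[of _ "- a + _"])
  then show "emeasure (leb n) ((+) a ` M) = emeasure (leb n) M" "(+) a ` M \<in> sets borel"
    using emeasure_leb_affine[OF assms(1), of 1 "- a" n] real_space_uminus[OF assms(2)] by simp_all
qed

lemma emeasure_leb_scale:
  assumes "M \<in> sets borel" "c > 0"
  shows "emeasure (leb n) ((*\<^sub>R) c ` M) = ennreal (c ^ n) * emeasure (leb n) M" "(*\<^sub>R) c ` M \<in> sets borel"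
proof -
  have e: "(*\<^sub>R) c ` M = {x. 0 + (1 / c) *\<^sub>R x \<in> M}"
    using assms(2) by (force simp: image_iff intro: bexI[of _ "(1 / c) *\<^sub>R _"])
  have s: "(*\<^sub>R) c ` M \<in> sets borel"
    unfolding e by (rule emeasure_leb_affine(2)[OF assms(1), of "1 / c" 0 n]) (use assms real_space_zero in auto)
  then show "(*\<^sub>R) c ` M \<in> sets borel" .
  have "{x. 0 + c *\<^sub>R x \<in> (*\<^sub>R) c ` M} = M" using assms(2) by auto
  then show "emeasure (leb n) ((*\<^sub>R) c ` M) = ennreal (c ^ n) * emeasure (leb n) M"
    using emeasure_leb_affine(1)[OF s assms(2) real_space_zero, of n] by simp
qed

text \<open>\<open>U\<close> is a maximal set of centres of disjoint translates of \<open>M\<close>.\<close>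

lemma packing_cover:
  fixes A M D :: "(nat \<Rightarrow> real) set"
  assumes A: "A \<subseteq> real_space n" and M: "M \<in> sets borel" "emeasure (leb n) M > 0"
    and D: "D \<in> sets borel" "emeasure (leb n) D < \<infinity>" and AM: "\<And>u m. u \<in> A \<Longrightarrow> m \<in> M \<Longrightarrow> u + m \<in> D"
  obtains U where "finite U" "U \<subseteq> A" "real (card U) * measure (leb n) M \<le> measure (leb n) D"
    "\<And>x. x \<in> A \<Longrightarrow> \<exists>u\<in>U. \<exists>m\<in>M. \<exists>m'\<in>M. x = u + m - m'"
proof (cases "A = {}")
  case True
  then show ?thesis by (intro that[of "{}"]) auto
next
  case False
  define fam where "fam U \<longleftrightarrow> finite U \<and> U \<subseteq> A \<and> (\<forall>u\<in>U. \<forall>u'\<in>U. u \<noteq> u' \<longrightarrow> (+) u ` M \<inter> (+) u' ` M = {})" for U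
  have sub: "(+) u ` M \<subseteq> D" if "u \<in> A" for u using AM that by auto
  have eM: "emeasure (leb n) M \<le> emeasure (leb n) D"
  proof -
    obtain u where u: "u \<in> A" using False by blast
    have "emeasure (leb n) M = emeasure (leb n) ((+) u ` M)"
      using emeasure_leb_translate(1)[OF M(1), of u n] u A by auto
    also have "\<dots> \<le> emeasure (leb n) D" using sub[OF u] D by (intro emeasure_mono) auto
    finally show ?thesis .
  qed
  then have fin: "emeasure (leb n) M < \<infinity>" using D(2) by (rule le_less_trans)
  have pos: "measure (leb n) M > 0"
    using M(2) fin by (simp add: measure_def enn2real_positive_iff)
  have bound: "real (card U) * measure (leb n) M \<le> measure (leb n) D" if U: "fam U" for U
  proof -
    have "(\<Sum>u\<in>U. emeasure (leb n) ((+) u ` M)) = emeasure (leb n) (\<Union>u\<in>U. (+) u ` M)"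
    proof (rule sum_emeasure)
      show "(\<lambda>u. (+) u ` M) ` U \<subseteq> sets (leb n)"
        using U A emeasure_leb_translate(2)[OF M(1)] by (auto simp: fam_def)
      show "disjoint_family_on (\<lambda>u. (+) u ` M) U" using U by (auto simp: fam_def disjoint_family_on_def)
    qed (use U in \<open>auto simp: fam_def\<close>)
    also have "\<dots> \<le> emeasure (leb n) D"
      using U sub D by (intro emeasure_mono) (auto simp: fam_def)
    also have "(\<Sum>u\<in>U. emeasure (leb n) ((+) u ` M)) = (\<Sum>u\<in>U. emeasure (leb n) M)"
      using U A emeasure_leb_translate(1)[OF M(1)] by (intro sum.cong) (auto simp: fam_def)
    finally have "of_nat (card U) * emeasure (leb n) M \<le> emeasure (leb n) D" by simp
    then have "enn2real (of_nat (card U) * emeasure (leb n) M) \<le> enn2real (emeasure (leb n) D)"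
      using D(2) by (intro enn2real_mono) auto
    then show ?thesis by (simp add: measure_def enn2real_mult)
  qed
  have cb: "card U \<le> nat \<lceil>measure (leb n) D / measure (leb n) M\<rceil>" if "fam U" for U
  proof -
    have "real (card U) \<le> measure (leb n) D / measure (leb n) M"
      using bound[OF that] pos by (simp add: field_simps)
    then show ?thesis by linarith
  qed
  have "fam {}" by (simp add: fam_def)
  then obtain U where U: "fam U" and max: "\<And>U'. fam U' \<Longrightarrow> card U' \<le> card U"
    using ex_has_greatest_nat[of fam "{}" card "Suc (nat \<lceil>measure (leb n) D / measure (leb n) M\<rceil>)"] cb
    by (metis le_imp_less_Suc less_imp_le)
  obtain m0 where m0: "m0 \<in> M" using M(2) by fastforce
  show ?thesis
  proof (rule that[of U])
    show "finite U" "U \<subseteq> A" using U by (auto simp: fam_def)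
    show "real (card U) * measure (leb n) M \<le> measure (leb n) D" by (rule bound[OF U])
    fix x assume x: "x \<in> A"
    show "\<exists>u\<in>U. \<exists>m\<in>M. \<exists>m'\<in>M. x = u + m - m'"
    proof (cases "x \<in> U")
      case True
      then show ?thesis using m0 by (intro bexI[of _ x] bexI[of _ m0]) auto
    next
      case False
      have "finite U" using U by (simp add: fam_def)
      then have "\<not> card (insert x U) \<le> card U" using False by simp
      then have "\<not> fam (insert x U)" using max by blast
      moreover have "fam (insert x U)" if h: "\<forall>u\<in>U. (+) x ` M \<inter> (+) u ` M = {}"
        unfolding fam_def
      proof (intro conjI ballI impI)
        show "finite (insert x U)" "insert x U \<subseteq> A" using U x by (auto simp: fam_def)
        fix a b assume "a \<in> insert x U" "b \<in> insert x U" "a \<noteq> b"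
        then consider "a = x" "b \<in> U" | "b = x" "a \<in> U" | "a \<in> U" "b \<in> U" "a \<noteq> b" by blast
        then show "(+) a ` M \<inter> (+) b ` M = {}"
        proof cases
          case 1 then show ?thesis using h by blast
        next
          case 2 then show ?thesis using h by (simp add: Int_commute)
        next
          case 3 then show ?thesis using U unfolding fam_def by blast
        qed
      qed
      ultimately obtain u where u: "u \<in> U" "(+) x ` M \<inter> (+) u ` M \<noteq> {}" by blast
      then obtain m m' where "m \<in> M" "m' \<in> M" "x + m' = u + m" by auto
      then show ?thesis using u(1) by (intro bexI[of _ u] bexI[of _ m] bexI[of _ m']) (auto simp: algebra_simps)
    qed
  qed
qed

section \<open>Support functions of finite sets\<close>

context lse begin

text \<open>The support function of the convex hull of \<open>V\<close>; its sublevel sets at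
  positive levels are multiples of the polar of \<open>V\<close>.\<close>

definition "pm x = Max ((\<lambda>v. dot n v x) ` V)"

lemma pm_ge: "v \<in> V \<Longrightarrow> dot n v x \<le> pm x"
  unfolding pm_def using finV by (intro Max_ge) auto

lemma pm_attained: "\<exists>v\<in>V. pm x = dot n v x"
proof -
  have "pm x \<in> (\<lambda>v. dot n v x) ` V" unfolding pm_def using finV neV by (intro Max_in) auto
  then show ?thesis by auto
qed

lemma pm_le_iff: "pm x \<le> a \<longleftrightarrow> (\<forall>v\<in>V. dot n v x \<le> a)"
  unfolding pm_def using finV neV by simp

lemma pm_measurable [measurable]: "pm \<in> borel_measurable borel"
proof -
  have m: "dot n v \<in> borel_measurable borel" for v
    by (intro continuous_imp_borel_fun continuous_intros)
  show ?thesis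
  proof (rule borel_measurableI_le)
    fix a
    have "{x. \<forall>v\<in>V. dot n v x \<le> a} \<in> sets borel" using finV m by measurable
    then show "{x \<in> space borel. pm x \<le> a} \<in> sets borel" by (simp add: pm_le_iff)
  qed
qed

lemma pm_scale: assumes "c > 0" shows "pm (c *\<^sub>R x) = c * pm x"
proof (rule antisym)
  show "pm (c *\<^sub>R x) \<le> c * pm x"
    unfolding pm_le_iff using pm_ge assms by (auto simp: dot_scaleR)
  obtain v where "v \<in> V" "pm x = dot n v x" using pm_attained by blast
  then show "c * pm x \<le> pm (c *\<^sub>R x)" using pm_ge[of v "c *\<^sub>R x"] by (simp add: dot_scaleR)
qed

lemma k0_le_pm: "k0 x \<le> real (card V) * exp (- pm x)"
  using pm_attained[of x] k0_bound by force

text \<open>Where \<open>pm\<close> exceeds \<open>4 * n\<close>, \<open>exp (- pm x)\<close> is at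
  most \<open>exp (- 2 * n) * exp (- pm x / 2)\<close>, whose integral is, by scaling, at most half
  of the total \<open>I\<close>. So the sublevel set has at least half of \<open>I\<close> as its
  volume; finiteness of \<open>I\<close> permits the subtraction.\<close>

lemma pm_volume:
  assumes span: "\<And>y. \<exists>v\<in>V. c * ell1 n y \<le> dot n v y" and c: "c > 0" and n: "n \<ge> 1"
  shows "(\<integral>x. exp (- pm x) \<partial>leb n) \<le> 2 * measure (leb n) {x. pm x \<le> 4 * real n}"
    and "integrable (leb n) (\<lambda>x. exp (- pm x))"
    and "emeasure (leb n) {x. pm x \<le> 4 * real n} < \<infinity>"
proof -
  let ?A = "{x. pm x \<le> 4 * real n}"
  have A [measurable]: "?A \<in> sets borel" by measurable
  have pc: "c * ell1 n y \<le> pm y" for y using span[of y] pm_ge[of _ y] by (auto intro: order_trans)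
  have pm0: "pm y \<ge> 0" for y using pc[of y] c ell1_nonneg[of n y] by (meson mult_nonneg_nonneg less_imp_le order_trans)
  define I where "I = (\<integral>\<^sup>+x. ennreal (exp (- pm x)) \<partial>leb n)"
  have "I \<le> (\<integral>\<^sup>+x. ennreal (exp (- c * ell1 n x)) \<partial>leb n)"
    unfolding I_def by (intro nn_integral_mono ennreal_leI) (simp add: pc)
  also have "\<dots> < \<infinity>" by (rule nn_integral_leb_exp[OF c])
  finally have fin: "I < \<infinity>" .
  show int: "integrable (leb n) (\<lambda>x. exp (- pm x))"
    using fin unfolding I_def by (intro integrableI_nonneg) auto
  have eA: "emeasure (leb n) ?A \<le> ennreal (exp (4 * real n)) * I"
  proof -
    have "emeasure (leb n) ?A = (\<integral>\<^sup>+x. indicator ?A x \<partial>leb n)" by simp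
    also have "\<dots> \<le> (\<integral>\<^sup>+x. ennreal (exp (4 * real n)) * ennreal (exp (- pm x)) \<partial>leb n)"
    proof (rule nn_integral_mono)
      fix x
      show "indicator ?A x \<le> ennreal (exp (4 * real n)) * ennreal (exp (- pm x))"
      proof (cases "x \<in> ?A")
        case True
        then have "1 \<le> exp (4 * real n) * exp (- pm x)" by (simp flip: exp_add)
        then show ?thesis using True by (simp flip: ennreal_mult)
      qed simp
    qed
    also have "\<dots> = ennreal (exp (4 * real n)) * I" unfolding I_def by (rule nn_integral_cmult) simp
    finally show ?thesis .
  qed
  also have "\<dots> < \<infinity>" using fin by (simp add: ennreal_mult_less_top)
  finally show finA: "emeasure (leb n) ?A < \<infinity>" .
  have half: "(\<integral>\<^sup>+x. ennreal (exp (- pm x / 2)) \<partial>leb n) = ennreal (2 ^ n) * I"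
  proof -
    have "(\<integral>\<^sup>+x. ennreal (exp (- pm x / 2)) \<partial>leb n) = ennreal (2 ^ n) * (\<integral>\<^sup>+x. ennreal (exp (- pm (\<lambda>i. 0 + 2 * x i) / 2)) \<partial>leb n)"
      by (rule nn_integral_leb_translate) (auto simp: mem_real_space)
    also have "(\<lambda>x. ennreal (exp (- pm (\<lambda>i. 0 + 2 * x i) / 2))) = (\<lambda>x. ennreal (exp (- pm x)))"
    proof
      fix x :: "nat \<Rightarrow> real"
      have "(\<lambda>i. 0 + 2 * x i) = 2 *\<^sub>R x" by (simp add: fun_eq_iff)
      then show "ennreal (exp (- pm (\<lambda>i. 0 + 2 * x i) / 2)) = ennreal (exp (- pm x))"
        by (simp only: pm_scale[of 2 x]) simp
    qed
    finally show ?thesis unfolding I_def .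
  qed
  have e2: "exp (- 2 * real n) * 2 ^ n \<le> (1 / 2 :: real)"
  proof -
    have "exp (- 2 :: real) \<le> 1 / 4"
    proof -
      have "(4 :: real) \<le> (1 + 1)\<^sup>2" by simp
      also have "\<dots> \<le> (exp 1)\<^sup>2" using exp_ge_add_one_self[of 1] by (intro power_mono) auto
      also have "\<dots> = exp 2" by (simp flip: exp_of_nat_mult)
      finally show ?thesis by (simp add: exp_minus field_simps)
    qed
    then have "(exp (- 2) * 2) ^ n \<le> (1 / 2 :: real) ^ n" by (intro power_mono) auto
    also have "\<dots> \<le> (1 / 2) ^ 1" using n by (intro power_decreasing) auto
    finally show ?thesis by (simp add: power_mult_distrib mult.commute flip: exp_of_nat_mult)
  qed
  have "I \<le> (\<integral>\<^sup>+x. indicator ?A x + ennreal (exp (- 2 * real n)) * ennreal (exp (- pm x / 2)) \<partial>leb n)"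
    unfolding I_def
  proof (rule nn_integral_mono)
    fix x
    show "ennreal (exp (- pm x)) \<le> indicator ?A x + ennreal (exp (- 2 * real n)) * ennreal (exp (- pm x / 2))"
    proof (cases "x \<in> ?A")
      case True
      have "ennreal (exp (- pm x)) \<le> 1" using pm0[of x] by (simp add: ennreal_le_1)
      then show ?thesis using True by (simp add: add_increasing2)
    next
      case False
      then have "exp (- pm x) \<le> exp (- 2 * real n) * exp (- pm x / 2)" by (simp flip: exp_add)
      then show ?thesis using False by (simp flip: ennreal_mult)
    qed
  qed
  also have "\<dots> = emeasure (leb n) ?A + ennreal (exp (- 2 * real n)) * (ennreal (2 ^ n) * I)"
  proof -
    have "(\<integral>\<^sup>+x. indicator ?A x + ennreal (exp (- 2 * real n)) * ennreal (exp (- pm x / 2)) \<partial>leb n)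
      = (\<integral>\<^sup>+x. indicator ?A x \<partial>leb n) + (\<integral>\<^sup>+x. ennreal (exp (- 2 * real n)) * ennreal (exp (- pm x / 2)) \<partial>leb n)"
      by (rule nn_integral_add) measurable
    also have "(\<integral>\<^sup>+x. ennreal (exp (- 2 * real n)) * ennreal (exp (- pm x / 2)) \<partial>leb n)
      = ennreal (exp (- 2 * real n)) * (\<integral>\<^sup>+x. ennreal (exp (- pm x / 2)) \<partial>leb n)"
      by (rule nn_integral_cmult) measurable
    also have "(\<integral>\<^sup>+x. indicator ?A x \<partial>leb n) = emeasure (leb n) ?A" by (rule nn_integral_indicator) simp
    finally show ?thesis unfolding half .
  qed
  also have "ennreal (exp (- 2 * real n)) * (ennreal (2 ^ n) * I) = ennreal (exp (- 2 * real n) * 2 ^ n) * I"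
    by (simp add: mult.assoc ennreal_mult)
  also have "\<dots> \<le> ennreal (1 / 2) * I" using e2 by (intro mult_right_mono ennreal_leI) auto
  finally have "I \<le> emeasure (leb n) ?A + ennreal (1 / 2) * I" by (simp add: add_left_mono)
  moreover have "I = ennreal (\<integral>x. exp (- pm x) \<partial>leb n)"
    unfolding I_def by (rule nn_integral_eq_integral[OF int]) auto
  moreover have "emeasure (leb n) ?A = ennreal (measure (leb n) ?A)"
    using finA by (simp add: emeasure_eq_ennreal_measure less_top)
  moreover have "ennreal m + ennreal (1 / 2) * ennreal l = ennreal (m + 1 / 2 * l)" if "m \<ge> 0" "l \<ge> 0" for m l :: real
    using that by (simp only: ennreal_mult[symmetric] ennreal_plus[symmetric] zero_le_divide_1_iff mult_nonneg_nonneg zero_le_numeral)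
  ultimately have "ennreal (\<integral>x. exp (- pm x) \<partial>leb n) \<le> ennreal (measure (leb n) ?A + 1 / 2 * (\<integral>x. exp (- pm x) \<partial>leb n))"
    by (metis Bochner_Integration.integral_nonneg exp_ge_zero measure_nonneg)
  then have "(\<integral>x. exp (- pm x) \<partial>leb n) \<le> measure (leb n) ?A + 1 / 2 * (\<integral>x. exp (- pm x) \<partial>leb n)"
    by (subst (asm) ennreal_le_iff) simp_all
  then show "(\<integral>x. exp (- pm x) \<partial>leb n) \<le> 2 * measure (leb n) ?A" by simp
qed

end

section \<open>Separation, symmetric bodies and their nets\<close>

definition cut :: "nat \<Rightarrow> (nat \<Rightarrow> real) \<Rightarrow> nat \<Rightarrow> real" where
  "cut n x = (\<lambda>i. if i < n then x i else 0)"

lemma cut_real_space: "cut n x \<in> real_space n" by (simp add: mem_real_space cut_def)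
lemma cut_apply: "i < n \<Longrightarrow> cut n x i = x i" by (simp add: cut_def)
lemma dot_cut: "dot n w (cut n x) = dot n w x" by (simp add: dot_def cut_def)
lemma ell1_cut: "ell1 n (cut n x) = ell1 n x" by (simp add: ell1_def cut_def)

lemma dot_self_eq_0: "x \<in> real_space n \<Longrightarrow> dot n x x = 0 \<Longrightarrow> x = 0"
proof
  fix i assume x: "x \<in> real_space n" "dot n x x = 0"
  show "x i = 0 i"
  proof (cases "i < n")
    case True
    then show ?thesis using x(2) by (simp add: dot_def sum_nonneg_eq_0_iff)
  next
    case False
    then show ?thesis using x(1) by (simp add: mem_real_space)
  qed
qed

lemma dot_self_nonneg: "dot n x x \<ge> 0"
  by (simp add: dot_def sum_nonneg)

text \<open>The functional is a multiple of \<open>z = u - y0\<close>, where \<open>y0\<close> is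
  the point of \<open>B\<close> nearest to \<open>u\<close>. If \<open>dot n z (y - y0)\<close> were
  positive, a step of length \<open>t\<close> towards \<open>y\<close> would come closer;
  \<open>t\<close> is chosen so that the linear gain beats the quadratic term.\<close>

lemma convex_separation:
  assumes "compact B" "B \<subseteq> real_space n" "convex B" "0 \<in> B" "u \<in> real_space n" "u \<notin> B"
  shows "\<exists>x. x \<in> real_space n \<and> (\<forall>y\<in>B. dot n x y \<le> 1) \<and> dot n x u = 1"
proof -
  have "continuous_on B (\<lambda>y. \<Sum>i<n. (u i - y i)\<^sup>2)" by (intro continuous_intros)
  then obtain y0 where y0: "y0 \<in> B" and min: "\<And>y. y \<in> B \<Longrightarrow> (\<Sum>i<n. (u i - y0 i)\<^sup>2) \<le> (\<Sum>i<n. (u i - y i)\<^sup>2)"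
    using continuous_attains_inf[of B "\<lambda>y. \<Sum>i<n. (u i - y i)\<^sup>2"] assms by blast
  define z where "z = u - y0"
  have sq: "(\<Sum>i<n. (u i - y i)\<^sup>2) = dot n (u - y) (u - y)" for y
    by (simp add: dot_def power2_eq_square)
  have zr: "z \<in> real_space n" using assms y0 by (auto simp: z_def intro: real_space_diff)
  have z0: "dot n z z > 0"
    using dot_self_nonneg[of n z] dot_self_eq_0[OF zr] assms(6) y0 by (auto simp: z_def less_le)
  have dir: "dot n z (y - y0) \<le> 0" if y: "y \<in> B" for y
  proof (rule ccontr)
    define a q where "a = dot n z (y - y0)" and "q = dot n (y - y0) (y - y0)"
    assume "\<not> dot n z (y - y0) \<le> 0"
    then have a: "a > 0" by (simp add: a_def)
    have q: "q \<ge> 0" by (simp add: q_def dot_self_nonneg)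
    define t where "t = min 1 (a / (q + 1))"
    have t: "0 < t" "t \<le> 1" "t \<le> a / (q + 1)" using a q by (auto simp: t_def)
    have "(1 - t) *\<^sub>R y0 + t *\<^sub>R y \<in> B"
      using convexD_alt[OF assms(3) y0 y, of t] t by auto
    moreover have "u - ((1 - t) *\<^sub>R y0 + t *\<^sub>R y) = z - t *\<^sub>R (y - y0)"
      by (rule ext) (simp add: z_def algebra_simps)
    ultimately have "dot n z z \<le> dot n (z - t *\<^sub>R (y - y0)) (z - t *\<^sub>R (y - y0))"
      using min[of "(1 - t) *\<^sub>R y0 + t *\<^sub>R y"] unfolding sq by (simp only: z_def)
    also have "\<dots> = dot n z z - 2 * t * a + t * (t * q)"
    proof -
      have "dot n (z - t *\<^sub>R e) (z - t *\<^sub>R e) = dot n z z - 2 * t * dot n z e + t * (t * dot n e e)" for e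
        unfolding dot_minus dot_minus_left dot_scaleR dot_scaleR_left dot_commute[of n e z] by (simp add: field_simps)
      then show ?thesis unfolding a_def q_def .
    qed
    finally have "t * (2 * a) \<le> t * (t * q)" by simp
    then have "2 * a \<le> t * q" using t by simp
    also have "\<dots> \<le> a / (q + 1) * q" using t q by (intro mult_right_mono) auto
    also have "\<dots> \<le> a" using a q by (simp add: field_simps)
    finally show False using a by simp
  qed
  have y0n: "dot n z y0 \<ge> 0" using dir[OF assms(4)] by (simp add: dot_minus dot_neg)
  have zu: "dot n z u = dot n z y0 + dot n z z" by (simp add: z_def dot_minus)
  then have zu0: "dot n z u > 0" using y0n z0 by simp
  show ?thesis
  proof (intro exI[of _ "(1 / dot n z u) *\<^sub>R z"] conjI ballI)
    show "(1 / dot n z u) *\<^sub>R z \<in> real_space n" using zr by (rule real_space_scaleR)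
    show "dot n ((1 / dot n z u) *\<^sub>R z) u = 1" using zu0 by (simp add: dot_scaleR_left)
    fix y assume "y \<in> B"
    then have "dot n z y \<le> dot n z u" using dir[of y] zu z0 by (simp add: dot_minus)
    then show "dot n ((1 / dot n z u) *\<^sub>R z) y \<le> 1" using zu0 by (simp add: dot_scaleR_left)
  qed
qed

text \<open>A symmetric convex body between two cubes of half-sides \<open>r\<close> and
  \<open>R\<close>. These radii enter intermediate choices such as the mesh of the grid, but none of
  the covering bounds depends on them.\<close>

locale sbody =
  fixes n :: nat and B :: "(nat \<Rightarrow> real) set" and r R :: real
  assumes n: "n \<ge> 1" and comp: "compact B" and closedB: "closed B" and sub: "B \<subseteq> real_space n" and conv: "convex B"
    and symm: "\<And>x. x \<in> B \<Longrightarrow> - x \<in> B"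
    and r: "r > 0" and inner: "\<And>x. x \<in> real_space n \<Longrightarrow> (\<And>i. i < n \<Longrightarrow> \<bar>x i\<bar> \<le> r) \<Longrightarrow> x \<in> B"
    and outer: "\<And>x i. x \<in> B \<Longrightarrow> \<bar>x i\<bar> \<le> R"
begin

definition "dil c = (*\<^sub>R) c ` B"
definition "v = measure (leb n) B"

lemma zeroB: "0 \<in> B" using r by (intro inner real_space_zero) auto

lemma R0: "R \<ge> 0" using outer[OF zeroB, of 0] by simp

lemma dil_iff: "c > 0 \<Longrightarrow> x \<in> dil c \<longleftrightarrow> (1 / c) *\<^sub>R x \<in> B"
  unfolding dil_def by (auto intro!: image_eqI[of _ _ "(1 / c) *\<^sub>R x"])

lemma dil_1: "dil 1 = B" by (simp add: dil_def)

lemma dil_sub: "dil c \<subseteq> real_space n"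
  unfolding dil_def using sub real_space_scaleR by auto

lemma dil_add: assumes "a > 0" "b > 0" "x \<in> dil a" "y \<in> dil b" shows "x + y \<in> dil (a + b)"
proof -
  have "(a / (a + b)) *\<^sub>R ((1 / a) *\<^sub>R x) + (b / (a + b)) *\<^sub>R ((1 / b) *\<^sub>R y) \<in> B"
    using assms dil_iff by (intro convexD[OF conv]) (auto simp: add_divide_distrib[symmetric])
  also have "(a / (a + b)) *\<^sub>R ((1 / a) *\<^sub>R x) + (b / (a + b)) *\<^sub>R ((1 / b) *\<^sub>R y) = (1 / (a + b)) *\<^sub>R (x + y)"
    using assms by (intro ext) (simp add: field_simps)
  finally show ?thesis using assms by (simp only: dil_iff add_pos_pos)
qed

lemma dil_uminus: "x \<in> dil c \<Longrightarrow> - x \<in> dil c"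
  unfolding dil_def using symm by (auto simp: image_iff) (metis scaleR_minus_right)

lemma dil_diff: "a > 0 \<Longrightarrow> b > 0 \<Longrightarrow> x \<in> dil a \<Longrightarrow> y \<in> dil b \<Longrightarrow> x - y \<in> dil (a + b)"
  using dil_add[of a b x "- y"] dil_uminus[of y b] by simp

lemma dil_mono: assumes "0 < a" "a \<le> b" "x \<in> dil a" shows "x \<in> dil b"
proof -
  have "(1 - a / b) *\<^sub>R 0 + (a / b) *\<^sub>R ((1 / a) *\<^sub>R x) \<in> B"
    using assms dil_iff zeroB by (intro convexD_alt[OF conv]) auto
  then show ?thesis using assms by (simp add: dil_iff)
qed

lemma dil_scale: "0 < c \<Longrightarrow> 0 < a \<Longrightarrow> x \<in> dil a \<Longrightarrow> c *\<^sub>R x \<in> dil (c * a)"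
  by (simp add: dil_iff)

lemma setsB [measurable]: "B \<in> sets borel" using closedB by simp

lemma sets_dil [measurable]: "c > 0 \<Longrightarrow> dil c \<in> sets borel"
  unfolding dil_def using emeasure_leb_scale(2)[OF setsB] by simp

lemma finB: "emeasure (leb n) B < \<infinity>"
proof -
  obtain k :: nat where "R \<le> real k" using real_arch_simple by blast
  then have "B \<subseteq> {x. \<forall>i<n. \<bar>x i\<bar> \<le> real k}" using outer by (auto intro: order_trans)
  moreover have "{x :: nat \<Rightarrow> real. \<forall>i<n. \<bar>x i\<bar> \<le> real k} \<in> sets borel"
  proof -
    have "{x :: nat \<Rightarrow> real. \<forall>i\<in>{..<n}. \<bar>x i\<bar> \<le> real k} \<in> sets borel" by measurable
    then show ?thesis by (simp add: Ball_def)
  qed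
  ultimately have "emeasure (leb n) B \<le> emeasure (leb n) {x. \<forall>i<n. \<bar>x i\<bar> \<le> real k}"
    by (intro emeasure_mono) auto
  then show ?thesis using emeasure_leb_box[of n k] by (rule le_less_trans)
qed

lemma emeasure_dil: "c > 0 \<Longrightarrow> emeasure (leb n) (dil c) = ennreal (c ^ n) * emeasure (leb n) B"
  unfolding dil_def by (rule emeasure_leb_scale(1)) auto

lemma fin_dil: "c > 0 \<Longrightarrow> emeasure (leb n) (dil c) < \<infinity>"
  using finB by (simp add: emeasure_dil ennreal_mult_less_top)

lemma vol_dil: "c > 0 \<Longrightarrow> measure (leb n) (dil c) = c ^ n * v"
  by (simp add: measure_def emeasure_dil enn2real_mult v_def)

text \<open>Otherwise the dilates of \<open>B\<close>, which cover \<open>real_space n\<close>,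
  would make \<open>leb n\<close> the zero measure, against the Gaussian integral.\<close>

lemma posB: "emeasure (leb n) B > 0"
proof (rule ccontr)
  assume "\<not> emeasure (leb n) B > 0"
  then have z: "emeasure (leb n) B = 0" by simp
  have cov: "real_space n \<subseteq> (\<Union>k::nat. dil (real (Suc k)))"
  proof
    fix x assume x: "x \<in> real_space n"
    obtain k :: nat where k: "ell1 n x / r \<le> real k" using real_arch_simple by blast
    have "\<bar>x i\<bar> \<le> r * real (Suc k)" if "i < n" for i
    proof -
      have "\<bar>x i\<bar> \<le> r * real k" using coord_le_ell1[OF that, of x] k r by (simp add: field_simps)
      then show ?thesis using r by (simp add: algebra_simps)
    qed
    then have "(1 / real (Suc k)) *\<^sub>R x \<in> B"
      using x by (intro inner real_space_scaleR) (auto simp: abs_mult field_simps)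
    then show "x \<in> (\<Union>k. dil (real (Suc k)))" by (auto simp: dil_iff intro!: exI[of _ k])
  qed
  have "emeasure (leb n) (\<Union>k::nat. dil (real (Suc k))) = 0"
    by (rule emeasure_UN_eq_0) (auto simp: emeasure_dil z)
  then have "(\<Union>k::nat. dil (real (Suc k))) \<in> null_sets (leb n)" by (intro null_setsI) auto
  then have "AE x in leb n. x \<notin> (\<Union>k::nat. dil (real (Suc k)))" by (rule AE_not_in)
  with AE_leb_real_space[of n] have "AE x in leb n. False"
    by eventually_elim (use cov in auto)
  then have "(\<integral>x. exp (- (\<Sum>k<n. (x k)\<^sup>2) / 2) \<partial>leb n) = (\<integral>x. 0 \<partial>leb n)"
    by (intro integral_cong_AE) (auto elim: eventually_mono)
  then show False unfolding integral_gauss by simp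
qed

lemma v_pos: "v > 0"
  using posB finB by (simp add: v_def measure_def enn2real_positive_iff)

lemma emeasure_dil_pos: "c > 0 \<Longrightarrow> emeasure (leb n) (dil c) > 0"
  using posB by (simp add: emeasure_dil ennreal_zero_less_mult_iff)

text \<open>Translates of \<open>dil (1 / 4)\<close> are packed into \<open>dil (a + 1 / 4)\<close>:
  the volume ratio is \<open>(4 * a + 1) ^ n\<close>, and differences of two points of the small
  copy lie in \<open>dil (1 / 2)\<close>.\<close>

lemma dil_net:
  assumes a: "a > 0"
  shows "\<exists>U. finite U \<and> U \<subseteq> dil a \<and> real (card U) \<le> (4 * a + 1) ^ n \<and> (\<forall>x\<in>dil a. \<exists>u\<in>U. x - u \<in> dil (1 / 2))"
proof -
  obtain U where U: "finite U" "U \<subseteq> dil a" "real (card U) * measure (leb n) (dil (1 / 4)) \<le> measure (leb n) (dil (a + 1 / 4))"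
    "\<And>x. x \<in> dil a \<Longrightarrow> \<exists>u\<in>U. \<exists>m\<in>dil (1 / 4). \<exists>m'\<in>dil (1 / 4). x = u + m - m'"
  proof (rule packing_cover[of "dil a" n "dil (1 / 4)" "dil (a + 1 / 4)"])
    show "u + m \<in> dil (a + 1 / 4)" if "u \<in> dil a" "m \<in> dil (1 / 4)" for u m
      using that a by (intro dil_add) auto
  qed (use dil_sub a fin_dil emeasure_dil_pos in auto)
  show ?thesis
  proof (intro exI[of _ U] conjI ballI U(1,2))
    have "real (card U) * ((1 / 4) ^ n * v) \<le> (a + 1 / 4) ^ n * v"
      using U(3) a by (simp add: vol_dil)
    then have "real (card U) * (1 / 4) ^ n \<le> (a + 1 / 4) ^ n" using v_pos by simp
    then have "real (card U) * ((1 / 4) ^ n * 4 ^ n) \<le> (a + 1 / 4) ^ n * 4 ^ n"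
      by (simp only: mult.assoc[symmetric]) (rule mult_right_mono, auto)
    then show "real (card U) \<le> (4 * a + 1) ^ n"
      unfolding power_mult_distrib[symmetric] by (simp add: algebra_simps)
    fix x assume "x \<in> dil a"
    then obtain u m m' where u: "u \<in> U" "m \<in> dil (1 / 4)" "m' \<in> dil (1 / 4)" "x = u + m - m'" using U(4) by blast
    then show "\<exists>u\<in>U. x - u \<in> dil (1 / 2)"
      using dil_diff[of "1/4" "1/4" m m'] by (intro bexI[of _ u]) (simp_all add: add_diff_eq[symmetric])
  qed
qed

text \<open>\<open>V\<close> is a symmetrized half-net of \<open>B\<close>, so its support function
  is at least half of that of \<open>B\<close>: the supremum \<open>s\<close> over \<open>B\<close>
  satisfies \<open>s \<le> a + s / 2\<close>, because the error \<open>y - u\<close> lies in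
  \<open>dil (1 / 2)\<close>.\<close>

lemma net_V:
  "\<exists>V. finite V \<and> V \<noteq> {} \<and> V \<subseteq> B \<and> (\<forall>x\<in>V. - x \<in> V) \<and> real (card V) \<le> 2 * 5 ^ n \<and>
    (\<forall>x y a. (\<forall>u\<in>V. dot n u x \<le> a) \<longrightarrow> y \<in> B \<longrightarrow> dot n y x \<le> 2 * a)"
proof -
  have E: "\<exists>U. finite U \<and> U \<subseteq> dil 1 \<and> real (card U) \<le> 5 ^ n \<and> (\<forall>x\<in>dil 1. \<exists>u\<in>U. x - u \<in> dil (1 / 2))"
    using dil_net[of 1] by simp
  obtain U where U: "finite U" "U \<subseteq> dil 1" "real (card U) \<le> 5 ^ n"
    "\<forall>x\<in>dil 1. \<exists>u\<in>U. x - u \<in> dil (1 / 2)"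
    using E by (elim exE conjE)
  define V where "V = U \<union> uminus ` U"
  show ?thesis
  proof (intro exI[of _ V] conjI ballI allI impI)
    show "finite V" using U by (simp add: V_def)
    show "V \<noteq> {}" using U(4)[unfolded dil_1, rule_format, OF zeroB] by (auto simp: V_def)
    show "V \<subseteq> B" using U(2) symm by (auto simp: V_def dil_1)
    show "- x \<in> V" if "x \<in> V" for x using that by (auto simp: V_def)
    have "card V \<le> card U + card (uminus ` U)" unfolding V_def by (rule card_Un_le)
    also have "\<dots> \<le> card U + card U" using card_image_le[OF U(1)] by simp
    finally have "real (card V) \<le> real (card U) + real (card U)" by (simp flip: of_nat_add)
    then show "real (card V) \<le> 2 * 5 ^ n" using U(3) by linarith
    fix x y a assume a: "\<forall>u\<in>V. dot n u x \<le> a" and y: "y \<in> B"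
    define s where "s = Sup ((\<lambda>y. dot n y x) ` B)"
    have "compact ((\<lambda>y. dot n y x) ` B)"
      unfolding dot_commute[of n _ x] by (intro compact_continuous_image comp continuous_intros)
    then have bdd: "bdd_above ((\<lambda>y. dot n y x) ` B)"
      by (intro bounded_imp_bdd_above compact_imp_bounded)
    have le: "dot n y x \<le> s" if "y \<in> B" for y unfolding s_def using that bdd by (intro cSup_upper) auto
    have "s \<le> a + s / 2"
      unfolding s_def[symmetric]
    proof (subst s_def, rule cSup_least)
      show "(\<lambda>y. dot n y x) ` B \<noteq> {}" using zeroB by auto
      fix d assume "d \<in> (\<lambda>y. dot n y x) ` B"
      then obtain y where y: "y \<in> B" "d = dot n y x" by auto
      obtain u where u: "u \<in> U" "y - u \<in> dil (1 / 2)" using U(4)[unfolded dil_1, rule_format, OF y(1)] by blast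
      have "dot n (2 *\<^sub>R (y - u)) x \<le> s" using u(2) by (intro le) (simp add: dil_iff)
      then have "dot n (y - u) x \<le> s / 2" by (simp add: dot_scaleR_left)
      moreover have "dot n u x \<le> a" using u(1) a by (simp add: V_def)
      ultimately show "d \<le> a + s / 2" using y(2) by (simp add: dot_minus_left)
    qed
    then show "dot n y x \<le> 2 * a" using le[OF y] by simp
  qed
qed

text \<open>A finite subset of \<open>n\<close> times the polar whose support function is at least
  \<open>n / 4\<close> times the gauge of \<open>B\<close>. A point \<open>y'\<close> of gauge
  between \<open>3 / 2\<close> and 2 is rounded to a net point \<open>u\<close>, still outside
  \<open>B\<close>, and the functional that separates \<open>u\<close> from \<open>B\<close> is at
  least \<open>1 / 2\<close> at \<open>y'\<close>.\<close>

lemma net_W: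
  "\<exists>W. finite W \<and> real (card W) \<le> 9 ^ n \<and> (\<forall>w\<in>W. \<forall>y\<in>B. dot n w y \<le> real n) \<and>
    (\<forall>y\<in>real_space n. \<forall>t>0. y \<notin> dil t \<longrightarrow> (\<exists>w\<in>W. real n * t / 4 \<le> dot n w y))"
proof -
  have E: "\<exists>U. finite U \<and> U \<subseteq> dil 2 \<and> real (card U) \<le> 9 ^ n \<and> (\<forall>x\<in>dil 2. \<exists>u\<in>U. x - u \<in> dil (1 / 2))"
    using dil_net[of 2] by simp
  obtain U where U: "finite U" "U \<subseteq> dil 2" "real (card U) \<le> 9 ^ n"
    "\<forall>x\<in>dil 2. \<exists>u\<in>U. x - u \<in> dil (1 / 2)"
    using E by (elim exE conjE)
  have "\<forall>u\<in>U - B. \<exists>x. x \<in> real_space n \<and> (\<forall>y\<in>B. dot n x y \<le> 1) \<and> dot n x u = 1"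
  proof
    fix u assume "u \<in> U - B"
    then have "u \<in> real_space n" "u \<notin> B" using U(2) dil_sub by auto
    then show "\<exists>x. x \<in> real_space n \<and> (\<forall>y\<in>B. dot n x y \<le> 1) \<and> dot n x u = 1"
      by (rule convex_separation[OF comp sub conv zeroB])
  qed
  from bchoice[OF this] obtain f where f0: "\<forall>u\<in>U - B. f u \<in> real_space n \<and> (\<forall>y\<in>B. dot n (f u) y \<le> 1) \<and> dot n (f u) u = 1"
    by (elim exE)
  have f: "(\<forall>y\<in>B. dot n (f u) y \<le> 1) \<and> dot n (f u) u = 1" if "u \<in> U - B" for u
    using f0 that by blast
  define W where "W = (\<lambda>u. real n *\<^sub>R f u) ` (U - B)"
  show ?thesis
  proof (intro exI[of _ W] conjI ballI allI impI)
    show "finite W" using U by (simp add: W_def)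
    have "card W \<le> card (U - B)" unfolding W_def using U(1) by (intro card_image_le) auto
    also have "\<dots> \<le> card U" using U(1) by (intro card_mono) auto
    finally show "real (card W) \<le> 9 ^ n" using U(3) by simp
    show "dot n w y \<le> real n" if w: "w \<in> W" and yB: "y \<in> B" for w y
    proof -
      obtain u where u: "u \<in> U - B" "w = real n *\<^sub>R f u" using w by (auto simp: W_def)
      have "real n * dot n (f u) y \<le> real n * 1" using f[OF u(1)] yB by (intro mult_left_mono) auto
      then show ?thesis by (simp add: u(2) dot_scaleR_left)
    qed
    fix y t assume y: "y \<in> real_space n" "t > 0" "y \<notin> dil t"
    define T where "T = {s. s > 0 \<and> y \<in> dil s}"
    have Tne: "T \<noteq> {}"
    proof -
      have "T \<noteq> {}"
      proof -
        have p: "(ell1 n y + 1) / r > 0" using r ell1_nonneg[of n y] by (intro divide_pos_pos) linarith+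
        have "(1 / ((ell1 n y + 1) / r)) *\<^sub>R y \<in> B"
        proof (intro inner real_space_scaleR y(1))
          fix i assume "i < n"
          then have "\<bar>y i\<bar> \<le> ell1 n y + 1" using coord_le_ell1[of i n y] by simp
          then have "r / (ell1 n y + 1) * \<bar>y i\<bar> \<le> r / (ell1 n y + 1) * (ell1 n y + 1)"
            using r ell1_nonneg[of n y] by (intro mult_left_mono divide_nonneg_pos) linarith+
          also have "\<dots> = r"
          proof -
            have "ell1 n y + 1 \<noteq> 0" using ell1_nonneg[of n y] by linarith
            then show ?thesis by simp
          qed
          finally show "\<bar>((1 / ((ell1 n y + 1) / r)) *\<^sub>R y) i\<bar> \<le> r"
            using r ell1_nonneg[of n y] by (simp add: abs_mult)
        qed
        with p have "(ell1 n y + 1) / r \<in> T" unfolding T_def mem_Collect_eq using dil_iff[OF p] by (intro conjI iffD2[OF dil_iff[OF p]])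
        then show ?thesis by blast
      qed
      then show ?thesis .
    qed
    have Tt: "t \<le> s" if s: "s \<in> T" for s
    proof (rule ccontr)
      assume "\<not> t \<le> s"
      then have "y \<in> dil t" using s dil_mono[of s t y] by (simp add: T_def)
      then show False using y(3) by blast
    qed
    have bdd: "bdd_below T" by (rule bdd_belowI[of _ t]) (rule Tt)
    define t0 where "t0 = Inf T"
    have t0: "t \<le> t0" unfolding t0_def using Tne Tt by (rule cInf_greatest)
    \<comment> \<open>Choosing \<open>t1\<close> within the factor \<open>4 / 3\<close> of the
      infimum places \<open>y\<close> in \<open>dil t1\<close> but not in
      \<open>dil (3 / 4 * t1)\<close>.\<close>
    have "t0 < 4 / 3 * t0" using t0 y(2) by simp
    then have "Inf T < 4 / 3 * t0" by (simp only: t0_def[symmetric])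
    from cInf_lessD[OF Tne this] obtain t1 where t1: "t1 \<in> T" "t1 < 4 / 3 * t0" by (elim bexE)
    have t1d: "t1 > 0" "y \<in> dil t1" using t1(1) unfolding T_def by simp_all
    have t1p: "t1 > 0" "t0 \<le> t1" using t1d cInf_lower[OF t1(1) bdd] by (simp_all add: t0_def)
    have nin: "y \<notin> dil (3 / 4 * t1)"
    proof
      assume "y \<in> dil (3 / 4 * t1)"
      then have "3 / 4 * t1 \<in> T" using t1p by (simp add: T_def)
      then have "t0 \<le> 3 / 4 * t1" unfolding t0_def by (rule cInf_lower[OF _ bdd])
      then show False using t1 by simp
    qed
    define y' where "y' = (2 / t1) *\<^sub>R y"
    have "y' \<in> dil (2 / t1 * t1)" unfolding y'_def using t1d by (intro dil_scale) simp_all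
    then have y2: "y' \<in> dil 2" using t1p by simp
    have y3: "y' \<notin> dil (3 / 2)"
    proof
      assume "y' \<in> dil (3 / 2)"
      then have "(t1 / 2) *\<^sub>R y' \<in> dil (t1 / 2 * (3 / 2))" using t1p by (intro dil_scale) simp_all
      moreover have "(t1 / 2) *\<^sub>R y' = y" "t1 / 2 * (3 / 2) = 3 / 4 * t1" using t1d by (simp_all add: y'_def)
      ultimately have "y \<in> dil (3 / 4 * t1)" by (simp only:)
      then show False using nin by blast
    qed
    obtain u where u: "u \<in> U" "y' - u \<in> dil (1 / 2)" using U(4)[rule_format, OF y2] by blast
    have "u \<notin> B"
    proof
      assume "u \<in> B"
      then have "u + (y' - u) \<in> dil (1 + 1 / 2)" using u by (intro dil_add) (auto simp: dil_1)
      then show False using y3 by simp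
    qed
    then have uB: "u \<in> U - B" using u by simp
    have "- (2 *\<^sub>R (y' - u)) \<in> B" using u(2) by (intro symm) (simp add: dil_iff)
    then have "dot n (f u) (- (2 *\<^sub>R (y' - u))) \<le> 1" using f[OF uB] by blast
    then have "dot n (f u) (y' - u) \<ge> - 1 / 2" by (simp add: dot_neg dot_scaleR)
    then have "dot n (f u) y' \<ge> 1 / 2" using f[OF uB] by (simp add: dot_minus)
    then have "dot n (f u) y \<ge> t1 / 4" using t1p by (simp add: y'_def dot_scaleR field_simps)
    then have "real n * (t1 / 4) \<le> real n * dot n (f u) y" by (intro mult_left_mono) auto
    moreover have "real n * (t / 4) \<le> real n * (t1 / 4)" using t0 t1p by (intro mult_left_mono) auto
    ultimately show "\<exists>w\<in>W. real n * t / 4 \<le> dot n w y"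
      using uB by (intro bexI[of _ "real n *\<^sub>R f u"]) (auto simp: W_def dot_scaleR_left)
  qed
qed

end

lemma (in lse) F_le: "(\<And>u. u \<in> V \<Longrightarrow> dot n u x \<le> a) \<Longrightarrow> F x \<le> a"
proof -
  assume "\<And>u. u \<in> V \<Longrightarrow> dot n u x \<le> a"
  then have "Z x \<le> (\<Sum>v\<in>V. exp a)" unfolding Z_def by (intro sum_mono) simp
  then have "Z x / real (card V) \<le> exp a" using card_pos by (simp add: field_simps)
  then have "ln (Z x / real (card V)) \<le> ln (exp a)" using Z_pos card_pos by (subst ln_le_cancel_iff) auto
  then show ?thesis by (simp add: F_def)
qed

lemma (in lse) k0_ge: "(\<And>u. u \<in> V \<Longrightarrow> dot n u x \<le> a) \<Longrightarrow> exp (- a) \<le> k0 x"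
  unfolding k0_eq using F_le[of x a] by simp

text \<open>Sublevel sets of \<open>pm\<close> are cylinders in the function space, so they lie in a
  body only up to the null set outside \<open>real_space n\<close>.\<close>

lemma measure_mono_AE_fin:
  assumes "AE x in M. x \<in> A \<longrightarrow> x \<in> B" "B \<in> sets M" "emeasure M B < \<infinity>"
  shows "measure M A \<le> measure M B"
  unfolding measure_def using emeasure_mono_AE[OF assms(1,2)] assms(3) by (intro enn2real_mono) auto

context sbody begin

text \<open>\<open>W\<close> plays the role of a net of \<open>n B\<degree>\<close> and \<open>S\<close> that of a multiple of \<open>n B\<degree>\<close>; the last estimate is the
  Bourgain-Milman inequality.\<close>

lemma dual_volume:
  "\<exists>W S k \<eta>. lse W \<and> S \<in> sets borel \<and> \<eta> > 0 \<and> (\<forall>y. \<exists>w\<in>W. \<eta> * ell1 n y \<le> dot n w y) \<and>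
    (\<forall>w\<in>W. \<forall>y\<in>B. dot n w y \<le> real n) \<and> (\<forall>x\<in>S. \<forall>y\<in>B. \<bar>dot n y x\<bar> \<le> 8 * real n) \<and>
    k = (\<integral>x. lse.k0 n W x \<partial>leb n) \<and> k > 0 \<and> k \<le> 306 ^ n * v \<and> emeasure (leb n) S < \<infinity> \<and>
    1 \<le> 60 ^ n * measure (leb n) S * k"
proof -
  obtain V where V0: "finite V" "V \<noteq> {}" "V \<subseteq> B" "\<forall>x\<in>V. - x \<in> V" "real (card V) \<le> 2 * 5 ^ n"
    "\<forall>x y a. (\<forall>u\<in>V. dot n u x \<le> a) \<longrightarrow> y \<in> B \<longrightarrow> dot n y x \<le> 2 * a"
    using net_V by (elim exE conjE)
  have V: "finite V" "V \<noteq> {}" "V \<subseteq> B" "\<And>x. x \<in> V \<Longrightarrow> - x \<in> V" "real (card V) \<le> 2 * 5 ^ n"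
    "\<And>x y a. (\<And>u. u \<in> V \<Longrightarrow> dot n u x \<le> a) \<Longrightarrow> y \<in> B \<Longrightarrow> dot n y x \<le> 2 * a"
    using V0 by simp_all
  obtain W where W0: "finite W" "real (card W) \<le> 9 ^ n" "\<forall>w\<in>W. \<forall>y\<in>B. dot n w y \<le> real n"
    "\<forall>y\<in>real_space n. \<forall>t>0. y \<notin> dil t \<longrightarrow> (\<exists>w\<in>W. real n * t / 4 \<le> dot n w y)"
    using net_W by (elim exE conjE)
  have W: "finite W" "real (card W) \<le> 9 ^ n" "\<And>w y. w \<in> W \<Longrightarrow> y \<in> B \<Longrightarrow> dot n w y \<le> real n"
    "\<And>y t. y \<in> real_space n \<Longrightarrow> t > 0 \<Longrightarrow> y \<notin> dil t \<Longrightarrow> \<exists>w\<in>W. real n * t / 4 \<le> dot n w y"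
    using W0 by simp_all
  have n0: "real n > 0" using n by simp
  define R' where "R' = R + 1"
  have R': "R' > 0" using R0 by (simp add: R'_def)
  have out: "ell1 n y \<le> real n * (t * R')" if "t > 0" "y \<in> dil t" for y t
  proof -
    have "\<bar>y i\<bar> \<le> t * R'" for i
    proof -
      have "\<bar>((1 / t) *\<^sub>R y) i\<bar> \<le> R" using that by (intro outer) (simp only: dil_iff)
      then have "\<bar>y i\<bar> \<le> t * R" using that by (simp add: abs_mult field_simps)
      then show ?thesis using that by (simp add: R'_def algebra_simps)
    qed
    then have "ell1 n y \<le> (\<Sum>i<n. t * R')" unfolding ell1_def by (intro sum_mono)
    then show ?thesis by simp
  qed
  have Wne: "W \<noteq> {}"
  proof -
    define y :: "nat \<Rightarrow> real" where "y = (\<lambda>i. if i = 0 then 2 * R' else 0)"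
    have "y \<in> real_space n" using n by (simp add: mem_real_space y_def)
    moreover have "y \<notin> dil 1" using outer[of y 0] R' by (auto simp: dil_1 y_def R'_def)
    ultimately show ?thesis using W(4)[of y 1] by auto
  qed
  interpret V: lse n V by standard (use V in auto)
  interpret W: lse n W by standard (use W Wne in auto)
  define \<eta> where "\<eta> = 1 / (8 * R')"
  have \<eta>: "\<eta> > 0" using R' by (simp add: \<eta>_def)
  have spanW: "\<exists>w\<in>W. \<eta> * ell1 n y \<le> dot n w y" for y
  proof (cases "ell1 n y = 0")
    case True
    then have "y i = 0" if "i < n" for i using that by (auto simp: ell1_def sum_nonneg_eq_0_iff)
    then have "dot n w y = 0" for w by (simp add: dot_def)
    then show ?thesis using Wne True by auto
  next
    case False
    then have l: "ell1 n y > 0" using ell1_nonneg[of n y] by (metis less_le)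
    \<comment> \<open>Half of the smallest gauge that \<open>out\<close> allows for this value of
      \<open>ell1\<close>; hence the point lies outside \<open>dil t\<close>, and
      \<open>n * t / 4\<close> is the desired bound.\<close>
    define t where "t = ell1 n y / (2 * real n * R')"
    have t: "t > 0" using l n0 R' by (simp add: t_def)
    have "cut n y \<notin> dil t"
    proof
      assume "cut n y \<in> dil t"
      from out[OF t this] have "ell1 n y \<le> real n * (t * R')" by (simp add: ell1_cut)
      also have "\<dots> = ell1 n y / 2" using n0 R' by (simp add: t_def)
      finally show False using l by simp
    qed
    then obtain w where w: "w \<in> W" "real n * t / 4 \<le> dot n w (cut n y)" using W(4)[OF cut_real_space t] by blast
    have "real n * t / 4 = \<eta> * ell1 n y" using n0 R' by (simp add: t_def \<eta>_def)
    then show ?thesis using w by (auto simp: dot_cut)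
  qed
  have spanV: "\<exists>u\<in>V. (r / 2) * ell1 n x \<le> dot n u x" for x
  proof -
    define y where "y = (\<lambda>i. if i < n then r * sgn (x i) else 0)"
    have "y \<in> B" using r by (intro inner) (auto simp: mem_real_space y_def sgn_if)
    then have "dot n y x \<le> 2 * V.pm x" using V(6)[of x "V.pm x" y, OF V.pm_ge] by blast
    moreover have "dot n y x = r * ell1 n x"
      unfolding dot_def ell1_def sum_distrib_left by (intro sum.cong) (auto simp: y_def abs_sgn mult_ac)
    moreover obtain u where u: "u \<in> V" "V.pm x = dot n u x" using V.pm_attained by blast
    ultimately show ?thesis by (intro bexI[OF _ u(1)]) simp
  qed
  define S where "S = {x. V.pm x \<le> 4 * real n}"
  note pmV = V.pm_volume[OF spanV _ n, folded S_def]
  note pmW = W.pm_volume[OF spanW \<eta> n]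
  define k where "k = (\<integral>x. W.k0 x \<partial>leb n)"
  have intk: "integrable (leb n) W.k0" by (rule lse_integrable_k0[OF W.lse_axioms spanW \<eta>])
  have k_le: "k \<le> 306 ^ n * v"
  proof -
    \<comment> \<open>Outside \<open>dil 17\<close> the support function of \<open>W\<close> is at
      least \<open>17 * n / 4\<close>, which exceeds the threshold \<open>4 * n\<close>. Below, 306
      is \<open>9 * 2 * 17\<close>.\<close>
    have 1: "measure (leb n) {x. W.pm x \<le> 4 * real n} \<le> measure (leb n) (dil 17)"
    proof (rule measure_mono_AE_fin)
      show "AE x in leb n. x \<in> {x. W.pm x \<le> 4 * real n} \<longrightarrow> x \<in> dil 17"
        using AE_leb_real_space[of n]
      proof eventually_elim
        fix x assume x: "x \<in> real_space n"
        show "x \<in> {x. W.pm x \<le> 4 * real n} \<longrightarrow> x \<in> dil 17"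
        proof (rule impI, rule ccontr)
          assume a: "x \<in> {x. W.pm x \<le> 4 * real n}" "x \<notin> dil 17"
          then obtain w where "w \<in> W" "real n * 17 / 4 \<le> dot n w x" using W(4)[OF x, of 17] by auto
          then have "real n * 17 / 4 \<le> W.pm x" using W.pm_ge[of w x] by linarith
          then show False using a n0 by simp
        qed
      qed
    qed (use fin_dil[of 17] in auto)
    have "k \<le> (\<integral>x. real (card W) * exp (- W.pm x) \<partial>leb n)"
      unfolding k_def by (rule integral_mono[OF intk]) (use pmW W.k0_le_pm in auto)
    also have "\<dots> = real (card W) * (\<integral>x. exp (- W.pm x) \<partial>leb n)" by simp
    also have "\<dots> \<le> 9 ^ n * (2 * (17 ^ n * v))"
      using W(2) pmW(1) 1 by (intro mult_mono) (simp_all add: vol_dil)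
    also have "\<dots> \<le> 9 ^ n * (2 ^ n * (17 ^ n * v))"
      using v_pos power_increasing[OF n, of "2 :: real"] by (intro mult_left_mono mult_right_mono) auto
    also have "\<dots> = 306 ^ n * v" by (simp add: mult.assoc[symmetric] flip: power_mult_distrib)
    finally show ?thesis by simp
  qed
  define q where "q = (\<Sum>w\<in>W. \<Sum>i<n. (w i)\<^sup>2)"
  have q: "q \<ge> 0" unfolding q_def by (intro sum_nonneg) auto
  \<comment> \<open>Small enough that the quadratic term of \<open>phi\<close> is at most 1 on all
    of \<open>W\<close>.\<close>
  define \<epsilon> where "\<epsilon> = 1 / (1 + q)"
  have \<epsilon>: "0 < \<epsilon>" "\<epsilon> \<le> 1" using q by (auto simp: \<epsilon>_def)
  have phiW: "V.phi \<epsilon> w \<le> real n + 1" if w: "w \<in> W" for w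
  proof -
    have "V.F w \<le> real n"
      using W(3)[OF w] V(3) by (intro V.F_le) (auto simp: dot_commute[of n _ w])
    moreover have "(\<Sum>i<n. (w i)\<^sup>2) \<le> q"
      unfolding q_def using W(1) w by (intro member_le_sum) (auto intro: sum_nonneg)
    then have "\<epsilon> / 2 * (\<Sum>i<n. (w i)\<^sup>2) \<le> \<epsilon> / 2 * q" using \<epsilon> by (intro mult_left_mono) auto
    moreover have "\<epsilon> / 2 * q \<le> 1" using q by (simp add: \<epsilon>_def field_simps)
    ultimately show ?thesis by (simp add: V.phi_def)
  qed
  have symV: "(\<lambda>i. - u i) \<in> V" if "u \<in> V" for u
  proof -
    have "(\<lambda>i. - u i) = - u" by auto
    then show ?thesis using V(4)[OF that] by simp
  qed
  have pv: "pi ^ n \<le> exp (real n + 1) * (\<integral>x. exp (- V.phi \<epsilon> x) \<partial>leb n) * k"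
    unfolding k_def by (rule V.volume_product[OF symV \<epsilon> W.lse_axioms spanW \<eta> phiW])
  have pv2: "(\<integral>x. exp (- V.phi \<epsilon> x) \<partial>leb n) \<le> (2 * 5 ^ n) * (2 * measure (leb n) S)"
  proof -
    have "(\<integral>x. exp (- V.phi \<epsilon> x) \<partial>leb n) \<le> (\<integral>x. real (card V) * exp (- V.pm x) \<partial>leb n)"
    proof (rule integral_mono[OF V.integrable_exp_phi[OF symV \<epsilon>]])
      show "integrable (leb n) (\<lambda>x. real (card V) * exp (- V.pm x))" using pmV r by auto
      fix x
      have "0 \<le> \<epsilon> / 2 * (\<Sum>i<n. (x i)\<^sup>2)" using \<epsilon> by (intro mult_nonneg_nonneg sum_nonneg) auto
      then have "exp (- V.phi \<epsilon> x) \<le> V.k0 x" by (simp add: V.phi_def V.k0_eq)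
      also have "\<dots> \<le> real (card V) * exp (- V.pm x)" by (rule V.k0_le_pm)
      finally show "exp (- V.phi \<epsilon> x) \<le> real (card V) * exp (- V.pm x)" .
    qed
    also have "\<dots> = real (card V) * (\<integral>x. exp (- V.pm x) \<partial>leb n)" by simp
    also have "\<dots> \<le> (2 * 5 ^ n) * (2 * measure (leb n) S)"
      using V(5) pmV(1) r by (intro mult_mono) auto
    finally show ?thesis .
  qed
  have kn: "k \<ge> 0" unfolding k_def by (intro Bochner_Integration.integral_nonneg less_imp_le W.k0_pos)
  have main: "pi ^ n \<le> exp (real n + 1) * ((2 * 5 ^ n) * (2 * measure (leb n) S)) * k"
    by (rule order_trans[OF pv]) (intro mult_right_mono mult_left_mono pv2 kn, simp)
  have k0: "k > 0"
  proof (rule ccontr)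
    assume "\<not> k > 0"
    then have "k = 0" using kn by simp
    then show False using main zero_less_power[OF pi_gt_zero, of n] by simp
  qed
  have e3: "exp 1 \<le> (3 :: real)" using exp_le by simp
  \<comment> \<open>Here \<open>exp (n + 1)\<close> is at most \<open>9 ^ n\<close> and
    \<open>4 * 5 ^ n\<close> at most \<open>20 ^ n\<close>, which gives 180; comparing with
    \<open>3 ^ n\<close>, a lower bound of \<open>pi ^ n\<close>, leaves 60.\<close>
  have c: "exp (real n + 1) * ((2 * 5 ^ n) * (2 * m)) * k \<le> 180 ^ n * m * k" if m: "m \<ge> 0" for m
  proof -
    have "exp (real n + 1) = exp 1 ^ n * exp 1" by (simp add: exp_add exp_of_nat_mult[symmetric])
    also have "\<dots> \<le> 3 ^ n * 3" using e3 by (intro mult_mono power_mono) auto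
    also have "\<dots> \<le> 3 ^ n * 3 ^ n" using power_increasing[OF n, of "3 :: real"] by (intro mult_left_mono) auto
    finally have "exp (real n + 1) \<le> 9 ^ n" by (simp flip: power_mult_distrib)
    moreover have "(2 * 5 ^ n) * (2 * m) \<le> (20 ^ n) * m"
    proof -
      have "(4 :: real) * 5 ^ n \<le> 4 ^ n * 5 ^ n" using power_increasing[OF n, of "4 :: real"] by (intro mult_right_mono) auto
      then have "4 * 5 ^ n \<le> (20 :: real) ^ n" by (simp flip: power_mult_distrib)
      from mult_right_mono[OF this m] show ?thesis by simp
    qed
    ultimately have "exp (real n + 1) * ((2 * 5 ^ n) * (2 * m)) \<le> 9 ^ n * (20 ^ n * m)"
      by (rule mult_mono) (use m in simp_all)
    also have "\<dots> = 180 ^ n * m" by (simp add: mult.assoc[symmetric] flip: power_mult_distrib)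
    finally show ?thesis using k0 by (intro mult_right_mono) auto
  qed
  have "3 ^ n \<le> pi ^ n" using pi_gt3 by (intro power_mono) auto
  then have "3 ^ n \<le> 180 ^ n * measure (leb n) S * k" using main c[of "measure (leb n) S"] by simp
  moreover have "(180 :: real) ^ n = 3 ^ n * 60 ^ n" by (simp flip: power_mult_distrib)
  ultimately have "3 ^ n * 1 \<le> 3 ^ n * (60 ^ n * measure (leb n) S * k)" by (simp only: mult.assoc mult_1_right)
  then have prod1: "1 \<le> 60 ^ n * measure (leb n) S * k" by simp
  show ?thesis
  proof (intro exI conjI allI ballI; (rule W.lse_axioms \<eta> spanW k_def k0 k_le prod1)?)
    show "dot n w y \<le> real n" if "w \<in> W" "y \<in> B" for w y using W(3) that by blast
    show "S \<in> sets borel" unfolding S_def by measurable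
    show "emeasure (leb n) S < \<infinity>" using pmV(3) r by simp
    fix x y assume x: "x \<in> S" and y: "y \<in> B"
    have S: "dot n u x \<le> 4 * real n" if "u \<in> V" for u
      using x that unfolding S_def by (simp add: V.pm_le_iff)
    have "dot n y x \<le> 2 * (4 * real n)" "dot n (- y) x \<le> 2 * (4 * real n)"
      using V(6)[of x "4 * real n" y, OF S y] V(6)[of x "4 * real n" "- y", OF S symm[OF y]] by blast+
    then show "\<bar>dot n y x\<bar> \<le> 8 * real n" by (simp add: dot_neg_left)
  qed
qed

end

section \<open>Quadratic forms and triangular orthonormal systems\<close>

definition qf :: "nat \<Rightarrow> (nat \<Rightarrow> nat \<Rightarrow> real) \<Rightarrow> (nat \<Rightarrow> real) \<Rightarrow> (nat \<Rightarrow> real) \<Rightarrow> real" where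
  "qf n A u w = (\<Sum>i<n. \<Sum>j<n. u i * A i j * w j)"

lemma qf_lin:
  "qf n A (\<lambda>i. u i - (\<Sum>l<m. c l * R l i)) w = qf n A u w - (\<Sum>l<m. c l * qf n A (R l) w)"
  "qf n A w (\<lambda>i. u i - (\<Sum>l<m. c l * R l i)) = qf n A w u - (\<Sum>l<m. c l * qf n A w (R l))"
proof -
  have 1: "(\<Sum>l<m. c l * qf n A (R l) w) = (\<Sum>i<n. \<Sum>j<n. (\<Sum>l<m. c l * R l i) * A i j * w j)"
  proof -
    have "(\<Sum>l<m. c l * qf n A (R l) w) = (\<Sum>l<m. \<Sum>i<n. \<Sum>j<n. c l * R l i * A i j * w j)"
      by (simp add: qf_def sum_distrib_left mult.assoc)
    also have "\<dots> = (\<Sum>i<n. \<Sum>l<m. \<Sum>j<n. c l * R l i * A i j * w j)" by (rule sum.swap)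
    also have "\<dots> = (\<Sum>i<n. \<Sum>j<n. \<Sum>l<m. c l * R l i * A i j * w j)" by (intro sum.cong refl sum.swap)
    finally show ?thesis by (simp add: sum_distrib_right)
  qed
  show "qf n A (\<lambda>i. u i - (\<Sum>l<m. c l * R l i)) w = qf n A u w - (\<Sum>l<m. c l * qf n A (R l) w)"
    unfolding 1 by (simp add: qf_def left_diff_distrib sum_subtractf)
  have 2: "(\<Sum>l<m. c l * qf n A w (R l)) = (\<Sum>i<n. \<Sum>j<n. w i * A i j * (\<Sum>l<m. c l * R l j))"
  proof -
    have "(\<Sum>l<m. c l * qf n A w (R l)) = (\<Sum>l<m. \<Sum>i<n. \<Sum>j<n. w i * A i j * (c l * R l j))"
      by (simp add: qf_def sum_distrib_left mult_ac)
    also have "\<dots> = (\<Sum>i<n. \<Sum>l<m. \<Sum>j<n. w i * A i j * (c l * R l j))" by (rule sum.swap)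
    also have "\<dots> = (\<Sum>i<n. \<Sum>j<n. \<Sum>l<m. w i * A i j * (c l * R l j))" by (intro sum.cong refl sum.swap)
    finally show ?thesis by (simp add: sum_distrib_left)
  qed
  show "qf n A w (\<lambda>i. u i - (\<Sum>l<m. c l * R l i)) = qf n A w u - (\<Sum>l<m. c l * qf n A w (R l))"
    unfolding 2 by (simp add: qf_def right_diff_distrib sum_subtractf)
qed

lemma qf_scale: "qf n A (\<lambda>i. c * u i) w = c * qf n A u w" "qf n A w (\<lambda>i. c * u i) = c * qf n A w u"
  by (simp_all add: qf_def sum_distrib_left mult_ac)

lemma qf_sym:
  assumes "\<And>i j. A i j = A j i" shows "qf n A u w = qf n A w u"
proof -
  have "qf n A u w = (\<Sum>j<n. \<Sum>i<n. u i * A i j * w j)" unfolding qf_def by (rule sum.swap)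
  also have "\<dots> = qf n A w u" unfolding qf_def by (intro sum.cong refl) (simp add: assms mult_ac)
  finally show ?thesis .
qed

text \<open>The Gram-Schmidt process for the inner product \<open>A\<close>, applied to the unit
  vectors in order. For \<open>m = n\<close> the rows satisfy \<open>R A R\<^sup>T = 1\<close>, so
  the forms \<open>dot n (R i) x\<close> measure \<open>x\<close> in the norm of the inverse of
  \<open>A\<close>. For a covariance matrix this describes the covariance ellipsoid in triangular
  coordinates.\<close>

lemma gram_schmidt:
  assumes sym: "\<And>i j. A i j = A j i" and pd: "\<And>u i. i < n \<Longrightarrow> u i \<noteq> 0 \<Longrightarrow> qf n A u u > 0" and "m \<le> n"
  shows "\<exists>R. (\<forall>i<m. \<forall>j>i. R i j = 0) \<and> (\<forall>i<m. R i i > 0) \<and> (\<forall>i<m. \<forall>l<m. qf n A (R i) (R l) = (if i = l then 1 else 0))"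
  using \<open>m \<le> n\<close>
proof (induction m)
  case (Suc m)
  then obtain R where R: "\<forall>i<m. \<forall>j>i. R i j = 0" "\<forall>i<m. R i i > 0"
    "\<forall>i<m. \<forall>l<m. qf n A (R i) (R l) = (if i = l then 1 else 0)" by auto
  define e :: "nat \<Rightarrow> real" where "e = (\<lambda>i. if i = m then 1 else 0)"
  define t where "t = (\<lambda>i. e i - (\<Sum>l<m. qf n A e (R l) * R l i))"
  have tm: "t m = 1"
    using R(1) by (simp add: t_def e_def)
  have t0: "t j = 0" if "m < j" for j
  proof -
    have "(\<Sum>l<m. qf n A e (R l) * R l j) = 0" using R(1) that by (intro sum.neutral) auto
    then show ?thesis using that by (simp add: t_def e_def)
  qed
  have tR: "qf n A t (R i) = 0" if "i < m" for i
  proof -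
    have "qf n A t (R i) = qf n A e (R i) - (\<Sum>l<m. qf n A e (R l) * qf n A (R l) (R i))"
      unfolding t_def by (rule qf_lin)
    also have "(\<Sum>l<m. qf n A e (R l) * qf n A (R l) (R i)) = (\<Sum>l<m. if l = i then qf n A e (R l) else 0)"
      using R(3) that by (intro sum.cong) auto
    also have "\<dots> = qf n A e (R i)" using that by simp
    finally show ?thesis by simp
  qed
  have tt: "qf n A t t > 0" using pd[of m t] tm Suc.prems by simp
  define c where "c = 1 / sqrt (qf n A t t)"
  have c: "c > 0" "c * c * qf n A t t = 1" using tt by (auto simp: c_def)
  define R' where "R' = R(m := (\<lambda>i. c * t i))"
  have "qf n A (R' i) (R' l) = (if i = l then 1 else 0)" if "i < Suc m" "l < Suc m" for i l
  proof -
    consider "i < m" "l < m" | "i = m" "l < m" | "i < m" "l = m" | "i = m" "l = m" using \<open>i < Suc m\<close> \<open>l < Suc m\<close> by linarith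
    then show ?thesis
    proof cases
      case 1 then show ?thesis using R(3) by (simp add: R'_def)
    next
      case 2 then show ?thesis by (simp add: R'_def qf_scale tR)
    next
      case 3 then show ?thesis by (simp add: R'_def qf_scale tR qf_sym[of A n "R i" t, OF sym])
    next
      case 4 then show ?thesis using c(2) by (simp add: R'_def qf_scale mult.assoc)
    qed
  qed
  moreover have "\<forall>i<Suc m. \<forall>j>i. R' i j = 0" using R(1) t0 by (auto simp: R'_def less_Suc_eq)
  moreover have "\<forall>i<Suc m. R' i i > 0" using R(2) tm c by (auto simp: R'_def less_Suc_eq)
  ultimately show ?case by blast
qed simp

lemma ldet_lower_triangular:
  fixes a :: "nat \<Rightarrow> nat \<Rightarrow> real"
  assumes "\<And>i j. i < j \<Longrightarrow> j < n \<Longrightarrow> a i j = 0" shows "ldet n a = (\<Prod>i<n. a i i)"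
proof -
  let ?A = "Matrix.mat n n (\<lambda>(i, j). a i j)"
  have "Determinant.det ?A = prod_list (diag_mat ?A)"
    by (rule det_lower_triangular[of n]) (use assms in auto)
  also have "\<dots> = (\<Prod>i<n. a i i)"
    by (simp add: prod_list_diag_prod atLeast0LessThan)
  finally show ?thesis by (simp add: ldet_eq_det)
qed

text \<open>Determinants are taken in \<open>R A R\<^sup>T = 1\<close>, where \<open>R\<close> is
  triangular.\<close>

lemma gram_schmidt_det:
  fixes A R :: "nat \<Rightarrow> nat \<Rightarrow> real"
  assumes "\<And>i j. i < n \<Longrightarrow> i < j \<Longrightarrow> R i j = 0" and "\<And>i l. i < n \<Longrightarrow> l < n \<Longrightarrow> qf n A (R i) (R l) = (if i = l then 1 else 0)"
  shows "ldet n A * (\<Prod>i<n. R i i)\<^sup>2 = 1"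
proof -
  have "ldet n (\<lambda>i l. \<Sum>k<n. (\<Sum>j<n. R i j * A j k) * R l k) = ldet n R * ldet n A * ldet n (\<lambda>k l. R l k)"
    by (simp only: det_mat_mult)
  moreover have "ldet n (\<lambda>i l. \<Sum>k<n. (\<Sum>j<n. R i j * A j k) * R l k) = ldet n (\<lambda>k j. if j = k then 1 else 0)"
  proof (rule ldet_cong)
    fix i l assume il: "i < n" "l < n"
    have "(\<Sum>k<n. (\<Sum>j<n. R i j * A j k) * R l k) = (\<Sum>k<n. \<Sum>j<n. R i j * A j k * R l k)"
      by (simp add: sum_distrib_right)
    also have "\<dots> = qf n A (R i) (R l)" unfolding qf_def by (rule sum.swap)
    finally show "(\<Sum>k<n. (\<Sum>j<n. R i j * A j k) * R l k) = (if l = i then 1 else 0)"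
      using assms(2)[OF il] by auto
  qed
  moreover have "ldet n R = (\<Prod>i<n. R i i)" using assms(1) by (intro ldet_lower_triangular) auto
  ultimately show ?thesis by (simp add: ldet_one ldet_transpose[of n R] power2_eq_square mult_ac)
qed

section \<open>Milman ellipsoids\<close>

lemma qf_add_scalar: "qf n (\<lambda>i j. A i j + (if i = j then \<delta> else 0)) u w = qf n A u w + \<delta> * dot n u w"
proof -
  have "(\<Sum>i<n. \<Sum>j<n. u i * (if i = j then \<delta> else 0) * w j) = (\<Sum>i<n. \<delta> * (u i * w i))"
  proof (intro sum.cong refl)
    fix i assume "i \<in> {..<n}"
    then have "(\<Sum>j<n. u i * (if i = j then \<delta> else 0) * w j) = (\<Sum>j<n. if i = j then u i * \<delta> * w j else 0)"
      by (intro sum.cong) auto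
    then show "(\<Sum>j<n. u i * (if i = j then \<delta> else 0) * w j) = \<delta> * (u i * w i)" using \<open>i \<in> _\<close> by simp
  qed
  then show ?thesis
    by (simp add: qf_def dot_def sum.distrib sum_distrib_left distrib_left distrib_right)
qed

lemma dot_self_coord: "i < n \<Longrightarrow> (u i)\<^sup>2 \<le> dot n u u"
  unfolding dot_def power2_eq_square by (rule member_le_sum) auto

text \<open>Because \<open>\<delta> \<le> 1\<close>, the form stays at least
  \<open>\<delta> * dot n v v\<close> along the segment from the identity, so no kernel vector
  occurs.\<close>

lemma ldet_pos:
  assumes pd: "\<And>u. \<delta> * dot n u u \<le> qf n A u u" and \<delta>: "0 < \<delta>" "\<delta> \<le> 1"
  shows "ldet n A > 0"
proof (rule ldet_pos_of_path)
  fix s i and v :: "nat \<Rightarrow> real" assume s: "0 \<le> s" "s \<le> 1" and i: "i < n"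
    and v: "\<And>i. i < n \<Longrightarrow> (1 - s) * v i + s * (\<Sum>j<n. A i j * v j) = 0"
  have "\<delta> * dot n v v \<le> (1 - s) * dot n v v + s * (\<delta> * dot n v v)"
  proof -
    have "(1 - s) * (\<delta> * dot n v v) \<le> (1 - s) * (1 * dot n v v)"
      using s \<delta> dot_self_nonneg[of n v] by (intro mult_left_mono mult_right_mono) auto
    then show ?thesis by (simp add: left_diff_distrib)
  qed
  also have "\<dots> \<le> (1 - s) * dot n v v + s * qf n A v v"
    using pd s by (intro add_left_mono mult_left_mono) auto
  also have "\<dots> = (\<Sum>i<n. v i * ((1 - s) * v i + s * (\<Sum>j<n. A i j * v j)))"
    by (simp add: qf_def dot_def distrib_left sum.distrib sum_distrib_left mult_ac)
  also have "\<dots> = 0" using v by simp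
  finally have "dot n v v \<le> 0" using \<delta> by (simp add: mult_le_0_iff)
  then have "(v i)\<^sup>2 \<le> 0" using dot_self_coord[OF i, of v] by linarith
  then show "v i = 0" by simp
qed

lemma dot_triangular:
  assumes "\<And>j. i < j \<Longrightarrow> R i j = 0" "i < n"
  shows "dot n (R i) x = (\<Sum>j\<le>i. R i j * x j)"
  unfolding dot_def using assms by (intro sum.mono_neutral_right) (auto simp: not_le)

text \<open>Injectivity is forward substitution along the triangle. A preimage of \<open>c\<close>
  is \<open>A R\<^sup>T (s c)\<close>, since \<open>R A R\<^sup>T = 1\<close>.\<close>

lemma triangular_GL:
  assumes R: "\<And>i j. i < n \<Longrightarrow> i < j \<Longrightarrow> R i j = 0" "\<And>i. i < n \<Longrightarrow> R i i > 0"
    and orth: "\<And>i l. i < n \<Longrightarrow> l < n \<Longrightarrow> qf n A (R i) (R l) = (if i = l then 1 else 0)" and s: "s > 0"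
  shows "(\<lambda>x i. if i < n then dot n (R i) x / s else 0) \<in> GL n"
proof -
  let ?\<gamma> = "\<lambda>x i. if i < n then dot n (R i) x / s else 0"
  have lin: "linear ?\<gamma>"
    by (rule linearI) (auto simp: dot_plus dot_scaleR add_divide_distrib)
  have inj: "x = y" if xy: "x \<in> real_space n" "y \<in> real_space n" "?\<gamma> x = ?\<gamma> y" for x y
  proof -
    define z where "z = x - y"
    have z: "z \<in> real_space n" using xy by (simp add: z_def real_space_diff)
    have dz: "dot n (R i) z = 0" if "i < n" for i
    proof -
      have "?\<gamma> x i = ?\<gamma> y i" by (rule fun_cong[OF xy(3)])
      then show ?thesis using that s by (simp add: z_def dot_minus)
    qed
    have "z i = 0" if "i < n" for i
      using that
    proof (induction i rule: less_induct)
      case (less i)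
      have "(\<Sum>j\<le>i. R i j * z j) = 0"
        using dz[OF less.prems] dot_triangular[of i R n z, OF R(1)[OF less.prems] less.prems] by simp
      also have "(\<Sum>j\<le>i. R i j * z j) = (\<Sum>j\<in>{i}. R i j * z j)"
        using less by (intro sum.mono_neutral_right) auto
      finally show ?case using R(2)[OF less.prems] by simp
    qed
    then have "z i = 0 i" for i using z by (cases "i < n") (simp_all add: mem_real_space)
    then have "z = 0" by (rule ext)
    then show ?thesis by (simp add: z_def)
  qed
  have surj: "\<exists>x\<in>real_space n. ?\<gamma> x = c" if c: "c \<in> real_space n" for c
  proof
    define x where "x = cut n (\<lambda>j. \<Sum>k<n. A j k * (\<Sum>l<n. s * c l * R l k))"
    show "x \<in> real_space n" by (simp add: x_def cut_real_space)
    have "dot n (R i) x = s * c i" if i: "i < n" for i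
    proof -
      have "dot n (R i) x = qf n A (R i) (\<lambda>k. \<Sum>l<n. s * c l * R l k)"
        unfolding x_def dot_cut by (simp add: dot_def qf_def sum_distrib_left mult.assoc)
      also have "\<dots> = qf n A (R i) (\<lambda>k. 0 - (\<Sum>l<n. (- (s * c l)) * R l k))"
        by (simp add: sum_negf)
      also have "\<dots> = qf n A (R i) (\<lambda>k. 0) - (\<Sum>l<n. (- (s * c l)) * qf n A (R i) (R l))"
        by (rule qf_lin)
      also have "\<dots> = (\<Sum>l<n. s * c l * qf n A (R i) (R l))"
      proof -
        have "qf n A (R i) (\<lambda>k. 0) = 0" by (simp add: qf_def)
        then show ?thesis by (simp add: sum_negf)
      qed
      also have "\<dots> = (\<Sum>l<n. if l = i then s * c l else 0)"
        by (intro sum.cong refl) (simp add: orth[OF i])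
      finally show ?thesis using i by simp
    qed
    then show "?\<gamma> x = c" using c s by (intro ext) (auto simp: mem_real_space)
  qed
  have "bij_betw ?\<gamma> (real_space n) (real_space n)"
    unfolding bij_betw_def
  proof (intro conjI inj_onI equalityI subsetI)
    show "x = y" if "x \<in> real_space n" "y \<in> real_space n" "?\<gamma> x = ?\<gamma> y" for x y using inj that by blast
    show "c \<in> real_space n" if "c \<in> ?\<gamma> ` real_space n" for c using that by (auto simp: mem_real_space)
    show "c \<in> ?\<gamma> ` real_space n" if "c \<in> real_space n" for c using surj[OF that] by blast
  qed
  with lin show ?thesis by (simp add: GL_def)
qed

lemma L2_set_le_iff: "s \<ge> 0 \<Longrightarrow> L2_set f A \<le> s \<longleftrightarrow> (\<Sum>i\<in>A. (f i)\<^sup>2) \<le> s\<^sup>2"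
  unfolding L2_set_def by (metis real_sqrt_le_iff real_sqrt_abs abs_of_nonneg)

text \<open>On the ellipsoid the Gaussian is at least \<open>exp (- n)\<close>, so its integral
  times \<open>exp n\<close> bounds the volume.\<close>

lemma triangular_ellipsoid_volume:
  assumes R: "\<And>i j. i < n \<Longrightarrow> i < j \<Longrightarrow> R i j = 0" "\<And>i. i < n \<Longrightarrow> R i i > 0"
  shows "emeasure (leb n) {x. L2_set (\<lambda>i. dot n (R i) x) {..<n} \<le> sqrt (2 * real n)}
    \<le> ennreal (exp (real n) * (\<Prod>i<n. sqrt (2 * pi) / R i i))"
proof -
  let ?g = "\<lambda>x. exp (- (\<Sum>i<n. (dot n (R i) x)\<^sup>2) / 2)"
  let ?E = "{x. L2_set (\<lambda>i. dot n (R i) x) {..<n} \<le> sqrt (2 * real n)}"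
  have bm [measurable]: "dot n u \<in> borel_measurable borel" for u
    by (intro borel_measurable_continuous_onI continuous_on_dot)
  have E: "?E = {x. (\<Sum>i<n. (dot n (R i) x)\<^sup>2) \<le> 2 * real n}" by (simp add: L2_set_le_iff)
  have Em: "?E \<in> sets borel" unfolding E by measurable
  have "emeasure (leb n) ?E = (\<integral>\<^sup>+x. indicator ?E x \<partial>leb n)" using Em by simp
  also have "\<dots> \<le> (\<integral>\<^sup>+x. ennreal (exp (real n)) * ennreal (?g x) \<partial>leb n)"
  proof (intro nn_integral_mono)
    fix x
    show "indicator ?E x \<le> ennreal (exp (real n)) * ennreal (?g x)"
    proof (cases "x \<in> ?E")
      case True
      then have "1 \<le> exp (real n) * ?g x" unfolding E exp_add[symmetric] by simp
      then have "ennreal 1 \<le> ennreal (exp (real n) * ?g x)" by (rule ennreal_leI)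
      then show ?thesis using True by (simp add: ennreal_mult)
    qed simp
  qed
  also have "\<dots> = ennreal (exp (real n)) * (\<integral>\<^sup>+x. ennreal (?g x) \<partial>leb n)"
    by (rule nn_integral_cmult) measurable
  also have "(\<lambda>x. ennreal (?g x)) = (\<lambda>x. ennreal (exp (- (\<Sum>i<n. (\<Sum>j\<le>i. R i j * x j)\<^sup>2) / 2)))"
    using dot_triangular[of _ R n, OF R(1)] by (intro ext) simp
  also have "(\<integral>\<^sup>+x. ennreal (exp (- (\<Sum>i<n. (\<Sum>j\<le>i. R i j * x j)\<^sup>2) / 2)) \<partial>leb n) = ennreal (\<Prod>i<n. sqrt (2 * pi) / R i i)"
    by (rule nn_integral_gauss_triangular) (rule R(2))
  finally show ?thesis by (simp add: ennreal_mult')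
qed

lemma (in lse) dot_gr: "dot n w (\<lambda>k. gr k x) = E (dot n w) x"
  unfolding dot_def gr_def by (simp add: E_sum E_cmult)

context sbody begin

text \<open>For \<open>x\<close> in the set \<open>S\<close> of \<open>dual_volume\<close> the first
  \<open>n\<close> coordinates are at most \<open>8 * n / r\<close> in modulus, so \<open>dl\<close>
  times \<open>x\<close> fits into the inner cube: the gradient map is perturbed there by a vector
  of \<open>B\<close>.\<close>

definition "dl = min 1 (r\<^sup>2 / (8 * real n))"

lemma dl: "0 < dl" "dl \<le> 1" using r n by (auto simp: dl_def)

text \<open>For \<open>x\<close> in \<open>S\<close> the gradient is a mean of points of
  \<open>B\<close> and the perturbation also lies in \<open>B\<close>, so \<open>k0\<close> of
  \<open>W\<close> is at least \<open>exp (- 2 * n)\<close> there. By the change of variables the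
  mean of the determinant over \<open>S\<close> is then at most \<open>c\<close>, and somewhere in
  \<open>S\<close> it does not exceed \<open>2 * c\<close>.\<close>

lemma det_bound:
  assumes "lse Y" "Y \<subseteq> B"
  shows "\<exists>x. (\<forall>y\<in>B. \<bar>dot n y x\<bar> \<le> 8 * real n) \<and>
    ldet n (\<lambda>k j. lse.H n Y k j x + (if k = j then dl else 0)) \<le> (10060 ^ n * v)\<^sup>2"
proof -
  obtain W S k \<eta> where W0: "lse W" "S \<in> sets borel" "\<eta> > 0" "\<forall>y. \<exists>w\<in>W. \<eta> * ell1 n y \<le> dot n w y"
    "\<forall>w\<in>W. \<forall>y\<in>B. dot n w y \<le> real n" "\<forall>x\<in>S. \<forall>y\<in>B. \<bar>dot n y x\<bar> \<le> 8 * real n"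
    "k = (\<integral>x. lse.k0 n W x \<partial>leb n)" "k > 0" "k \<le> 306 ^ n * v" "emeasure (leb n) S < \<infinity>"
    "1 \<le> 60 ^ n * measure (leb n) S * k"
    using dual_volume by (elim exE conjE)
  interpret W: lse n W by (rule W0(1))
  interpret Y: lse n Y by (rule assms(1))
  have n0: "real n > 0" using n by simp
  define mS where "mS = measure (leb n) S"
  have mS: "mS > 0"
  proof (rule ccontr)
    assume "\<not> mS > 0"
    then have "mS = 0" using measure_nonneg[of "leb n" S] by (simp add: mS_def)
    then show False using W0(11) by (simp add: mS_def)
  qed
  define D where "D x = ldet n (\<lambda>k j. Y.H k j x + (if k = j then dl else 0))" for x
  have D0: "D x > 0" for x
    unfolding D_def
  proof (rule ldet_pos[OF _ dl])
    fix u show "dl * dot n u u \<le> qf n (\<lambda>k j. Y.H k j x + (if k = j then dl else 0)) u u"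
      unfolding qf_add_scalar using Y.H_nonneg[of u x] by (simp add: qf_def)
  qed
  define f where "f x = W.k0 (\<lambda>k. Y.gr k x + dl * x k) * D x" for x
  note igm = integral_gradient_map[OF assms(1) W0(1) W0(4)[rule_format] W0(3) dl]
  have int1: "(\<integral>x. f x \<partial>leb n) = k"
    unfolding f_def D_def W0(7) by (rule conjunct1[OF igm])
  have int2: "integrable (leb n) f"
    unfolding f_def[abs_def] D_def by (rule conjunct2[OF igm])
  have low: "exp (- (2 * real n)) \<le> W.k0 (\<lambda>k. Y.gr k x + dl * x k)" if x: "x \<in> S" for x
  proof (rule W.k0_ge)
    fix w assume w: "w \<in> W"
    have "Y.E (dot n w) x \<le> Y.E (\<lambda>_. real n) x"
      using W0(5) w assms(2) by (intro Y.E_mono) auto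
    then have 1: "Y.E (dot n w) x \<le> real n" by (simp add: Y.E_const)
    have ex: "r * ell1 n x \<le> 8 * real n"
    proof -
      define y where "y = (\<lambda>i. if i < n then r * sgn (x i) else 0)"
      have "y \<in> B" using r by (intro inner) (auto simp: mem_real_space y_def sgn_if)
      moreover have "dot n y x = r * ell1 n x"
        unfolding dot_def ell1_def sum_distrib_left by (intro sum.cong) (auto simp: y_def abs_sgn mult_ac)
      ultimately show ?thesis using W0(6) x by (metis abs_le_D1)
    qed
    have "dl *\<^sub>R cut n x \<in> B"
    proof (intro inner real_space_scaleR cut_real_space)
      fix i assume i: "i < n"
      have "\<bar>x i\<bar> \<le> ell1 n x" by (rule coord_le_ell1[OF i])
      then have "r * \<bar>x i\<bar> \<le> r * ell1 n x" using r by (intro mult_left_mono) auto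
      then have "r * \<bar>x i\<bar> \<le> 8 * real n" using ex by linarith
      then have "\<bar>x i\<bar> \<le> 8 * real n / r" using r by (simp add: field_simps)
      then have "dl * \<bar>x i\<bar> \<le> r\<^sup>2 / (8 * real n) * (8 * real n / r)"
        using r n0 by (intro mult_mono) (auto simp: dl_def)
      also have "\<dots> = r" using r n0 by (simp add: power2_eq_square)
      finally show "\<bar>(dl *\<^sub>R cut n x) i\<bar> \<le> r" using i dl by (simp add: cut_apply abs_mult)
    qed
    then have "dot n w (dl *\<^sub>R cut n x) \<le> real n" using W0(5) w by blast
    then have 2: "dl * dot n w x \<le> real n" by (simp add: dot_scaleR dot_cut)
    have "dot n w (\<lambda>k. Y.gr k x + dl * x k) = Y.E (dot n w) x + dl * dot n w x"
      by (simp add: dot_add dot_scale Y.dot_gr)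
    then show "dot n w (\<lambda>k. Y.gr k x + dl * x k) \<le> 2 * real n" using 1 2 by linarith
  qed
  define c where "c = exp (2 * real n) * k / mS"
  have c: "c > 0" using W0(8) mS by (simp add: c_def)
  have "\<exists>x\<in>S. D x \<le> 2 * c"
  proof (rule ccontr)
    assume "\<not> ?thesis"
    then have big: "2 * c \<le> D x" if "x \<in> S" for x using that by (auto simp: not_le intro: less_imp_le)
    have "(\<integral>x. (exp (- (2 * real n)) * (2 * c)) * indicator S x \<partial>leb n) \<le> (\<integral>x. f x \<partial>leb n)"
    proof (rule integral_mono[OF _ int2])
      show "integrable (leb n) (\<lambda>x. (exp (- (2 * real n)) * (2 * c)) * indicator S x)"
        using W0(2,10) by (intro integrable_mult_right) (simp add: integrable_indicator_iff)
      fix x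
      show "(exp (- (2 * real n)) * (2 * c)) * indicator S x \<le> f x"
      proof (cases "x \<in> S")
        case True
        have "exp (- (2 * real n)) * (2 * c) \<le> f x"
          unfolding f_def using low[OF True] big[OF True] c W.k0_pos by (intro mult_mono) (auto intro: less_imp_le)
        then show ?thesis using True by simp
      next
        case False
        then show ?thesis using D0[of x] W.k0_pos by (simp add: f_def less_imp_le)
      qed
    qed
    also have "(\<integral>x. (exp (- (2 * real n)) * (2 * c)) * indicator S x \<partial>leb n) = exp (- (2 * real n)) * (2 * c) * mS"
      using W0(2) by (simp add: mS_def)
    also have "\<dots> = 2 * k" using mS by (simp add: c_def exp_minus)
    finally show False using int1 W0(8) by simp
  qed
  then obtain x where x: "x \<in> S" "D x \<le> 2 * c" by blast
  \<comment> \<open>The Bourgain-Milman bound replaces \<open>1 / mS\<close> by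
    \<open>60 ^ n * k\<close>. Afterwards \<open>2 * 9 * 60 * 306\<^sup>2\<close> is just below
    \<open>10060\<^sup>2\<close>.\<close>
  have "2 * c \<le> 2 * (9 ^ n * (60 ^ n * (306 ^ n * v)\<^sup>2))"
  proof -
    have e3: "exp 1 \<le> (3 :: real)" using exp_le by simp
    have "exp (2 * real n) = (exp 1 * exp 1) ^ n"
      by (simp add: exp_of_nat_mult[symmetric] exp_add[symmetric] mult.commute)
    also have "\<dots> \<le> (3 * 3) ^ n" using e3 by (intro power_mono mult_mono) auto
    finally have e: "exp (2 * real n) \<le> 9 ^ n" by simp
    have "k * 1 \<le> k * (60 ^ n * mS * k)" using W0(8,11) by (intro mult_left_mono) (auto simp: mS_def)
    then have "k / mS \<le> 60 ^ n * k\<^sup>2" using mS by (simp add: field_simps power2_eq_square)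
    also have "\<dots> \<le> 60 ^ n * (306 ^ n * v)\<^sup>2" using W0(8,9) by (intro mult_left_mono power_mono) auto
    finally have "k / mS \<le> 60 ^ n * (306 ^ n * v)\<^sup>2" .
    then have "exp (2 * real n) * (k / mS) \<le> 9 ^ n * (60 ^ n * (306 ^ n * v)\<^sup>2)"
      using e W0(8) mS by (intro mult_mono) auto
    then show ?thesis by (simp add: c_def)
  qed
  also have "\<dots> \<le> 2 ^ n * (9 ^ n * (60 ^ n * (306 ^ n * v)\<^sup>2))"
    using power_increasing[OF n, of "2 :: real"] by (intro mult_right_mono) auto
  also have "\<dots> = (2 * 9 * 60 * 306\<^sup>2) ^ n * v\<^sup>2"
    unfolding power_mult_distrib by (simp only: power_mult[symmetric] mult.assoc mult.commute[of 2 n])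
  also have "\<dots> \<le> (10060\<^sup>2) ^ n * v\<^sup>2" by (intro mult_right_mono power_mono) auto
  also have "\<dots> = (10060 ^ n * v)\<^sup>2"
    unfolding power_mult_distrib by (simp only: power_mult[symmetric] mult.commute[of 2 n])
  finally have "2 * c \<le> (10060 ^ n * v)\<^sup>2" .
  then show ?thesis using x W0(6) unfolding D_def by (intro exI[of _ x]) auto
qed

end

text \<open>The tilted mean of \<open>Q\<close> is the trace of the covariance in the frame
  \<open>R\<close>, so by Markov's inequality the points with \<open>Q\<close> at most
  \<open>2 * s\<close> carry half of the tilted weight. The weights before normalization lie between
  \<open>exp (- a)\<close> and \<open>exp a\<close>, so passing to the counting measure costs
  \<open>exp (2 * a)\<close>.\<close>

lemma (in lse) half_concentrated:
  assumes x: "\<And>u. u \<in> V \<Longrightarrow> \<bar>dot n u x\<bar> \<le> a"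
    and tr: "(\<Sum>i<n. qf n (\<lambda>k j. H k j x) (R i) (R i)) \<le> s" and s: "s > 0"
  shows "real (card V) \<le> 2 * exp (2 * a) *
    real (card {u \<in> V. L2_set (\<lambda>i. dot n (R i) (u - cut n (\<lambda>k. gr k x))) {..<n} \<le> sqrt (2 * s)})"
proof -
  define Q where "Q u = (\<Sum>i<n. (dot n (R i) (u - cut n (\<lambda>k. gr k x)))\<^sup>2)" for u
  define g where "g = {u \<in> V. Q u \<le> 2 * s}"
  have g: "g = {u \<in> V. L2_set (\<lambda>i. dot n (R i) (u - cut n (\<lambda>k. gr k x))) {..<n} \<le> sqrt (2 * s)}"
    using s by (simp add: g_def Q_def L2_set_le_iff)
  have "E Q x = (\<Sum>i<n. E (\<lambda>u. (dot n (R i) (u - cut n (\<lambda>k. gr k x)))\<^sup>2) x)"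
    unfolding Q_def by (rule E_sum)
  also have "\<dots> = (\<Sum>i<n. qf n (\<lambda>k j. H k j x) (R i) (R i))"
    unfolding qf_def H_quadratic by (simp add: dot_minus dot_cut) (simp add: dot_def)
  finally have EQ: "E Q x \<le> s" using tr by simp
  have "E (\<lambda>u. 1 - (1 / (2 * s)) * Q u) x \<le> E (\<lambda>u. if Q u \<le> 2 * s then 1 else 0) x"
  proof (rule E_mono)
    fix u
    have "Q u \<ge> 0" unfolding Q_def by (intro sum_nonneg) auto
    then show "1 - (1 / (2 * s)) * Q u \<le> (if Q u \<le> 2 * s then 1 else 0)"
      using s by (auto simp: field_simps)
  qed
  also have "\<dots> = (\<Sum>u\<in>g. exp (dot n u x)) / Z x"
  proof -
    have "(\<Sum>u\<in>V. (if Q u \<le> 2 * s then 1 else 0) * exp (dot n u x)) = (\<Sum>u\<in>g. exp (dot n u x))"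
      unfolding g_def using finV by (intro sum.mono_neutral_cong_right) auto
    then show ?thesis by (simp add: E_def)
  qed
  also have "E (\<lambda>u. 1 - (1 / (2 * s)) * Q u) x = 1 - (1 / (2 * s)) * E Q x"
    by (simp only: E_diff E_const E_cmult)
  finally have 1: "1 - (1 / (2 * s)) * E Q x \<le> (\<Sum>u\<in>g. exp (dot n u x)) / Z x" .
  have "(1 / (2 * s)) * E Q x \<le> (1 / (2 * s)) * s" using EQ s by (intro mult_left_mono) auto
  also have "\<dots> = 1 / 2" using s by simp
  finally have "1 / 2 \<le> (\<Sum>u\<in>g. exp (dot n u x)) / Z x" using 1 by linarith
  then have "Z x \<le> 2 * (\<Sum>u\<in>g. exp (dot n u x))" using Z_pos[of x] by (simp add: field_simps)
  also have "(\<Sum>u\<in>g. exp (dot n u x)) \<le> (\<Sum>u\<in>g. exp a)"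
    using x by (intro sum_mono) (auto simp: g_def abs_le_iff)
  finally have 2: "Z x \<le> 2 * (real (card g) * exp a)" by simp
  have "(\<Sum>u\<in>V. exp (- a)) \<le> Z x"
    unfolding Z_def
  proof (rule sum_mono)
    fix u assume "u \<in> V"
    then have "- a \<le> dot n u x" using x[of u] by linarith
    then show "exp (- a) \<le> exp (dot n u x)" by simp
  qed
  then have "real (card V) * exp (- a) \<le> 2 * (real (card g) * exp a)" using 2 by simp
  then have "real (card V) * exp (- a) * exp a \<le> 2 * (real (card g) * exp a) * exp a"
    by (rule mult_right_mono) simp
  moreover have "real (card V) * exp (- a) * exp a = real (card V)"
    by (simp add: mult.assoc flip: exp_add)
  moreover have "2 * (real (card g) * exp a) * exp a = 2 * exp (2 * a) * real (card g)"
  proof -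
    have e2: "exp (2 * a) = exp a * exp a" by (simp only: exp_double power2_eq_square)
    show ?thesis unfolding e2 by (simp only: mult_ac)
  qed
  ultimately show ?thesis unfolding g by simp
qed

section \<open>Discretization of a body by a grid\<close>

context sbody begin

definition "grid t = {y \<in> B. \<forall>i. \<exists>m::int. y i = t * of_int m}"
text \<open>Half-open, so that the cells at different grid points are disjoint.\<close>

definition "cell t = {z \<in> real_space n. \<forall>i\<in>{..<n}. 0 \<le> z i \<and> z i < t}"

lemma finite_grid:
  assumes t: "t > 0" shows "finite (grid t)"
proof -
  define N where "N = \<lceil>R / t\<rceil>"
  define Bv where "Bv = (\<lambda>m. t * real_of_int m) ` {- N..N}"
  have sub': "grid t \<subseteq> {f. \<forall>x. (x \<in> {..<n} \<longrightarrow> f x \<in> Bv) \<and> (x \<notin> {..<n} \<longrightarrow> f x = 0)}"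
  proof (intro subsetI CollectI allI conjI impI)
    fix y x assume y: "y \<in> grid t"
    then have yB: "y \<in> B" by (simp add: grid_def)
    obtain m :: int where m: "y x = t * of_int m" using y by (auto simp: grid_def)
    have "\<bar>t * of_int m\<bar> \<le> R" using outer[OF yB, of x] m by simp
    then have "\<bar>real_of_int m\<bar> \<le> R / t" using t by (simp add: abs_mult field_simps)
    also have "\<dots> \<le> of_int N" unfolding N_def by (rule le_of_int_ceiling)
    finally have "\<bar>m\<bar> \<le> N" by (simp flip: of_int_abs)
    then show "y x \<in> Bv" unfolding Bv_def m by (intro imageI) auto
    show "y x = 0" if "x \<notin> {..<n}" using yB sub that by (auto simp: mem_real_space)
  qed
  have "finite Bv" by (simp add: Bv_def)
  then show ?thesis by (intro finite_subset[OF sub'] finite_set_of_finite_funs finite_lessThan)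
qed

lemma zero_grid: "0 \<in> grid t"
  using zeroB by (auto simp: grid_def intro!: exI[of _ "0::int"])

lemma cells_disjoint:
  assumes "t > 0" "y \<in> grid t" "y' \<in> grid t" "y \<noteq> y'"
  shows "(+) y ` cell t \<inter> (+) y' ` cell t = {}"
proof (rule ccontr)
  assume "(+) y ` cell t \<inter> (+) y' ` cell t \<noteq> {}"
  then obtain z z' where z: "z \<in> cell t" "z' \<in> cell t" "y + z = y' + z'" by blast
  have "y i = y' i" for i
  proof (cases "i < n")
    case True
    obtain m m' :: int where m: "y i = t * of_int m" "y' i = t * of_int m'" using assms(2,3) unfolding grid_def by blast
    have "t * real_of_int m + z i = t * real_of_int m' + z' i"
      using fun_cong[OF z(3), of i] by (simp add: m)
    then have e: "t * real_of_int (m - m') = z' i - z i" unfolding of_int_diff right_diff_distrib by linarith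
    have "0 \<le> z i" "z i < t" "0 \<le> z' i" "z' i < t" using z True by (auto simp: cell_def)
    then have "t * real_of_int (m - m') < t * 1" "t * (- 1) < t * real_of_int (m - m')" unfolding e by linarith+
    then have "real_of_int (m - m') < 1" "- 1 < real_of_int (m - m')" using assms(1) by (simp_all only: mult_less_cancel_left_pos)
    then have "m = m'" by linarith
    then show ?thesis using m by simp
  next
    case False
    moreover have "y \<in> real_space n" "y' \<in> real_space n" using assms(2,3) sub by (auto simp: grid_def)
    ultimately show ?thesis by (simp add: mem_real_space)
  qed
  then show False using assms(4) by auto
qed

lemma sets_cell [measurable]: "cell t \<in> sets borel"
proof -
  have "cell t = real_space n \<inter> {z. \<forall>i\<in>{..<n}. 0 \<le> z i \<and> z i < t}" by (auto simp: cell_def)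
  also have "\<dots> \<in> sets borel" by measurable
  finally show ?thesis .
qed

lemma cell_sub:
  assumes "t \<le> r / 2" shows "cell t \<subseteq> dil (1 / 2)"
proof
  fix z assume z: "z \<in> cell t"
  have "2 *\<^sub>R z \<in> B"
  proof (intro inner real_space_scaleR)
    show "z \<in> real_space n" using z by (simp add: cell_def)
    fix i assume "i < n"
    then have "0 \<le> z i" "z i < t" using z by (auto simp: cell_def)
    then show "\<bar>(2 *\<^sub>R z) i\<bar> \<le> r" using assms by simp
  qed
  then show "z \<in> dil (1 / 2)" using dil_iff[of "1 / 2" z] by simp
qed

text \<open>Rounding down changes \<open>z\<close> by an element of a cell, which lies in
  \<open>dil (1 / 2)\<close>; hence the grid point is still in \<open>B\<close>. Covering only
  \<open>dil (1 / 2)\<close> costs the factor \<open>2 ^ n\<close> in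
  \<open>cell_measure\<close>.\<close>

lemma grid_cover:
  assumes t: "0 < t" "t \<le> r / 2" and z: "z \<in> dil (1 / 2)"
  shows "\<exists>y\<in>grid t. \<exists>c\<in>cell t. z = y + c"
proof -
  define y where "y = (\<lambda>i. t * real_of_int (if i < n then \<lfloor>z i / t\<rfloor> else 0))"
  have zr: "z \<in> real_space n" using z dil_sub by blast
  have yr: "y \<in> real_space n" by (simp add: mem_real_space y_def)
  have c: "z - y \<in> cell t"
    unfolding cell_def
  proof (intro CollectI conjI ballI real_space_diff zr yr)
    fix i assume i: "i \<in> {..<n}"
    have f: "real_of_int \<lfloor>z i / t\<rfloor> \<le> z i / t" "z i / t < real_of_int \<lfloor>z i / t\<rfloor> + 1" by linarith+
    then have "t * real_of_int \<lfloor>z i / t\<rfloor> \<le> t * (z i / t)" "t * (z i / t) < t * (real_of_int \<lfloor>z i / t\<rfloor> + 1)"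
      using f t(1) by (simp_all only: mult_le_cancel_left_pos mult_less_cancel_left_pos)
    then have "t * real_of_int \<lfloor>z i / t\<rfloor> \<le> z i" "z i < t * real_of_int \<lfloor>z i / t\<rfloor> + t"
      using t by (simp_all add: distrib_left)
    then show "0 \<le> (z - y) i" "(z - y) i < t" using i by (simp_all add: y_def)
  qed
  have "z - (z - y) \<in> dil (1 / 2 + 1 / 2)"
    using c cell_sub[OF t(2)] z by (intro dil_diff) auto
  then have "y \<in> B" by (simp add: dil_1)
  then have "y \<in> grid t" unfolding grid_def by (auto simp: y_def)
  then show ?thesis using c by (intro bexI[of _ y] bexI[of _ "z - y"]) simp_all
qed

lemma cell_measure:
  assumes t: "0 < t" "t \<le> r / 2"
  shows "v \<le> 2 ^ n * real (card (grid t)) * measure (leb n) (cell t)"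
    and "g \<subseteq> grid t \<Longrightarrow> measure (leb n) (\<Union>y\<in>g. (+) y ` cell t) = real (card g) * measure (leb n) (cell t)"
proof -
  have fc: "emeasure (leb n) (cell t) < \<infinity>"
    using emeasure_mono[OF cell_sub[OF t(2)], of "leb n"] fin_dil[of "1 / 2"] by (auto intro: le_less_trans)
  have rs: "y \<in> real_space n" if "y \<in> grid t" for y using that sub by (auto simp: grid_def)
  have tr: "emeasure (leb n) ((+) y ` cell t) = emeasure (leb n) (cell t)" "(+) y ` cell t \<in> sets borel" if "y \<in> grid t" for y
    using emeasure_leb_translate[OF sets_cell rs[OF that]] by auto
  have trm: "measure (leb n) ((+) y ` cell t) = measure (leb n) (cell t)" if "y \<in> grid t" for y
    using tr[OF that] by (simp add: measure_def)
  show un: "measure (leb n) (\<Union>y\<in>g. (+) y ` cell t) = real (card g) * measure (leb n) (cell t)" if g: "g \<subseteq> grid t" for g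
  proof -
    have "finite g" using g finite_grid[OF t(1)] by (rule finite_subset)
    then have "measure (leb n) (\<Union>y\<in>g. (+) y ` cell t) = (\<Sum>y\<in>g. measure (leb n) ((+) y ` cell t))"
    proof (rule measure_finite_Union)
      show "(\<lambda>y. (+) y ` cell t) ` g \<subseteq> sets (leb n)" using g tr(2) by auto
      show "disjoint_family_on (\<lambda>y. (+) y ` cell t) g"
        unfolding disjoint_family_on_def using g cells_disjoint[OF t(1)] by blast
      show "emeasure (leb n) ((+) y ` cell t) \<noteq> \<infinity>" if "y \<in> g" for y
        using tr(1)[of y] that g fc by auto
    qed
    also have "\<dots> = (\<Sum>y\<in>g. measure (leb n) (cell t))" using g trm by (intro sum.cong) auto
    finally show ?thesis by simp
  qed
  have "(1 / 2) ^ n * v = measure (leb n) (dil (1 / 2))" by (simp add: vol_dil)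
  also have "\<dots> \<le> measure (leb n) (\<Union>y\<in>grid t. (+) y ` cell t)"
  proof (rule measure_mono_AE_fin)
    have "dil (1 / 2) \<subseteq> (\<Union>y\<in>grid t. (+) y ` cell t)" using grid_cover[OF t] by blast
    then show "AE x in leb n. x \<in> dil (1 / 2) \<longrightarrow> x \<in> (\<Union>y\<in>grid t. (+) y ` cell t)" by (intro AE_I2) blast
    show "(\<Union>y\<in>grid t. (+) y ` cell t) \<in> sets (leb n)"
      using tr(2) finite_grid[OF t(1)] by (intro sets.finite_UN) auto
    have "emeasure (leb n) (\<Union>y\<in>grid t. (+) y ` cell t) \<le> (\<Sum>y\<in>grid t. emeasure (leb n) ((+) y ` cell t))"
      using tr(2) finite_grid[OF t(1)] by (intro emeasure_subadditive_finite) auto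
    also have "\<dots> < \<infinity>" using tr(1) fc finite_grid[OF t(1)] by (auto simp: ennreal_mult_less_top of_nat_less_top)
    finally show "emeasure (leb n) (\<Union>y\<in>grid t. (+) y ` cell t) < \<infinity>" .
  qed
  also have "\<dots> = real (card (grid t)) * measure (leb n) (cell t)" by (rule un) simp
  finally have "2 ^ n * ((1 / 2) ^ n * v) \<le> 2 ^ n * (real (card (grid t)) * measure (leb n) (cell t))"
    by (intro mult_left_mono) auto
  moreover have "2 ^ n * ((1 / 2) ^ n * v) = v" by (simp add: mult.assoc[symmetric] flip: power_mult_distrib)
  ultimately show "v \<le> 2 ^ n * real (card (grid t)) * measure (leb n) (cell t)" by (simp only: mult.assoc)
qed

text \<open>\<open>g\<close> consists of the grid points in the covariance ellipsoid around the
  tilted mean \<open>b\<close>. In the frame \<open>R\<close> the regularized covariance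
  \<open>A\<close> is the identity, so the trace of \<open>H\<close> is at most \<open>n\<close>,
  which gives the radius \<open>sqrt (2 * n)\<close>. The exponent 16 is twice the 8 of
  \<open>det_bound\<close>.\<close>

lemma ellipsoid_frame:
  "\<exists>A R g b t. (\<forall>i<n. \<forall>j>i. R i j = 0) \<and> (\<forall>i<n. R i i > 0) \<and>
    (\<forall>i<n. \<forall>l<n. qf n A (R i) (R l) = (if i = l then 1 else 0)) \<and>
    (\<Prod>i<n. 1 / R i i) \<le> 10060 ^ n * v \<and>
    0 < t \<and> t \<le> r / 2 \<and> g \<subseteq> grid t \<and> real (card (grid t)) \<le> 2 * exp (16 * real n) * real (card g) \<and>
    (\<forall>y\<in>g. L2_set (\<lambda>i. dot n (R i) (y - b)) {..<n} \<le> sqrt (2 * real n)) \<and>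
    (\<forall>c\<in>cell t. L2_set (\<lambda>i. dot n (R i) c) {..<n} \<le> sqrt (2 * real n))"
proof -
  have n0: "real n > 0" "real n \<ge> 1" using n by simp_all
  \<comment> \<open>The second bound makes a cell small against the ellipsoid: it gives
    \<open>dot n c c \<le> dl\<close>, while \<open>A\<close> dominates \<open>dl\<close> times the
    identity and so limits each row to \<open>dl * dot n (R i) (R i) \<le> 1\<close>.\<close>
  define t where "t = min (r / 2) (dl / real n)"
  have t: "t \<le> r / 2" "t \<le> dl / real n" "0 < t" unfolding t_def
    by (rule min.cobounded1, rule min.cobounded2) (use r dl n0 in simp)
  interpret Y: lse n "grid t" by standard (use finite_grid[OF t(3)] zero_grid in auto)
  have YB: "grid t \<subseteq> B" by (auto simp: grid_def)
  obtain x where x: "\<forall>y\<in>B. \<bar>dot n y x\<bar> \<le> 8 * real n"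
    "ldet n (\<lambda>k j. Y.H k j x + (if k = j then dl else 0)) \<le> (10060 ^ n * v)\<^sup>2"
    using det_bound[OF Y.lse_axioms YB] by (elim exE conjE)
  define A where "A = (\<lambda>k j. Y.H k j x + (if k = j then dl else 0))"
  have qA: "qf n A u w = qf n (\<lambda>k j. Y.H k j x) u w + dl * dot n u w" for u w
    unfolding A_def by (rule qf_add_scalar)
  have Hn: "0 \<le> qf n (\<lambda>k j. Y.H k j x) u u" for u using Y.H_nonneg[of u x] by (simp add: qf_def)
  have sym: "A i j = A j i" for i j using Y.H_sym[of i j x] by (simp add: A_def)
  have pd: "qf n A u u > 0" if "i < n" "u i \<noteq> 0" for u i
  proof -
    have "0 < (u i)\<^sup>2" using that by simp
    then have "0 < dot n u u" using dot_self_coord[OF that(1), of u] by linarith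
    then show ?thesis using Hn[of u] dl by (simp add: qA add_nonneg_pos)
  qed
  have GS: "\<exists>R. (\<forall>i<n. \<forall>j>i. R i j = 0) \<and> (\<forall>i<n. R i i > 0) \<and>
      (\<forall>i<n. \<forall>l<n. qf n A (R i) (R l) = (if i = l then 1 else 0))"
    by (rule gram_schmidt[OF sym _ order_refl]) (rule pd)
  obtain R where R: "\<forall>i<n. \<forall>j>i. R i j = 0" "\<forall>i<n. R i i > 0"
    "\<forall>i<n. \<forall>l<n. qf n A (R i) (R l) = (if i = l then 1 else 0)"
    using GS by (elim exE conjE)
  define P where "P = (\<Prod>i<n. R i i)"
  have P: "P > 0" unfolding P_def using R(2) by (intro prod_pos) auto
  have "ldet n A * P\<^sup>2 = 1" unfolding P_def using R by (intro gram_schmidt_det) auto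
  then have "ldet n A = 1 / P\<^sup>2" using P by (simp add: field_simps)
  then have "(1 / P)\<^sup>2 \<le> (10060 ^ n * v)\<^sup>2" using x(2) by (simp add: A_def power_divide)
  then have "1 / P \<le> 10060 ^ n * v" using v_pos by (intro power2_le_imp_le[of "1 / P"]) auto
  then have detP: "(\<Prod>i<n. 1 / R i i) \<le> 10060 ^ n * v" by (simp add: P_def prod_dividef)
  define b where "b = cut n (\<lambda>k. Y.gr k x)"
  define g where "g = {u \<in> grid t. L2_set (\<lambda>i. dot n (R i) (u - b)) {..<n} \<le> sqrt (2 * real n)}"
  have "(\<Sum>i<n. qf n (\<lambda>k j. Y.H k j x) (R i) (R i)) \<le> (\<Sum>i<n. 1)"
  proof (rule sum_mono)
    fix i assume "i \<in> {..<n}"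
    then have "qf n A (R i) (R i) = 1" using R(3) by simp
    moreover have "0 \<le> dl * dot n (R i) (R i)" using dl by (intro mult_nonneg_nonneg dot_self_nonneg) auto
    ultimately show "qf n (\<lambda>k j. Y.H k j x) (R i) (R i) \<le> 1" unfolding qA by linarith
  qed
  then have tr: "(\<Sum>i<n. qf n (\<lambda>k j. Y.H k j x) (R i) (R i)) \<le> real n" by simp
  have xg: "\<bar>dot n u x\<bar> \<le> 8 * real n" if "u \<in> grid t" for u using x(1) YB that by blast
  have "real (card (grid t)) \<le> 2 * exp (2 * (8 * real n)) * real (card g)"
    unfolding g_def b_def by (rule Y.half_concentrated[OF xg tr n0(1)])
  then have cg: "real (card (grid t)) \<le> 2 * exp (16 * real n) * real (card g)" by simp
  have cell: "L2_set (\<lambda>i. dot n (R i) c) {..<n} \<le> sqrt (2 * real n)" if c: "c \<in> cell t" for c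
  proof -
    have cc: "dot n c c \<le> real n * t\<^sup>2"
    proof -
      have "dot n c c \<le> (\<Sum>i<n. t\<^sup>2)"
        unfolding dot_def power2_eq_square using c by (intro sum_mono mult_mono) (auto simp: cell_def intro: less_imp_le)
      then show ?thesis by simp
    qed
    have tt: "real n * t\<^sup>2 \<le> dl"
    proof -
      have "t * t \<le> (dl / real n) * (1 / real n)"
        using t dl n0 by (intro mult_mono order_trans[OF t(2)] divide_right_mono) auto
      then have "real n * t\<^sup>2 \<le> real n * ((dl / real n) * (1 / real n))"
        by (simp only: power2_eq_square) (rule mult_left_mono, auto)
      also have "\<dots> = dl / real n" using n0 by simp
      also have "\<dots> \<le> dl / 1" using dl n0 by (intro divide_left_mono) auto
      finally show ?thesis by simp
    qed
    have "(dot n (R i) c)\<^sup>2 \<le> 1" if i: "i < n" for i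
    proof -
      have "qf n A (R i) (R i) = 1" using R(3) i by simp
      then have Ri: "dl * dot n (R i) (R i) \<le> 1" using Hn[of "R i"] unfolding qA by linarith
      have "(dot n (R i) c)\<^sup>2 \<le> dot n (R i) (R i) * dot n c c"
        using Cauchy_Schwarz_ineq_sum[of "R i" c "{..<n}"] by (simp add: dot_def power2_eq_square)
      also have "\<dots> \<le> dot n (R i) (R i) * dl" using cc tt dot_self_nonneg by (intro mult_left_mono) auto
      finally show ?thesis using Ri by (simp add: mult.commute)
    qed
    then have "(\<Sum>i<n. (dot n (R i) c)\<^sup>2) \<le> (\<Sum>i<n. 1)" by (intro sum_mono) auto
    then show ?thesis using n0 by (simp add: L2_set_le_iff)
  qed
  show ?thesis
  proof (rule exI[of _ A], rule exI[of _ R], rule exI[of _ g], rule exI[of _ b], rule exI[of _ t], intro conjI)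
    show "\<forall>i<n. \<forall>j>i. R i j = 0" "\<forall>i<n. R i i > 0"
      "\<forall>i<n. \<forall>l<n. qf n A (R i) (R l) = (if i = l then 1 else 0)" by (rule R)+
    show "(\<Prod>i<n. 1 / R i i) \<le> 10060 ^ n * v" "0 < t" "t \<le> r / 2" by (rule detP t)+
    show "g \<subseteq> grid t" by (auto simp: g_def)
    show "\<forall>y\<in>g. L2_set (\<lambda>i. dot n (R i) (y - b)) {..<n} \<le> sqrt (2 * real n)" by (simp add: g_def)
    show "\<forall>c\<in>cell t. L2_set (\<lambda>i. dot n (R i) c) {..<n} \<le> sqrt (2 * real n)" by (intro ballI cell)
  qed (rule cg)
qed

end

text \<open>In \<open>cov1\<close>, \<open>4 * 3 ^ 16\<close> is the volume lost from
  \<open>B\<close> to the set \<open>M\<close> below and \<open>5 / 2\<close> the dilate in which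
  its translates are packed. In \<open>cov2\<close>, 4 comes from packing
  \<open>dil (1 / 4)\<close>, 9 from the radius \<open>9 * \<rho>\<close>, and
  \<open>90540 = 3 * 3 * 10060\<close> from the volume of the ellipsoid.\<close>

definition "cov1 = (10 * 3 ^ 16 :: real)"
definition "cov2 = (36 * 90540 * cov1 :: real)"

context sbody begin

text \<open>\<open>M\<close>, the union of the cells at \<open>g\<close>, has large volume, lies in
  \<open>dil (3 / 2)\<close>, and is within \<open>2 * \<rho>\<close> of \<open>b\<close> in the
  norm \<open>N\<close>. Packing translates of \<open>M\<close> covers \<open>B\<close> by
  ellipsoids of radius \<open>4 * \<rho>\<close>, and packing \<open>dil (1 / 4)\<close> covers the
  ellipsoid of radius \<open>8 * \<rho>\<close>. Dividing by \<open>4 * \<rho>\<close> in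
  \<open>\<gamma>\<close> turns these radii into 1 and 2.\<close>

theorem milman_ellipsoid:
  "\<exists>\<gamma> U U'. \<gamma> \<in> GL n \<and> finite U \<and> real (card U) \<le> cov1 ^ n \<and>
    finite U' \<and> real (card U') \<le> cov2 ^ n \<and>
    (\<forall>x\<in>B. \<exists>u\<in>U. L2_set (\<gamma> (x - u)) {..<n} \<le> 1) \<and>
    (\<forall>z\<in>real_space n. L2_set (\<gamma> z) {..<n} \<le> 2 \<longrightarrow> (\<exists>u\<in>U'. z - u \<in> dil (1 / 2)))"
proof -
  obtain A R g b t where fr: "\<forall>i<n. \<forall>j>i. R i j = 0" "\<forall>i<n. R i i > 0"
    "\<forall>i<n. \<forall>l<n. qf n A (R i) (R l) = (if i = l then 1 else 0)"
    "(\<Prod>i<n. 1 / R i i) \<le> 10060 ^ n * v" "0 < t" "t \<le> r / 2" "g \<subseteq> grid t"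
    "real (card (grid t)) \<le> 2 * exp (16 * real n) * real (card g)"
    "\<forall>y\<in>g. L2_set (\<lambda>i. dot n (R i) (y - b)) {..<n} \<le> sqrt (2 * real n)"
    "\<forall>c\<in>cell t. L2_set (\<lambda>i. dot n (R i) c) {..<n} \<le> sqrt (2 * real n)"
    using ellipsoid_frame by (elim exE conjE)
  have n0: "real n > 0" using n by simp
  define \<rho> where "\<rho> = sqrt (2 * real n)"
  have \<rho>: "\<rho> > 0" using n0 by (simp add: \<rho>_def)
  define N where "N z = L2_set (\<lambda>i. dot n (R i) z) {..<n}" for z
  have N_add: "N (x + y) \<le> N x + N y" for x y
    unfolding N_def dot_plus by (rule L2_set_triangle_ineq)
  have N_uminus: "N (- x) = N x" for x
    unfolding N_def dot_neg L2_set_def by simp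
  have N_diff: "N (x - y) \<le> N x + N y" for x y
    using N_add[of x "- y"] N_uminus[of y] by simp
  have N_scale: "N (c *\<^sub>R x) = c * N x" if "c \<ge> 0" for c x
    unfolding N_def dot_scaleR by (rule L2_set_right_distrib[OF that, symmetric])
  have Nm: "{z. N (z - w) \<le> s} \<in> sets borel" for w s
  proof -
    have "continuous_on UNIV (\<lambda>z. N (z - w))"
      unfolding N_def dot_minus L2_set_def by (intro continuous_intros)
    then have "(\<lambda>z. N (z - w)) \<in> borel_measurable borel" by (rule borel_measurable_continuous_onI)
    then show ?thesis by measurable
  qed
  have expK: "2 * exp (16 * real n) * 2 ^ n \<le> (4 * 3 ^ 16) ^ n"
  proof -
    have "exp (16 * real n) = (exp 1 ^ 16) ^ n"
      by (simp only: exp_of_nat_mult[symmetric] power_mult[symmetric]) simp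
    also have "\<dots> \<le> (3 ^ 16) ^ n" using exp_le by (intro power_mono) auto
    finally have "2 * exp (16 * real n) * 2 ^ n \<le> 2 ^ n * (3 ^ 16) ^ n * 2 ^ n"
      using power_increasing[OF n, of "2 :: real"] by (intro mult_right_mono mult_mono) auto
    also have "\<dots> = (2 * 3 ^ 16 * 2) ^ n" by (simp only: power_mult_distrib)
    finally show ?thesis by simp
  qed
  define M where "M = (\<Union>y\<in>g. (+) y ` cell t)"
  have gr: "y \<in> real_space n" "y \<in> dil 1" if "y \<in> g" for y
    using that fr(7) sub by (auto simp: grid_def dil_1)
  have fing: "finite g" using fr(7) finite_grid[OF fr(5)] by (rule finite_subset)
  have Ms: "M \<in> sets borel"
    unfolding M_def using emeasure_leb_translate(2)[OF sets_cell gr(1)] fing by (intro sets.finite_UN) auto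
  have M_meas: "v \<le> (4 * 3 ^ 16) ^ n * measure (leb n) M"
  proof -
    define cv where "cv = measure (leb n) (cell t)"
    have cv: "cv \<ge> 0" by (simp add: cv_def)
    have "v \<le> 2 ^ n * real (card (grid t)) * cv" unfolding cv_def by (rule cell_measure(1)[OF fr(5,6)])
    also have "\<dots> \<le> 2 ^ n * (2 * exp (16 * real n) * real (card g)) * cv"
      using fr(8) cv by (intro mult_right_mono mult_left_mono) auto
    also have "\<dots> = (2 * exp (16 * real n) * 2 ^ n) * (real (card g) * cv)" by (simp only: mult_ac)
    also have "\<dots> \<le> (4 * 3 ^ 16) ^ n * (real (card g) * cv)"
      using expK cv by (intro mult_right_mono) auto
    also have "real (card g) * cv = measure (leb n) M"
      unfolding cv_def M_def by (rule cell_measure(2)[OF fr(5,6,7), symmetric])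
    finally show ?thesis .
  qed
  have Mpos: "emeasure (leb n) M > 0"
  proof (rule ccontr)
    assume "\<not> emeasure (leb n) M > 0"
    then have "measure (leb n) M = 0" by (simp add: measure_def)
    then show False using M_meas v_pos by simp
  qed
  have M_dil: "m \<in> dil (1 + 1 / 2)" and M_N: "N (m - b) \<le> 2 * \<rho>" if m: "m \<in> M" for m
  proof -
    obtain y c where yc: "y \<in> g" "c \<in> cell t" "m = y + c" using m by (auto simp: M_def)
    show "m \<in> dil (1 + 1 / 2)"
      unfolding yc(3) using yc gr(2) cell_sub[OF fr(6)] by (intro dil_add) auto
    have "N (y - b) \<le> \<rho>" "N c \<le> \<rho>" using fr(9,10) yc by (simp_all add: N_def \<rho>_def)
    then have "N ((y - b) + c) \<le> 2 * \<rho>" using N_add[of "y - b" c] by linarith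
    moreover have "m - b = (y - b) + c" by (simp add: yc(3))
    ultimately show "N (m - b) \<le> 2 * \<rho>" by (simp only:)
  qed
  obtain U where U: "finite U" "U \<subseteq> B" "real (card U) * measure (leb n) M \<le> measure (leb n) (dil (5 / 2))"
    "\<And>x. x \<in> B \<Longrightarrow> \<exists>u\<in>U. \<exists>m\<in>M. \<exists>m'\<in>M. x = u + m - m'"
  proof (rule packing_cover[of B n M "dil (5 / 2)"])
    show "u + m \<in> dil (5 / 2)" if "u \<in> B" "m \<in> M" for u m
    proof -
      have "u + m \<in> dil (1 + (1 + 1 / 2))" using that M_dil by (intro dil_add) (auto simp: dil_1)
      then show ?thesis by simp
    qed
  qed (use sub Ms Mpos fin_dil in auto)
  have cardU: "real (card U) \<le> cov1 ^ n"
  proof -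
    have "real (card U) * v \<le> real (card U) * ((4 * 3 ^ 16) ^ n * measure (leb n) M)"
      by (rule mult_left_mono[OF M_meas]) simp
    also have "\<dots> = (4 * 3 ^ 16) ^ n * (real (card U) * measure (leb n) M)" by (simp only: mult_ac)
    also have "\<dots> \<le> (4 * 3 ^ 16) ^ n * ((5 / 2) ^ n * v)"
      using U(3) by (intro mult_left_mono) (simp_all add: vol_dil)
    also have "\<dots> = (4 * 3 ^ 16 * (5 / 2)) ^ n * v" by (simp only: power_mult_distrib mult.assoc)
    also have "(4 * 3 ^ 16 * (5 / 2)) = cov1" by (simp add: cov1_def)
    finally show ?thesis using v_pos by simp
  qed
  have covU: "\<exists>u\<in>U. N (x - u) \<le> 4 * \<rho>" if x: "x \<in> B" for x
  proof -
    obtain u m m' where u: "u \<in> U" "m \<in> M" "m' \<in> M" "x = u + m - m'" using U(4)[OF x] by blast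
    have "x - u = (m - b) - (m' - b)" by (simp add: u(4))
    then have "N (x - u) \<le> N (m - b) + N (m' - b)" using N_diff[of "m - b" "m' - b"] by simp
    then show ?thesis using M_N[OF u(2)] M_N[OF u(3)] u(1) by (intro bexI[of _ u]) auto
  qed
  define E1 where "E1 = {z. N z \<le> \<rho>}"
  have E1: "emeasure (leb n) E1 \<le> ennreal (90540 ^ n * v)"
  proof -
    have "emeasure (leb n) E1 \<le> ennreal (exp (real n) * (\<Prod>i<n. sqrt (2 * pi) / R i i))"
      unfolding E1_def N_def \<rho>_def using fr(1,2) by (intro triangular_ellipsoid_volume) auto
    also have "\<dots> \<le> ennreal (90540 ^ n * v)"
    proof (rule ennreal_leI)
      have s: "sqrt (2 * pi) \<le> 3"
      proof -
        have "sqrt (2 * pi) \<le> sqrt 9" using pi_less_4 by (intro real_sqrt_le_mono) simp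
        then show ?thesis by simp
      qed
      have "(\<Prod>i<n. sqrt (2 * pi) / R i i) = sqrt (2 * pi) ^ n * (\<Prod>i<n. 1 / R i i)"
        by (simp add: prod_dividef)
      also have "\<dots> \<le> 3 ^ n * (10060 ^ n * v)"
        using fr(2,4) s by (intro mult_mono power_mono prod_nonneg) (auto simp: less_imp_le)
      finally have 1: "(\<Prod>i<n. sqrt (2 * pi) / R i i) \<le> 3 ^ n * (10060 ^ n * v)" .
      have "exp (real n) = exp 1 ^ n" by (simp add: exp_of_nat_mult[symmetric])
      then have 2: "exp (real n) \<le> 3 ^ n" using exp_le by (simp add: power_mono)
      have "exp (real n) * (\<Prod>i<n. sqrt (2 * pi) / R i i) \<le> 3 ^ n * (3 ^ n * (10060 ^ n * v))"
        by (rule mult_mono[OF 2 1]) (use fr(2) in \<open>auto intro!: prod_nonneg simp: less_imp_le\<close>)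
      also have "\<dots> = (3 * 3 * 10060) ^ n * v" by (simp only: power_mult_distrib mult.assoc)
      finally show "exp (real n) * (\<Prod>i<n. sqrt (2 * pi) / R i i) \<le> 90540 ^ n * v" by simp
    qed
    finally show ?thesis .
  qed
  \<comment> \<open>\<open>D\<close> has to contain all sums of a point of \<open>E8\<close> and a
    point of \<open>dil (1 / 4)\<close>. Scaled by \<open>1 / 4\<close>, the first cover puts
    \<open>dil (1 / 4)\<close> within \<open>\<rho>\<close> of the points \<open>u / 4\<close>, and
    \<open>8 * \<rho> + \<rho>\<close> gives the radius.\<close>
  define Dc where "Dc u = {z. N (z - (1 / 4) *\<^sub>R u) \<le> 9 * \<rho>}" for u
  have Dcs: "Dc u \<in> sets borel" for u unfolding Dc_def by (rule Nm)
  have Dc: "emeasure (leb n) (Dc u) \<le> ennreal (9 ^ n * (90540 ^ n * v))" if u: "u \<in> U" for u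
  proof -
    have ur: "(1 / 4) *\<^sub>R u \<in> real_space n" using u U(2) sub by (auto intro: real_space_scaleR)
    have "emeasure (leb n) (Dc u) = ennreal (9 ^ n) * emeasure (leb n) {x. (1 / 4) *\<^sub>R u + 9 *\<^sub>R x \<in> Dc u}"
      by (rule emeasure_leb_affine[OF Dcs _ ur]) simp
    also have "{x. (1 / 4) *\<^sub>R u + 9 *\<^sub>R x \<in> Dc u} = E1"
    proof -
      have "((1 / 4) *\<^sub>R u + 9 *\<^sub>R x \<in> Dc u) = (x \<in> E1)" for x
        unfolding Dc_def E1_def mem_Collect_eq add_diff_cancel_left' using N_scale[of 9 x] by simp
      then show ?thesis by blast
    qed
    also have "ennreal (9 ^ n) * emeasure (leb n) E1 \<le> ennreal (9 ^ n) * ennreal (90540 ^ n * v)"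
      by (rule mult_left_mono[OF E1]) simp
    also have "\<dots> = ennreal (9 ^ n * (90540 ^ n * v))" using v_pos by (simp flip: ennreal_mult)
    finally show ?thesis .
  qed
  define D where "D = (\<Union>u\<in>U. Dc u)"
  have De: "emeasure (leb n) D \<le> ennreal (real (card U) * (9 ^ n * (90540 ^ n * v)))"
  proof -
    have "emeasure (leb n) D \<le> (\<Sum>u\<in>U. emeasure (leb n) (Dc u))"
      unfolding D_def using Dcs U(1) by (intro emeasure_subadditive_finite) auto
    also have "\<dots> \<le> (\<Sum>u\<in>U. ennreal (9 ^ n * (90540 ^ n * v)))" by (intro sum_mono Dc)
    also have "\<dots> = ennreal (\<Sum>u\<in>U. 9 ^ n * (90540 ^ n * v))"
      using v_pos by (intro sum_ennreal) simp
    finally show ?thesis by simp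
  qed
  have Dfin: "emeasure (leb n) D < \<infinity>" using De by (rule le_less_trans) simp
  have Dm: "measure (leb n) D \<le> real (card U) * (9 ^ n * (90540 ^ n * v))"
    unfolding measure_def using enn2real_mono[OF De] v_pos by simp
  define E8 where "E8 = {z \<in> real_space n. N z \<le> 8 * \<rho>}"
  obtain U' where U': "finite U'" "U' \<subseteq> E8" "real (card U') * measure (leb n) (dil (1 / 4)) \<le> measure (leb n) D"
    "\<And>x. x \<in> E8 \<Longrightarrow> \<exists>u\<in>U'. \<exists>m\<in>dil (1 / 4). \<exists>m'\<in>dil (1 / 4). x = u + m - m'"
  proof (rule packing_cover[of E8 n "dil (1 / 4)" D])
    show "D \<in> sets borel" unfolding D_def using Dcs U(1) by (intro sets.finite_UN) auto
    show "u + m \<in> D" if "u \<in> E8" "m \<in> dil (1 / 4)" for u m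
    proof -
      have "4 *\<^sub>R m \<in> B" using that(2) dil_iff[of "1 / 4" m] by simp
      then obtain w where w: "w \<in> U" "N (4 *\<^sub>R m - w) \<le> 4 * \<rho>" using covU by blast
      have "(1 / 4) *\<^sub>R (4 *\<^sub>R m - w) = m - (1 / 4) *\<^sub>R w" by (rule ext) simp
      then have "N (m - (1 / 4) *\<^sub>R w) \<le> \<rho>" using w(2) N_scale[of "1 / 4" "4 *\<^sub>R m - w"] by simp
      moreover have "N (u + m - (1 / 4) *\<^sub>R w) = N (u + (m - (1 / 4) *\<^sub>R w))"
        by (rule arg_cong[where f = N]) (rule add_diff_eq[symmetric])
      ultimately have "N (u + m - (1 / 4) *\<^sub>R w) \<le> N u + \<rho>" using N_add[of u "m - (1 / 4) *\<^sub>R w"] by linarith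
      also have "\<dots> \<le> 9 * \<rho>" using that(1) by (simp add: E8_def)
      finally have "u + m \<in> Dc w" unfolding Dc_def mem_Collect_eq .
      then show ?thesis using w(1) unfolding D_def by blast
    qed
    show "E8 \<subseteq> real_space n" by (auto simp: E8_def)
    show "emeasure (leb n) (dil (1 / 4)) > 0" by (rule emeasure_dil_pos) simp
    show "dil (1 / 4) \<in> sets borel" by (rule sets_dil) simp
  qed (use Dfin in auto)
  have cardU': "real (card U') \<le> cov2 ^ n"
  proof -
    have "real (card U') * ((1 / 4) ^ n * v) \<le> real (card U) * (9 ^ n * (90540 ^ n * v))"
      using U'(3) Dm by (simp add: vol_dil)
    also have "\<dots> \<le> cov1 ^ n * (9 ^ n * (90540 ^ n * v))"
      using cardU v_pos by (intro mult_right_mono) auto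
    also have "\<dots> = (cov1 * (9 * 90540)) ^ n * v" by (simp only: power_mult_distrib mult.assoc)
    finally have "real (card U') * (1 / 4) ^ n \<le> (cov1 * (9 * 90540)) ^ n"
      using v_pos by (simp only: mult.assoc[symmetric] mult_le_cancel_right_pos)
    then have "real (card U') * (1 / 4) ^ n * 4 ^ n \<le> (cov1 * (9 * 90540)) ^ n * 4 ^ n"
      by (rule mult_right_mono) simp
    moreover have "real (card U') * (1 / 4) ^ n * 4 ^ n = real (card U')"
      by (simp add: mult.assoc flip: power_mult_distrib)
    moreover have "(cov1 * (9 * 90540)) ^ n * 4 ^ n = cov2 ^ n"
      unfolding power_mult_distrib[symmetric] cov2_def by simp
    ultimately show ?thesis by (simp only:)
  qed
  define \<gamma> where "\<gamma> = (\<lambda>x i. if i < n then dot n (R i) x / (4 * \<rho>) else 0)"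
  have \<gamma>N: "L2_set (\<gamma> z) {..<n} = N z / (4 * \<rho>)" for z
  proof -
    have "L2_set (\<gamma> z) {..<n} = L2_set (\<lambda>i. 1 / (4 * \<rho>) * dot n (R i) z) {..<n}"
      by (rule L2_set_cong) (simp_all add: \<gamma>_def)
    also have "\<dots> = 1 / (4 * \<rho>) * N z"
      unfolding N_def using \<rho> by (intro L2_set_right_distrib[symmetric]) simp
    finally show ?thesis by simp
  qed
  show ?thesis
  proof (rule exI[of _ \<gamma>], rule exI[of _ U], rule exI[of _ U'], intro conjI ballI impI)
    show "\<gamma> \<in> GL n"
      unfolding \<gamma>_def using fr(1-3) \<rho> by (intro triangular_GL[where A = A]) auto
    show "finite U" "finite U'" "real (card U) \<le> cov1 ^ n" "real (card U') \<le> cov2 ^ n"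
      by (rule U(1) U'(1) cardU cardU')+
    show "\<exists>u\<in>U. L2_set (\<gamma> (x - u)) {..<n} \<le> 1" if "x \<in> B" for x
      using covU[OF that] \<rho> by (simp add: \<gamma>N)
    fix z assume z: "z \<in> real_space n" "L2_set (\<gamma> z) {..<n} \<le> 2"
    then have "z \<in> E8" using \<rho> by (simp add: E8_def \<gamma>N field_simps)
    then obtain u m m' where u: "u \<in> U'" "m \<in> dil (1 / 4)" "m' \<in> dil (1 / 4)" "z = u + m - m'" using U'(4) by blast
    have "z - u = m - m'" by (simp add: u(4))
    moreover have "m - m' \<in> dil (1 / 4 + 1 / 4)" using u by (intro dil_diff) auto
    ultimately show "\<exists>u\<in>U'. z - u \<in> dil (1 / 2)" using u(1) by (intro bexI[of _ u]) simp_all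
  qed
qed

end

section \<open>Lattice points and progressions\<close>

lemma sum_apply: "(\<Sum>i\<in>I. f i) x = (\<Sum>i\<in>I. f i x)" for f :: "'i \<Rightarrow> nat \<Rightarrow> real"
  by (induction I rule: infinite_finite_induct) simp_all

lemma L2_set_linear_diff:
  fixes \<gamma> :: "(nat \<Rightarrow> real) \<Rightarrow> nat \<Rightarrow> real"
  assumes "linear \<gamma>" shows "L2_set (\<gamma> (x - y)) {..<n} \<le> L2_set (\<gamma> x) {..<n} + L2_set (\<gamma> y) {..<n}"
proof -
  have "L2_set (\<gamma> (x - y)) {..<n} = L2_set (\<lambda>i. \<gamma> x i + (- \<gamma> y i)) {..<n}"
    unfolding linear_diff[OF assms] by (simp add: L2_set_def)
  also have "\<dots> \<le> L2_set (\<gamma> x) {..<n} + L2_set (\<lambda>i. - \<gamma> y i) {..<n}" by (rule L2_set_triangle_ineq)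
  also have "L2_set (\<lambda>i. - \<gamma> y i) {..<n} = L2_set (\<gamma> y) {..<n}" by (simp add: L2_set_def)
  finally show ?thesis .
qed

lemma L2_set_linear_scale:
  fixes \<gamma> :: "(nat \<Rightarrow> real) \<Rightarrow> nat \<Rightarrow> real"
  assumes "linear \<gamma>" "c \<ge> 0" shows "L2_set (\<gamma> (c *\<^sub>R x)) {..<n} = c * L2_set (\<gamma> x) {..<n}"
proof -
  have "L2_set (\<gamma> (c *\<^sub>R x)) {..<n} = L2_set (\<lambda>i. c * \<gamma> x i) {..<n}"
  proof -
    have "c *\<^sub>R \<gamma> x = (\<lambda>i. c * \<gamma> x i)" by (rule ext) (simp only: scaleR_apply)
    then show ?thesis unfolding linear_scale[OF assms(1)] by (simp only:)
  qed
  then show ?thesis unfolding L2_set_right_distrib[OF assms(2)] .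
qed

lemma int_lattice_diff: "x \<in> int_lattice n \<Longrightarrow> y \<in> int_lattice n \<Longrightarrow> x - y \<in> int_lattice n"
  unfolding int_lattice_def by (auto intro: real_space_diff)

lemma GL_scale:
  assumes "\<gamma> \<in> GL n" "c > 0" shows "(\<lambda>x. \<gamma> (c *\<^sub>R x)) \<in> GL n"
proof -
  have lin: "linear \<gamma>" and bij: "bij_betw \<gamma> (real_space n) (real_space n)" using assms by (auto simp: GL_def)
  have l: "linear (\<lambda>x. \<gamma> (c *\<^sub>R x))"
    by (rule linearI) (simp_all only: scaleR_add_right linear_add[OF lin] linear_scale[OF lin] scaleR_left_commute[of c])
  have sc: "bij_betw ((*\<^sub>R) c) (real_space n) (real_space n)"
    by (rule bij_betw_byWitness[where f' = "(*\<^sub>R) (1 / c)"]) (use assms(2) in \<open>auto intro: real_space_scaleR\<close>)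
  have "bij_betw (\<gamma> \<circ> (*\<^sub>R) c) (real_space n) (real_space n)" by (rule bij_betw_trans[OF sc bij])
  then have "bij_betw (\<lambda>x. \<gamma> (c *\<^sub>R x)) (real_space n) (real_space n)" unfolding comp_def .
  with l show ?thesis unfolding GL_def by blast
qed

lemma (in sbody) finite_lattice: "finite (B \<inter> int_lattice n)"
proof -
  have "B \<inter> int_lattice n \<subseteq> grid 1"
    by (auto simp: grid_def int_lattice_def elim: Ints_cases)
  then show ?thesis using finite_grid[of 1] by (rule finite_subset) simp
qed

text \<open>The centres \<open>u\<close> of the cover need not be integral. Each is replaced by a
  lattice point of \<open>B\<close> in its ellipsoid, which doubles the ellipsoid, hence
  \<open>\<gamma>'\<close>. Conversely a translate of \<open>dil (1 / 2)\<close> contains at most as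
  many lattice points as \<open>B\<close>, since subtracting one of them maps them all into
  \<open>B\<close>.\<close>

lemma (in sbody) lattice_ellipsoid:
  "\<exists>\<gamma> X. \<gamma> \<in> GL n \<and> finite X \<and> X \<subseteq> int_lattice n \<and> real (card X) \<le> cov1 ^ n \<and>
    real (card (ellipsoid_lattice_points n \<gamma>)) \<le> cov2 ^ n * real (card (B \<inter> int_lattice n)) \<and>
    (\<forall>x\<in>B \<inter> int_lattice n. \<exists>w\<in>X. x - w \<in> ellipsoid_lattice_points n \<gamma>)"
proof -
  obtain \<gamma> U U' where g: "\<gamma> \<in> GL n" "finite U" "real (card U) \<le> cov1 ^ n" "finite U'" "real (card U') \<le> cov2 ^ n"
    "\<forall>x\<in>B. \<exists>u\<in>U. L2_set (\<gamma> (x - u)) {..<n} \<le> 1"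
    "\<forall>z\<in>real_space n. L2_set (\<gamma> z) {..<n} \<le> 2 \<longrightarrow> (\<exists>u\<in>U'. z - u \<in> dil (1 / 2))"
    using milman_ellipsoid by (elim exE conjE)
  have lin: "linear \<gamma>" using g(1) by (simp add: GL_def)
  define \<gamma>' where "\<gamma>' = (\<lambda>x. \<gamma> ((1 / 2) *\<^sub>R x))"
  have g'GL: "\<gamma>' \<in> GL n" unfolding \<gamma>'_def by (rule GL_scale[OF g(1)]) simp
  have g'iff: "L2_set (\<gamma>' z) {..<n} \<le> 1 \<longleftrightarrow> L2_set (\<gamma> z) {..<n} \<le> 2" for z
    unfolding \<gamma>'_def by (subst L2_set_linear_scale[OF lin]) auto
  define Q where "Q u x \<longleftrightarrow> x \<in> B \<inter> int_lattice n \<and> L2_set (\<gamma> (x - u)) {..<n} \<le> 1" for u x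
  define rep where "rep u = (SOME x. Q u x)" for u
  define X where "X = rep ` {u \<in> U. \<exists>x. Q u x}"
  have rep: "Q u (rep u)" if "Q u x" for u x unfolding rep_def by (rule someI[of "Q u" x]) (rule that)
  define EL where "EL = ellipsoid_lattice_points n \<gamma>'"
  have cov: "\<exists>w\<in>X. x - w \<in> EL" if x: "x \<in> B \<inter> int_lattice n" for x
  proof -
    obtain u where u: "u \<in> U" "L2_set (\<gamma> (x - u)) {..<n} \<le> 1" using g(6) x by blast
    then have q: "Q u x" using x by (simp add: Q_def)
    then have r: "Q u (rep u)" by (rule rep)
    have "x - rep u = (x - u) - (rep u - u)" by simp
    then have "L2_set (\<gamma> (x - rep u)) {..<n} \<le> L2_set (\<gamma> (x - u)) {..<n} + L2_set (\<gamma> (rep u - u)) {..<n}"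
      using L2_set_linear_diff[OF lin, of "x - u" "rep u - u" n] by simp
    then have "L2_set (\<gamma> (x - rep u)) {..<n} \<le> 2" using q r unfolding Q_def by linarith
    moreover have "x - rep u \<in> int_lattice n" using q r unfolding Q_def by (intro int_lattice_diff) blast+
    ultimately have "x - rep u \<in> EL" unfolding EL_def ellipsoid_lattice_points_def by (simp add: g'iff)
    moreover have "rep u \<in> X" unfolding X_def using u(1) q by blast
    ultimately show ?thesis by blast
  qed
  define S where "S u = {z \<in> int_lattice n. z - u \<in> dil (1 / 2)}" for u
  have S: "finite (S u) \<and> card (S u) \<le> card (B \<inter> int_lattice n)" for u
  proof (cases "S u = {}")
    case False
    then obtain z0 where z0: "z0 \<in> S u" by blast
    have "(\<lambda>z. z - z0) ` S u \<subseteq> B \<inter> int_lattice n"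
    proof
      fix y assume "y \<in> (\<lambda>z. z - z0) ` S u"
      then obtain z where z: "z \<in> S u" "y = z - z0" by blast
      have "(z - u) - (z0 - u) \<in> dil (1 / 2 + 1 / 2)" using z z0 unfolding S_def by (intro dil_diff) auto
      moreover have "(z - u) - (z0 - u) = y" by (simp add: z(2))
      ultimately have "y \<in> B" by (simp add: dil_1)
      moreover have "y \<in> int_lattice n" unfolding z(2) using z z0 unfolding S_def by (intro int_lattice_diff) blast+
      ultimately show "y \<in> B \<inter> int_lattice n" by blast
    qed
    moreover have inj: "inj_on (\<lambda>z. z - z0) (S u)" by (rule inj_onI) simp
    ultimately show ?thesis using finite_lattice by (metis card_inj_on_le inj_on_finite)
  qed simp
  have "EL \<subseteq> (\<Union>u\<in>U'. S u)"
  proof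
    fix z assume "z \<in> EL"
    then have z: "z \<in> int_lattice n" "L2_set (\<gamma> z) {..<n} \<le> 2"
      by (simp_all add: EL_def ellipsoid_lattice_points_def g'iff)
    then have "z \<in> real_space n" by (simp add: int_lattice_def)
    then obtain u where "u \<in> U'" "z - u \<in> dil (1 / 2)" using g(7) z(2) by blast
    then show "z \<in> (\<Union>u\<in>U'. S u)" using z(1) by (auto simp: S_def)
  qed
  then have "card EL \<le> card (\<Union>u\<in>U'. S u)" using S g(4) by (intro card_mono) auto
  also have "\<dots> \<le> (\<Sum>u\<in>U'. card (S u))" by (rule card_UN_le[OF g(4)])
  also have "\<dots> \<le> (\<Sum>u\<in>U'. card (B \<inter> int_lattice n))" using S by (intro sum_mono) blast
  finally have "card EL \<le> card U' * card (B \<inter> int_lattice n)" by simp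
  then have "real (card EL) \<le> real (card U' * card (B \<inter> int_lattice n))" by (simp only: of_nat_le_iff)
  also have "\<dots> = real (card U') * real (card (B \<inter> int_lattice n))" by simp
  also have "\<dots> \<le> cov2 ^ n * real (card (B \<inter> int_lattice n))" using g(5) by (rule mult_right_mono) simp
  finally have cEL: "real (card EL) \<le> cov2 ^ n * real (card (B \<inter> int_lattice n))" .
  show ?thesis
  proof (rule exI[of _ \<gamma>'], rule exI[of _ X], intro conjI)
    show "\<gamma>' \<in> GL n" by (rule g'GL)
    show "finite X" unfolding X_def using g(2) by simp
    show "X \<subseteq> int_lattice n" unfolding X_def using rep by (auto simp: Q_def)
    have "card X \<le> card U"
      unfolding X_def using g(2) by (intro order_trans[OF card_image_le] card_mono) auto
    then have "real (card X) \<le> real (card U)" by simp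
    then show "real (card X) \<le> cov1 ^ n" using g(3) by linarith
    show "real (card (ellipsoid_lattice_points n \<gamma>')) \<le> cov2 ^ n * real (card (B \<inter> int_lattice n))"
      using cEL unfolding EL_def .
    show "\<forall>x\<in>B \<inter> int_lattice n. \<exists>w\<in>X. x - w \<in> ellipsoid_lattice_points n \<gamma>'"
      using cov unfolding EL_def by blast
  qed
qed

section \<open>Convex bodies in the topology of \<open>Euclidean_space\<close>\<close>

lemma Euclidean_space_eq: "Euclidean_space d = subtopology euclidean (real_space d)"
proof -
  have "real_space d = {x. \<forall>i\<ge>d. x i = 0}" by (auto simp: mem_real_space)
  then show ?thesis by (simp only: Euclidean_space_def euclidean_product_topology)
qed

lemma compactin_Euclidean_space_iff: "compactin (Euclidean_space d) B \<longleftrightarrow> compact B \<and> B \<subseteq> real_space d"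
  unfolding Euclidean_space_eq by (simp add: compactin_subtopology)

text \<open>A basic open set of the product topology restricts single coordinates. Inside
  \<open>real_space d\<close> those from \<open>d\<close> on agree with \<open>p\<close>, so only
  finitely many radii matter, and they have a positive minimum.\<close>

lemma openin_box:
  assumes U: "openin (Euclidean_space d) U" and p: "p \<in> U"
  shows "\<exists>\<epsilon>>0. \<forall>x\<in>real_space d. (\<forall>i<d. \<bar>x i - p i\<bar> \<le> \<epsilon>) \<longrightarrow> x \<in> U"
proof -
  obtain T where T: "openin (powertop_real UNIV) T" "U = T \<inter> {x. \<forall>i\<ge>d. x i = 0}"
    using U unfolding Euclidean_space_def openin_subtopology by blast
  have "p \<in> T" using p T(2) by blast
  from product_topology_open_contains_basis[OF T(1) this] obtain X where
    X: "p \<in> (\<Pi>\<^sub>E i\<in>UNIV. X i)" "\<forall>i. openin euclideanreal (X i)" "(\<Pi>\<^sub>E i\<in>UNIV. X i) \<subseteq> T" by (elim exE conjE)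
  have pX: "p i \<in> X i" for i using X(1) by (simp add: PiE_iff)
  have "\<exists>e>0. \<forall>y. \<bar>y - p i\<bar> \<le> e \<longrightarrow> y \<in> X i" for i
  proof -
    have "open (X i)" using X(2) by simp
    then obtain e where e: "e > 0" "cball (p i) e \<subseteq> X i" using pX open_contains_cball by blast
    then show ?thesis by (intro exI[of _ e]) (auto simp: subset_iff dist_real_def abs_minus_commute)
  qed
  then obtain e where e: "\<And>i. e i > 0" "\<And>i y. \<bar>y - p i\<bar> \<le> e i \<Longrightarrow> y \<in> X i" by metis
  \<comment> \<open>The element 1 keeps the set nonempty when \<open>d = 0\<close>.\<close>
  define \<epsilon> where "\<epsilon> = Min (insert 1 (e ` {..<d}))"
  have \<epsilon>: "\<epsilon> > 0" unfolding \<epsilon>_def using e(1) by (subst Min_gr_iff) auto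
  have \<epsilon>e: "\<epsilon> \<le> e i" if "i < d" for i unfolding \<epsilon>_def using that by (intro Min_le) auto
  show ?thesis
  proof (rule exI[of _ \<epsilon>], intro conjI ballI impI \<epsilon>)
    fix x assume x: "x \<in> real_space d" "\<forall>i<d. \<bar>x i - p i\<bar> \<le> \<epsilon>"
    have "x i \<in> X i" for i
    proof (cases "i < d")
      case True
      then show ?thesis using e(2)[of "x i" i] x(2) \<epsilon>e[of i] by fastforce
    next
      case False
      then have "x i = p i" using x(1) p T(2) by (simp add: mem_real_space)
      then show ?thesis using pX by simp
    qed
    then have "x \<in> (\<Pi>\<^sub>E i\<in>UNIV. X i)" by (simp add: PiE_iff)
    then show "x \<in> U" using X(3) T(2) x(1) by (auto simp: mem_real_space)
  qed
qed

text \<open>The box around an interior point \<open>p\<close> is moved to the origin: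
  \<open>x\<close> is the midpoint of \<open>p + x\<close> and \<open>- (p - x)\<close>, both of
  which lie in \<open>B\<close>.\<close>

lemma convex_body_sbody:
  assumes "convex_body d B" "centrally_symmetric B" "d \<ge> 1"
  shows "\<exists>r R. sbody d B r R"
proof -
  have c: "compact B" "B \<subseteq> real_space d" "convex B" "(Euclidean_space d) interior_of B \<noteq> {}"
    using assms(1) by (auto simp: convex_body_def compactin_Euclidean_space_iff)
  have sy: "- x \<in> B" if "x \<in> B" for x using assms(2) that by (auto simp: centrally_symmetric_def)
  have "compact (ell1 d ` B)"
    using c(1) unfolding ell1_def[abs_def] by (intro compact_continuous_image continuous_intros)
  then obtain R where "\<forall>y\<in>ell1 d ` B. norm y \<le> R"
    using compact_imp_bounded bounded_iff by blast
  then have R: "ell1 d x \<le> R" if "x \<in> B" for x using that by auto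
  obtain p where pint: "p \<in> (Euclidean_space d) interior_of B" using c(4) by blast
  from openin_box[OF openin_interior_of pint] obtain \<epsilon> where
    e: "\<epsilon> > 0" "\<forall>x\<in>real_space d. (\<forall>i<d. \<bar>x i - p i\<bar> \<le> \<epsilon>) \<longrightarrow> x \<in> (Euclidean_space d) interior_of B" by (elim exE conjE)
  have pB: "p \<in> B" by (rule subsetD[OF interior_of_subset pint])
  have "sbody d B \<epsilon> R"
  proof
    show "closed B" using c(1) by (rule compact_imp_closed)
    fix x assume x: "x \<in> real_space d" "\<And>i. i < d \<Longrightarrow> \<bar>x i\<bar> \<le> \<epsilon>"
    have 1: "p + y \<in> B" if "y \<in> real_space d" "\<And>i. i < d \<Longrightarrow> \<bar>y i\<bar> \<le> \<epsilon>" for y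
    proof -
      have "p + y \<in> real_space d" using pB c(2) that by (intro real_space_add) auto
      moreover have "\<forall>i<d. \<bar>(p + y) i - p i\<bar> \<le> \<epsilon>" using that by simp
      ultimately have "p + y \<in> (Euclidean_space d) interior_of B" using e(2) by blast
      then show ?thesis by (rule subsetD[OF interior_of_subset])
    qed
    have "p + x \<in> B" using x by (rule 1)
    moreover have "- (p + - x) \<in> B" using x by (intro sy 1 real_space_uminus) simp_all
    ultimately have "(1 / 2) *\<^sub>R (p + x) + (1 / 2) *\<^sub>R (- (p + - x)) \<in> B"
      by (intro convexD[OF c(3)]) simp_all
    also have "(1 / 2) *\<^sub>R (p + x) + (1 / 2) *\<^sub>R (- (p + - x)) = x"
      by (rule ext) (simp add: field_simps)
    finally show "x \<in> B" .
  next
    fix x i assume x: "x \<in> B"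
    show "\<bar>x i\<bar> \<le> R"
    proof (cases "i < d")
      case True
      then show ?thesis using coord_le_ell1[of i d x] R[OF x] by linarith
    next
      case False
      then have "x i = 0" using x c(2) by (auto simp: mem_real_space)
      then show ?thesis using R[OF x] ell1_nonneg[of d x] by linarith
    qed
  qed (use assms(3) c sy e(1) in auto)
  then show ?thesis by blast
qed

lemma cov_ge_1: "1 \<le> cov1" "cov1 \<le> cov2"
  by (simp_all add: cov1_def cov2_def)

lemma convex_body_lattice_ellipsoid:
  assumes B: "convex_body d B" "centrally_symmetric B"
  shows "\<exists>\<gamma> X. \<gamma> \<in> GL d \<and> finite X \<and> X \<subseteq> int_lattice d \<and> real (card X) \<le> cov2 ^ d \<and>
    real (card (ellipsoid_lattice_points d \<gamma>)) \<le> cov2 ^ d * real (card (B \<inter> int_lattice d)) \<and>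
    (\<forall>x\<in>B \<inter> int_lattice d. \<exists>w\<in>X. x - w \<in> ellipsoid_lattice_points d \<gamma>)"
proof (cases "d \<ge> 1")
  case True
  from convex_body_sbody[OF B this] obtain r R where "sbody d B r R" by blast
  from sbody.lattice_ellipsoid[OF this] obtain \<gamma> X where X: "\<gamma> \<in> GL d" "finite X" "X \<subseteq> int_lattice d"
    "real (card X) \<le> cov1 ^ d"
    "real (card (ellipsoid_lattice_points d \<gamma>)) \<le> cov2 ^ d * real (card (B \<inter> int_lattice d))"
    "\<forall>x\<in>B \<inter> int_lattice d. \<exists>w\<in>X. x - w \<in> ellipsoid_lattice_points d \<gamma>" by (elim exE conjE)
  have "cov1 ^ d \<le> cov2 ^ d" using cov_ge_1 by (intro power_mono) auto
  then have "real (card X) \<le> cov2 ^ d" using X(4) by linarith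
  then show ?thesis using X by blast
next
  \<comment> \<open>\<open>sbody\<close> requires positive dimension. In dimension 0 the body, the
    lattice and the ellipsoid are all \<open>{0}\<close>.\<close>
  case False
  then have d: "d = 0" by simp
  have r0: "real_space 0 = {0}" by (auto simp: mem_real_space)
  have L: "int_lattice 0 = {0}" unfolding int_lattice_def r0 by auto
  have B0: "(Euclidean_space 0) interior_of B \<noteq> {}" "B \<subseteq> real_space 0"
    using B(1) by (auto simp: d convex_body_def compactin_Euclidean_space_iff)
  have "B \<noteq> {}"
  proof
    assume "B = {}"
    then show False using B0(1) by (simp add: interior_of_empty)
  qed
  then have "B = {0}" using B0(2) unfolding r0 by (simp add: subset_singleton_iff)
  moreover have "linear (id :: (nat \<Rightarrow> real) \<Rightarrow> nat \<Rightarrow> real)" by (rule linearI) simp_all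
  then have "id \<in> GL 0" unfolding GL_def using bij_betw_id by blast
  moreover have "ellipsoid_lattice_points 0 id = {0}" by (auto simp: ellipsoid_lattice_points_def L)
  ultimately show ?thesis unfolding d by (intro exI[of _ id] exI[of _ "{0}"]) (simp add: L)
qed

section \<open>Ellipsoids as convex bodies\<close>

definition ellipsoid :: "nat \<Rightarrow> ((nat \<Rightarrow> real) \<Rightarrow> nat \<Rightarrow> real) \<Rightarrow> (nat \<Rightarrow> real) set" where
  "ellipsoid d \<gamma> = {x \<in> real_space d. L2_set (\<gamma> x) {..<d} \<le> 1}"

lemma real_space_expand:
  "x \<in> real_space d \<Longrightarrow> x = (\<Sum>j<d. x j *\<^sub>R (\<lambda>i. if i = j then 1 else 0))"
proof
  fix i assume "x \<in> real_space d"
  then show "x i = (\<Sum>j<d. x j *\<^sub>R (\<lambda>i. if i = j then 1 else 0)) i"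
    by (simp add: sum_apply mem_real_space if_distrib[of "\<lambda>u. _ * u"] cong: if_cong)
qed

text \<open>With respect to the preimages \<open>c i\<close> of the unit vectors, the coefficients
  of \<open>x\<close> are the entries of \<open>\<gamma> x\<close>, which are at most 1 in
  modulus.\<close>

lemma ellipsoid_bounded:
  assumes "\<gamma> \<in> GL d"
  shows "\<exists>K. \<forall>x\<in>ellipsoid d \<gamma>. \<forall>j. \<bar>x j\<bar> \<le> K"
proof -
  have lin: "linear \<gamma>" and bij: "bij_betw \<gamma> (real_space d) (real_space d)" using assms by (auto simp: GL_def)
  define e :: "nat \<Rightarrow> nat \<Rightarrow> real" where "e j = (\<lambda>i. if i = j then 1 else 0)" for j
  have "\<exists>c. c \<in> real_space d \<and> \<gamma> c = e i" if "i < d" for i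
  proof -
    have "e i \<in> real_space d" using that by (simp add: mem_real_space e_def)
    then show ?thesis using bij_betw_imp_surj_on[OF bij] by (metis imageE)
  qed
  then obtain c where c: "\<And>i. i < d \<Longrightarrow> c i \<in> real_space d" "\<And>i. i < d \<Longrightarrow> \<gamma> (c i) = e i" by metis
  define K where "K = (\<Sum>i<d. \<Sum>j<d. \<bar>c i j\<bar>)"
  have "\<bar>x j\<bar> \<le> K" if x: "x \<in> ellipsoid d \<gamma>" for x j
  proof (cases "j < d")
    case True
    have xr: "x \<in> real_space d" and x1: "L2_set (\<gamma> x) {..<d} \<le> 1" using x by (auto simp: ellipsoid_def)
    have yr: "\<gamma> x \<in> real_space d" by (rule bij_betw_apply[OF bij xr])
    define x' where "x' = (\<Sum>i<d. \<gamma> x i *\<^sub>R c i)"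
    have x'r: "x' \<in> real_space d"
      unfolding mem_real_space x'_def sum_apply using c(1) by (auto simp: mem_real_space intro!: sum.neutral)
    have "\<gamma> x' = (\<Sum>i<d. \<gamma> x i *\<^sub>R e i)"
      unfolding x'_def linear_sum[OF lin] linear_scale[OF lin] using c(2) by (intro sum.cong) auto
    also have "\<dots> = \<gamma> x" unfolding e_def by (rule real_space_expand[OF yr, symmetric])
    finally have xx: "x' = x" by (rule inj_onD[OF bij_betw_imp_inj_on[OF bij] _ x'r xr])
    have "x j = x' j" by (simp only: xx)
    also have "x' j = (\<Sum>i<d. \<gamma> x i * c i j)" by (simp add: x'_def sum_apply)
    finally have "\<bar>x j\<bar> = \<bar>\<Sum>i<d. \<gamma> x i * c i j\<bar>" by (rule arg_cong)
    also have "\<dots> \<le> (\<Sum>i<d. \<bar>\<gamma> x i * c i j\<bar>)" by (rule sum_abs)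
    also have "\<dots> \<le> (\<Sum>i<d. \<Sum>j<d. \<bar>c i j\<bar>)"
    proof (rule sum_mono)
      fix i assume i: "i \<in> {..<d}"
      have "\<bar>\<gamma> x i\<bar> \<le> L2_set (\<lambda>i. \<bar>\<gamma> x i\<bar>) {..<d}" using i by (intro member_le_L2_set) auto
      also have "\<dots> = L2_set (\<gamma> x) {..<d}" by (simp add: L2_set_def)
      finally have "\<bar>\<gamma> x i\<bar> \<le> 1" using x1 by linarith
      then have "\<bar>\<gamma> x i * c i j\<bar> \<le> 1 * \<bar>c i j\<bar>" unfolding abs_mult by (intro mult_right_mono) auto
      also have "1 * \<bar>c i j\<bar> = \<bar>c i j\<bar>" by simp
      also have "\<dots> \<le> (\<Sum>j<d. \<bar>c i j\<bar>)" using True by (intro member_le_sum[where f = "\<lambda>j. \<bar>c i j\<bar>"]) auto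
      finally show "\<bar>\<gamma> x i * c i j\<bar> \<le> (\<Sum>j<d. \<bar>c i j\<bar>)" .
    qed
    finally show ?thesis unfolding K_def .
  next
    case False
    then have "x j = 0" using x by (simp add: ellipsoid_def mem_real_space)
    then show ?thesis unfolding K_def by (auto intro!: sum_nonneg)
  qed
  then show ?thesis by blast
qed

text \<open>A linear map on the function space need not be continuous, but on
  \<open>real_space d\<close> it agrees with the finite sum \<open>G\<close>, which is. Compactness
  follows from Tychonoff's theorem, the ellipsoid being closed in a product of bounded
  intervals.\<close>

lemma ellipsoid_convex_body:
  assumes g: "\<gamma> \<in> GL d"
  shows "convex_body d (ellipsoid d \<gamma>)"
proof -
  have lin: "linear \<gamma>" using g by (simp add: GL_def)
  define G where "G x i = (\<Sum>j<d. x j * \<gamma> (\<lambda>i. if i = j then 1 else 0) i)" for x :: "nat \<Rightarrow> real" and i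
  have G: "\<gamma> x i = G x i" if "x \<in> real_space d" for x i
  proof -
    have "\<gamma> x = \<gamma> (\<Sum>j<d. x j *\<^sub>R (\<lambda>i. if i = j then 1 else 0))" by (rule arg_cong[OF real_space_expand[OF that]])
    also have "\<dots> = (\<Sum>j<d. x j *\<^sub>R \<gamma> (\<lambda>i. if i = j then 1 else 0))"
      by (simp only: linear_sum[OF lin] linear_scale[OF lin])
    finally show ?thesis by (simp add: sum_apply G_def)
  qed
  have cont: "continuous_on UNIV (\<lambda>x. L2_set (G x) {..<d})"
    unfolding L2_set_def G_def by (intro continuous_intros)
  have El: "ellipsoid d \<gamma> = real_space d \<inter> {x. L2_set (G x) {..<d} \<le> 1}"
    unfolding ellipsoid_def using G by (auto simp: L2_set_def)
  have clR: "closed (real_space d)"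
  proof -
    have "real_space d = (\<Inter>i\<in>{d..}. {x. x i = 0})" by (auto simp: mem_real_space)
    also have "closed \<dots>" by (intro closed_INT ballI closed_Collect_eq continuous_intros)
    finally show ?thesis .
  qed
  have cl: "closed (ellipsoid d \<gamma>)"
    unfolding El by (intro closed_Int clR closed_Collect_le cont continuous_intros)
  obtain K where K: "\<forall>x\<in>ellipsoid d \<gamma>. \<forall>j. \<bar>x j\<bar> \<le> K" using ellipsoid_bounded[OF g] by blast
  have "compactin (product_topology (\<lambda>i. euclideanreal) UNIV) (\<Pi>\<^sub>E i\<in>(UNIV :: nat set). {- K..K})"
    unfolding compactin_PiE by simp
  then have "compact (\<Pi>\<^sub>E i\<in>(UNIV :: nat set). {- K..K})"
    unfolding euclidean_product_topology by simp
  then have "compact ((\<Pi>\<^sub>E i\<in>(UNIV :: nat set). {- K..K}) \<inter> ellipsoid d \<gamma>)" using cl by (rule compact_Int_closed)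
  moreover have "(\<Pi>\<^sub>E i\<in>(UNIV :: nat set). {- K..K}) \<inter> ellipsoid d \<gamma> = ellipsoid d \<gamma>"
    using K by (auto simp: PiE_iff abs_le_iff) (smt (verit))
  ultimately have comp: "compact (ellipsoid d \<gamma>)" by simp
  have conv: "convex (ellipsoid d \<gamma>)"
  proof (rule convexI)
    fix x y u v assume h: "x \<in> ellipsoid d \<gamma>" "y \<in> ellipsoid d \<gamma>" "0 \<le> u" "0 \<le> v" "u + v = (1 :: real)"
    have "L2_set (\<gamma> (u *\<^sub>R x + v *\<^sub>R y)) {..<d} = L2_set (\<lambda>i. u * \<gamma> x i + v * \<gamma> y i) {..<d}"
      unfolding linear_add[OF lin] linear_scale[OF lin] by (simp add: L2_set_def)
    also have "\<dots> \<le> L2_set (\<lambda>i. u * \<gamma> x i) {..<d} + L2_set (\<lambda>i. v * \<gamma> y i) {..<d}" by (rule L2_set_triangle_ineq)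
    also have "\<dots> = u * L2_set (\<gamma> x) {..<d} + v * L2_set (\<gamma> y) {..<d}"
      using h by (simp only: L2_set_right_distrib)
    also have "\<dots> \<le> u * 1 + v * 1" using h by (intro add_mono mult_left_mono) (auto simp: ellipsoid_def)
    also have "\<dots> = 1" using h by simp
    finally show "u *\<^sub>R x + v *\<^sub>R y \<in> ellipsoid d \<gamma>"
      unfolding ellipsoid_def using h by (auto simp: ellipsoid_def intro!: real_space_add real_space_scaleR)
  qed
  have int: "(Euclidean_space d) interior_of (ellipsoid d \<gamma>) \<noteq> {}"
  proof -
    define T where "T = {x. L2_set (G x) {..<d} < 1}"
    have "open T" unfolding T_def by (intro open_Collect_less cont continuous_intros)
    then have "openin (Euclidean_space d) (T \<inter> real_space d)"
      unfolding Euclidean_space_eq by (intro openin_subtopology_Int) simp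
    moreover have "T \<inter> real_space d \<subseteq> ellipsoid d \<gamma>" unfolding El T_def by auto
    ultimately have "T \<inter> real_space d \<subseteq> (Euclidean_space d) interior_of (ellipsoid d \<gamma>)" by (simp add: interior_of_maximal)
    moreover have "0 \<in> T \<inter> real_space d" by (simp add: T_def G_def L2_set_def real_space_zero)
    ultimately show ?thesis by blast
  qed
  show ?thesis
    unfolding convex_body_def compactin_Euclidean_space_iff
    by (intro conjI comp conv int) (simp add: El)
qed

lemma ellipsoid_symmetric:
  assumes "\<gamma> \<in> GL d"
  shows "centrally_symmetric (ellipsoid d \<gamma>)"
proof -
  have lin: "linear \<gamma>" using assms by (simp add: GL_def)
  have s: "- x \<in> ellipsoid d \<gamma>" if "x \<in> ellipsoid d \<gamma>" for x
    using that linear_neg[OF lin, of x] unfolding ellipsoid_def by (simp add: real_space_uminus L2_set_def)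
  have "x \<in> uminus ` ellipsoid d \<gamma>" if "x \<in> ellipsoid d \<gamma>" for x
    using s[OF that] by (intro image_eqI[of _ _ "- x"]) simp_all
  then show ?thesis unfolding centrally_symmetric_def using s by blast
qed

lemma ellipsoid_lattice_points_eq: "ellipsoid_lattice_points d \<gamma> = int_lattice d \<inter> ellipsoid d \<gamma>"
  by (auto simp: ellipsoid_lattice_points_def ellipsoid_def int_lattice_def)

section \<open>Progressions and absorption of constants\<close>

lemma integer_combination_closed:
  assumes G: "G \<in> {real_space m, int_lattice m}" and w: "w \<in> int_lattice d"
    and a: "\<forall>i\<le>d. a i \<in> G" and x: "x \<in> G"
  shows "(\<Sum>i<d. w i *\<^sub>R a (Suc i)) + x \<in> G"
proof -
  have "((\<Sum>i<d. w i *\<^sub>R a (Suc i)) + x) \<in> real_space m" if "\<forall>i\<le>d. a i \<in> real_space m" "x \<in> real_space m"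
    using that by (auto simp: mem_real_space sum_apply intro!: sum.neutral)
  moreover have "((\<Sum>i<d. w i *\<^sub>R a (Suc i)) + x) k \<in> \<int>" if "\<forall>i\<le>d. a i \<in> int_lattice m" "x \<in> int_lattice m" for k
    using that w by (auto simp: sum_apply int_lattice_def intro!: Ints_add Ints_sum Ints_mult)
  ultimately show ?thesis using G a x by (auto simp: int_lattice_def)
qed

text \<open>A translation by the lattice vector \<open>w\<close> becomes a translation in the group
  by the combination of the generators with coefficients \<open>w\<close>, without
  \<open>a 0\<close>, and is joined to \<open>X\<close>.\<close>

lemma progression_translates:
  assumes cov: "\<forall>x\<in>N. \<exists>w\<in>W. x - w \<in> N'" and A: "A \<subseteq> progression d a N + X"
  shows "A \<subseteq> progression d a N' + (\<lambda>(w, x). (\<Sum>i<d. w i *\<^sub>R a (Suc i)) + x) ` (W \<times> X)"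
proof
  fix y assume "y \<in> A"
  then obtain n x where n: "n \<in> N" "x \<in> X" "y = a 0 + (\<Sum>i<d. n i *\<^sub>R a (Suc i)) + x"
    using A by (auto simp: progression_def set_plus_def)
  obtain w where w: "w \<in> W" "n - w \<in> N'" using cov n(1) by blast
  have "(\<Sum>i<d. n i *\<^sub>R a (Suc i)) = (\<Sum>i<d. (n - w) i *\<^sub>R a (Suc i)) + (\<Sum>i<d. w i *\<^sub>R a (Suc i))"
    unfolding sum.distrib[symmetric] by (intro sum.cong refl) (simp add: scaleR_left_diff_distrib)
  then have "y = (a 0 + (\<Sum>i<d. (n - w) i *\<^sub>R a (Suc i))) + ((\<Sum>i<d. w i *\<^sub>R a (Suc i)) + x)"
    unfolding n(3) by (simp only: add.assoc)
  moreover have "a 0 + (\<Sum>i<d. (n - w) i *\<^sub>R a (Suc i)) \<in> progression d a N'"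
    unfolding progression_def using w(2) by blast
  moreover have "(\<Sum>i<d. w i *\<^sub>R a (Suc i)) + x \<in> (\<lambda>(w, x). (\<Sum>i<d. w i *\<^sub>R a (Suc i)) + x) ` (W \<times> X)"
    using w(1) n(2) by (intro image_eqI[of _ _ "(w, x)"]) simp_all
  ultimately show "y \<in> progression d a N' + (\<lambda>(w, x). (\<Sum>i<d. w i *\<^sub>R a (Suc i)) + x) ` (W \<times> X)"
    by (simp only: set_plus_intro)
qed

text \<open>With \<open>L = ln c\<close>, the power \<open>c ^ d\<close> is at most
  \<open>(2 * K) powr (C0 * L)\<close>: the logarithmic bound on \<open>d\<close> turns losses
  exponential in \<open>d\<close> into powers of \<open>K\<close>.\<close>

lemma constant_absorption:
  assumes C0: "C0 \<ge> 1" and c: "c \<ge> 1"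
  shows "\<exists>C\<ge>C0. \<forall>K\<ge>1. \<forall>d::nat. real d \<le> C0 * ln (2 * K) \<longrightarrow> c ^ d * (C0 * K powr C0) \<le> C * K powr C"
proof -
  define L where "L = ln c"
  have L: "L \<ge> 0" using c by (simp add: L_def)
  \<comment> \<open>The sum dominates both the factor \<open>C0 * 2 powr (C0 * L)\<close> and the
    exponent \<open>C0 * L + C0\<close>.\<close>
  define C where "C = C0 * 2 powr (C0 * L) + C0 + C0 * L"
  have p: "0 \<le> C0 * L" "0 < 2 powr (C0 * L)" "0 \<le> C0 * 2 powr (C0 * L)" using C0 L by auto
  show ?thesis
  proof (intro exI[of _ C] conjI allI impI)
    show "C0 \<le> C" using p by (simp add: C_def)
    fix K :: real and d :: nat assume K: "K \<ge> 1" and d: "real d \<le> C0 * ln (2 * K)"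
    have "c ^ d = exp (L * real d)" using c by (simp add: L_def exp_of_nat2_mult)
    also have "\<dots> \<le> exp (L * (C0 * ln (2 * K)))" using d L by (simp add: mult_left_mono)
    also have "\<dots> = (2 * K) powr (C0 * L)" using K by (simp add: powr_def mult_ac)
    also have "\<dots> = 2 powr (C0 * L) * K powr (C0 * L)" using K by (simp add: powr_mult)
    finally have "c ^ d * (C0 * K powr C0) \<le> (2 powr (C0 * L) * K powr (C0 * L)) * (C0 * K powr C0)"
      using C0 K by (intro mult_right_mono) auto
    also have "\<dots> = (C0 * 2 powr (C0 * L)) * K powr (C0 * L + C0)" by (simp add: powr_add mult_ac)
    also have "\<dots> \<le> C * K powr C"
      using K p C0 by (intro mult_mono powr_mono) (auto simp: C_def)
    finally show "c ^ d * (C0 * K powr C0) \<le> C * K powr C" .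
  qed
qed

theorem theorem1p4:
  shows
  "(\<exists>C0::real. C0 \<ge> 1 \<and>
      (\<forall>m::nat. m \<ge> 1 \<longrightarrow>
        (\<forall>G \<in> {real_space m, int_lattice m}. \<forall>K::real. K \<ge> 1 \<longrightarrow>
          (\<forall>A. finite A \<and> A \<noteq> {} \<and> A \<subseteq> G \<and> real (card (A + A)) \<le> K * real (card A) \<longrightarrow>
            (\<exists>(d::nat) B a X.
               real d \<le> C0 * ln (2 * K) \<and>
               convex_body d B \<and> centrally_symmetric B \<and>
               (\<forall>i\<le>d. a i \<in> G) \<and> finite X \<and> X \<subseteq> G \<and>
               real (card (B \<inter> int_lattice d)) \<le> C0 * K powr C0 * real (card A) \<and>
               real (card X) \<le> C0 * K powr C0 \<and>
               A \<subseteq> progression d a (int_lattice d \<inter> B) + X)))))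
   \<longleftrightarrow>
   (\<exists>C0::real. C0 \<ge> 1 \<and>
      (\<forall>m::nat. m \<ge> 1 \<longrightarrow>
        (\<forall>G \<in> {real_space m, int_lattice m}. \<forall>K::real. K \<ge> 1 \<longrightarrow>
          (\<forall>A. finite A \<and> A \<noteq> {} \<and> A \<subseteq> G \<and> real (card (A + A)) \<le> K * real (card A) \<longrightarrow>
            (\<exists>(d::nat) \<gamma> a X.
               real d \<le> C0 * ln (2 * K) \<and>
               \<gamma> \<in> GL d \<and>
               (\<forall>i\<le>d. a i \<in> G) \<and> finite X \<and> X \<subseteq> G \<and>
               real (card (ellipsoid_lattice_points d \<gamma>)) \<le> C0 * K powr C0 * real (card A) \<and>
               real (card X) \<le> C0 * K powr C0 \<and>
               A \<subseteq> progression d a (ellipsoid_lattice_points d \<gamma>) + X)))))"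
proof (intro iffI; elim exE conjE)
  fix C0 :: real assume C0: "C0 \<ge> 1"
  assume I: "\<forall>m::nat. m \<ge> 1 \<longrightarrow>
        (\<forall>G \<in> {real_space m, int_lattice m}. \<forall>K::real. K \<ge> 1 \<longrightarrow>
          (\<forall>A. finite A \<and> A \<noteq> {} \<and> A \<subseteq> G \<and> real (card (A + A)) \<le> K * real (card A) \<longrightarrow>
            (\<exists>(d::nat) B a X.
               real d \<le> C0 * ln (2 * K) \<and>
               convex_body d B \<and> centrally_symmetric B \<and>
               (\<forall>i\<le>d. a i \<in> G) \<and> finite X \<and> X \<subseteq> G \<and>
               real (card (B \<inter> int_lattice d)) \<le> C0 * K powr C0 * real (card A) \<and>
               real (card X) \<le> C0 * K powr C0 \<and>
               A \<subseteq> progression d a (int_lattice d \<inter> B) + X)))"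
  have c2: "1 \<le> cov2" using cov_ge_1 by linarith
  obtain C where C: "C \<ge> C0" "\<forall>K\<ge>1. \<forall>d::nat. real d \<le> C0 * ln (2 * K) \<longrightarrow> cov2 ^ d * (C0 * K powr C0) \<le> C * K powr C"
    using constant_absorption[OF C0 c2] by blast
  show "\<exists>C0::real. C0 \<ge> 1 \<and>
      (\<forall>m::nat. m \<ge> 1 \<longrightarrow>
        (\<forall>G \<in> {real_space m, int_lattice m}. \<forall>K::real. K \<ge> 1 \<longrightarrow>
          (\<forall>A. finite A \<and> A \<noteq> {} \<and> A \<subseteq> G \<and> real (card (A + A)) \<le> K * real (card A) \<longrightarrow>
            (\<exists>(d::nat) \<gamma> a X.
               real d \<le> C0 * ln (2 * K) \<and>
               \<gamma> \<in> GL d \<and>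
               (\<forall>i\<le>d. a i \<in> G) \<and> finite X \<and> X \<subseteq> G \<and>
               real (card (ellipsoid_lattice_points d \<gamma>)) \<le> C0 * K powr C0 * real (card A) \<and>
               real (card X) \<le> C0 * K powr C0 \<and>
               A \<subseteq> progression d a (ellipsoid_lattice_points d \<gamma>) + X))))"
  proof (rule exI[of _ C], intro conjI allI ballI impI)
    show "1 \<le> C" using C0 C(1) by linarith
    fix m :: nat and G and K :: real and A
    assume m: "1 \<le> m" and G: "G \<in> {real_space m, int_lattice m}" and K: "1 \<le> K"
      and A: "finite A \<and> A \<noteq> {} \<and> A \<subseteq> G \<and> real (card (A + A)) \<le> K * real (card A)"
    obtain d B a X where h: "real d \<le> C0 * ln (2 * K)" "convex_body d B" "centrally_symmetric B"
      "\<forall>i\<le>d. a i \<in> G" "finite X" "X \<subseteq> G"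
      "real (card (B \<inter> int_lattice d)) \<le> C0 * K powr C0 * real (card A)"
      "real (card X) \<le> C0 * K powr C0" "A \<subseteq> progression d a (int_lattice d \<inter> B) + X"
      using I[rule_format, OF m G K A] by (elim exE conjE)
    obtain \<gamma> W where W: "\<gamma> \<in> GL d" "finite W" "W \<subseteq> int_lattice d" "real (card W) \<le> cov2 ^ d"
      "real (card (ellipsoid_lattice_points d \<gamma>)) \<le> cov2 ^ d * real (card (B \<inter> int_lattice d))"
      "\<forall>x\<in>B \<inter> int_lattice d. \<exists>w\<in>W. x - w \<in> ellipsoid_lattice_points d \<gamma>"
      using convex_body_lattice_ellipsoid[OF h(2,3)] by (elim exE conjE)
    \<comment> \<open>One translate for each pair of a lattice vector in \<open>W\<close> and an
      element of \<open>X\<close>, so the cardinality is at most \<open>cov2 ^ d\<close> times that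
      allowed for \<open>X\<close>.\<close>
    define X' where "X' = (\<lambda>(w, x). (\<Sum>i<d. w i *\<^sub>R a (Suc i)) + x) ` (W \<times> X)"
    have CK: "cov2 ^ d * (C0 * K powr C0) \<le> C * K powr C" using C(2) K h(1) by blast
    have cp: "0 \<le> cov2 ^ d" using c2 by simp
    show "\<exists>(d::nat) \<gamma> a X.
               real d \<le> C * ln (2 * K) \<and>
               \<gamma> \<in> GL d \<and>
               (\<forall>i\<le>d. a i \<in> G) \<and> finite X \<and> X \<subseteq> G \<and>
               real (card (ellipsoid_lattice_points d \<gamma>)) \<le> C * K powr C * real (card A) \<and>
               real (card X) \<le> C * K powr C \<and>
               A \<subseteq> progression d a (ellipsoid_lattice_points d \<gamma>) + X"
    proof (rule exI[of _ d], rule exI[of _ \<gamma>], rule exI[of _ a], rule exI[of _ X'], intro conjI)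
      have "C0 * ln (2 * K) \<le> C * ln (2 * K)" using C(1) K by (intro mult_right_mono ln_ge_zero) auto
      then show "real d \<le> C * ln (2 * K)" using h(1) by linarith
      show "\<gamma> \<in> GL d" "\<forall>i\<le>d. a i \<in> G" by (rule W(1) h(4))+
      show "finite X'" unfolding X'_def using W(2) h(5) by simp
      show "X' \<subseteq> G"
        unfolding X'_def using integer_combination_closed[OF G _ h(4)] W(3) h(6) by auto
      have "real (card (ellipsoid_lattice_points d \<gamma>)) \<le> cov2 ^ d * (C0 * K powr C0 * real (card A))"
        using W(5) mult_left_mono[OF h(7) cp] by linarith
      also have "\<dots> = cov2 ^ d * (C0 * K powr C0) * real (card A)" by (simp only: mult.assoc)
      also have "\<dots> \<le> C * K powr C * real (card A)" using CK by (rule mult_right_mono) simp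
      finally show "real (card (ellipsoid_lattice_points d \<gamma>)) \<le> C * K powr C * real (card A)" .
      have "card X' \<le> card (W \<times> X)" unfolding X'_def using W(2) h(5) by (intro card_image_le) simp
      also have "\<dots> = card W * card X" by (rule card_cartesian_product)
      finally have "real (card X') \<le> real (card W) * real (card X)" by (simp only: of_nat_mult[symmetric] of_nat_le_iff)
      also have "\<dots> \<le> cov2 ^ d * (C0 * K powr C0)" using W(4) h(8) cp by (intro mult_mono) auto
      also note CK
      finally show "real (card X') \<le> C * K powr C" .
      show "A \<subseteq> progression d a (ellipsoid_lattice_points d \<gamma>) + X'"
        unfolding X'_def
      proof (rule progression_translates)
        show "\<forall>x\<in>int_lattice d \<inter> B. \<exists>w\<in>W. x - w \<in> ellipsoid_lattice_points d \<gamma>" using W(6) by blast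
      qed (rule h(9))
    qed
  qed
next
  fix C0 :: real assume C0: "C0 \<ge> 1"
  assume II: "\<forall>m::nat. m \<ge> 1 \<longrightarrow>
        (\<forall>G \<in> {real_space m, int_lattice m}. \<forall>K::real. K \<ge> 1 \<longrightarrow>
          (\<forall>A. finite A \<and> A \<noteq> {} \<and> A \<subseteq> G \<and> real (card (A + A)) \<le> K * real (card A) \<longrightarrow>
            (\<exists>(d::nat) \<gamma> a X.
               real d \<le> C0 * ln (2 * K) \<and>
               \<gamma> \<in> GL d \<and>
               (\<forall>i\<le>d. a i \<in> G) \<and> finite X \<and> X \<subseteq> G \<and>
               real (card (ellipsoid_lattice_points d \<gamma>)) \<le> C0 * K powr C0 * real (card A) \<and>
               real (card X) \<le> C0 * K powr C0 \<and>
               A \<subseteq> progression d a (ellipsoid_lattice_points d \<gamma>) + X)))"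
  show "\<exists>C0::real. C0 \<ge> 1 \<and>
      (\<forall>m::nat. m \<ge> 1 \<longrightarrow>
        (\<forall>G \<in> {real_space m, int_lattice m}. \<forall>K::real. K \<ge> 1 \<longrightarrow>
          (\<forall>A. finite A \<and> A \<noteq> {} \<and> A \<subseteq> G \<and> real (card (A + A)) \<le> K * real (card A) \<longrightarrow>
            (\<exists>(d::nat) B a X.
               real d \<le> C0 * ln (2 * K) \<and>
               convex_body d B \<and> centrally_symmetric B \<and>
               (\<forall>i\<le>d. a i \<in> G) \<and> finite X \<and> X \<subseteq> G \<and>
               real (card (B \<inter> int_lattice d)) \<le> C0 * K powr C0 * real (card A) \<and>
               real (card X) \<le> C0 * K powr C0 \<and>
               A \<subseteq> progression d a (int_lattice d \<inter> B) + X))))"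
  proof (rule exI[of _ C0], intro conjI allI ballI impI)
    show "1 \<le> C0" by (rule C0)
    fix m :: nat and G and K :: real and A
    assume m: "1 \<le> m" and G: "G \<in> {real_space m, int_lattice m}" and K: "1 \<le> K"
      and A: "finite A \<and> A \<noteq> {} \<and> A \<subseteq> G \<and> real (card (A + A)) \<le> K * real (card A)"
    obtain d \<gamma> a X where h: "real d \<le> C0 * ln (2 * K)" "\<gamma> \<in> GL d"
      "\<forall>i\<le>d. a i \<in> G" "finite X" "X \<subseteq> G"
      "real (card (ellipsoid_lattice_points d \<gamma>)) \<le> C0 * K powr C0 * real (card A)"
      "real (card X) \<le> C0 * K powr C0" "A \<subseteq> progression d a (ellipsoid_lattice_points d \<gamma>) + X"
      using II[rule_format, OF m G K A] by (elim exE conjE)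
    show "\<exists>(d::nat) B a X.
               real d \<le> C0 * ln (2 * K) \<and>
               convex_body d B \<and> centrally_symmetric B \<and>
               (\<forall>i\<le>d. a i \<in> G) \<and> finite X \<and> X \<subseteq> G \<and>
               real (card (B \<inter> int_lattice d)) \<le> C0 * K powr C0 * real (card A) \<and>
               real (card X) \<le> C0 * K powr C0 \<and>
               A \<subseteq> progression d a (int_lattice d \<inter> B) + X"
    proof (rule exI[of _ d], rule exI[of _ "ellipsoid d \<gamma>"], rule exI[of _ a], rule exI[of _ X], intro conjI)
      show "real d \<le> C0 * ln (2 * K)" "\<forall>i\<le>d. a i \<in> G" "finite X" "X \<subseteq> G"
        "real (card X) \<le> C0 * K powr C0" by (rule h)+
      show "convex_body d (ellipsoid d \<gamma>)" by (rule ellipsoid_convex_body[OF h(2)])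
      show "centrally_symmetric (ellipsoid d \<gamma>)" by (rule ellipsoid_symmetric[OF h(2)])
      show "real (card (ellipsoid d \<gamma> \<inter> int_lattice d)) \<le> C0 * K powr C0 * real (card A)"
        using h(6) unfolding ellipsoid_lattice_points_eq by (simp only: Int_commute)
      show "A \<subseteq> progression d a (int_lattice d \<inter> ellipsoid d \<gamma>) + X"
        using h(8) unfolding ellipsoid_lattice_points_eq .
    qed
  qed
qed

end
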